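(* Let $\mathcal{M}_2$, $\mathbf{H}$, $\mathrm{Per}_1(1)$, $\mathbf{M}_1$, $\mathbf{B}_0$, $\mathbf{B}_1$, $\mathbf{B}_2$ be as defined in the context, and let $\partial\mathbf{H}$ and $\overline{\mathbf{B}}_2$ denote the boundary of $\mathbf{H}$ and the closure of $\mathbf{B}_2$ in $\mathcal{M}_2$. Then the following statements hold: (1) $\partial\mathbf{H}=\mathbf{B}_0\cup\mathbf{B}_1\cup\overline{\mathbf{B}}_2$; (2) $\mathbf{B}_2\cap\mathbf{M}_1=\emptyset$; (3) $\partial\mathbf{H}\cap(\mathrm{Per}_1(1)\setminus\mathbf{M}_1)\neq\mathrm{Per}_1(1)\setminus\mathbf{M}_1$.
   Context: $\mathcal{M}_2$ denotes the complex orbifold of holomorphic (Möbius) conjugacy classes $[f]$ of rational maps $f$ of degree $2$ on the Riemann sphere $\overline{\mathbb{C}}$, with its quotient topology. $J(f)$ denotes the Julia set of $f$. The eigenvalue of $f$ at a fixed point is its multiplier (derivative) there. $\mathbb{D}$ is the open unit disk in $\mathbb{C}$. A rational map is hyperbolic if the orbit of every critical point converges to an attracting (or super-attracting) periodic cycle; a hyperbolic component is a connected component of the open set of hyperbolic classes. For $\lambda_1,\lambda_2\in\mathbb{C}$ with $\lambda_1\lambda_2\neq1$ put $$f_{\lambda_1,\lambda_2}(z)=\frac{\lambda_1z+z^2}{\lambda_2z+1},$$ a quadratic rational map with fixed points $0$ and $\infty$ whose eigenvalues there are $\lambda_1$ and $\lambda_2$ respectively. $\mathbf{H}$ is the central quadratic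 hyperbolic component, i.e. the hyperbolic component in $\mathcal{M}_2$ containing the class of $z\mapsto z^2$; it can be expressed as $\mathbf{H}=\{[f_{\lambda_1,\lambda_2}]:(\lambda_1,\lambda_2)\in\mathbb{D}\times\mathbb{D}\}$. $\mathrm{Per}_1(1)=\{[f]\in\mathcal{M}_2: f \text{ has a fixed point with eigenvalue } 1\}$ and $\mathbf{M}_1=\{[f]\in\mathrm{Per}_1(1): J(f)\text{ is connected}\}$. $\mathbf{B}_0=\{[f_{\lambda_1,\lambda_2}]:(\lambda_1,\lambda_2)\in\overline{\mathbb{D}}\times\partial\mathbb{D},\ \lambda_1\neq1,\ \lambda_2\neq1,\ \lambda_1\lambda_2\neq1\}$, $\mathbf{B}_1=\{[f_{1,\lambda}]:\lambda\in\overline{\mathbb{D}}\setminus\{1\}\}$, $\mathbf{B}_2=\{[f_{1,\lambda}]:\mathrm{Re}\,\lambda>1\}$. *)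

theory Defs
  imports "HOL-Complex_Analysis.Complex_Analysis"
begin

section \<open>The Riemann sphere with its chordal metric\<close>

datatype riemann_sphere = Fin complex | Infty

fun stereographic :: "riemann_sphere \<Rightarrow> complex \<times> real" where
  "stereographic (Fin z) =
     ((2 / (1 + (cmod z)\<^sup>2)) *\<^sub>R z, ((cmod z)\<^sup>2 - 1) / ((cmod z)\<^sup>2 + 1))"
| "stereographic Infty = (0, 1)"

lemma inj_stereographic: "inj stereographic"
proof -
  define h :: "complex \<Rightarrow> real" where "h z = 2 / (1 + (cmod z)\<^sup>2)" for z
  have pos: "1 + (cmod z)\<^sup>2 > 0" for z :: complex
    by (simp add: add_pos_nonneg)
  have h: "h z > 0" for z
    unfolding h_def using pos[of z] by simp
  have height: "((cmod z)\<^sup>2 - 1) / ((cmod z)\<^sup>2 + 1) = 1 - h z" for z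
    unfolding h_def using pos[of z] by (simp add: field_simps)
  have Fin: "stereographic (Fin z) = (h z *\<^sub>R z, 1 - h z)" for z
    using height[of z] by (simp only: stereographic.simps flip: h_def)
  have eq: "z = w" if "stereographic (Fin z) = stereographic (Fin w)" for z w
  proof -
    have "h z = h w" "h z *\<^sub>R z = h w *\<^sub>R w"
      using that unfolding Fin prod.inject by (linarith, blast)
    then show ?thesis
      using h[of w] by auto
  qed
  have ne: "stereographic (Fin z) \<noteq> stereographic Infty" for z
    unfolding Fin using h[of z] by simp
  show ?thesis
  proof (rule injI)
    fix x y assume "stereographic x = stereographic y"
    then show "x = y"
      using ne[THEN not_sym] ne eq
      by (cases x; cases y) (auto simp del: stereographic.simps)
  qed
qed

instantiation riemann_sphere :: metric_space
begin

definition dist_riemann_sphere :: "riemann_sphere \<Rightarrow> riemann_sphere \<Rightarrow> real" where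
  "dist_riemann_sphere x y = dist (stereographic x) (stereographic y)"

definition uniformity_riemann_sphere :: "(riemann_sphere \<times> riemann_sphere) filter" where
  "uniformity_riemann_sphere = (INF e\<in>{0 <..}. principal {(x, y). dist x y < e})"

definition open_riemann_sphere :: "riemann_sphere set \<Rightarrow> bool" where
  "open_riemann_sphere U \<longleftrightarrow> (\<forall>x\<in>U. eventually (\<lambda>(x', y). x' = x \<longrightarrow> y \<in> U) uniformity)"

instance
proof
  fix x y z :: riemann_sphere
  show "dist x y = 0 \<longleftrightarrow> x = y"
    using inj_stereographic by (auto simp: dist_riemann_sphere_def dest: injD)
  show "dist x y \<le> dist x z + dist y z"
    unfolding dist_riemann_sphere_def by (rule dist_triangle2)
qed (simp_all add: uniformity_riemann_sphere_def open_riemann_sphere_def)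

end

section \<open>Rational maps\<close>

text \<open>The point \<open>[a : b]\<close> of the projective line; only used with \<open>(a, b) \<noteq> (0, 0)\<close>.\<close>
definition ratio :: "complex \<Rightarrow> complex \<Rightarrow> riemann_sphere" where
  "ratio a b = (if b = 0 then Infty else Fin (a / b))"

fun rat_map :: "complex poly \<Rightarrow> complex poly \<Rightarrow> riemann_sphere \<Rightarrow> riemann_sphere" where
  "rat_map p q (Fin z) = ratio (poly p z) (poly q z)"
| "rat_map p q Infty =
     (let d = max (degree p) (degree q) in ratio (coeff p d) (coeff q d))"

definition rational_maps :: "nat \<Rightarrow> (riemann_sphere \<Rightarrow> riemann_sphere) set" where
  "rational_maps d = {rat_map p q | p q. coprime p q \<and> max (degree p) (degree q) = d}"

subsection \<open>Derivatives in local coordinates\<close>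

text \<open>The coordinate centred near \<open>p\<close> is \<open>z\<close> if \<open>p\<close> is finite and \<open>1/z\<close> if \<open>p = \<infinity>\<close>.
  Each coordinate omits one point of the sphere, where the value is a dummy.\<close>
definition chart :: "riemann_sphere \<Rightarrow> riemann_sphere \<Rightarrow> complex" where
  "chart p x =
     (case p of
        Fin _ \<Rightarrow> (case x of Fin z \<Rightarrow> z | Infty \<Rightarrow> 0)
      | Infty \<Rightarrow> (case x of Fin z \<Rightarrow> 1 / z | Infty \<Rightarrow> 0))"

definition inv_chart :: "riemann_sphere \<Rightarrow> complex \<Rightarrow> riemann_sphere" where
  "inv_chart p z = (case p of Fin _ \<Rightarrow> Fin z | Infty \<Rightarrow> ratio 1 z)"

definition local_deriv :: "(riemann_sphere \<Rightarrow> riemann_sphere) \<Rightarrow> riemann_sphere \<Rightarrow> complex" where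
  "local_deriv f p = deriv (\<lambda>z. chart (f p) (f (inv_chart p z))) (chart p p)"

definition has_fixed_point_with_eigenvalue ::
    "(riemann_sphere \<Rightarrow> riemann_sphere) \<Rightarrow> complex \<Rightarrow> bool" where
  "has_fixed_point_with_eigenvalue f \<mu> \<longleftrightarrow> (\<exists>p. f p = p \<and> local_deriv f p = \<mu>)"

definition critical_point :: "(riemann_sphere \<Rightarrow> riemann_sphere) \<Rightarrow> riemann_sphere \<Rightarrow> bool" where
  "critical_point f c \<longleftrightarrow> local_deriv f c = 0"

subsection \<open>Julia sets and hyperbolicity\<close>

definition normal_on ::
    "riemann_sphere set \<Rightarrow> (riemann_sphere \<Rightarrow> riemann_sphere) set \<Rightarrow> bool" where
  "normal_on U F \<longleftrightarrow>
     (\<forall>s :: nat \<Rightarrow> riemann_sphere \<Rightarrow> riemann_sphere. range s \<subseteq> F \<longrightarrow>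
        (\<exists>r g. strict_mono r \<and>
           (\<forall>K. compact K \<and> K \<subseteq> U \<longrightarrow> uniform_limit K (s \<circ> r) g sequentially)))"

definition Fatou_set :: "(riemann_sphere \<Rightarrow> riemann_sphere) \<Rightarrow> riemann_sphere set" where
  "Fatou_set f = \<Union> {U. open U \<and> normal_on U (range (\<lambda>n. f ^^ n))}"

definition Julia_set :: "(riemann_sphere \<Rightarrow> riemann_sphere) \<Rightarrow> riemann_sphere set" where
  "Julia_set f = - Fatou_set f"

text \<open>The period \<open>n\<close> need not be minimal; this affects neither the cycle
  nor whether it is attracting. Super-attracting cycles are included.\<close>
definition attracting_cycle ::
    "(riemann_sphere \<Rightarrow> riemann_sphere) \<Rightarrow> riemann_sphere set \<Rightarrow> bool" where
  "attracting_cycle f A \<longleftrightarrow>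
     (\<exists>p n. n > 0 \<and> (f ^^ n) p = p \<and> cmod (local_deriv (f ^^ n) p) < 1 \<and>
        A = (\<lambda>i. (f ^^ i) p) ` {..<n})"

definition hyperbolic :: "(riemann_sphere \<Rightarrow> riemann_sphere) \<Rightarrow> bool" where
  "hyperbolic f \<longleftrightarrow>
     (\<forall>c. critical_point f c \<longrightarrow>
        (\<exists>A. attracting_cycle f A \<and> (\<lambda>k. infdist ((f ^^ k) c) A) \<longlonglongrightarrow> 0))"

section \<open>The moduli space of quadratic rational maps\<close>

definition quotient_topology :: "'a topology \<Rightarrow> ('a \<Rightarrow> 'b) \<Rightarrow> 'b topology" where
  "quotient_topology X q =
     topology (\<lambda>U. U \<subseteq> q ` topspace X \<and> openin X {x \<in> topspace X. q x \<in> U})"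

lemma openin_quotient_topology:
  "openin (quotient_topology X q) U \<longleftrightarrow>
     U \<subseteq> q ` topspace X \<and> openin X {x \<in> topspace X. q x \<in> U}"
proof -
  have "istopology (\<lambda>U. U \<subseteq> q ` topspace X \<and> openin X {x \<in> topspace X. q x \<in> U})"
    unfolding istopology_def
  proof (intro conjI allI impI; (elim conjE)?)
    fix S T
    assume "openin X {x \<in> topspace X. q x \<in> S}" "openin X {x \<in> topspace X. q x \<in> T}"
    then have "openin X ({x \<in> topspace X. q x \<in> S} \<inter> {x \<in> topspace X. q x \<in> T})"
      by (rule openin_Int)
    then show "openin X {x \<in> topspace X. q x \<in> S \<inter> T}"
      by (rule back_subst) auto
  next
    fix \<K>
    assume *: "\<forall>K\<in>\<K>. K \<subseteq> q ` topspace X \<and> openin X {x \<in> topspace X. q x \<in> K}"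
    then have "openin X (\<Union>K\<in>\<K>. {x \<in> topspace X. q x \<in> K})"
      by (intro openin_Union) auto
    then show "openin X {x \<in> topspace X. q x \<in> \<Union>\<K>}"
      by (rule back_subst) auto
  qed auto
  then show ?thesis
    by (simp add: quotient_topology_def)
qed

lemma topspace_quotient_topology [simp]:
  "topspace (quotient_topology X q) = q ` topspace X"
proof
  show "topspace (quotient_topology X q) \<subseteq> q ` topspace X"
    using openin_quotient_topology[of X q "topspace (quotient_topology X q)"] by simp
  have "{x \<in> topspace X. q x \<in> q ` topspace X} = topspace X"
    by auto
  then have "openin (quotient_topology X q) (q ` topspace X)"
    by (simp add: openin_quotient_topology)
  then show "q ` topspace X \<subseteq> topspace (quotient_topology X q)"
    by (rule openin_subset)
qed

lemma quotient_map_quotient_topology: "quotient_map X (quotient_topology X q) q"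
  by (auto simp: quotient_map_def openin_quotient_topology)

type_synonym quad_coeffs = "(complex \<times> complex \<times> complex) \<times> (complex \<times> complex \<times> complex)"

fun quad_poly :: "complex \<times> complex \<times> complex \<Rightarrow> complex poly" where
  "quad_poly (a, b, c) = [:a, b, c:]"

definition quad_coeff_set :: "quad_coeffs set" where
  "quad_coeff_set =
     {(u, v). coprime (quad_poly u) (quad_poly v) \<and>
              max (degree (quad_poly u)) (degree (quad_poly v)) = 2}"

text \<open>The usual topology on the space of quadratic rational maps, as an open subset of the
  projective space of coefficient vectors: two vectors in \<open>quad_coeff_set\<close> define the same map
  iff they are proportional.\<close>
definition Rat2_topology :: "(riemann_sphere \<Rightarrow> riemann_sphere) topology" where
  "Rat2_topology =
     quotient_topology (top_of_set quad_coeff_set)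
       (\<lambda>(u, v). rat_map (quad_poly u) (quad_poly v))"

definition moebius_conjugacy ::
    "((riemann_sphere \<Rightarrow> riemann_sphere) \<times> (riemann_sphere \<Rightarrow> riemann_sphere)) set" where
  "moebius_conjugacy =
     {(f, g). f \<in> rational_maps 2 \<and> g \<in> rational_maps 2 \<and>
              (\<exists>\<phi>\<in>rational_maps 1. \<phi> \<circ> f = g \<circ> \<phi>)}"

definition conj_class ::
    "(riemann_sphere \<Rightarrow> riemann_sphere) \<Rightarrow> (riemann_sphere \<Rightarrow> riemann_sphere) set" where
  "conj_class f = moebius_conjugacy `` {f}"

definition M2_topology :: "(riemann_sphere \<Rightarrow> riemann_sphere) set topology" where
  "M2_topology = quotient_topology Rat2_topology conj_class"

lemma topspace_Rat2_topology: "topspace Rat2_topology = rational_maps 2"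
proof -
  have surj: "\<exists>u. p = quad_poly u" if "degree p \<le> 2" for p
  proof
    show "p = quad_poly (coeff p 0, coeff p 1, coeff p 2)"
      using that
      by (intro poly_eqI)
         (auto simp: coeff_pCons numeral_2_eq_2 coeff_eq_0 split: nat.splits)
  qed
  show ?thesis
  proof (intro set_eqI iffI)
    fix f assume "f \<in> rational_maps 2"
    then obtain p q where f: "f = rat_map p q"
      and pq: "coprime p q" "max (degree p) (degree q) = 2"
      by (auto simp: rational_maps_def)
    from pq(2) have "degree p \<le> 2" "degree q \<le> 2"
      by linarith+
    with surj obtain u v where "p = quad_poly u" "q = quad_poly v"
      by blast
    with f pq show "f \<in> topspace Rat2_topology"
      unfolding Rat2_topology_def quad_coeff_set_def
      by (auto intro!: image_eqI[where x = "(u, v)"])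
  qed (auto simp: Rat2_topology_def quad_coeff_set_def rational_maps_def)
qed

lemma topspace_M2_topology: "topspace M2_topology = rational_maps 2 // moebius_conjugacy"
  by (auto simp: M2_topology_def topspace_Rat2_topology conj_class_def quotient_def)

section \<open>Distinguished subsets of the moduli space\<close>

definition hyperbolic_classes :: "(riemann_sphere \<Rightarrow> riemann_sphere) set set" where
  "hyperbolic_classes = conj_class ` {f \<in> rational_maps 2. hyperbolic f}"

definition square_map :: "riemann_sphere \<Rightarrow> riemann_sphere" where
  "square_map = rat_map [:0, 0, 1:] 1"

definition central_component :: "(riemann_sphere \<Rightarrow> riemann_sphere) set set" where
  "central_component =
     connected_component_of_set (subtopology M2_topology hyperbolic_classes)
       (conj_class square_map)"

definition Per1 :: "complex \<Rightarrow> (riemann_sphere \<Rightarrow> riemann_sphere) set set" where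
  "Per1 \<mu> = conj_class ` {f \<in> rational_maps 2. has_fixed_point_with_eigenvalue f \<mu>}"

definition M1 :: "(riemann_sphere \<Rightarrow> riemann_sphere) set set" where
  "M1 = {conj_class f | f. f \<in> rational_maps 2 \<and> conj_class f \<in> Per1 1 \<and>
                           connected (Julia_set f)}"

text \<open>\<open>f\<^bsub>a,b\<^esub>(z) = (a z + z\<^sup>2) / (b z + 1)\<close>, a quadratic rational map only if \<open>a * b \<noteq> 1\<close>.\<close>
definition fam :: "complex \<Rightarrow> complex \<Rightarrow> riemann_sphere \<Rightarrow> riemann_sphere" where
  "fam a b = rat_map [:0, a, 1:] [:1, b:]"

definition B0 :: "(riemann_sphere \<Rightarrow> riemann_sphere) set set" where
  "B0 = {conj_class (fam a b) | a b.
           a \<in> cball 0 1 \<and> b \<in> sphere 0 1 \<and> a \<noteq> 1 \<and> b \<noteq> 1 \<and> a * b \<noteq> 1}"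

definition B1 :: "(riemann_sphere \<Rightarrow> riemann_sphere) set set" where
  "B1 = {conj_class (fam 1 b) | b. b \<in> cball 0 1 - {1}}"

definition B2 :: "(riemann_sphere \<Rightarrow> riemann_sphere) set set" where
  "B2 = {conj_class (fam 1 b) | b. Re b > 1}"

end

theory Submission
  imports Defs "HOL-Computational_Algebra.Fundamental_Theorem_Algebra"
begin

text \<open>The classes with two attracting fixed points form a connected open set, which is the central
  component because no boundary class is hyperbolic: such a class has an indifferent fixed point,
  from which hyperbolicity would keep the critical orbits away, even after a perturbation that makes it
  attracting. If two attracting multipliers converge with \<open>a b \<rightarrow> 1\<close>, both tend to \<open>1\<close> and the two fixed
  points collide, while the index formula keeps the real part of the third multiplier at least \<open>1\<close>; this produces the closure of \<open>B2\<close>.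

  The maps \<open>fam 1 c\<close> are conjugate to \<open>z + 1/z + T\<close> with \<open>T\<^sup>2 = 1 - c\<close>, and \<open>Re c > 1\<close> puts \<open>T\<close> (up to sign) in a
  sector around the imaginary axis. An invariant half-plane shows that one critical point lies in the basin
  of \<open>\<infinity>\<close>. The other one does so on half of the sector; coincidences of its orbit with itself or with its
  preimages are impossible, since they would persist in the central component, so a normal family argument
  in \<open>T\<close> spreads the conclusion over the sector. With both critical points in the basin, the Julia set is
  disconnected.\<close>

text \<open>The moduli space is never given coordinates. The class map on coefficient vectors is
  open, so limits of classes lift to limits of vectors, and all estimates are made on coefficients.
  That each of two attracting fixed points attracts a critical point is Koenigs' argument: otherwise
  the inverse branches at the fixed point extend to discs of unbounded radius. Hyperbolicity admits
  cycles of every period, so refuting it on the boundary means following an arbitrary cycle under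
  perturbation. For the second statement the obstacle is that a critical orbit might land on
  \<infinity>, which is a Julia point, instead of escaping to it. The orbit is therefore carried as
  a pair of polynomials in T, and a cross-ratio turns the forbidden coincidences into omitted
  values. Landing is refuted on its own: \<infinity> has multiplier 1, and the maximum principle
  forbids this once the orbits of neighbouring parameters converge to \<infinity>. The third
  statement uses one explicit map whose critical orbits both escape and whose multipliers fit no
  class of the closure.\<close>

section \<open>Limits, charts and compactness on the sphere\<close>

lemma one_plus_sq_pos: "0 < 1 + (cmod z)\<^sup>2" "0 < (cmod z)\<^sup>2 + 1"
  by (simp_all add: add_pos_nonneg add_nonneg_pos)

text \<open>In homogeneous coordinates the denominator never vanishes, so \<open>Infty\<close> is on
  the same footing as finite points and limits through poles need no separate treatment.\<close>

lemma stereographic_ratio: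
  assumes "(a, b) \<noteq> (0, 0)"
  shows "stereographic (ratio a b) =
    ((2 / ((cmod a)\<^sup>2 + (cmod b)\<^sup>2)) *\<^sub>R (a * cnj b),
     ((cmod a)\<^sup>2 - (cmod b)\<^sup>2) / ((cmod a)\<^sup>2 + (cmod b)\<^sup>2))"
proof (cases "b = 0")
  case True
  with assms show ?thesis by (simp add: ratio_def)
next
  case False
  have pos: "(cmod b)\<^sup>2 > 0" using False by simp
  have s: "(cmod a)\<^sup>2 + (cmod b)\<^sup>2 \<noteq> 0"
    using pos by (metis add.commute add_pos_nonneg less_irrefl zero_le_power2)
  have 1: "(2 / (1 + (cmod (a / b))\<^sup>2)) = (2 * (cmod b)\<^sup>2) / ((cmod a)\<^sup>2 + (cmod b)\<^sup>2)"
  proof -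
    have "2 / (1 + A / B) = 2 * B / (A + B)" if "B > 0" "A \<ge> 0" for A B :: real
      using that by (simp add: field_simps)
    then show ?thesis using pos by (simp add: norm_divide power_divide)
  qed
  have 2: "(2 * (cmod b)\<^sup>2 / ((cmod a)\<^sup>2 + (cmod b)\<^sup>2)) *\<^sub>R (a / b) =
     (2 / ((cmod a)\<^sup>2 + (cmod b)\<^sup>2)) *\<^sub>R (a * cnj b)"
  proof -
    have "(cmod b)\<^sup>2 *\<^sub>R (a / b) = a * cnj b"
      unfolding scaleR_conv_of_real complex_norm_square using False by simp
    moreover have "(2 * (cmod b)\<^sup>2 / ((cmod a)\<^sup>2 + (cmod b)\<^sup>2)) *\<^sub>R (a / b) =
        (2 / ((cmod a)\<^sup>2 + (cmod b)\<^sup>2)) *\<^sub>R ((cmod b)\<^sup>2 *\<^sub>R (a / b))"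
      by simp
    ultimately show ?thesis by simp
  qed
  have 3: "((cmod (a / b))\<^sup>2 - 1) / ((cmod (a / b))\<^sup>2 + 1) =
      ((cmod a)\<^sup>2 - (cmod b)\<^sup>2) / ((cmod a)\<^sup>2 + (cmod b)\<^sup>2)"
  proof -
    have e: "(cmod (a / b))\<^sup>2 - 1 = ((cmod a)\<^sup>2 - (cmod b)\<^sup>2) / (cmod b)\<^sup>2"
      "(cmod (a / b))\<^sup>2 + 1 = ((cmod a)\<^sup>2 + (cmod b)\<^sup>2) / (cmod b)\<^sup>2"
    proof -
      have "A / B - 1 = (A - B) / B" "A / B + 1 = (A + B) / B" if "B > 0" for A B :: real
        using that by (simp_all add: field_simps)
      then show "(cmod (a / b))\<^sup>2 - 1 = ((cmod a)\<^sup>2 - (cmod b)\<^sup>2) / (cmod b)\<^sup>2"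
        "(cmod (a / b))\<^sup>2 + 1 = ((cmod a)\<^sup>2 + (cmod b)\<^sup>2) / (cmod b)\<^sup>2"
        using pos by (simp_all add: norm_divide power_divide)
    qed
    show ?thesis unfolding e using pos by simp
  qed
  from False show ?thesis
    by (simp add: ratio_def 1 2 3)
qed

lemma tendsto_sphere_iff:
  fixes f :: "'a \<Rightarrow> riemann_sphere"
  shows "(f \<longlongrightarrow> l) F \<longleftrightarrow> ((\<lambda>x. stereographic (f x)) \<longlongrightarrow> stereographic l) F"
  by (simp add: tendsto_iff dist_riemann_sphere_def)

lemma tendsto_ratio:
  assumes "(a \<longlongrightarrow> a0) F" "(b \<longlongrightarrow> b0) F" "(a0, b0) \<noteq> (0, 0)"
  shows "((\<lambda>x. ratio (a x) (b x)) \<longlongrightarrow> ratio a0 b0) F"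
proof -
  have pos: "(cmod a0)\<^sup>2 + (cmod b0)\<^sup>2 \<noteq> 0"
    using assms(3) by (auto simp: add_nonneg_eq_0_iff)
  have ev: "eventually (\<lambda>x. (a x, b x) \<noteq> (0, 0)) F"
  proof -
    have "((\<lambda>x. (a x, b x)) \<longlongrightarrow> (a0, b0)) F"
      using assms by (intro tendsto_Pair)
    then show ?thesis using assms(3) by (rule tendsto_imp_eventually_ne)
  qed
  have "((\<lambda>x. ((2 / ((cmod (a x))\<^sup>2 + (cmod (b x))\<^sup>2)) *\<^sub>R (a x * cnj (b x)),
     ((cmod (a x))\<^sup>2 - (cmod (b x))\<^sup>2) / ((cmod (a x))\<^sup>2 + (cmod (b x))\<^sup>2))) \<longlongrightarrow>
     ((2 / ((cmod a0)\<^sup>2 + (cmod b0)\<^sup>2)) *\<^sub>R (a0 * cnj b0),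
     ((cmod a0)\<^sup>2 - (cmod b0)\<^sup>2) / ((cmod a0)\<^sup>2 + (cmod b0)\<^sup>2))) F"
    using assms pos by (intro tendsto_intros) auto
  then show ?thesis
    unfolding tendsto_sphere_iff stereographic_ratio[OF assms(3)]
    by (rule Lim_transform_eventually) (use ev in \<open>auto elim!: eventually_mono simp: stereographic_ratio\<close>)
qed

lemma ratio_eq_iff:
  assumes "(a, b) \<noteq> (0, 0)" "(c, d) \<noteq> (0, 0)"
  shows "ratio a b = ratio c d \<longleftrightarrow> a * d = b * c"
  using assms by (auto simp: ratio_def field_simps)

lemma ratio_scale [simp]: "k \<noteq> 0 \<Longrightarrow> ratio (k * a) (k * b) = ratio a b"
  by (auto simp: ratio_def)

lemma ratio_simps [simp]: "ratio z 1 = Fin z" "ratio 1 0 = Infty" "ratio a 0 = Infty"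
  by (auto simp: ratio_def)

lemma ratio_cases:
  obtains u v where "(u, v) \<noteq> (0, 0)" "x = ratio u v"
proof (cases x)
  case (Fin z)
  then show ?thesis using that[of z 1] by simp
next
  case Infty
  then show ?thesis using that[of 1 0] by simp
qed

lemma tendsto_Fin: "(f \<longlongrightarrow> z) F \<Longrightarrow> ((\<lambda>x. Fin (f x)) \<longlongrightarrow> Fin z) F"
  using tendsto_ratio[of f z F "\<lambda>_. 1" 1] by simp

text \<open>Projection from the north pole, hence continuous where the last coordinate is not 1. At
  \<open>Infty\<close> the quotient 0/0 yields the dummy value 0 of \<open>chart\<close>.\<close>

lemma chart_Fin_eq: "chart (Fin p) x = fst (stereographic x) / of_real (1 - snd (stereographic x))"
proof (cases x)
  case (Fin z)
  have "1 - ((cmod z)\<^sup>2 - 1) / ((cmod z)\<^sup>2 + 1) = 2 / (1 + (cmod z)\<^sup>2)"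
    using one_plus_sq_pos[of z] by (simp add: field_simps)
  then show ?thesis using one_plus_sq_pos[of z] Fin
    by (simp add: chart_def scaleR_conv_of_real del: of_real_divide of_real_add of_real_diff)
qed (simp add: chart_def)

text \<open>Projection from the south pole, conjugated because 1/z is \<open>cnj z\<close> divided
  by |z|^2.\<close>

lemma chart_Infty_eq: "chart Infty x = cnj (fst (stereographic x)) / of_real (1 + snd (stereographic x))"
proof (cases x)
  case (Fin z)
  have e: "1 + ((cmod z)\<^sup>2 - 1) / ((cmod z)\<^sup>2 + 1) = 2 * (cmod z)\<^sup>2 / (1 + (cmod z)\<^sup>2)"
    using one_plus_sq_pos[of z] by (simp add: field_simps)
  show ?thesis
  proof (cases "z = 0")
    case False
    have "complex_of_real (2 * (cmod z)\<^sup>2 / (1 + (cmod z)\<^sup>2)) = 2 * (z * cnj z) / of_real (1 + (cmod z)\<^sup>2)"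
      unfolding of_real_divide of_real_mult complex_norm_square by simp
    moreover have "complex_of_real (1 + (cmod z)\<^sup>2) \<noteq> 0"
      using one_plus_sq_pos[of z] by (metis less_irrefl of_real_eq_0_iff)
    ultimately show ?thesis using Fin False
      by (simp add: chart_def scaleR_conv_of_real e del: of_real_add of_real_power)
  qed (simp add: Fin chart_def)
qed (simp add: chart_def)

lemma Infty_iff_snd: "snd (stereographic x) = 1 \<longleftrightarrow> x = Infty"
proof (cases x)
  case (Fin z)
  then show ?thesis using one_plus_sq_pos[of z] by (simp add: divide_eq_eq)
qed simp

lemma zero_iff_snd: "snd (stereographic x) = -1 \<longleftrightarrow> x = Fin 0"
proof (cases x)
  case (Fin z)
  then show ?thesis using one_plus_sq_pos[of z] by (auto simp: divide_eq_eq)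
qed simp

text \<open>Where the chart is a genuine coordinate; at the one point left out \<open>chart\<close>
  has its dummy value.\<close>

definition chart_dom :: "riemann_sphere \<Rightarrow> riemann_sphere set" where
  "chart_dom p = (if p = Infty then - {Fin 0} else - {Infty})"

lemma tendsto_chart:
  assumes "(f \<longlongrightarrow> x) F" "x \<in> chart_dom p"
  shows "((\<lambda>t. chart p (f t)) \<longlongrightarrow> chart p x) F"
proof -
  have s: "((\<lambda>t. stereographic (f t)) \<longlongrightarrow> stereographic x) F"
    using assms(1) by (simp add: tendsto_sphere_iff)
  show ?thesis
  proof (cases p)
    case (Fin q)
    have "1 - snd (stereographic x) \<noteq> 0"
      using assms(2) Infty_iff_snd[of x] by (auto simp: chart_dom_def Fin)
    then show ?thesis
      unfolding Fin chart_Fin_eq by (intro tendsto_intros s) (metis of_real_eq_0_iff)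
  next
    case Infty
    have "1 + snd (stereographic x) \<noteq> 0"
      using assms(2) zero_iff_snd[of x] by (auto simp: chart_dom_def Infty)
    then show ?thesis
      unfolding Infty chart_Infty_eq by (intro tendsto_intros s) (metis of_real_eq_0_iff)
  qed
qed

lemma isCont_Fin: "isCont Fin z"
  unfolding isCont_def by (rule tendsto_Fin) simp

lemma isCont_inv_chart: "isCont (inv_chart p) z"
proof (cases p)
  case (Fin w)
  then have "inv_chart p = Fin" by (auto simp: inv_chart_def)
  then show ?thesis by (simp add: isCont_Fin)
next
  case Infty
  then have e: "inv_chart p = ratio 1" by (auto simp: inv_chart_def)
  have "((\<lambda>z. ratio 1 z) \<longlongrightarrow> ratio 1 z) (at z)"
    by (rule tendsto_ratio) auto
  then show ?thesis by (simp add: isCont_def e)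
qed

lemma open_chart_dom: "open (chart_dom p)" and chart_dom_self: "p \<in> chart_dom p"
  by (auto simp: chart_dom_def)

lemma inv_chart_chart: "x \<in> chart_dom p \<Longrightarrow> inv_chart p (chart p x) = x"
  by (cases p; cases x) (auto simp: chart_dom_def chart_def inv_chart_def ratio_def)

lemma chart_inv_chart: "chart p (inv_chart p z) = z"
  by (cases p) (auto simp: chart_def inv_chart_def ratio_def)

lemma isCont_sphereI:
  fixes f :: "riemann_sphere \<Rightarrow> 'a::topological_space"
  assumes "isCont (\<lambda>z. f (inv_chart x z)) (chart x x)"
  shows "isCont f x"
proof -
  have c: "((\<lambda>y. chart x y) \<longlongrightarrow> chart x x) (at x)"
    by (rule tendsto_chart) (auto simp: chart_dom_self)
  have "((\<lambda>y. f (inv_chart x (chart x y))) \<longlongrightarrow> f (inv_chart x (chart x x))) (at x)"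
    using isCont_tendsto_compose[OF assms c] .
  moreover have "eventually (\<lambda>y. f (inv_chart x (chart x y)) = f y) (at x)"
    using eventually_at_in_open'[OF open_chart_dom chart_dom_self[of x]]
    by eventually_elim (simp add: inv_chart_chart)
  ultimately have "(f \<longlongrightarrow> f (inv_chart x (chart x x))) (at x)"
    by (rule Lim_transform_eventually)
  then show ?thesis
    by (simp add: isCont_def inv_chart_chart chart_dom_self)
qed

lemma compact_sphere: "compact (UNIV :: riemann_sphere set)"
proof -
  have "compact (Fin ` cball 0 1)"
    by (intro compact_continuous_image continuous_at_imp_continuous_on ballI isCont_Fin) auto
  moreover have "compact (inv_chart Infty ` cball 0 1)"
    by (intro compact_continuous_image continuous_at_imp_continuous_on ballI isCont_inv_chart) auto
  moreover have "UNIV = Fin ` cball 0 1 \<union> inv_chart Infty ` cball 0 1"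
  proof (intro set_eqI iffI UNIV_I)
    fix x
    show "x \<in> Fin ` cball 0 1 \<union> inv_chart Infty ` cball 0 1"
    proof (cases x)
      case (Fin z)
      show ?thesis
      proof (cases "norm z \<le> 1")
        case False
        then have "x = inv_chart Infty (1 / z)" "norm (1 / z) \<le> 1"
          by (auto simp: Fin inv_chart_def ratio_def norm_divide divide_le_eq)
        then show ?thesis by auto
      qed (simp add: Fin)
    next
      case Infty
      then have "x = inv_chart Infty 0" by (auto simp: inv_chart_def ratio_def)
      then show ?thesis by force
    qed
  qed
  ultimately show ?thesis by (metis compact_Un)
qed

lemma tendsto_Infty_iff:
  "((\<lambda>x. Fin (f x)) \<longlongrightarrow> Infty) F \<longleftrightarrow> filterlim f at_infinity F"
proof
  assume "filterlim f at_infinity F"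
  then have i: "((\<lambda>x. inverse (f x)) \<longlongrightarrow> 0) F"
    by (rule filterlim_compose[OF tendsto_inverse_0])
  have ne: "eventually (\<lambda>x. f x \<noteq> 0) F"
    using \<open>filterlim f at_infinity F\<close> by (simp add: filterlim_at_infinity_imp_eventually_ne)
  have "((\<lambda>x. ratio 1 (inverse (f x))) \<longlongrightarrow> ratio 1 0) F"
    by (rule tendsto_ratio) (auto intro: i)
  then show "((\<lambda>x. Fin (f x)) \<longlongrightarrow> Infty) F"
    unfolding ratio_simps
    by (rule Lim_transform_eventually)
       (use ne in \<open>auto elim!: eventually_mono simp: ratio_def inverse_eq_divide\<close>)
next
  assume a: "((\<lambda>x. Fin (f x)) \<longlongrightarrow> Infty) F"
  have "((\<lambda>x. chart Infty (Fin (f x))) \<longlongrightarrow> chart Infty Infty) F"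
    by (rule tendsto_chart[OF a chart_dom_self])
  then have i: "((\<lambda>x. inverse (f x)) \<longlongrightarrow> 0) F"
    by (simp add: chart_def inverse_eq_divide)
  have "eventually (\<lambda>x. Fin (f x) \<in> chart_dom Infty) F"
    using topological_tendstoD[OF a open_chart_dom chart_dom_self] .
  then have "eventually (\<lambda>x. f x \<noteq> 0) F"
    by eventually_elim (auto simp: chart_dom_def)
  then show "filterlim f at_infinity F"
    using filterlim_inverse_at_iff[of f F, unfolded filterlim_at] i
    by (auto elim!: eventually_mono)
qed

lemma tendsto_Fin_iff: "((\<lambda>x. Fin (f x)) \<longlongrightarrow> Fin z) F \<longleftrightarrow> (f \<longlongrightarrow> z) F"
proof
  assume "((\<lambda>x. Fin (f x)) \<longlongrightarrow> Fin z) F"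
  from tendsto_chart[OF this chart_dom_self] show "(f \<longlongrightarrow> z) F"
    by (simp add: chart_def)
qed (rule tendsto_Fin)

lemma open_Fin_image: "open U \<Longrightarrow> open (Fin ` U)"
proof -
  assume U: "open U"
  have c: "continuous_on (- {Infty}) (chart (Fin 0))"
    unfolding continuous_on_def
  proof
    fix x :: riemann_sphere assume "x \<in> - {Infty}"
    then show "(chart (Fin 0) \<longlongrightarrow> chart (Fin 0) x) (at x within - {Infty})"
      by (intro tendsto_chart) (auto simp: chart_dom_def)
  qed
  have "open (chart (Fin 0) -` U \<inter> - {Infty})"
    using continuous_on_open_vimage[of "- {Infty}" "chart (Fin 0)"] c U by blast
  also have "chart (Fin 0) -` U \<inter> - {Infty} = Fin ` U"
  proof (intro set_eqI)
    fix x show "x \<in> chart (Fin 0) -` U \<inter> - {Infty} \<longleftrightarrow> x \<in> Fin ` U"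
      by (cases x) (auto simp: chart_def)
  qed
  finally show ?thesis .
qed

section \<open>Holomorphy in charts and the chain rule\<close>

text \<open>Continuity is a separate condition: because of the dummy value of \<open>chart\<close>,
  the chart expression can be differentiable although \<open>f\<close> jumps to the omitted
  point.\<close>

definition holo_at :: "(riemann_sphere \<Rightarrow> riemann_sphere) \<Rightarrow> riemann_sphere \<Rightarrow> bool" where
  "holo_at f x \<longleftrightarrow> isCont f x \<and>
     (\<lambda>z. chart (f x) (f (inv_chart x z))) field_differentiable at (chart x x)"

lemma holo_at_has_derivative:
  assumes "holo_at f x"
  shows "((\<lambda>z. chart (f x) (f (inv_chart x z))) has_field_derivative local_deriv f x) (at (chart x x))"
  using assms unfolding holo_at_def local_deriv_def by (simp add: field_differentiable_derivI)

lemma holo_at_compose: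
  assumes f: "holo_at f x" and g: "holo_at g (f x)"
  shows "holo_at (g \<circ> f) x" and "local_deriv (g \<circ> f) x = local_deriv g (f x) * local_deriv f x"
proof -
  define c where "c = chart x x"
  have ic: "inv_chart x c = x" by (simp add: c_def inv_chart_chart chart_dom_self)
  have F: "((\<lambda>z. chart (f x) (f (inv_chart x z))) has_field_derivative local_deriv f x) (at c)"
    unfolding c_def by (rule holo_at_has_derivative[OF f])
  have G: "((\<lambda>z. chart (g (f x)) (g (inv_chart (f x) z))) has_field_derivative local_deriv g (f x))
     (at (chart (f x) (f (inv_chart x c))))"
    unfolding ic by (rule holo_at_has_derivative[OF g])
  have GF: "((\<lambda>z. chart (g (f x)) (g (inv_chart (f x) (chart (f x) (f (inv_chart x z))))))
     has_field_derivative local_deriv g (f x) * local_deriv f x) (at c)"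
    using DERIV_chain2[OF G F] .
  have cont: "isCont (\<lambda>z. f (inv_chart x z)) c"
    by (rule isCont_o2[OF isCont_inv_chart]) (use f ic in \<open>simp add: holo_at_def\<close>)
  have "((\<lambda>z. f (inv_chart x z)) \<longlongrightarrow> f x) (at c)"
    using cont unfolding isCont_def ic .
  from topological_tendstoD[OF this open_chart_dom chart_dom_self]
  have ev: "eventually (\<lambda>z. f (inv_chart x z) \<in> chart_dom (f x)) (nhds c)"
    unfolding eventually_nhds_conv_at using ic chart_dom_self[of "f x"] by simp
  have D: "((\<lambda>z. chart ((g \<circ> f) x) ((g \<circ> f) (inv_chart x z))) has_field_derivative
     local_deriv g (f x) * local_deriv f x) (at c)"
    using GF
    by (rule DERIV_cong_ev[OF refl _ refl, THEN iffD1, rotated])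
       (use ev in \<open>auto elim!: eventually_mono simp: inv_chart_chart\<close>)
  show "holo_at (g \<circ> f) x"
    unfolding holo_at_def
  proof
    show "isCont (g \<circ> f) x"
      unfolding comp_def by (rule isCont_o2) (use f g in \<open>auto simp: holo_at_def\<close>)
    show "(\<lambda>z. chart ((g \<circ> f) x) ((g \<circ> f) (inv_chart x z))) field_differentiable at (chart x x)"
      using D unfolding c_def field_differentiable_def by blast
  qed
  show "local_deriv (g \<circ> f) x = local_deriv g (f x) * local_deriv f x"
    using DERIV_imp_deriv[OF D] unfolding local_deriv_def c_def .
qed

lemma chart_Fin_ratio: "chart (Fin w) (ratio a b) = a / b"
  by (auto simp: chart_def ratio_def)

lemma chart_Infty_ratio: "chart Infty (ratio a b) = b / a"
  by (auto simp: chart_def ratio_def)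

text \<open>Both charts produce the Wronskian \<open>p' * q c - p c * q'\<close> up to a nonzero
  factor, so critical points are its zeros whether or not the value is \<open>Infty\<close>.\<close>

lemma holo_at_ratio:
  assumes rep: "\<And>z. f (inv_chart x z) = ratio (p z) (q z)"
    and p: "(p has_field_derivative p') (at c)" and q: "(q has_field_derivative q') (at c)"
    and c: "c = chart x x" and nz: "(p c, q c) \<noteq> (0, 0)"
  shows "holo_at f x" and "f x = ratio (p c) (q c)"
    and "local_deriv f x = (if q c = 0 then - (p' * q c - p c * q') / (p c)\<^sup>2
           else (p' * q c - p c * q') / (q c)\<^sup>2)"
proof -
  show fx: "f x = ratio (p c) (q c)"
    using rep[of c] by (simp add: c inv_chart_chart chart_dom_self)
  have "isCont (\<lambda>z. f (inv_chart x z)) (chart x x)"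
    unfolding rep isCont_def c[symmetric]
    using p q nz by (intro tendsto_ratio) (auto dest: DERIV_isCont simp: isCont_def)
  then have cont: "isCont f x" by (rule isCont_sphereI)
  define D where "D = (if q c = 0 then - (p' * q c - p c * q') / (p c)\<^sup>2
           else (p' * q c - p c * q') / (q c)\<^sup>2)"
  have D: "((\<lambda>z. chart (f x) (f (inv_chart x z))) has_field_derivative D) (at c)"
  proof (cases "q c = 0")
    case True
    then have "f x = Infty" by (simp add: fx)
    then have "(\<lambda>z. chart (f x) (f (inv_chart x z))) = (\<lambda>z. q z / p z)"
      by (simp add: rep chart_Infty_ratio)
    moreover have "((\<lambda>z. q z / p z) has_field_derivative (q' * p c - q c * p') / (p c * p c)) (at c)"
      using DERIV_divide[OF q p] nz True by auto
    ultimately show ?thesis using True by (simp add: D_def power2_eq_square)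
  next
    case False
    then have "f x = Fin (p c / q c)" by (simp add: fx ratio_def)
    then have "(\<lambda>z. chart (f x) (f (inv_chart x z))) = (\<lambda>z. p z / q z)"
      by (simp add: rep chart_Fin_ratio)
    moreover have "((\<lambda>z. p z / q z) has_field_derivative (p' * q c - p c * q') / (q c * q c)) (at c)"
      using DERIV_divide[OF p q] False by auto
    ultimately show ?thesis using False by (simp add: D_def power2_eq_square)
  qed
  show "holo_at f x"
    using cont D unfolding holo_at_def c[symmetric] field_differentiable_def by blast
  show "local_deriv f x = (if q c = 0 then - (p' * q c - p c * q') / (p c)\<^sup>2
           else (p' * q c - p c * q') / (q c)\<^sup>2)"
    using DERIV_imp_deriv[OF D] unfolding local_deriv_def c[symmetric] D_def .
qed

section \<open>Quadratic maps and Moebius conjugation\<close>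

text \<open>Homogenization with \<open>z = s / t\<close>.\<close>
fun qform :: "complex \<times> complex \<times> complex \<Rightarrow> complex \<Rightarrow> complex \<Rightarrow> complex" where
  "qform (a, b, c) s t = a * t\<^sup>2 + b * s * t + c * s\<^sup>2"

definition qmap :: "quad_coeffs \<Rightarrow> riemann_sphere \<Rightarrow> riemann_sphere" where
  "qmap x = rat_map (quad_poly (fst x)) (quad_poly (snd x))"

lemma coprime_complex_poly_iff:
  fixes p q :: "complex poly"
  shows "coprime p q \<longleftrightarrow> (\<forall>z. poly p z \<noteq> 0 \<or> poly q z \<noteq> 0)"
proof
  assume c: "coprime p q"
  show "\<forall>z. poly p z \<noteq> 0 \<or> poly q z \<noteq> 0"
  proof (rule ccontr)
    assume "\<not> ?thesis"
    then obtain z where "poly p z = 0" "poly q z = 0" by auto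
    then have "[:-z, 1:] dvd p" "[:-z, 1:] dvd q" by (simp_all add: poly_eq_0_iff_dvd)
    with c have "is_unit [:-z, 1:]" by (meson coprime_common_divisor)
    then show False by (simp add: is_unit_iff_degree)
  qed
next
  assume nz: "\<forall>z. poly p z \<noteq> 0 \<or> poly q z \<noteq> 0"
  show "coprime p q"
  proof (rule coprimeI)
    fix d assume d: "d dvd p" "d dvd q"
    have "d \<noteq> 0"
      using d nz by (metis dvd_0_left poly_0)
    moreover have "degree d = 0"
    proof (rule ccontr)
      assume "degree d \<noteq> 0"
      then obtain z where "poly d z = 0"
        by (metis fundamental_theorem_of_algebra constant_degree)
      then have "poly p z = 0" "poly q z = 0"
        using d by (auto elim!: dvdE)
      then show False using nz by auto
    qed
    ultimately show "is_unit d" by (simp add: is_unit_iff_degree)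
  qed
qed

lemma degree_quad_poly:
  "degree (quad_poly (a, b, c)) = (if c \<noteq> 0 then 2 else if b \<noteq> 0 then 1 else 0)"
  by auto

lemma poly_quad_poly: "poly (quad_poly u) z = qform u z 1"
  by (cases u) (auto simp: algebra_simps power2_eq_square)

lemma qform_scale: "qform u (k * s) (k * t) = k\<^sup>2 * qform u s t"
  by (cases u) (auto simp: algebra_simps power2_eq_square)

text \<open>Coprimality excludes common zeros at finite points; the degree condition excludes one at
  [1 : 0], where the forms take their leading coefficients.\<close>

lemma quad_coeff_set_iff:
  "(u, v) \<in> quad_coeff_set \<longleftrightarrow> (\<forall>s t. (s, t) \<noteq> (0, 0) \<longrightarrow> (qform u s t, qform v s t) \<noteq> (0, 0))"
proof -
  obtain a b c where u: "u = (a, b, c)" by (cases u)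
  obtain a' b' c' where v: "v = (a', b', c')" by (cases v)
  have deg: "max (degree (quad_poly u)) (degree (quad_poly v)) = 2 \<longleftrightarrow> (c, c') \<noteq> (0, 0)"
    unfolding u v degree_quad_poly by auto
  have "(\<forall>s t. (s, t) \<noteq> (0, 0) \<longrightarrow> (qform u s t, qform v s t) \<noteq> (0, 0)) \<longleftrightarrow>
     (\<forall>z. qform u z 1 \<noteq> 0 \<or> qform v z 1 \<noteq> 0) \<and> (c, c') \<noteq> (0, 0)" (is "?L \<longleftrightarrow> ?R")
  proof
    assume L: ?L
    have "qform u z 1 \<noteq> 0 \<or> qform v z 1 \<noteq> 0" for z
      using L[rule_format, of z 1] by simp
    moreover have "(c, c') \<noteq> (0, 0)"
      using L[rule_format, of 1 0] by (simp add: u v)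
    ultimately show ?R by blast
  next
    assume R: ?R
    show ?L
    proof (intro allI impI)
      fix s t :: complex assume st: "(s, t) \<noteq> (0, 0)"
      show "(qform u s t, qform v s t) \<noteq> (0, 0)"
      proof (cases "t = 0")
        case True
        then show ?thesis using st R by (auto simp: u v)
      next
        case False
        have "qform w s t = t\<^sup>2 * qform w (s / t) 1" for w
          using qform_scale[of w t "s / t" 1] False by simp
        then show ?thesis using R False by auto
      qed
    qed
  qed
  moreover have "(u, v) \<in> quad_coeff_set \<longleftrightarrow> coprime (quad_poly u) (quad_poly v) \<and>
      max (degree (quad_poly u)) (degree (quad_poly v)) = 2"
    by (simp add: quad_coeff_set_def)
  ultimately show ?thesis
    unfolding coprime_complex_poly_iff poly_quad_poly deg by blast
qed

lemma qmap_ratio: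
  assumes x: "x \<in> quad_coeff_set" and st: "(s, t) \<noteq> (0, 0)"
  shows "qmap x (ratio s t) = ratio (qform (fst x) s t) (qform (snd x) s t)"
proof -
  obtain a b c a' b' c' where e: "x = ((a, b, c), (a', b', c'))" by (metis surj_pair)
  show ?thesis
  proof (cases "t = 0")
    case True
    have "max (degree (quad_poly (a, b, c))) (degree (quad_poly (a', b', c'))) = 2"
      using x by (simp add: quad_coeff_set_def e)
    moreover have "s\<^sup>2 \<noteq> 0" using st True by simp
    ultimately show ?thesis using True
      by (simp add: qmap_def e ratio_def numeral_2_eq_2)
  next
    case False
    have "qform w s t = t\<^sup>2 * qform w (s / t) 1" for w
      using qform_scale[of w t "s / t" 1] False by simp
    moreover have "t\<^sup>2 \<noteq> 0" using False by simp
    ultimately show ?thesis using False ratio_scale[of "t\<^sup>2"]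
      by (simp add: qmap_def ratio_def[of s t] poly_quad_poly)
  qed
qed

lemma qmap_nz:
  assumes "x \<in> quad_coeff_set" "(s, t) \<noteq> (0, 0)"
  shows "(qform (fst x) s t, qform (snd x) s t) \<noteq> (0, 0)"
  using assms quad_coeff_set_iff[of "fst x" "snd x"] by simp

lemma rational_maps_2: "rational_maps 2 = qmap ` quad_coeff_set"
proof -
  have "rational_maps 2 = (\<lambda>(u, v). rat_map (quad_poly u) (quad_poly v)) ` quad_coeff_set"
    using topspace_Rat2_topology by (simp add: Rat2_topology_def)
  then show ?thesis by (auto simp: qmap_def split_def image_def)
qed

lemma qmap_eqI:
  assumes "\<And>s t. (s, t) \<noteq> (0, 0) \<Longrightarrow> f (ratio s t) = g (ratio s t)"
  shows "f = g"
proof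
  fix x show "f x = g x" by (metis ratio_cases assms)
qed

definition moeb :: "complex \<Rightarrow> complex \<Rightarrow> complex \<Rightarrow> complex \<Rightarrow> riemann_sphere \<Rightarrow> riemann_sphere" where
  "moeb a b c d x = (case x of Fin z \<Rightarrow> ratio (a * z + b) (c * z + d) | Infty \<Rightarrow> ratio a c)"

lemma moeb_nz:
  fixes a b c d s t :: complex
  assumes "a * d - b * c \<noteq> 0" "(s, t) \<noteq> (0, 0)"
  shows "(a * s + b * t, c * s + d * t) \<noteq> (0, 0)"
proof
  assume "(a * s + b * t, c * s + d * t) = (0, 0)"
  then have e: "a * s + b * t = 0" "c * s + d * t = 0" by auto
  have "(a * d - b * c) * s = d * (a * s + b * t) - b * (c * s + d * t)"
    "(a * d - b * c) * t = a * (c * s + d * t) - c * (a * s + b * t)"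
    by (simp_all add: algebra_simps)
  then show False using assms e by simp
qed

lemma moeb_ratio:
  assumes "(s, t) \<noteq> (0, 0)"
  shows "moeb a b c d (ratio s t) = ratio (a * s + b * t) (c * s + d * t)"
proof (cases "t = 0")
  case True
  then show ?thesis using assms by (simp add: moeb_def ratio_def)
next
  case False
  then have "a * s + b * t = t * (a * (s / t) + b)" "c * s + d * t = t * (c * (s / t) + d)"
    by (simp_all add: field_simps)
  then show ?thesis using False by (simp add: moeb_def ratio_def[of s t])
qed

lemma rat_map_moeb:
  assumes "a * d - b * c \<noteq> 0"
  shows "rat_map [:b, a:] [:d, c:] = moeb a b c d"
proof
  fix x show "rat_map [:b, a:] [:d, c:] x = moeb a b c d x"
  proof (cases x)
    case (Fin z)
    then show ?thesis by (simp add: moeb_def algebra_simps)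
  next
    case Infty
    have "max (degree [:b, a:]) (degree [:d, c:]) = 1"
      using assms by auto
    then show ?thesis by (simp add: moeb_def Infty Let_def)
  qed
qed

lemma rational_maps_1: "rational_maps 1 = {moeb a b c d | a b c d. a * d - b * c \<noteq> 0}"
proof (intro set_eqI iffI)
  fix f assume "f \<in> rational_maps 1"
  then obtain p q where f: "f = rat_map p q" and cp: "coprime p q" and deg: "max (degree p) (degree q) = 1"
    by (auto simp: rational_maps_def)
  have lin: "r = [:coeff r 0, coeff r 1:]" if "degree r \<le> 1" for r :: "complex poly"
    using that by (intro poly_eqI) (auto simp: coeff_pCons coeff_eq_0 split: nat.splits)
  obtain b a where p: "p = [:b, a:]" using lin[of p] deg by fastforce
  obtain d c where q: "q = [:d, c:]" using lin[of q] deg by fastforce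
  have "a * d - b * c \<noteq> 0"
  proof
    assume z: "a * d - b * c = 0"
    have "(a, c) \<noteq> (0, 0)" using deg by (auto simp: p q)
    then consider "a \<noteq> 0" | "c \<noteq> 0" by auto
    then show False
    proof cases
      case 1
      then have "poly p (- b / a) = 0" "poly q (- b / a) = 0"
        using z by (auto simp: p q field_simps)
      then show ?thesis using cp by (auto simp: coprime_complex_poly_iff)
    next
      case 2
      then have "poly p (- d / c) = 0" "poly q (- d / c) = 0"
        using z by (auto simp: p q field_simps)
      then show ?thesis using cp by (auto simp: coprime_complex_poly_iff)
    qed
  qed
  then show "f \<in> {moeb a b c d | a b c d. a * d - b * c \<noteq> 0}"
    using f p q rat_map_moeb by blast
next
  fix f assume "f \<in> {moeb a b c d | a b c d. a * d - b * c \<noteq> 0}"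
  then obtain a b c d where f: "f = moeb a b c d" and nz: "a * d - b * c \<noteq> 0" by auto
  have "poly [:b, a:] z \<noteq> 0 \<or> poly [:d, c:] z \<noteq> 0" for z
    using moeb_nz[OF nz, of z 1] by (auto simp: algebra_simps)
  then have "coprime [:b, a:] [:d, c:]" by (simp add: coprime_complex_poly_iff)
  moreover have "max (degree [:b, a:]) (degree [:d, c:]) = 1" using nz by auto
  ultimately show "f \<in> rational_maps 1"
    unfolding rational_maps_def f rat_map_moeb[OF nz, symmetric] by blast
qed

lemma moeb_compose:
  assumes "a' * d' - b' * c' \<noteq> 0"
  shows "moeb a b c d \<circ> moeb a' b' c' d' =
    moeb (a * a' + b * c') (a * b' + b * d') (c * a' + d * c') (c * b' + d * d')"
proof (rule qmap_eqI)
  fix s t :: complex assume st: "(s, t) \<noteq> (0, 0)"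
  show "(moeb a b c d \<circ> moeb a' b' c' d') (ratio s t) =
    moeb (a * a' + b * c') (a * b' + b * d') (c * a' + d * c') (c * b' + d * d') (ratio s t)"
    using moeb_nz[OF assms st] st by (simp add: moeb_ratio algebra_simps)
qed

lemma moeb_id: "k \<noteq> 0 \<Longrightarrow> moeb k 0 0 k = id"
  by (rule qmap_eqI) (simp add: moeb_ratio)

lemma moeb_inverse:
  assumes "a * d - b * c \<noteq> 0"
  shows "moeb d (- b) (- c) a \<circ> moeb a b c d = id" "moeb a b c d \<circ> moeb d (- b) (- c) a = id"
proof -
  have "d * a - b * c \<noteq> 0" "a * d - b * c \<noteq> 0" "d * a - - b * - c \<noteq> 0"
    using assms by (simp_all add: mult.commute)
  then show "moeb d (- b) (- c) a \<circ> moeb a b c d = id" "moeb a b c d \<circ> moeb d (- b) (- c) a = id"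
    using moeb_id by (simp_all add: moeb_compose algebra_simps)
qed

lemma rational_maps_1E:
  assumes "\<phi> \<in> rational_maps 1"
  obtains a b c d where "\<phi> = moeb a b c d" "a * d - b * c \<noteq> 0"
  using assms unfolding rational_maps_1 by blast

lemma rational_maps_1I: "a * d - b * c \<noteq> 0 \<Longrightarrow> moeb a b c d \<in> rational_maps 1"
  unfolding rational_maps_1 by blast

lemma rational_maps_1_compose:
  assumes "\<phi> \<in> rational_maps 1" "\<psi> \<in> rational_maps 1"
  shows "\<phi> \<circ> \<psi> \<in> rational_maps 1"
proof -
  obtain a b c d where p: "\<phi> = moeb a b c d" "a * d - b * c \<noteq> 0"
    using assms(1) by (rule rational_maps_1E)
  obtain a' b' c' d' where q: "\<psi> = moeb a' b' c' d'" "a' * d' - b' * c' \<noteq> 0"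
    using assms(2) by (rule rational_maps_1E)
  have "(a * a' + b * c') * (c * b' + d * d') - (a * b' + b * d') * (c * a' + d * c') =
     (a * d - b * c) * (a' * d' - b' * c')" by (simp add: algebra_simps)
  then have "(a * a' + b * c') * (c * b' + d * d') - (a * b' + b * d') * (c * a' + d * c') \<noteq> 0"
    using p q by simp
  from rational_maps_1I[OF this] show ?thesis using p q by (simp add: moeb_compose)
qed

lemma rational_maps_1_inverse:
  assumes "\<phi> \<in> rational_maps 1"
  obtains \<psi> where "\<psi> \<in> rational_maps 1" "\<psi> \<circ> \<phi> = id" "\<phi> \<circ> \<psi> = id"
proof -
  obtain a b c d where p: "\<phi> = moeb a b c d" "a * d - b * c \<noteq> 0"
    using assms by (rule rational_maps_1E)
  show ?thesis
  proof (rule that)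
    have "d * a - - b * - c \<noteq> 0" using p by (simp add: mult.commute)
    then show "moeb d (- b) (- c) a \<in> rational_maps 1" by (rule rational_maps_1I)
  qed (use p moeb_inverse in auto)
qed

lemma id_rational_maps_1: "id \<in> rational_maps 1"
proof -
  have "moeb 1 0 0 1 \<in> rational_maps 1" unfolding rational_maps_1 by force
  then show ?thesis by (simp add: moeb_id)
qed

lemma moeb_holo: "a * d - b * c \<noteq> 0 \<Longrightarrow> holo_at (moeb a b c d) x"
proof (cases x)
  case (Fin z)
  assume nz: "a * d - b * c \<noteq> 0"
  show ?thesis
  proof (rule holo_at_ratio(1))
    show "moeb a b c d (inv_chart x w) = ratio (a * w + b) (c * w + d)" for w
      by (simp add: Fin inv_chart_def moeb_def)
    show "((\<lambda>w. a * w + b) has_field_derivative a) (at (chart x x))"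
      "((\<lambda>w. c * w + d) has_field_derivative c) (at (chart x x))"
      by (auto intro!: derivative_eq_intros)
    show "(a * chart x x + b, c * chart x x + d) \<noteq> (0, 0)"
      using moeb_nz[OF nz, of "chart x x" 1] by simp
  qed auto
next
  case Infty
  assume nz: "a * d - b * c \<noteq> 0"
  show ?thesis
  proof (rule holo_at_ratio(1))
    show "moeb a b c d (inv_chart x w) = ratio (a + b * w) (c + d * w)" for w
      by (simp add: Infty inv_chart_def moeb_ratio)
    show "((\<lambda>w. a + b * w) has_field_derivative b) (at (chart x x))"
      "((\<lambda>w. c + d * w) has_field_derivative d) (at (chart x x))"
      by (auto intro!: derivative_eq_intros)
    show "(a + b * chart x x, c + d * chart x x) \<noteq> (0, 0)"
      using moeb_nz[OF nz, of 1 "chart x x"] by (simp add: mult.commute)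
  qed auto
qed

lemma rational_maps_1_holo: "\<phi> \<in> rational_maps 1 \<Longrightarrow> holo_at \<phi> x"
  by (metis rational_maps_1E moeb_holo)

lemma qmap_holo:
  assumes X: "x \<in> quad_coeff_set"
  shows "holo_at (qmap x) y"
proof -
  obtain a b c a' b' c' where e: "x = ((a, b, c), (a', b', c'))" by (metis surj_pair)
  show ?thesis
  proof (cases y)
    case (Fin z)
    show ?thesis
    proof (rule holo_at_ratio(1))
      show "qmap x (inv_chart y w) = ratio (qform (a,b,c) w 1) (qform (a',b',c') w 1)" for w
        using qmap_ratio[OF X, of w 1] by (simp add: Fin inv_chart_def e)
      show "((\<lambda>w. qform (a,b,c) w 1) has_field_derivative (b + 2 * c * chart y y)) (at (chart y y))"
        "((\<lambda>w. qform (a',b',c') w 1) has_field_derivative (b' + 2 * c' * chart y y)) (at (chart y y))"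
        by (auto intro!: derivative_eq_intros)
      show "(qform (a,b,c) (chart y y) 1, qform (a',b',c') (chart y y) 1) \<noteq> (0, 0)"
        using qmap_nz[OF X, of "chart y y" 1] by (simp add: e)
    qed auto
  next
    case Infty
    show ?thesis
    proof (rule holo_at_ratio(1))
      show "qmap x (inv_chart y w) = ratio (qform (a,b,c) 1 w) (qform (a',b',c') 1 w)" for w
        using qmap_ratio[OF X, of 1 w] by (simp add: Infty inv_chart_def e)
      show "((\<lambda>w. qform (a,b,c) 1 w) has_field_derivative (2 * a * chart y y + b)) (at (chart y y))"
        "((\<lambda>w. qform (a',b',c') 1 w) has_field_derivative (2 * a' * chart y y + b')) (at (chart y y))"
        by (auto intro!: derivative_eq_intros)
      show "(qform (a,b,c) 1 (chart y y), qform (a',b',c') 1 (chart y y)) \<noteq> (0, 0)"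
        using qmap_nz[OF X, of 1 "chart y y"] by (simp add: e)
    qed auto
  qed
qed

lemma rational_maps_2_holo: "f \<in> rational_maps 2 \<Longrightarrow> holo_at f y"
  by (auto simp: rational_maps_2 qmap_holo)

lemma holo_at_id: "holo_at id x" "local_deriv id x = 1"
proof -
  have i: "(\<lambda>z. chart (id x) (id (inv_chart x z))) = (\<lambda>z. z)" by (simp add: chart_inv_chart)
  show "holo_at id x" unfolding holo_at_def i by simp
  show "local_deriv id x = 1" unfolding local_deriv_def i by simp
qed

lemma holo_at_funpow:
  assumes "\<And>y. holo_at f y"
  shows "holo_at (f ^^ n) x"
proof (induction n)
  case 0
  then show ?case using holo_at_id by (simp add: id_def)
next
  case (Suc n)
  then show ?case using holo_at_compose(1)[OF Suc.IH assms] by (simp add: comp_def)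
qed

lemma local_deriv_funpow_fixed:
  assumes "\<And>y. holo_at f y" "f x = x"
  shows "local_deriv (f ^^ n) x = local_deriv f x ^ n"
proof (induction n)
  case 0
  then show ?case using holo_at_id by (simp add: id_def)
next
  case (Suc n)
  have "(f ^^ n) x = x" using assms(2) by (induction n) auto
  then show ?case
    using holo_at_compose(2)[OF holo_at_funpow[OF assms(1)] assms(1), of n x] Suc by (simp add: comp_def)
qed

text \<open>Substitution of the adjugate of the Moebius matrix, see \<open>qform_qsub\<close>. The
  coefficients are written out so that continuity in them is visible.\<close>

fun qsub :: "complex \<Rightarrow> complex \<Rightarrow> complex \<Rightarrow> complex \<Rightarrow> complex \<times> complex \<times> complex \<Rightarrow> complex \<times> complex \<times> complex" where
  "qsub a b c d (p, q, r) =
     (p * a\<^sup>2 - q * a * b + r * b\<^sup>2,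
      q * (a * d + b * c) - 2 * p * a * c - 2 * r * b * d,
      p * c\<^sup>2 - q * c * d + r * d\<^sup>2)"

fun qlin :: "complex \<Rightarrow> complex \<Rightarrow> complex \<times> complex \<times> complex \<Rightarrow> complex \<times> complex \<times> complex \<Rightarrow> complex \<times> complex \<times> complex" where
  "qlin a b (p, q, r) (p', q', r') = (a * p + b * p', a * q + b * q', a * r + b * r')"

definition qconj :: "complex \<Rightarrow> complex \<Rightarrow> complex \<Rightarrow> complex \<Rightarrow> quad_coeffs \<Rightarrow> quad_coeffs" where
  "qconj a b c d x =
     (qlin a b (qsub a b c d (fst x)) (qsub a b c d (snd x)),
      qlin c d (qsub a b c d (fst x)) (qsub a b c d (snd x)))"

lemma qform_qsub: "qform (qsub a b c d u) s t = qform u (d * s - b * t) (a * t - c * s)"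
  by (cases u) (simp add: algebra_simps power2_eq_square)

lemma qform_qlin: "qform (qlin a b u v) s t = a * qform u s t + b * qform v s t"
  by (cases u; cases v) (simp add: algebra_simps)

lemma qconj_mem:
  assumes nz: "a * d - b * c \<noteq> 0" and X: "x \<in> quad_coeff_set"
  shows "qconj a b c d x \<in> quad_coeff_set"
    and "qmap (qconj a b c d x) \<circ> moeb a b c d = moeb a b c d \<circ> qmap x"
proof -
  have i: "d * a - - b * - c \<noteq> 0" using nz by (simp add: mult.commute)
  have f: "qform (fst (qconj a b c d x)) s t =
       a * qform (fst x) (d * s - b * t) (a * t - c * s) + b * qform (snd x) (d * s - b * t) (a * t - c * s)"
     "qform (snd (qconj a b c d x)) s t =
       c * qform (fst x) (d * s - b * t) (a * t - c * s) + d * qform (snd x) (d * s - b * t) (a * t - c * s)"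
    for s t by (simp_all add: qconj_def qform_qlin qform_qsub)
  have "(qform (fst (qconj a b c d x)) s t, qform (snd (qconj a b c d x)) s t) \<noteq> (0, 0)"
    if st: "(s, t) \<noteq> (0, 0)" for s t
  proof -
    have "(d * s - b * t, a * t - c * s) \<noteq> (0, 0)"
      using moeb_nz[OF i st] by auto
    from moeb_nz[OF nz qmap_nz[OF X this]] show ?thesis by (simp add: f)
  qed
  then show mem: "qconj a b c d x \<in> quad_coeff_set"
    using quad_coeff_set_iff[of "fst (qconj a b c d x)" "snd (qconj a b c d x)"] by simp
  show "qmap (qconj a b c d x) \<circ> moeb a b c d = moeb a b c d \<circ> qmap x"
  proof (rule qmap_eqI)
    fix s t :: complex assume st: "(s, t) \<noteq> (0, 0)"
    define k where "k = a * d - b * c"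
    have k: "k\<^sup>2 \<noteq> 0" using nz by (simp add: k_def)
    \<comment> \<open>Adjugate times matrix is the determinant, so the substitution multiplies both
      forms by its square, which cancels in \<open>ratio\<close>.\<close>
    have s: "d * (a * s + b * t) - b * (c * s + d * t) = k * s"
      "a * (c * s + d * t) - c * (a * s + b * t) = k * t"
      by (simp_all add: k_def algebra_simps)
    have "(qmap (qconj a b c d x) \<circ> moeb a b c d) (ratio s t) =
       ratio (qform (fst (qconj a b c d x)) (a * s + b * t) (c * s + d * t))
             (qform (snd (qconj a b c d x)) (a * s + b * t) (c * s + d * t))"
      using qmap_ratio[OF mem moeb_nz[OF nz st]] by (simp add: moeb_ratio[OF st])
    also have "\<dots> = ratio (k\<^sup>2 * (a * qform (fst x) s t + b * qform (snd x) s t))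
       (k\<^sup>2 * (c * qform (fst x) s t + d * qform (snd x) s t))"
      by (simp only: f s qform_scale) (simp add: algebra_simps)
    also have "\<dots> = (moeb a b c d \<circ> qmap x) (ratio s t)"
      using qmap_nz[OF X st] k by (simp add: qmap_ratio[OF X st] moeb_ratio)
    finally show "(qmap (qconj a b c d x) \<circ> moeb a b c d) (ratio s t) = (moeb a b c d \<circ> qmap x) (ratio s t)" .
  qed
qed

lemma rational_maps_1_cont: "\<phi> \<in> rational_maps 1 \<Longrightarrow> isCont \<phi> x"
  using rational_maps_1_holo[of \<phi> x] by (simp add: holo_at_def)

lemma rational_maps_2_cont: "f \<in> rational_maps 2 \<Longrightarrow> isCont f x"
  using rational_maps_2_holo[of f x] by (simp add: holo_at_def)

section \<open>What conjugation preserves\<close>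

text \<open>The conjugating map is kept as a parameter because fixed points, multipliers and orbits
  are transported by it. Rationality of \<open>g\<close> follows from that of \<open>f\<close> by
  \<open>conjugates_rational\<close>.\<close>

definition conjugates ::
    "(riemann_sphere \<Rightarrow> riemann_sphere) \<Rightarrow> (riemann_sphere \<Rightarrow> riemann_sphere) \<Rightarrow>
     (riemann_sphere \<Rightarrow> riemann_sphere) \<Rightarrow> bool" where
  "conjugates \<phi> f g \<longleftrightarrow> \<phi> \<in> rational_maps 1 \<and> \<phi> \<circ> f = g \<circ> \<phi>"

lemma conjugates_apply: "conjugates \<phi> f g \<Longrightarrow> \<phi> (f x) = g (\<phi> x)"
  unfolding conjugates_def by (metis comp_apply)

lemma conjugates_sym:
  assumes "conjugates \<phi> f g"
  obtains \<psi> where "conjugates \<psi> g f" "\<psi> \<circ> \<phi> = id" "\<phi> \<circ> \<psi> = id"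
proof -
  obtain \<psi> where p: "\<psi> \<in> rational_maps 1" "\<psi> \<circ> \<phi> = id" "\<phi> \<circ> \<psi> = id"
    using rational_maps_1_inverse assms unfolding conjugates_def by blast
  have "\<psi> \<circ> g = f \<circ> \<psi>"
  proof
    fix x
    have "x = \<phi> (\<psi> x)" using p(3) by (metis comp_apply id_apply)
    then have "\<psi> (g x) = \<psi> (\<phi> (f (\<psi> x)))"
      using conjugates_apply[OF assms] by metis
    then show "(\<psi> \<circ> g) x = (f \<circ> \<psi>) x"
      using p(2) by (metis comp_apply id_apply)
  qed
  then show ?thesis using p that unfolding conjugates_def by blast
qed

lemma conjugates_trans:
  assumes "conjugates \<phi> f g" "conjugates \<psi> g h"
  shows "conjugates (\<psi> \<circ> \<phi>) f h"
  using assms rational_maps_1_compose unfolding conjugates_def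
  by (metis comp_assoc)

lemma conjugates_refl: "conjugates id f f"
  unfolding conjugates_def using id_rational_maps_1 by (metis comp_id id_comp)

lemma conjugates_qmap:
  assumes "a * d - b * c \<noteq> 0" "x \<in> quad_coeff_set"
  shows "conjugates (moeb a b c d) (qmap x) (qmap (qconj a b c d x))"
  unfolding conjugates_def using qconj_mem[OF assms] rational_maps_1I[OF assms(1)] by metis

lemma conjugates_rational:
  assumes "conjugates \<phi> f g" "f \<in> rational_maps 2"
  shows "g \<in> rational_maps 2"
proof -
  obtain a b c d where p: "\<phi> = moeb a b c d" "a * d - b * c \<noteq> 0"
    using assms(1) unfolding conjugates_def by (blast elim: rational_maps_1E)
  obtain x where x: "f = qmap x" "x \<in> quad_coeff_set"
    using assms(2) by (auto simp: rational_maps_2)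
  obtain \<psi> where s: "\<phi> \<circ> \<psi> = id" using conjugates_sym[OF assms(1)] by metis
  have "qmap (qconj a b c d x) \<circ> \<phi> = g \<circ> \<phi>"
    using qconj_mem(2)[OF p(2) x(2)] assms(1) p x unfolding conjugates_def by metis
  then have "qmap (qconj a b c d x) = g"
    by (metis comp_assoc s comp_id)
  then show ?thesis using qconj_mem(1)[OF p(2) x(2)] by (auto simp: rational_maps_2)
qed

lemma moebius_conjugacy_iff:
  "(f, g) \<in> moebius_conjugacy \<longleftrightarrow> f \<in> rational_maps 2 \<and> (\<exists>\<phi>. conjugates \<phi> f g)"
  unfolding moebius_conjugacy_def conjugates_def[symmetric]
  using conjugates_rational by (auto simp: conjugates_def)

lemma equiv_moebius_conjugacy: "equiv (rational_maps 2) moebius_conjugacy"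
proof (rule equivI)
  show "moebius_conjugacy \<subseteq> rational_maps 2 \<times> rational_maps 2"
    by (auto simp: moebius_conjugacy_def)
  show "refl_on (rational_maps 2) moebius_conjugacy"
    unfolding refl_on_def moebius_conjugacy_iff using conjugates_refl by blast
  show "sym moebius_conjugacy"
    unfolding sym_def moebius_conjugacy_iff by (metis conjugates_sym conjugates_rational)
  show "trans moebius_conjugacy"
    unfolding trans_def moebius_conjugacy_iff by (metis conjugates_trans)
qed

lemma conj_class_eqI:
  assumes "conjugates \<phi> f g" "f \<in> rational_maps 2"
  shows "conj_class f = conj_class g"
  unfolding conj_class_def
  by (rule equiv_class_eq[OF equiv_moebius_conjugacy]) (use assms in \<open>auto simp: moebius_conjugacy_iff\<close>)

lemma conj_class_eqD:
  assumes "conj_class f = conj_class g" "f \<in> rational_maps 2"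
  obtains \<phi> where "conjugates \<phi> f g"
proof -
  have "f \<in> conj_class f"
    using assms(2) conjugates_refl by (auto simp: conj_class_def moebius_conjugacy_iff)
  then have "f \<in> conj_class g" by (simp only: assms(1))
  then have "(g, f) \<in> moebius_conjugacy" by (simp add: conj_class_def)
  then obtain \<phi> where "conjugates \<phi> g f" by (auto simp: moebius_conjugacy_iff)
  then show ?thesis using conjugates_sym that by metis
qed

lemma conjugates_funpow: "conjugates \<phi> f g \<Longrightarrow> \<phi> ((f ^^ n) x) = (g ^^ n) (\<phi> x)"
  by (induction n) (auto simp: conjugates_apply)

lemma conjugates_inj:
  assumes "conjugates \<phi> f g" shows "\<phi> x = \<phi> y \<longleftrightarrow> x = y"
  using conjugates_sym[OF assms] by (metis comp_apply id_apply)

lemma conjugates_surj: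
  assumes "conjugates \<phi> f g" obtains x where "\<phi> x = y"
  using conjugates_sym[OF assms] by (metis comp_apply id_apply)

lemma rational_maps_1_deriv_nz:
  assumes "\<phi> \<in> rational_maps 1" shows "local_deriv \<phi> x \<noteq> 0"
proof -
  obtain \<psi> where p: "\<psi> \<in> rational_maps 1" "\<psi> \<circ> \<phi> = id"
    using rational_maps_1_inverse[OF assms] by metis
  have "local_deriv (\<psi> \<circ> \<phi>) x = local_deriv \<psi> (\<phi> x) * local_deriv \<phi> x"
    using assms p by (intro holo_at_compose rational_maps_1_holo)
  then show ?thesis using p(2) holo_at_id(2)[of x] by auto
qed

lemma conjugates_chain:
  assumes "conjugates \<phi> f g" and f: "\<And>y. holo_at f y" and g: "\<And>y. holo_at g y"
  shows "local_deriv \<phi> ((f ^^ n) x) * local_deriv (f ^^ n) x = local_deriv (g ^^ n) (\<phi> x) * local_deriv \<phi> x"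
proof -
  have ph: "holo_at \<phi> y" for y using assms(1) rational_maps_1_holo by (auto simp: conjugates_def)
  have "\<phi> \<circ> (f ^^ n) = (g ^^ n) \<circ> \<phi>" using conjugates_funpow[OF assms(1)] by auto
  then show ?thesis
    using holo_at_compose(2)[OF holo_at_funpow[OF f, of n x] ph]
      holo_at_compose(2)[OF ph holo_at_funpow[OF g, of n "\<phi> x"]] by metis
qed

lemma conjugates_multiplier:
  assumes c: "conjugates \<phi> f g" and f: "f \<in> rational_maps 2" and p: "(f ^^ n) p = p"
  shows "local_deriv (g ^^ n) (\<phi> p) = local_deriv (f ^^ n) p"
proof -
  have "local_deriv \<phi> p \<noteq> 0" using c rational_maps_1_deriv_nz by (auto simp: conjugates_def)
  moreover have "local_deriv \<phi> p * local_deriv (f ^^ n) p = local_deriv (g ^^ n) (\<phi> p) * local_deriv \<phi> p"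
    using conjugates_chain[OF c rational_maps_2_holo[OF f] rational_maps_2_holo[OF conjugates_rational[OF c f]], of n p] p
    by simp
  ultimately show ?thesis by simp
qed

lemma conjugates_multiplier_1:
  assumes c: "conjugates \<phi> f g" and f: "f \<in> rational_maps 2" and p: "f p = p"
  shows "local_deriv g (\<phi> p) = local_deriv f p"
  using conjugates_multiplier[OF c f, of 1 p] p by simp

lemma conjugates_critical:
  assumes c: "conjugates \<phi> f g" and f: "f \<in> rational_maps 2"
  shows "critical_point g (\<phi> p) \<longleftrightarrow> critical_point f p"
proof -
  have "local_deriv \<phi> p \<noteq> 0" "local_deriv \<phi> (f p) \<noteq> 0"
    using c rational_maps_1_deriv_nz by (auto simp: conjugates_def)
  moreover have "local_deriv \<phi> (f p) * local_deriv f p = local_deriv g (\<phi> p) * local_deriv \<phi> p"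
    using conjugates_chain[OF c rational_maps_2_holo[OF f] rational_maps_2_holo[OF conjugates_rational[OF c f]], of 1 p]
    by simp
  ultimately show ?thesis by (auto simp: critical_point_def)
qed

lemma conjugates_eigenvalue:
  assumes c: "conjugates \<phi> f g" and f: "f \<in> rational_maps 2"
  shows "has_fixed_point_with_eigenvalue f m \<Longrightarrow> has_fixed_point_with_eigenvalue g m"
  unfolding has_fixed_point_with_eigenvalue_def
  using conjugates_multiplier_1[OF c f] conjugates_apply[OF c] by metis

lemma class_eigenvalue:
  assumes "conj_class f = conj_class g" "f \<in> rational_maps 2"
  shows "has_fixed_point_with_eigenvalue f m \<Longrightarrow> has_fixed_point_with_eigenvalue g m"
  using conj_class_eqD[OF assms] conjugates_eigenvalue assms(2) by metis

lemma uniformly_continuous_sphere: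
  fixes f :: "riemann_sphere \<Rightarrow> riemann_sphere"
  assumes "\<And>x. isCont f x" and "e > 0"
  obtains d where "d > 0" "\<And>x y. dist x y < d \<Longrightarrow> dist (f x) (f y) < e"
proof -
  have "uniformly_continuous_on UNIV f"
    using assms(1) by (intro compact_uniformly_continuous compact_sphere continuous_at_imp_continuous_on) auto
  then show ?thesis using that assms(2) unfolding uniformly_continuous_on_def by (metis UNIV_I dist_commute)
qed

lemma conjugates_tendsto:
  assumes "conjugates \<phi> f g" "(\<lambda>k. (f ^^ k) x) \<longlonglongrightarrow> y"
  shows "(\<lambda>k. (g ^^ k) (\<phi> x)) \<longlonglongrightarrow> \<phi> y"
proof -
  have "isCont \<phi> y" using assms(1) rational_maps_1_cont by (auto simp: conjugates_def)
  from isCont_tendsto_compose[OF this assms(2)] show ?thesis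
    by (simp add: conjugates_funpow[OF assms(1)])
qed

lemma conjugates_infdist:
  assumes c: "conjugates \<phi> f g" and A: "A \<noteq> {}"
    and l: "(\<lambda>k. infdist ((f ^^ k) x) A) \<longlonglongrightarrow> 0"
  shows "(\<lambda>k. infdist ((g ^^ k) (\<phi> x)) (\<phi> ` A)) \<longlonglongrightarrow> 0"
proof (rule LIMSEQ_I)
  fix e :: real assume "e > 0"
  obtain d where d: "d > 0" "\<And>x y. dist x y < d \<Longrightarrow> dist (\<phi> x) (\<phi> y) < e"
    using uniformly_continuous_sphere[OF rational_maps_1_cont \<open>e > 0\<close>, of \<phi>] c
    unfolding conjugates_def by metis
  obtain N where N: "\<And>k. k \<ge> N \<Longrightarrow> infdist ((f ^^ k) x) A < d"
    using LIMSEQ_D[OF l \<open>d > 0\<close>] by (auto simp: infdist_nonneg)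
  show "\<exists>N. \<forall>k\<ge>N. norm (infdist ((g ^^ k) (\<phi> x)) (\<phi> ` A) - 0) < e"
  proof (intro exI allI impI)
    fix k assume "N \<le> k"
    then have "infdist ((f ^^ k) x) A < d" by (rule N)
    have "\<exists>a\<in>A. dist ((f ^^ k) x) a < d"
    proof (rule ccontr)
      assume "\<not> (\<exists>a\<in>A. dist ((f ^^ k) x) a < d)"
      then have "d \<le> (INF a\<in>A. dist ((f ^^ k) x) a)"
        by (intro cINF_greatest[OF A]) force
      then show False
        using \<open>infdist ((f ^^ k) x) A < d\<close> by (simp add: infdist_notempty[OF A])
    qed
    then obtain a where a: "a \<in> A" "dist ((f ^^ k) x) a < d" by blast
    then have "dist ((g ^^ k) (\<phi> x)) (\<phi> a) < e"
      using d(2) conjugates_funpow[OF c] by metis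
    then have "infdist ((g ^^ k) (\<phi> x)) (\<phi> ` A) < e"
      using a(1) by (meson image_eqI infdist_le le_less_trans)
    then show "norm (infdist ((g ^^ k) (\<phi> x)) (\<phi> ` A) - 0) < e"
      by (simp add: infdist_nonneg)
  qed
qed

lemma attracting_cycle_finite: "attracting_cycle f A \<Longrightarrow> finite A \<and> A \<noteq> {}"
  by (auto simp: attracting_cycle_def)

lemma conjugates_hyperbolic:
  assumes c: "conjugates \<phi> f g" and f: "f \<in> rational_maps 2" and h: "hyperbolic f"
  shows "hyperbolic g"
  unfolding hyperbolic_def
proof (intro allI impI)
  fix w assume w: "critical_point g w"
  obtain v where v: "\<phi> v = w" using conjugates_surj[OF c] .
  then have "critical_point f v" using w conjugates_critical[OF c f] by auto
  then obtain A where A: "attracting_cycle f A" "(\<lambda>k. infdist ((f ^^ k) v) A) \<longlonglongrightarrow> 0"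
    using h by (auto simp: hyperbolic_def)
  obtain p n where p: "n > 0" "(f ^^ n) p = p" "cmod (local_deriv (f ^^ n) p) < 1"
      "A = (\<lambda>i. (f ^^ i) p) ` {..<n}"
    using A(1) by (auto simp: attracting_cycle_def)
  have "(g ^^ n) (\<phi> p) = \<phi> p" using conjugates_funpow[OF c, of n p] p(2) by simp
  moreover have "\<phi> ` A = (\<lambda>i. (g ^^ i) (\<phi> p)) ` {..<n}"
    by (simp add: p(4) image_image conjugates_funpow[OF c])
  ultimately have "attracting_cycle g (\<phi> ` A)"
    unfolding attracting_cycle_def using p conjugates_multiplier[OF c f p(2)] by metis
  moreover have "(\<lambda>k. infdist ((g ^^ k) w) (\<phi> ` A)) \<longlonglongrightarrow> 0"
    using conjugates_infdist[OF c _ A(2)] attracting_cycle_finite[OF A(1)] v by blast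
  ultimately show "\<exists>A. attracting_cycle g A \<and> (\<lambda>k. infdist ((g ^^ k) w) A) \<longlonglongrightarrow> 0" by blast
qed

text \<open>Hyperbolicity with fixed points in place of cycles and a limit in place of a distance.
  Perturbation arguments need such a limit in order to compare it with \<open>Infty\<close>.\<close>

definition fixed_attracted :: "(riemann_sphere \<Rightarrow> riemann_sphere) \<Rightarrow> bool" where
  "fixed_attracted f \<longleftrightarrow> (\<forall>c. critical_point f c \<longrightarrow>
     (\<exists>p. f p = p \<and> cmod (local_deriv f p) < 1 \<and> (\<lambda>k. (f ^^ k) c) \<longlonglongrightarrow> p))"

lemma conjugates_fixed_attracted:
  assumes c: "conjugates \<phi> f g" and f: "f \<in> rational_maps 2" and h: "fixed_attracted f"
  shows "fixed_attracted g"
  unfolding fixed_attracted_def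
proof (intro allI impI)
  fix w assume w: "critical_point g w"
  obtain v where v: "\<phi> v = w" using conjugates_surj[OF c] .
  then have "critical_point f v" using w conjugates_critical[OF c f] by auto
  then obtain p where p: "f p = p" "cmod (local_deriv f p) < 1" "(\<lambda>k. (f ^^ k) v) \<longlonglongrightarrow> p"
    using h by (auto simp: fixed_attracted_def)
  show "\<exists>p. g p = p \<and> cmod (local_deriv g p) < 1 \<and> (\<lambda>k. (g ^^ k) w) \<longlonglongrightarrow> p"
    using conjugates_tendsto[OF c p(3)] conjugates_multiplier_1[OF c f p(1)] conjugates_apply[OF c, of p] p v
    by (intro exI[of _ "\<phi> p"]) simp
qed

lemma fixed_attracted_hyperbolic:
  assumes "fixed_attracted f"
  shows "hyperbolic f"
  unfolding hyperbolic_def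
proof (intro allI impI)
  fix c assume "critical_point f c"
  then obtain p where p: "f p = p" "cmod (local_deriv f p) < 1" "(\<lambda>k. (f ^^ k) c) \<longlonglongrightarrow> p"
    using assms by (auto simp: fixed_attracted_def)
  have "attracting_cycle f {p}"
    unfolding attracting_cycle_def
  proof (intro exI conjI)
    show "{p} = (\<lambda>i. (f ^^ i) p) ` {..<1}" by (auto simp: lessThan_Suc)
  qed (use p(1,2) in simp_all)
  moreover have "(\<lambda>k. infdist ((f ^^ k) c) {p}) \<longlonglongrightarrow> 0"
    using tendsto_dist_iff[THEN iffD1, OF p(3)] by simp
  ultimately show "\<exists>A. attracting_cycle f A \<and> (\<lambda>k. infdist ((f ^^ k) c) A) \<longlonglongrightarrow> 0" by blast
qed

lemma conjugates_Fatou: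
  assumes c: "conjugates \<phi> f g" and x: "x \<in> Fatou_set f"
  shows "\<phi> x \<in> Fatou_set g"
proof -
  obtain U where U: "open U" "x \<in> U" "normal_on U (range (\<lambda>n. f ^^ n))"
    using x by (auto simp: Fatou_set_def)
  obtain \<psi> where s: "conjugates \<psi> g f" "\<psi> \<circ> \<phi> = id" "\<phi> \<circ> \<psi> = id"
    using conjugates_sym[OF c] .
  have inv: "\<psi> (\<phi> y) = y" "\<phi> (\<psi> y) = y" for y
    using s by (metis comp_apply id_apply)+
  have pc: "isCont \<phi> y" "isCont \<psi> y" for y
    using c s rational_maps_1_cont by (auto simp: conjugates_def)
  have im: "\<phi> ` U = \<psi> -` U" using inv by (auto simp: image_iff) metis
  have "open (\<phi> ` U)"
    unfolding im by (rule open_vimage[OF U(1)]) (simp add: pc continuous_at_imp_continuous_on)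
  moreover have "normal_on (\<phi> ` U) (range (\<lambda>n. g ^^ n))"
    unfolding normal_on_def
  proof (intro allI impI)
    fix t :: "nat \<Rightarrow> riemann_sphere \<Rightarrow> riemann_sphere"
    assume "range t \<subseteq> range (\<lambda>n. g ^^ n)"
    then have "\<forall>k. \<exists>m. t k = g ^^ m" by auto
    then obtain m where m: "\<And>k. t k = g ^^ m k" by metis
    have "range (\<lambda>k. f ^^ m k) \<subseteq> range (\<lambda>n. f ^^ n)" by auto
    then obtain r G where r: "strict_mono r" and
      G: "\<And>K. compact K \<Longrightarrow> K \<subseteq> U \<Longrightarrow> uniform_limit K ((\<lambda>k. f ^^ m k) \<circ> r) G sequentially"
      using U(3) unfolding normal_on_def by meson
    show "\<exists>r g'. strict_mono r \<and> (\<forall>K. compact K \<and> K \<subseteq> \<phi> ` U \<longrightarrow> uniform_limit K (t \<circ> r) g' sequentially)"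
    proof (intro exI conjI allI impI)
      show "strict_mono r" by (rule r)
      fix K assume K: "compact K \<and> K \<subseteq> \<phi> ` U"
      have "compact (\<psi> ` K)"
        using K by (intro compact_continuous_image continuous_at_imp_continuous_on) (auto simp: pc)
      moreover have "\<psi> ` K \<subseteq> U" using K inv by auto
      ultimately have u: "uniform_limit (\<psi> ` K) ((\<lambda>k. f ^^ m k) \<circ> r) G sequentially" by (rule G)
      show "uniform_limit K (t \<circ> r) (\<phi> \<circ> G \<circ> \<psi>) sequentially"
      proof (rule uniform_limitI)
        fix e :: real assume "e > 0"
        obtain d where d: "d > 0" "\<And>x y. dist x y < d \<Longrightarrow> dist (\<phi> x) (\<phi> y) < e"
          using uniformly_continuous_sphere[of \<phi>, OF pc(1) \<open>e > 0\<close>] by metis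
        show "\<forall>\<^sub>F n in sequentially. \<forall>x\<in>K. dist ((t \<circ> r) n x) ((\<phi> \<circ> G \<circ> \<psi>) x) < e"
          using uniform_limitD[OF u d(1)]
        proof eventually_elim
          case (elim n)
          show ?case
          proof
            fix y assume "y \<in> K"
            then have "dist ((f ^^ m (r n)) (\<psi> y)) (G (\<psi> y)) < d" using elim by simp
            from d(2)[OF this] show "dist ((t \<circ> r) n y) ((\<phi> \<circ> G \<circ> \<psi>) y) < e"
              by (simp add: conjugates_funpow[OF c] inv m)
          qed
        qed
      qed
    qed
  qed
  ultimately show ?thesis using U(2) unfolding Fatou_set_def by blast
qed

lemma conjugates_Julia_connected:
  assumes c: "conjugates \<phi> f g" and J: "connected (Julia_set f)"
  shows "connected (Julia_set g)"
proof -
  obtain \<psi> where s: "conjugates \<psi> g f" "\<psi> \<circ> \<phi> = id" "\<phi> \<circ> \<psi> = id"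
    using conjugates_sym[OF c] .
  have inv: "\<psi> (\<phi> y) = y" "\<phi> (\<psi> y) = y" for y
    using s by (metis comp_apply id_apply)+
  have "Julia_set g = \<phi> ` Julia_set f"
  proof (intro set_eqI iffI)
    fix y assume "y \<in> Julia_set g"
    then have "\<psi> y \<in> Julia_set f"
      using conjugates_Fatou[OF c, of "\<psi> y"] inv by (auto simp: Julia_set_def)
    then show "y \<in> \<phi> ` Julia_set f" using inv by (metis image_eqI)
  next
    fix y assume "y \<in> \<phi> ` Julia_set f"
    then show "y \<in> Julia_set g"
      using conjugates_Fatou[OF s(1)] inv by (auto simp: Julia_set_def) metis
  qed
  moreover have "continuous_on (Julia_set f) \<phi>"
    using c by (intro continuous_at_imp_continuous_on) (auto simp: conjugates_def rational_maps_1_cont)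
  ultimately show ?thesis using connected_continuous_image[OF _ J] by simp
qed

section \<open>Values, multipliers and critical points in terms of coefficients\<close>

lemma qmap_at_Fin:
  assumes X: "((p0, p1, p2), (q0, q1, q2)) \<in> quad_coeff_set"
  defines "P \<equiv> \<lambda>z. p0 + p1 * z + p2 * z\<^sup>2" and "Q \<equiv> \<lambda>z. q0 + q1 * z + q2 * z\<^sup>2"
  shows "qmap ((p0, p1, p2), (q0, q1, q2)) (Fin z) = ratio (P z) (Q z)"
    and "local_deriv (qmap ((p0, p1, p2), (q0, q1, q2))) (Fin z) =
      (if Q z = 0 then - ((p1 + 2 * p2 * z) * Q z - P z * (q1 + 2 * q2 * z)) / (P z)\<^sup>2
       else ((p1 + 2 * p2 * z) * Q z - P z * (q1 + 2 * q2 * z)) / (Q z)\<^sup>2)"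
    and "(P z, Q z) \<noteq> (0, 0)"
    and "critical_point (qmap ((p0, p1, p2), (q0, q1, q2))) (Fin z) \<longleftrightarrow>
      (p1 + 2 * p2 * z) * Q z - P z * (q1 + 2 * q2 * z) = 0"
proof -
  have nz: "(P w, Q w) \<noteq> (0, 0)" for w
    using qmap_nz[OF X, of w 1] by (simp add: P_def Q_def)
  then show "(P z, Q z) \<noteq> (0, 0)" .
  have e: "qmap ((p0, p1, p2), (q0, q1, q2)) (inv_chart (Fin z) w) = ratio (P w) (Q w)" for w
    using qmap_ratio[OF X, of w 1] by (simp add: inv_chart_def P_def Q_def)
  have P: "(P has_field_derivative p1 + 2 * p2 * z) (at z)"
    and Q: "(Q has_field_derivative q1 + 2 * q2 * z) (at z)"
    unfolding P_def Q_def by (auto intro!: derivative_eq_intros)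
  have c: "z = chart (Fin z) (Fin z)" by (simp add: chart_def)
  show "qmap ((p0, p1, p2), (q0, q1, q2)) (Fin z) = ratio (P z) (Q z)"
    using holo_at_ratio(2)[OF e P Q c nz] .
  show d: "local_deriv (qmap ((p0, p1, p2), (q0, q1, q2))) (Fin z) =
      (if Q z = 0 then - ((p1 + 2 * p2 * z) * Q z - P z * (q1 + 2 * q2 * z)) / (P z)\<^sup>2
       else ((p1 + 2 * p2 * z) * Q z - P z * (q1 + 2 * q2 * z)) / (Q z)\<^sup>2)"
    using holo_at_ratio(3)[OF e P Q c nz] .
  show "critical_point (qmap ((p0, p1, p2), (q0, q1, q2))) (Fin z) \<longleftrightarrow>
      (p1 + 2 * p2 * z) * Q z - P z * (q1 + 2 * q2 * z) = 0"
    unfolding critical_point_def d using nz[of z] by (simp only: split: if_splits) auto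
qed

lemma qmap_at_Infty:
  assumes X: "((p0, p1, p2), (q0, q1, q2)) \<in> quad_coeff_set"
  shows "qmap ((p0, p1, p2), (q0, q1, q2)) Infty = ratio p2 q2"
    and "local_deriv (qmap ((p0, p1, p2), (q0, q1, q2))) Infty =
      (if q2 = 0 then - (p1 * q2 - p2 * q1) / p2\<^sup>2 else (p1 * q2 - p2 * q1) / q2\<^sup>2)"
    and "(p2, q2) \<noteq> (0, 0)"
proof -
  define P Q where "P = (\<lambda>w. p0 * w\<^sup>2 + p1 * w + p2)" and "Q = (\<lambda>w. q0 * w\<^sup>2 + q1 * w + q2)"
  have v: "P 0 = p2" "Q 0 = q2" by (auto simp: P_def Q_def)
  have nz: "(P 0, Q 0) \<noteq> (0, 0)"
    using qmap_nz[OF X, of 1 0] by (simp add: P_def Q_def)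
  then show "(p2, q2) \<noteq> (0, 0)" by (simp add: v)
  have e: "qmap ((p0, p1, p2), (q0, q1, q2)) (inv_chart Infty w) = ratio (P w) (Q w)" for w
    using qmap_ratio[OF X, of 1 w] by (simp add: inv_chart_def P_def Q_def)
  have P: "(P has_field_derivative p1) (at 0)" and Q: "(Q has_field_derivative q1) (at 0)"
    unfolding P_def Q_def by (auto intro!: derivative_eq_intros)
  have c: "0 = chart Infty Infty" by (simp add: chart_def)
  show "qmap ((p0, p1, p2), (q0, q1, q2)) Infty = ratio p2 q2"
    using holo_at_ratio(2)[OF e P Q c nz] v by simp
  show "local_deriv (qmap ((p0, p1, p2), (q0, q1, q2))) Infty =
      (if q2 = 0 then - (p1 * q2 - p2 * q1) / p2\<^sup>2 else (p1 * q2 - p2 * q1) / q2\<^sup>2)"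
    using holo_at_ratio(3)[OF e P Q c nz] unfolding v .
qed

section \<open>Normal forms and their multipliers\<close>

definition fam_coeffs :: "complex \<Rightarrow> complex \<Rightarrow> quad_coeffs" where
  "fam_coeffs a b = ((0, a, 1), (1, b, 0))"

lemma fam_qmap: "fam a b = qmap (fam_coeffs a b)"
  by (simp add: fam_def qmap_def fam_coeffs_def)

lemma fam_mem:
  assumes "a * b \<noteq> 1"
  shows "fam_coeffs a b \<in> quad_coeff_set"
proof -
  have "(qform (0, a, 1) s t, qform (1, b, 0) s t) \<noteq> (0, 0)" if "(s, t) \<noteq> (0, 0)" for s t
  proof
    assume "(qform (0, a, 1) s t, qform (1, b, 0) s t) = (0, 0)"
    then have e: "s * (a * t + s) = 0" "t * (t + b * s) = 0"
      by (auto simp: algebra_simps power2_eq_square)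
    show False
    proof (cases "s = 0 \<or> t = 0")
      case True
      then show False using e that by auto
    next
      case False
      then have "s = - (a * t)" "t + b * s = 0"
        using e by (auto simp: add_eq_0_iff)
      then have "t * (1 - a * b) = 0" by (simp add: algebra_simps)
      then show False using False assms by auto
    qed
  qed
  then show ?thesis by (simp add: fam_coeffs_def quad_coeff_set_iff)
qed

lemma fam_rational: "a * b \<noteq> 1 \<Longrightarrow> fam a b \<in> rational_maps 2"
  using fam_mem by (auto simp: fam_qmap rational_maps_2)

lemma fam_Infty [simp]: "fam a b Infty = Infty"
  by (simp add: fam_def)

lemma fam_zero [simp]: "fam a b (Fin 0) = Fin 0"
  by (simp add: fam_def ratio_def)

lemma fam_Fin: "fam a b (Fin z) = ratio (a * z + z\<^sup>2) (1 + b * z)"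
  by (simp add: fam_def algebra_simps power2_eq_square)

lemma fam_deriv:
  assumes "a * b \<noteq> 1"
  shows "local_deriv (fam a b) (Fin 0) = a" "local_deriv (fam a b) Infty = b"
  using qmap_at_Fin(2)[OF fam_mem[OF assms, unfolded fam_coeffs_def], of 0]
    qmap_at_Infty(2)[OF fam_mem[OF assms, unfolded fam_coeffs_def]]
  by (simp_all add: fam_qmap fam_coeffs_def)

lemma fam_deriv_Fin:
  assumes "a * b \<noteq> 1" "1 + b * z \<noteq> 0"
  shows "local_deriv (fam a b) (Fin z) = (a + 2 * z + b * z\<^sup>2) / (1 + b * z)\<^sup>2"
proof -
  have "(a + 2 * z) * (1 + b * z) - (a * z + z\<^sup>2) * b = a + 2 * z + b * z\<^sup>2"
    by (simp add: algebra_simps power2_eq_square)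
  then show ?thesis
    using qmap_at_Fin(2)[OF fam_mem[OF assms(1), unfolded fam_coeffs_def], of z] assms(2)
    by (simp add: fam_qmap fam_coeffs_def)
qed

lemma fam_critical:
  assumes "a * b \<noteq> 1"
  shows "critical_point (fam a b) (Fin z) \<longleftrightarrow> a + 2 * z + b * z\<^sup>2 = 0"
proof -
  have W: "(a + 2 * z) * (1 + b * z) - (a * z + z\<^sup>2) * b = a + 2 * z + b * z\<^sup>2"
    by (simp add: algebra_simps power2_eq_square)
  show ?thesis
    using qmap_at_Fin(4)[OF fam_mem[OF assms, unfolded fam_coeffs_def], of z] W
    by (simp add: fam_qmap fam_coeffs_def)
qed

text \<open>The multiplier is the solution c of the index formula 1/(1-a) + 1/(1-b) + 1/(1-c) = 1. A
  third fixed point solves a + z = 1 + b z, and for b = 1 this would force a = 1, hence a b =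
  1.\<close>

lemma fam_third_fixed:
  assumes ab: "a * b \<noteq> 1" and r: "fam a b r = r" "r \<noteq> Fin 0" "r \<noteq> Infty"
  shows "b \<noteq> 1" "r = Fin ((1 - a) / (1 - b))" "local_deriv (fam a b) r = (2 - a - b) / (1 - a * b)"
proof -
  obtain z where z: "r = Fin z" "z \<noteq> 0" using r by (cases r) auto
  have nz: "1 + b * z \<noteq> 0" using r(1) by (auto simp: z fam_Fin ratio_def)
  have "a * z + z\<^sup>2 = z * (1 + b * z)"
    using r(1) nz by (simp add: z fam_Fin ratio_def divide_eq_eq)
  then have "z * (a + z) = z * (1 + b * z)" by (simp add: algebra_simps power2_eq_square)
  then have e: "a + z = 1 + b * z" using z by simp
  then have e': "z * (1 - b) = 1 - a" by (simp add: algebra_simps)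
  show b: "b \<noteq> 1" using e' ab by auto
  then have zz: "z = (1 - a) / (1 - b)" using e' by (simp add: eq_divide_eq)
  then show "r = Fin ((1 - a) / (1 - b))" by (simp add: z)
  have "(1 + b * z) * (1 - b) = (1 - b) + b * (z * (1 - b))" "(1 + z) * (1 - b) = (1 - b) + z * (1 - b)"
    by (simp_all add: algebra_simps)
  then have "(1 + b * z) * (1 - b) = 1 - a * b" "(1 + z) * (1 - b) = 2 - a - b"
    unfolding e' by (simp_all add: algebra_simps)
  then have r1: "1 + b * z = (1 - a * b) / (1 - b)" "1 + z = (2 - a - b) / (1 - b)"
    using b by (simp_all add: eq_divide_eq)
  have "a + 2 * z + b * z\<^sup>2 = (1 + z) * (1 + b * z)"
  proof -
    have "b * z\<^sup>2 = z * (b * z)" by (simp add: power2_eq_square)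
    also have "b * z = a + z - 1" using e by (simp add: algebra_simps)
    finally have "b * z\<^sup>2 = z * (a + z - 1)" .
    then show ?thesis unfolding e[symmetric] by (simp add: algebra_simps)
  qed
  then have "local_deriv (fam a b) r = (1 + z) / (1 + b * z)"
    using fam_deriv_Fin[OF ab nz] nz by (simp add: z power2_eq_square)
  also have "\<dots> = (2 - a - b) / (1 - a * b)"
    unfolding r1 using b ab by simp
  finally show "local_deriv (fam a b) r = (2 - a - b) / (1 - a * b)" .
qed

lemma fam_third_exists:
  assumes ab: "a * b \<noteq> 1" and "a \<noteq> 1" "b \<noteq> 1"
  shows "fam a b (Fin ((1 - a) / (1 - b))) = Fin ((1 - a) / (1 - b))" "(1 - a) / (1 - b) \<noteq> 0"
proof -
  define z where "z = (1 - a) / (1 - b)"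
  show "(1 - a) / (1 - b) \<noteq> 0" using assms by auto
  then have z0: "z \<noteq> 0" by (simp add: z_def)
  have e: "z * (1 - b) = 1 - a" using assms by (simp add: z_def)
  then have e2: "a + z = 1 + b * z" by (simp add: algebra_simps)
  have "(1 + b * z) * (1 - b) = (1 - b) + b * (z * (1 - b))" by (simp add: algebra_simps)
  then have "(1 + b * z) * (1 - b) = 1 - a * b" unfolding e by (simp add: algebra_simps)
  then have nz: "1 + b * z \<noteq> 0" using ab by auto
  have "a * z + z\<^sup>2 = z * (1 + b * z)" unfolding e2[symmetric] by (simp add: algebra_simps power2_eq_square)
  then have "fam a b (Fin z) = Fin z" using nz by (simp add: fam_Fin ratio_def)
  then show "fam a b (Fin ((1 - a) / (1 - b))) = Fin ((1 - a) / (1 - b))" by (simp add: z_def)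
qed

lemma fam_eigenvalue_iff:
  assumes ab: "a * b \<noteq> 1"
  shows "has_fixed_point_with_eigenvalue (fam a b) m \<longleftrightarrow> m \<in> {a, b, (2 - a - b) / (1 - a * b)}"
proof
  assume "has_fixed_point_with_eigenvalue (fam a b) m"
  then obtain p where p: "fam a b p = p" "local_deriv (fam a b) p = m"
    by (auto simp: has_fixed_point_with_eigenvalue_def)
  show "m \<in> {a, b, (2 - a - b) / (1 - a * b)}"
    using p fam_deriv[OF ab] fam_third_fixed(3)[OF ab p(1)] by (cases "p = Fin 0"; cases "p = Infty") auto
next
  assume m: "m \<in> {a, b, (2 - a - b) / (1 - a * b)}"
  have A: "has_fixed_point_with_eigenvalue (fam a b) a" "has_fixed_point_with_eigenvalue (fam a b) b"
    unfolding has_fixed_point_with_eigenvalue_def using fam_deriv[OF ab] by (metis fam_zero, metis fam_Infty)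
  have C: "has_fixed_point_with_eigenvalue (fam a b) ((2 - a - b) / (1 - a * b))"
  proof -
    \<comment> \<open>For a = 1 or b = 1 the third fixed point has merged with 0 or \<infinity>, and
      the formula returns the multiplier 1 found there.\<close>
    consider "a = 1" | "b = 1" | "a \<noteq> 1" "b \<noteq> 1" by auto
    then show ?thesis
    proof cases
      case 1
      then have "(2 - a - b) / (1 - a * b) = a" using ab by simp
      then show ?thesis using A by simp
    next
      case 2
      then have "(2 - a - b) / (1 - a * b) = b" using ab by simp
      then show ?thesis using A by simp
    next
      case 3
      then show ?thesis
        unfolding has_fixed_point_with_eigenvalue_def
        using fam_third_exists[OF ab 3] fam_third_fixed(3)[OF ab]
        by (metis riemann_sphere.distinct(1) riemann_sphere.inject)
    qed
  qed
  from m A C show "has_fixed_point_with_eigenvalue (fam a b) m" by auto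
qed

text \<open>A Moebius map with zero \<open>p\<close> and pole \<open>q\<close> leaves (p1 z + p2
  z^2)/(q0 + q1 z); the remaining freedom, a scaling, normalizes two coefficients to 1.\<close>

lemma two_fixed_points_normal_form:
  assumes f: "f \<in> rational_maps 2" and p: "f p = p" and q: "f q = q" and pq: "p \<noteq> q"
  obtains a b \<phi> where "a * b \<noteq> 1" "conjugates \<phi> f (fam a b)" "\<phi> p = Fin 0" "\<phi> q = Infty"
    "a = local_deriv f p" "b = local_deriv f q"
proof -
  obtain s1 t1 where P: "(s1, t1) \<noteq> (0, 0)" "p = ratio s1 t1" using ratio_cases .
  obtain s2 t2 where Q: "(s2, t2) \<noteq> (0, 0)" "q = ratio s2 t2" using ratio_cases .
  have "s1 * t2 \<noteq> t1 * s2" using pq ratio_eq_iff[OF P(1) Q(1)] P Q by auto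
  then have d1: "t1 * (- s2) - (- s1) * t2 \<noteq> 0" by (simp add: algebra_simps)
  define \<phi>1 where "\<phi>1 = moeb t1 (- s1) t2 (- s2)"
  obtain x where x: "f = qmap x" "x \<in> quad_coeff_set" using f by (auto simp: rational_maps_2)
  define y where "y = qconj t1 (- s1) t2 (- s2) x"
  have c1: "conjugates \<phi>1 f (qmap y)"
    unfolding \<phi>1_def y_def x(1) by (rule conjugates_qmap[OF d1 x(2)])
  have Y: "y \<in> quad_coeff_set" unfolding y_def by (rule qconj_mem[OF d1 x(2)])
  obtain p0 p1 p2 q0 q1 q2 where e: "y = ((p0, p1, p2), (q0, q1, q2))" by (metis surj_pair)
  note Y' = Y[unfolded e]
  have f1: "\<phi>1 p = Fin 0" "\<phi>1 q = Infty"
    using d1 unfolding \<phi>1_def P(2) Q(2) moeb_ratio[OF P(1)] moeb_ratio[OF Q(1)]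
    by (auto simp: ratio_def algebra_simps)
  have "qmap y (Fin 0) = Fin 0" "qmap y Infty = Infty"
    using conjugates_apply[OF c1, of p] conjugates_apply[OF c1, of q] p q f1 by auto
  then have z: "p0 = 0" "q2 = 0" "q0 \<noteq> 0" "p2 \<noteq> 0"
    using qmap_at_Fin(1)[OF Y', of 0] qmap_at_Infty(1)[OF Y'] qmap_at_Infty(3)[OF Y']
    unfolding e by (auto simp: ratio_def split: if_splits)
  define a b where "a = p1 / q0" and "b = q1 / p2"
  \<comment> \<open>With a b = 1 numerator and denominator would share the zero -p1/p2.\<close>
  have ab: "a * b \<noteq> 1"
  proof
    assume "a * b = 1"
    then have h: "p1 * q1 = q0 * p2" using z by (simp add: a_def b_def field_simps)
    have "q0 + q1 * (- p1 / p2) = 0"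
      using h z by (simp add: field_simps)
    moreover have "p0 + p1 * (- p1 / p2) + p2 * (- p1 / p2)\<^sup>2 = 0"
      using z by (simp add: field_simps power2_eq_square)
    ultimately show False using qmap_at_Fin(3)[OF Y', of "- p1 / p2"] z by simp
  qed
  define \<phi>2 where "\<phi>2 = moeb p2 0 0 q0"
  have d2: "p2 * q0 - 0 * 0 \<noteq> 0" using z by simp
  have c2: "conjugates \<phi>2 (qmap y) (fam a b)"
    unfolding conjugates_def
  proof
    show "\<phi>2 \<in> rational_maps 1" unfolding \<phi>2_def by (rule rational_maps_1I[OF d2])
    show "\<phi>2 \<circ> qmap y = fam a b \<circ> \<phi>2"
    proof (rule qmap_eqI)
      fix s t :: complex assume st: "(s, t) \<noteq> (0, 0)"
      have nz2: "(p2 * s + 0 * t, 0 * s + q0 * t) \<noteq> (0, 0)" using st z by auto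
      have "(\<phi>2 \<circ> qmap y) (ratio s t) =
          ratio (p2 * (p1 * s * t + p2 * s\<^sup>2)) (q0 * (q0 * t\<^sup>2 + q1 * s * t))"
        using qmap_nz[OF Y st] unfolding comp_apply qmap_ratio[OF Y st] \<phi>2_def
        by (subst moeb_ratio) (auto simp: e z)
      also have "p2 * (p1 * s * t + p2 * s\<^sup>2) = a * (p2 * s) * (q0 * t) + (p2 * s)\<^sup>2"
        using z by (simp add: a_def algebra_simps power2_eq_square)
      also have "q0 * (q0 * t\<^sup>2 + q1 * s * t) = (q0 * t)\<^sup>2 + b * (p2 * s) * (q0 * t)"
        using z by (simp add: b_def algebra_simps power2_eq_square)
      also have "ratio (a * (p2 * s) * (q0 * t) + (p2 * s)\<^sup>2) ((q0 * t)\<^sup>2 + b * (p2 * s) * (q0 * t)) =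
         (fam a b \<circ> \<phi>2) (ratio s t)"
        unfolding comp_apply \<phi>2_def moeb_ratio[OF st] fam_qmap qmap_ratio[OF fam_mem[OF ab] nz2]
        by (simp add: fam_coeffs_def)
      finally show "(\<phi>2 \<circ> qmap y) (ratio s t) = (fam a b \<circ> \<phi>2) (ratio s t)" .
    qed
  qed
  have c: "conjugates (\<phi>2 \<circ> \<phi>1) f (fam a b)" using conjugates_trans[OF c1 c2] .
  have v: "(\<phi>2 \<circ> \<phi>1) p = Fin 0" "(\<phi>2 \<circ> \<phi>1) q = Infty"
    using z by (auto simp: f1 \<phi>2_def moeb_def ratio_def)
  have "a = local_deriv f p" "b = local_deriv f q"
    using conjugates_multiplier_1[OF c f p] conjugates_multiplier_1[OF c f q] v fam_deriv[OF ab] by simp_all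
  then show ?thesis using that ab c v by blast
qed

definition gcoeffs :: "complex \<Rightarrow> complex \<Rightarrow> quad_coeffs" where
  "gcoeffs b T = ((1, T, 1), (0, b, 0))"

text \<open>Normal form with critical points \<open>1\<close>, \<open>-1\<close> and a fixed point of multiplier \<open>b\<close> at \<open>\<infinity>\<close>.\<close>
definition gmap :: "complex \<Rightarrow> complex \<Rightarrow> riemann_sphere \<Rightarrow> riemann_sphere" where
  "gmap b T = qmap (gcoeffs b T)"

definition gfun :: "complex \<Rightarrow> complex \<Rightarrow> complex \<Rightarrow> complex" where
  "gfun b T z = (z + 1 / z + T) / b"

lemma gcoeffs_mem:
  assumes "b \<noteq> 0" shows "gcoeffs b T \<in> quad_coeff_set"
proof -
  have "(qform (1, T, 1) s t, qform (0, b, 0) s t) \<noteq> (0, 0)" if "(s, t) \<noteq> (0, 0)" for s t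
    using that assms by auto
  then show ?thesis unfolding gcoeffs_def quad_coeff_set_iff by blast
qed

lemma gmap_rational: "b \<noteq> 0 \<Longrightarrow> gmap b T \<in> rational_maps 2"
  using gcoeffs_mem by (auto simp: gmap_def rational_maps_2)

lemma gmap_simps:
  assumes "b \<noteq> 0"
  shows "gmap b T Infty = Infty" "gmap b T (Fin 0) = Infty" "z \<noteq> 0 \<Longrightarrow> gmap b T (Fin z) = Fin (gfun b T z)"
proof -
  note X = gcoeffs_mem[OF assms, of T, unfolded gcoeffs_def]
  show "gmap b T Infty = Infty" using qmap_at_Infty(1)[OF X] by (simp add: gmap_def gcoeffs_def)
  show "gmap b T (Fin 0) = Infty" using qmap_at_Fin(1)[OF X, of 0] by (simp add: gmap_def gcoeffs_def)
  assume "z \<noteq> 0"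
  then show "gmap b T (Fin z) = Fin (gfun b T z)" using qmap_at_Fin(1)[OF X, of z] assms
    by (simp add: gmap_def gcoeffs_def ratio_def gfun_def field_simps power2_eq_square)
qed

lemma gmap_deriv:
  assumes "b \<noteq> 0"
  shows "local_deriv (gmap b T) Infty = b" "z \<noteq> 0 \<Longrightarrow> local_deriv (gmap b T) (Fin z) = (1 - 1 / z\<^sup>2) / b"
    "local_deriv (gmap b T) (Fin 0) \<noteq> 0"
proof -
  note X = gcoeffs_mem[OF assms, of T, unfolded gcoeffs_def]
  show "local_deriv (gmap b T) Infty = b" using qmap_at_Infty(2)[OF X] by (simp add: gmap_def gcoeffs_def)
  show "local_deriv (gmap b T) (Fin 0) \<noteq> 0"
    using qmap_at_Fin(2)[OF X, of 0] assms by (simp add: gmap_def gcoeffs_def)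
  assume z: "z \<noteq> 0"
  have "((T + 2 * z) * (b * z) - (1 + T * z + z\<^sup>2) * b) / (b * z)\<^sup>2 = (1 - 1 / z\<^sup>2) / b"
    using z assms by (simp add: field_simps power2_eq_square)
  then show "local_deriv (gmap b T) (Fin z) = (1 - 1 / z\<^sup>2) / b"
    using qmap_at_Fin(2)[OF X, of z] assms z by (simp add: gmap_def gcoeffs_def)
qed

lemma gmap_critical:
  assumes "b \<noteq> 0"
  shows "critical_point (gmap b T) c \<longleftrightarrow> c = Fin 1 \<or> c = Fin (-1)"
proof (cases c)
  case (Fin z)
  show ?thesis
  proof (cases "z = 0")
    case False
    then have "critical_point (gmap b T) c \<longleftrightarrow> z\<^sup>2 = 1"
      using assms by (auto simp: critical_point_def Fin gmap_deriv)
    then show ?thesis by (auto simp: Fin power2_eq_1_iff)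
  qed (use gmap_deriv(3)[OF assms, of T] in \<open>auto simp: critical_point_def Fin\<close>)
qed (use assms in \<open>auto simp: critical_point_def gmap_deriv\<close>)

lemma gmap_holo: "b \<noteq> 0 \<Longrightarrow> holo_at (gmap b T) y"
  by (rule rational_maps_2_holo[OF gmap_rational])

text \<open>The critical points of \<open>fam a b\<close> satisfy (z + 1/b)^2 = (1 - a b)/b^2. An
  affine map that fixes \<infinity> takes them to 1 and -1; its sign is free, so only T^2 is
  determined by the multipliers.\<close>

lemma fam_conj_gmap:
  assumes b: "b \<noteq> 0" and ab: "a * b \<noteq> 1" and T: "T\<^sup>2 = (a * b + b - 2)\<^sup>2 / (1 - a * b)"
  obtains \<phi> where "conjugates \<phi> (fam a b) (gmap b T)" "\<phi> Infty = Infty"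
proof -
  define k0 where "k0 = csqrt (1 - a * b) / b"
  have k0: "k0\<^sup>2 = (1 - a * b) / b\<^sup>2" by (simp add: k0_def power_divide)
  then have k0nz: "k0 \<noteq> 0" using b ab by auto
  define T0 where "T0 = (a + 1 - 2 / b) / k0"
  have "a + 1 - 2 / b = (a * b + b - 2) / b" using b by (simp add: field_simps)
  then have "T0\<^sup>2 = ((a * b + b - 2)\<^sup>2 / b\<^sup>2) / ((1 - a * b) / b\<^sup>2)"
    unfolding T0_def power_divide k0 by (simp only: power_divide)
  then have "T0\<^sup>2 = T\<^sup>2" using b by (simp add: T)
  then have "T = T0 \<or> T = - T0" by (simp add: power2_eq_iff) (metis minus_minus)
  \<comment> \<open>The sign of \<open>k\<close> labels the two critical points; it is chosen to
    reach the given \<open>T\<close> and not its negative.\<close>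
  define k where "k = (if T = T0 then k0 else - k0)"
  have k: "k\<^sup>2 = (1 - a * b) / b\<^sup>2" "k \<noteq> 0" using k0 k0nz by (auto simp: k_def)
  have Tk: "T * k = a + 1 - 2 / b"
    using \<open>T = T0 \<or> T = - T0\<close> k0nz by (auto simp: k_def T0_def)
  define \<phi> where "\<phi> = moeb 1 (1 / b) 0 k"
  have d: "1 * k - (1 / b) * 0 \<noteq> 0" using k by simp
  have "\<phi> \<circ> fam a b = gmap b T \<circ> \<phi>"
  proof (rule qmap_eqI)
    fix s t :: complex assume st: "(s, t) \<noteq> (0, 0)"
    have nz: "(1 * s + 1 / b * t, 0 * s + k * t) \<noteq> (0, 0)" by (rule moeb_nz[OF d st])
    have "(\<phi> \<circ> fam a b) (ratio s t) = ratio (1 * (a * s * t + s\<^sup>2) + 1 / b * (t\<^sup>2 + b * s * t))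
        (0 * (a * s * t + s\<^sup>2) + k * (t\<^sup>2 + b * s * t))"
      using qmap_nz[OF fam_mem[OF ab] st]
      unfolding comp_apply fam_qmap qmap_ratio[OF fam_mem[OF ab] st] \<phi>_def
      by (subst moeb_ratio) (auto simp: fam_coeffs_def)
    also have "1 * (a * s * t + s\<^sup>2) + 1 / b * (t\<^sup>2 + b * s * t) =
       k\<^sup>2 * t\<^sup>2 + (T * k) * (s + t / b) * t + (s + t / b)\<^sup>2"
      unfolding k(1) Tk using b by (simp add: field_simps power2_eq_square)
    also have "0 * (a * s * t + s\<^sup>2) + k * (t\<^sup>2 + b * s * t) = b * (s + t / b) * (k * t)"
      using b by (simp add: field_simps power2_eq_square)
    also have "ratio (k\<^sup>2 * t\<^sup>2 + (T * k) * (s + t / b) * t + (s + t / b)\<^sup>2) (b * (s + t / b) * (k * t)) =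
       (gmap b T \<circ> \<phi>) (ratio s t)"
      unfolding comp_apply \<phi>_def moeb_ratio[OF st] gmap_def qmap_ratio[OF gcoeffs_mem[OF b] nz]
      by (simp add: gcoeffs_def algebra_simps power2_eq_square)
    finally show "(\<phi> \<circ> fam a b) (ratio s t) = (gmap b T \<circ> \<phi>) (ratio s t)" .
  qed
  moreover have "\<phi> \<in> rational_maps 1" unfolding \<phi>_def by (rule rational_maps_1I[OF d])
  moreover have "\<phi> Infty = Infty" by (simp add: \<phi>_def moeb_def)
  ultimately show ?thesis using that by (auto simp: conjugates_def)
qed

lemma fam_swap:
  assumes ab: "a * b \<noteq> 1"
  obtains \<phi> where "conjugates \<phi> (fam a b) (fam b a)" "\<phi> (Fin 0) = Infty" "\<phi> Infty = Fin 0"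
proof -
  have ba: "b * a \<noteq> 1" using ab by (simp add: mult.commute)
  define \<phi> where "\<phi> = moeb 0 1 1 0"
  have "\<phi> \<circ> fam a b = fam b a \<circ> \<phi>"
  proof (rule qmap_eqI)
    fix s t :: complex assume st: "(s, t) \<noteq> (0, 0)"
    then have ts: "(t, s) \<noteq> (0, 0)" by auto
    show "(\<phi> \<circ> fam a b) (ratio s t) = (fam b a \<circ> \<phi>) (ratio s t)"
      using qmap_nz[OF fam_mem[OF ab] st] st ts
      by (simp add: \<phi>_def moeb_ratio fam_qmap qmap_ratio[OF fam_mem[OF ab]] qmap_ratio[OF fam_mem[OF ba]])
         (simp add: fam_coeffs_def algebra_simps)
  qed
  moreover have "\<phi> \<in> rational_maps 1" unfolding \<phi>_def by (rule rational_maps_1I) simp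
  moreover have "\<phi> Infty = Fin 0" "\<phi> (Fin 0) = Infty" by (simp_all add: \<phi>_def moeb_def ratio_def)
  ultimately show ?thesis using that by (auto simp: conjugates_def)
qed

text \<open>With the fixed point at \<infinity>, numerator minus z times denominator has degree at
  most 2 and no zero, so it is constant. What remains is z plus a constant over a linear function,
  an affine copy of z + 1/z.\<close>

lemma single_fixed_point_normal_form:
  assumes f: "f \<in> rational_maps 2" and p: "f p = p" and single: "\<And>q. f q = q \<Longrightarrow> q = p"
  shows "conj_class f = conj_class (gmap 1 0)"
proof -
  obtain s1 t1 where P: "(s1, t1) \<noteq> (0, 0)" "p = ratio s1 t1" using ratio_cases .
  obtain u v where uv: "u * (- s1) - v * t1 \<noteq> 0"
  proof (cases "t1 = 0")
    case True then show ?thesis using that[of 1 0] P by simp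
  next
    case False then show ?thesis using that[of 0 1] by simp
  qed
  define \<phi>1 where "\<phi>1 = moeb u v t1 (- s1)"
  obtain x where x: "f = qmap x" "x \<in> quad_coeff_set" using f by (auto simp: rational_maps_2)
  define y where "y = qconj u v t1 (- s1) x"
  have c1: "conjugates \<phi>1 f (qmap y)"
    unfolding \<phi>1_def y_def x(1) by (rule conjugates_qmap[OF uv x(2)])
  have Y: "y \<in> quad_coeff_set" unfolding y_def by (rule qconj_mem[OF uv x(2)])
  obtain p0 p1 p2 q0 q1 q2 where e: "y = ((p0, p1, p2), (q0, q1, q2))" by (metis surj_pair)
  note Y' = Y[unfolded e]
  have f1: "\<phi>1 p = Infty"
    unfolding \<phi>1_def P(2) moeb_ratio[OF P(1)] by (simp add: ratio_def)
  have fix1: "qmap y Infty = Infty" using conjugates_apply[OF c1, of p] p f1 by auto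
  then have z: "q2 = 0" "p2 \<noteq> 0"
    using qmap_at_Infty(1)[OF Y'] qmap_at_Infty(3)[OF Y'] unfolding e by (auto simp: ratio_def split: if_splits)
  have nofix: "qmap y (Fin w) \<noteq> Fin w" for w
  proof
    assume "qmap y (Fin w) = Fin w"
    obtain r where r: "\<phi>1 r = Fin w" using conjugates_surj[OF c1] .
    then have "f r = r" using conjugates_apply[OF c1, of r] conjugates_inj[OF c1] \<open>qmap y (Fin w) = Fin w\<close> by metis
    then show False using single[of r] r f1 by auto
  qed
  define e2 e1 where "e2 = p2 - q1" and "e1 = p1 - q0"
  have nz: "p0 + e1 * w + e2 * w\<^sup>2 \<noteq> 0" for w
  proof
    assume h: "p0 + e1 * w + e2 * w\<^sup>2 = 0"
    have h2: "p0 + p1 * w + p2 * w\<^sup>2 = w * (q0 + q1 * w)"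
      using h by (simp add: e1_def e2_def algebra_simps power2_eq_square)
    have "q0 + q1 * w \<noteq> 0"
      using qmap_at_Fin(3)[OF Y', of w] z h2 by auto
    then show False using nofix[of w] qmap_at_Fin(1)[OF Y', of w] h2 z
      by (simp add: e ratio_def)
  qed
  have "poly [:p0, e1, e2:] w \<noteq> 0" for w
    using nz[of w] by (simp add: algebra_simps power2_eq_square)
  then have "degree [:p0, e1, e2:] = 0"
    by (metis fundamental_theorem_of_algebra constant_degree)
  then have ee: "e1 = 0" "e2 = 0" by (auto split: if_splits)
  then have p0: "p0 \<noteq> 0" using nz[of 0] by simp
  have pq: "q1 = p2" "q0 = p1" using ee by (simp_all add: e1_def e2_def)
  define k where "k = csqrt (p0 / p2)"
  have k: "k\<^sup>2 = p0 / p2" by (simp add: k_def)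
  then have k0: "k \<noteq> 0" using p0 z by auto
  have k2: "k * k * p2 = p0" using k z by (simp add: power2_eq_square field_simps)
  define \<phi>2 where "\<phi>2 = moeb 1 (p1 / p2) 0 k"
  have d: "1 * k - (p1 / p2) * 0 \<noteq> 0" using k0 by simp
  have g1: "(1::complex) \<noteq> 0" by simp
  have "\<phi>2 \<circ> qmap y = gmap 1 0 \<circ> \<phi>2"
  proof (rule qmap_eqI)
    fix s t :: complex assume st: "(s, t) \<noteq> (0, 0)"
    have n2: "(1 * s + p1 / p2 * t, 0 * s + k * t) \<noteq> (0, 0)" by (rule moeb_nz[OF d st])
    define S where "S = s + p1 / p2 * t"
    have S: "p2 * S = p2 * s + p1 * t" using z by (simp add: S_def field_simps)
    have Pf: "p0 * t\<^sup>2 + p1 * s * t + p2 * s\<^sup>2 + p1 / p2 * (t * (p2 * S)) = p2 * (k\<^sup>2 * t\<^sup>2 + S\<^sup>2)"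
      using z unfolding k S_def by (simp add: field_simps power2_eq_square)
    have Qf: "q0 * t\<^sup>2 + q1 * s * t + q2 * s\<^sup>2 = t * (p2 * S)"
      using S z by (simp add: pq algebra_simps power2_eq_square)
    have "(\<phi>2 \<circ> qmap y) (ratio s t) =
       ratio (1 * qform (p0, p1, p2) s t + p1 / p2 * qform (q0, q1, q2) s t) (0 * qform (p0, p1, p2) s t + k * qform (q0, q1, q2) s t)"
      using qmap_nz[OF Y st] unfolding comp_apply qmap_ratio[OF Y st] \<phi>2_def
      by (subst moeb_ratio) (auto simp: e)
    also have "\<dots> = ratio (p2 * (k\<^sup>2 * t\<^sup>2 + S\<^sup>2)) (p2 * (S * (k * t)))"
      using Pf Qf by (simp add: mult_ac)
    also have "\<dots> = ratio (k\<^sup>2 * t\<^sup>2 + S\<^sup>2) (S * (k * t))" using z by (intro ratio_scale)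
    also have "\<dots> = (gmap 1 0 \<circ> \<phi>2) (ratio s t)"
      unfolding comp_apply \<phi>2_def moeb_ratio[OF st] gmap_def qmap_ratio[OF gcoeffs_mem[OF g1] n2]
      by (simp add: gcoeffs_def S_def power_mult_distrib)
    finally show "(\<phi>2 \<circ> qmap y) (ratio s t) = (gmap 1 0 \<circ> \<phi>2) (ratio s t)" .
  qed
  then have "conjugates \<phi>2 (qmap y) (gmap 1 0)"
    using rational_maps_1I[OF d] by (simp add: conjugates_def \<phi>2_def)
  from conj_class_eqI[OF conjugates_trans[OF c1 this] f] show ?thesis .
qed

section \<open>The topology of the moduli space\<close>

definition cls :: "quad_coeffs \<Rightarrow> (riemann_sphere \<Rightarrow> riemann_sphere) set" where
  "cls x = conj_class (qmap x)"

lemma topspace_M2: "topspace M2_topology = cls ` quad_coeff_set"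
  by (auto simp: M2_topology_def topspace_Rat2_topology rational_maps_2 cls_def)

lemma openin_M2_iff:
  "openin M2_topology U \<longleftrightarrow> U \<subseteq> cls ` quad_coeff_set \<and>
     openin (top_of_set quad_coeff_set) {x \<in> quad_coeff_set. cls x \<in> U}"
proof -
  have q: "(\<lambda>(u, v). rat_map (quad_poly u) (quad_poly v)) = qmap"
    by (auto simp: qmap_def fun_eq_iff)
  have R: "topspace Rat2_topology = qmap ` quad_coeff_set"
    by (simp add: topspace_Rat2_topology rational_maps_2)
  have "{x \<in> quad_coeff_set. qmap x \<in> {f \<in> qmap ` quad_coeff_set. conj_class f \<in> U}} =
     {x \<in> quad_coeff_set. cls x \<in> U}"
    by (auto simp: cls_def)
  moreover have "conj_class ` qmap ` quad_coeff_set = cls ` quad_coeff_set"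
    by (auto simp: cls_def)
  ultimately show ?thesis
    unfolding M2_topology_def openin_quotient_topology R
    unfolding Rat2_topology_def q openin_quotient_topology
    by auto
qed

lemma M2_openD:
  assumes "openin M2_topology U" "x \<in> quad_coeff_set" "cls x \<in> U"
  obtains e where "e > 0" "\<And>y. y \<in> quad_coeff_set \<Longrightarrow> dist y x < e \<Longrightarrow> cls y \<in> U"
proof -
  have "\<forall>x\<in>{x \<in> quad_coeff_set. cls x \<in> U}.
     \<exists>e>0. \<forall>x'\<in>quad_coeff_set. dist x' x < e \<longrightarrow> x' \<in> {x \<in> quad_coeff_set. cls x \<in> U}"
    using assms(1) unfolding openin_M2_iff openin_euclidean_subtopology_iff by (elim conjE)
  from bspec[OF this, of x] show ?thesis using that assms(2,3) by auto
qed

text \<open>Linear factors are removed one at a time: a root of \<open>p\<close> is a root of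
  \<open>q * r\<close> but not of \<open>q\<close>, hence of \<open>r\<close>.\<close>

lemma complex_poly_dvd_cancel:
  fixes p q r :: "complex poly"
  assumes "p \<noteq> 0" "\<And>z. poly p z = 0 \<Longrightarrow> poly q z \<noteq> 0" "p dvd q * r"
  shows "p dvd r"
  using assms
proof (induction "degree p" arbitrary: p r)
  case 0
  then have "is_unit p" by (simp add: is_unit_iff_degree)
  then show ?case by (rule unit_imp_dvd)
next
  case (Suc n)
  obtain z where z: "poly p z = 0"
    using Suc(2) by (metis fundamental_theorem_of_algebra constant_degree nat.distinct(1))
  then obtain p1 where p1: "p = [:-z, 1:] * p1" by (auto simp: poly_eq_0_iff_dvd elim: dvdE)
  obtain k where k: "q * r = p * k" using Suc.prems(3) by (elim dvdE)
  have "poly (q * r) z = 0" unfolding k using z by simp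
  then have "poly r z = 0" using Suc.prems(2)[OF z] by simp
  then obtain r1 where r1: "r = [:-z, 1:] * r1" by (auto simp: poly_eq_0_iff_dvd elim: dvdE)
  have "[:-z, 1:] * (q * r1) = [:-z, 1:] * (p1 * k)" using k unfolding p1 r1 by (simp only: mult_ac)
  then have "q * r1 = p1 * k" by (metis mult_left_cancel pCons_eq_0_iff zero_neq_one)
  then have "p1 dvd q * r1" by simp
  moreover have "p1 \<noteq> 0" using Suc.prems(1) p1 by auto
  moreover have "degree p1 = n" using Suc(2) \<open>p1 \<noteq> 0\<close> unfolding p1 by (subst (asm) degree_mult_eq) auto
  moreover have "\<And>w. poly p1 w = 0 \<Longrightarrow> poly q w \<noteq> 0" using Suc.prems(2) unfolding p1 by simp
  ultimately have "p1 dvd r1" using Suc(1) by blast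
  then show ?case unfolding p1 r1 by (rule mult_dvd_mono[OF dvd_refl])
qed

text \<open>Cross-multiplication and coprimality make the two numerators divide each other. In
  \<open>cls_open_map\<close> this turns equality of maps into a relation between vectors by
  \<open>qscale\<close>.\<close>

lemma qmap_eq_imp_proportional:
  assumes X: "(u, v) \<in> quad_coeff_set" and Y: "(u', v') \<in> quad_coeff_set"
    and eq: "qmap (u, v) = qmap (u', v')"
  obtains k where "k \<noteq> 0" "quad_poly u' = smult k (quad_poly u)" "quad_poly v' = smult k (quad_poly v)"
proof -
  define p q p' q' where "p = quad_poly u" and "q = quad_poly v" and "p' = quad_poly u'" and "q' = quad_poly v'"
  note d = p_def q_def p'_def q'_def
  have cp: "coprime p q" "max (degree p) (degree q) = 2" "coprime p' q'"
    using X Y by (simp_all add: quad_coeff_set_def d)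
  have "poly (p * q') z = poly (q * p') z" for z
  proof -
    have n: "(poly p z, poly q z) \<noteq> (0, 0)" "(poly p' z, poly q' z) \<noteq> (0, 0)"
      using cp by (auto simp: coprime_complex_poly_iff)
    have "ratio (poly p z) (poly q z) = ratio (poly p' z) (poly q' z)"
      using fun_cong[OF eq, of "Fin z"] by (simp add: qmap_def d)
    then show ?thesis using ratio_eq_iff[OF n] by simp
  qed
  then have e: "p * q' = q * p'" by (intro poly_eq_poly_eq_iff[THEN iffD1]) auto
  have p0: "p \<noteq> 0"
  proof
    assume "p = 0"
    then have "is_unit q" using cp(1) by simp
    then have "degree q = 0" by (metis is_unit_iff_degree not_is_unit_0)
    then show False using cp(2) \<open>p = 0\<close> by simp
  qed
  have "p dvd p'"
    using complex_poly_dvd_cancel[of p q p'] cp(1) e p0 by (metis coprime_complex_poly_iff dvd_triv_left)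
  then obtain r where r: "p' = p * r" by (elim dvdE)
  have "p' \<noteq> 0"
  proof
    assume "p' = 0"
    then have "q' = 0" using e p0 by simp
    then show False using cp(3) \<open>p' = 0\<close> by simp
  qed
  then have "p' dvd p"
    using complex_poly_dvd_cancel[of p' q' p] cp(3) e
    by (metis coprime_complex_poly_iff dvd_triv_right mult.commute)
  then obtain r' where r': "p = p' * r'" by (elim dvdE)
  have "p * (r * r') = p * 1" by (metis r r' mult.assoc mult.right_neutral)
  then have "r * r' = 1" using p0 by (metis mult_left_cancel)
  then have "is_unit r" by (metis dvd_triv_left)
  then obtain k where k: "r = [:k:]" "k \<noteq> 0"
    by (metis is_unit_polyE not_is_unit_0 pCons_0_0)
  have "p * q' = p * (q * r)" using e r by (simp add: algebra_simps)
  then have "q' = q * r" using p0 by (metis mult_left_cancel)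
  with r k that show ?thesis by (simp add: d)
qed

lemma quad_poly_inj: "quad_poly u = quad_poly v \<longleftrightarrow> u = v"
  by (cases u; cases v) auto

definition qscale :: "complex \<Rightarrow> quad_coeffs \<Rightarrow> quad_coeffs" where
  "qscale k x = (let ((p0, p1, p2), (q0, q1, q2)) = x in ((k * p0, k * p1, k * p2), (k * q0, k * q1, k * q2)))"

lemma qform_qscale:
  "qform (fst (qscale k x)) s t = k * qform (fst x) s t" "qform (snd (qscale k x)) s t = k * qform (snd x) s t"
  by (cases x; auto simp: qscale_def algebra_simps split: prod.splits)+

lemma qscale_mem:
  assumes "k \<noteq> 0" "x \<in> quad_coeff_set"
  shows "qscale k x \<in> quad_coeff_set" "qmap (qscale k x) = qmap x"
proof -
  show m: "qscale k x \<in> quad_coeff_set"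
    using assms(1) qmap_nz[OF assms(2)] quad_coeff_set_iff[of "fst (qscale k x)" "snd (qscale k x)"]
    by (simp add: qform_qscale)
  show "qmap (qscale k x) = qmap x"
    by (rule qmap_eqI) (simp add: qmap_ratio[OF m] qmap_ratio[OF assms(2)] qform_qscale assms(1))
qed

lemma qsub_alt: "qsub a b c d u =
     (fst u * a\<^sup>2 - fst (snd u) * a * b + snd (snd u) * b\<^sup>2,
      fst (snd u) * (a * d + b * c) - 2 * fst u * a * c - 2 * snd (snd u) * b * d,
      fst u * c\<^sup>2 - fst (snd u) * c * d + snd (snd u) * d\<^sup>2)"
  by (cases u) simp

lemma qlin_alt: "qlin a b u v = (a * fst u + b * fst v, a * fst (snd u) + b * fst (snd v), a * snd (snd u) + b * snd (snd v))"
  by (cases u; cases v) simp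

lemma qscale_alt: "qscale k x = ((k * fst (fst x), k * fst (snd (fst x)), k * snd (snd (fst x))),
    (k * fst (snd x), k * fst (snd (snd x)), k * snd (snd (snd x))))"
  by (simp add: qscale_def split: prod.splits)

lemma continuous_qconj: "continuous_on UNIV (\<lambda>x. qscale k (qconj a b c d x))"
  unfolding qscale_alt qconj_def qlin_alt qsub_alt by (auto intro!: continuous_intros)

lemma cls_qconj:
  assumes "a * d - b * c \<noteq> 0" "x \<in> quad_coeff_set"
  shows "cls (qconj a b c d x) = cls x"
  unfolding cls_def using conj_class_eqI[OF conjugates_qmap[OF assms]] assms(2) by (simp add: rational_maps_2)

text \<open>The class map is open because it is the quotient by a group acting by homeomorphisms.\<close>
lemma cls_open_map:
  assumes W: "openin (top_of_set quad_coeff_set) W"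
  shows "openin M2_topology (cls ` W)"
proof -
  have WX: "W \<subseteq> quad_coeff_set" using W by (rule openin_imp_subset)
  have "\<exists>e>0. \<forall>y\<in>quad_coeff_set. dist y x < e \<longrightarrow> cls y \<in> cls ` W"
    if x: "x \<in> quad_coeff_set" and cx: "cls x \<in> cls ` W" for x
  proof -
    obtain w where w: "w \<in> W" "conj_class (qmap x) = conj_class (qmap w)"
      using cx by (auto simp: cls_def)
    obtain \<phi> where c: "conjugates \<phi> (qmap x) (qmap w)"
      using conj_class_eqD[OF w(2)] x by (auto simp: rational_maps_2)
    obtain a b c' d where m: "\<phi> = moeb a b c' d" "a * d - b * c' \<noteq> 0"
      using c unfolding conjugates_def by (blast elim: rational_maps_1E)
    obtain \<psi> where s: "\<phi> \<circ> \<psi> = id" using conjugates_sym[OF c] by metis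
    define y where "y = qconj a b c' d x"
    have Y: "y \<in> quad_coeff_set" unfolding y_def by (rule qconj_mem[OF m(2) x])
    have "qmap y \<circ> \<phi> = qmap w \<circ> \<phi>"
      using qconj_mem(2)[OF m(2) x] c unfolding y_def m(1) conjugates_def by simp
    then have "qmap y = qmap w" by (metis comp_assoc s comp_id)
    then obtain k where k: "k \<noteq> 0" "quad_poly (fst w) = smult k (quad_poly (fst y))"
        "quad_poly (snd w) = smult k (quad_poly (snd y))"
      using qmap_eq_imp_proportional[of "fst y" "snd y" "fst w" "snd w"] Y w(1) WX by auto
    have "quad_poly (fst w) = quad_poly (fst (qscale k y))" "quad_poly (snd w) = quad_poly (snd (qscale k y))"
      using k by (auto simp: qscale_def split: prod.splits)
    then have wy: "w = qscale k y" by (simp add: quad_poly_inj prod_eq_iff)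
    obtain e where e: "e > 0" "\<And>z. z \<in> quad_coeff_set \<Longrightarrow> dist z w < e \<Longrightarrow> z \<in> W"
      using W w(1) unfolding openin_euclidean_subtopology_iff by blast
    obtain \<delta> where \<delta>: "\<delta> > 0" "\<And>z. dist z x < \<delta> \<Longrightarrow> dist (qscale k (qconj a b c' d z)) w < e"
      using continuous_qconj[of k a b c' d] e(1) unfolding continuous_on_iff wy y_def by (metis UNIV_I)
    show ?thesis
    proof (intro exI conjI ballI impI)
      fix z assume z: "z \<in> quad_coeff_set" "dist z x < \<delta>"
      have q: "qconj a b c' d z \<in> quad_coeff_set" by (rule qconj_mem[OF m(2) z(1)])
      have "qscale k (qconj a b c' d z) \<in> W"
        by (rule e(2)[OF qscale_mem(1)[OF k(1) q] \<delta>(2)[OF z(2)]])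
      moreover have "cls (qscale k (qconj a b c' d z)) = cls z"
        using cls_qconj[OF m(2) z(1)] qscale_mem(2)[OF k(1) q] by (simp add: cls_def)
      ultimately show "cls z \<in> cls ` W" by (metis image_eqI)
    qed (rule \<delta>(1))
  qed
  note * = this
  show ?thesis
    unfolding openin_M2_iff openin_euclidean_subtopology_iff
  proof (intro conjI ballI)
    show "cls ` W \<subseteq> cls ` quad_coeff_set" using WX by (rule image_mono)
    fix x assume "x \<in> {x \<in> quad_coeff_set. cls x \<in> cls ` W}"
    then obtain e where "e > 0" "\<forall>y\<in>quad_coeff_set. dist y x < e \<longrightarrow> cls y \<in> cls ` W"
      using *[of x] by blast
    then show "\<exists>e>0. \<forall>x'\<in>quad_coeff_set. dist x' x < e \<longrightarrow> x' \<in> {x \<in> quad_coeff_set. cls x \<in> cls ` W}"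
      by (intro exI[of _ e]) simp
  qed simp
qed

lemma cls_closureI:
  assumes x: "x \<in> quad_coeff_set" and y: "\<And>n. y n \<in> quad_coeff_set" "y \<longlonglongrightarrow> x" "\<And>n. cls (y n) \<in> S"
  shows "cls x \<in> M2_topology closure_of S"
  unfolding in_closure_of
proof (intro conjI allI impI)
  show "cls x \<in> topspace M2_topology" using x by (auto simp: topspace_M2)
  fix T assume T: "cls x \<in> T \<and> openin M2_topology T"
  then obtain e where e: "e > 0" "\<And>z. z \<in> quad_coeff_set \<Longrightarrow> dist z x < e \<Longrightarrow> cls z \<in> T"
    using M2_openD[of T x] x by blast
  obtain n where "dist (y n) x < e" using tendstoD[OF y(2) e(1)] by (auto simp: eventually_sequentially)
  then show "\<exists>C. C \<in> S \<and> C \<in> T" using e(2)[OF y(1)] y(3) by blast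
qed

section \<open>The bidisc of multipliers and its openness in the moduli space\<close>

definition disc_classes :: "(riemann_sphere \<Rightarrow> riemann_sphere) set set" where
  "disc_classes = {conj_class (fam a b) | a b. cmod a < 1 \<and> cmod b < 1}"

lemma norm_mult_lt_1: "cmod a < 1 \<Longrightarrow> cmod b < 1 \<Longrightarrow> a * b \<noteq> 1"
  by (metis norm_mult norm_one mult_strict_mono' norm_ge_zero mult_1 less_irrefl)

lemma two_attracting_disc_classes:
  assumes "f \<in> rational_maps 2" "f p = p" "f q = q" "p \<noteq> q"
    "cmod (local_deriv f p) < 1" "cmod (local_deriv f q) < 1"
  shows "conj_class f \<in> disc_classes"
proof -
  obtain a b \<phi> where "a * b \<noteq> 1" "conjugates \<phi> f (fam a b)" "a = local_deriv f p" "b = local_deriv f q"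
    using two_fixed_points_normal_form[OF assms(1-4)] .
  then show ?thesis using conj_class_eqI[of \<phi> f "fam a b"] assms unfolding disc_classes_def by blast
qed

text \<open>In the coordinate 1/(1-z) the index formula is additive and the unit disc becomes a
  half-plane; the multiplier estimates pass through it for this reason.\<close>

lemma re_inverse_one_minus:
  assumes "cmod a < 1" shows "Re (1 / (1 - a)) > 1 / 2"
proof -
  have a1: "a \<noteq> 1" using assms by auto
  have pos: "(cmod (1 - a))\<^sup>2 > 0" using a1 by simp
  have "(cmod a)\<^sup>2 < 1" using assms by (simp add: power_less_one_iff)
  then have "(cmod (1 - a))\<^sup>2 < 2 * Re (1 - a)"
    unfolding cmod_power2 by (simp add: power2_eq_square algebra_simps)
  then have "1 / 2 < Re (1 - a) / (cmod (1 - a))\<^sup>2" using pos by (simp add: field_simps)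
  then show ?thesis by (simp only: Re_divide_numeral complex_div_gt_0 Re_divide) (simp add: cmod_power2 Re_divide)
qed

lemma norm_one_minus_inverse:
  assumes "Re S > 1 / 2" shows "cmod (1 - 1 / S) < 1"
proof -
  have S0: "S \<noteq> 0" using assms by auto
  have "(cmod (S - 1))\<^sup>2 < (cmod S)\<^sup>2"
    using assms unfolding cmod_power2 by (simp add: power2_eq_square algebra_simps)
  then have "cmod (S - 1) < cmod S" by (rule power2_less_imp_less) simp
  moreover have "1 - 1 / S = (S - 1) / S" using S0 by (simp add: field_simps)
  ultimately show ?thesis using S0 by (simp add: norm_divide)
qed

lemma re_inverse_pos: "Re z > 0 \<Longrightarrow> Re (1 / z) > 0"
proof -
  assume "Re z > 0"
  then have "(Re z)\<^sup>2 + (Im z)\<^sup>2 > 0" by (simp add: add_pos_nonneg)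
  then show ?thesis using \<open>Re z > 0\<close> by (simp add: Re_divide)
qed

lemma third_multiplier_identity:
  assumes "a * b \<noteq> 1" "a \<noteq> 1" "b \<noteq> (1::complex)"
  shows "1 / ((2 - a - b) / (1 - a * b) - 1) = 1 / (1 - a) + 1 / (1 - b) - 1"
proof -
  have "(2 - a - b) / (1 - a * b) - 1 = (1 - a) * (1 - b) / (1 - a * b)"
    using assms by (simp add: divide_simps) (simp add: algebra_simps)
  moreover have "1 / (1 - a) + 1 / (1 - b) - 1 = (1 - a * b) / ((1 - a) * (1 - b))"
    using assms by (simp add: divide_simps) (simp add: algebra_simps)
  ultimately show ?thesis by simp
qed

text \<open>By the index formula 1/(c-1) is a sum of two numbers with real part above 1/2, minus 1,
  and inversion preserves the right half-plane.\<close>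

lemma third_multiplier_re:
  assumes "cmod a < 1" "cmod b < 1"
  shows "Re ((2 - a - b) / (1 - a * b)) > 1"
proof -
  define c where "c = (2 - a - b) / (1 - a * b)"
  have n: "a * b \<noteq> 1" "a \<noteq> 1" "b \<noteq> 1" using assms norm_mult_lt_1[OF assms] by auto
  have "Re (1 / (c - 1)) > 0"
    unfolding c_def third_multiplier_identity[OF n]
    using re_inverse_one_minus[OF assms(1)] re_inverse_one_minus[OF assms(2)] by simp
  from re_inverse_pos[OF this] show ?thesis by (simp add: c_def)
qed

text \<open>The map contracts the disc of radius \<open>r\<close> about \<open>0\<close> into itself.\<close>
definition attr_cond :: "real \<Rightarrow> quad_coeffs \<Rightarrow> bool" where
  "attr_cond r x \<longleftrightarrow>
    (let p0 = cmod (fst (fst x)); p1 = cmod (fst (snd (fst x))); p2 = cmod (snd (snd (fst x)));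
         q0 = cmod (fst (snd x)); q1 = cmod (fst (snd (snd x))); q2 = cmod (snd (snd (snd x)))
     in p0 + p1 * r + p2 * r\<^sup>2 < r * (q0 - q1 * r - q2 * r\<^sup>2) \<and>
        (p1 + 2 * p2 * r) * (q0 + q1 * r + q2 * r\<^sup>2) + (p0 + p1 * r + p2 * r\<^sup>2) * (q1 + 2 * q2 * r)
          < (q0 - q1 * r - q2 * r\<^sup>2)\<^sup>2)"

lemma open_attr_cond: "open {x. attr_cond r x}"
  unfolding attr_cond_def Let_def
  by (intro open_Collect_conj open_Collect_less continuous_intros)

text \<open>The first inequality gives |P/Q| < r on the disc, so Brouwer yields a fixed point; the
  second bounds the Wronskian there by |Q|^2. Only moduli of coefficients enter, which makes the
  condition open.\<close>

lemma attr_cond_fixed_point: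
  assumes X: "x \<in> quad_coeff_set" and r: "0 < r" and A: "attr_cond r x"
  obtains p where "cmod p \<le> r" "qmap x (Fin p) = Fin p" "cmod (local_deriv (qmap x) (Fin p)) < 1"
proof -
  obtain p0 p1 p2 q0 q1 q2 where e: "x = ((p0, p1, p2), (q0, q1, q2))" by (metis surj_pair)
  note X' = X[unfolded e]
  define P Q where "P = (\<lambda>z. p0 + p1 * z + p2 * z\<^sup>2)" and "Q = (\<lambda>z. q0 + q1 * z + q2 * z\<^sup>2)"
  define m where "m = cmod q0 - cmod q1 * r - cmod q2 * r\<^sup>2"
  have c1: "cmod p0 + cmod p1 * r + cmod p2 * r\<^sup>2 < r * m"
    and c2: "(cmod p1 + 2 * cmod p2 * r) * (cmod q0 + cmod q1 * r + cmod q2 * r\<^sup>2) +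
       (cmod p0 + cmod p1 * r + cmod p2 * r\<^sup>2) * (cmod q1 + 2 * cmod q2 * r) < m\<^sup>2"
    using A by (auto simp: attr_cond_def e Let_def m_def)
  have "0 \<le> cmod p0 + cmod p1 * r + cmod p2 * r\<^sup>2" using r by simp
  then have "0 < r * m" using c1 by linarith
  then have m: "m > 0" using r by (simp add: zero_less_mult_iff)
  have tri: "cmod (u + v + w) \<le> cmod u + cmod v + cmod w" for u v w
    using norm_triangle_ineq[of "u + v" w] norm_triangle_ineq[of u v] by linarith
  have Pb: "cmod (P z) \<le> cmod p0 + cmod p1 * r + cmod p2 * r\<^sup>2" if "cmod z \<le> r" for z
  proof -
    have "cmod (P z) \<le> cmod p0 + cmod (p1 * z) + cmod (p2 * z\<^sup>2)"
      unfolding P_def by (rule tri)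
    also have "\<dots> \<le> cmod p0 + cmod p1 * r + cmod p2 * r\<^sup>2"
      using that by (auto simp: norm_mult norm_power intro!: add_mono mult_left_mono power_mono)
    finally show ?thesis .
  qed
  have Qb: "m \<le> cmod (Q z)" "cmod (Q z) \<le> cmod q0 + cmod q1 * r + cmod q2 * r\<^sup>2" if "cmod z \<le> r" for z
  proof -
    have b: "cmod (q1 * z) \<le> cmod q1 * r" "cmod (q2 * z\<^sup>2) \<le> cmod q2 * r\<^sup>2"
      using that by (auto simp: norm_mult norm_power intro!: mult_left_mono power_mono)
    have "cmod q0 \<le> cmod (Q z) + cmod (q1 * z) + cmod (q2 * z\<^sup>2)"
    proof -
      have "q0 = Q z - q1 * z - q2 * z\<^sup>2" by (simp add: Q_def)
      then show ?thesis
        using norm_triangle_ineq4[of "Q z - q1 * z" "q2 * z\<^sup>2"] norm_triangle_ineq4[of "Q z" "q1 * z"] by simp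
    qed
    then show "m \<le> cmod (Q z)" using b by (simp add: m_def)
    have "cmod (Q z) \<le> cmod q0 + cmod (q1 * z) + cmod (q2 * z\<^sup>2)"
      unfolding Q_def by (rule tri)
    then show "cmod (Q z) \<le> cmod q0 + cmod q1 * r + cmod q2 * r\<^sup>2" using b by simp
  qed
  have Q0: "Q z \<noteq> 0" if "cmod z \<le> r" for z using Qb(1)[OF that] m by auto
  obtain p where p': "p \<in> cball 0 r" "P p / Q p = p"
  proof (rule brouwer)
    show "compact (cball (0::complex) r)" "convex (cball (0::complex) r)" "cball (0::complex) r \<noteq> {}" using r by auto
    show "continuous_on (cball 0 r) (\<lambda>z. P z / Q z)"
      using Q0 unfolding P_def Q_def by (intro continuous_intros) auto
    show "(\<lambda>z. P z / Q z) \<in> cball 0 r \<rightarrow> cball 0 r"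
    proof
      fix z :: complex assume "z \<in> cball 0 r"
      then have z: "cmod z \<le> r" by simp
      have "cmod (P z) \<le> r * m" using Pb[OF z] c1 by linarith
      also have "\<dots> \<le> r * cmod (Q z)" using Qb(1)[OF z] r by simp
      finally show "P z / Q z \<in> cball 0 r" using Q0[OF z] by (simp add: norm_divide divide_le_eq)
    qed
  qed
  then have p: "cmod p \<le> r" "P p / Q p = p" by auto
  show ?thesis
  proof
    show "cmod p \<le> r" by (rule p)
    show "qmap x (Fin p) = Fin p"
      using qmap_at_Fin(1)[OF X', of p] p Q0[OF p(1)] by (simp add: e P_def Q_def ratio_def)
    have d: "local_deriv (qmap x) (Fin p) = ((p1 + 2 * p2 * p) * Q p - P p * (q1 + 2 * q2 * p)) / (Q p)\<^sup>2"
      using qmap_at_Fin(2)[OF X', of p] Q0[OF p(1)] by (simp add: e P_def Q_def)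
    have l: "cmod (a + 2 * b * p) \<le> cmod a + 2 * cmod b * r" for a b
      using norm_triangle_ineq[of a "2 * b * p"] p(1) mult_left_mono[of "cmod p" r "cmod b"]
      by (simp add: norm_mult)
    have "cmod ((p1 + 2 * p2 * p) * Q p - P p * (q1 + 2 * q2 * p)) \<le>
       cmod (p1 + 2 * p2 * p) * cmod (Q p) + cmod (P p) * cmod (q1 + 2 * q2 * p)"
      unfolding norm_mult[symmetric] by (rule norm_triangle_ineq4)
    also have "\<dots> \<le> (cmod p1 + 2 * cmod p2 * r) * (cmod q0 + cmod q1 * r + cmod q2 * r\<^sup>2) +
       (cmod p0 + cmod p1 * r + cmod p2 * r\<^sup>2) * (cmod q1 + 2 * cmod q2 * r)"
      using l Qb(2)[OF p(1)] Pb[OF p(1)] r by (intro add_mono mult_mono) auto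
    also have "\<dots> < m\<^sup>2" by (rule c2)
    also have "\<dots> \<le> (cmod (Q p))\<^sup>2" using Qb(1)[OF p(1)] m by (intro power_mono) auto
    finally show "cmod (local_deriv (qmap x) (Fin p)) < 1"
      using Q0[OF p(1)] by (simp add: d norm_divide norm_power divide_less_eq)
  qed
qed

lemma attr_cond_fam:
  assumes "cmod a < 1" "cmod b < 1"
  obtains R where "R > 0" "\<And>r. 0 < r \<Longrightarrow> r < R \<Longrightarrow> attr_cond r (fam_coeffs a b)"
proof
  \<comment> \<open>The 9 collects the error terms below: 5r and 2r on the left, and 2r lost in (1 -
    B r)^2.\<close>
  show "min 1 ((1 - cmod a) / 9) > 0" using assms by simp
  fix r assume r: "0 < r" "r < min 1 ((1 - cmod a) / 9)"
  define A B where "A = cmod a" and "B = cmod b"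
  have AB: "0 \<le> A" "A < 1" "0 \<le> B" "B < 1" "9 * r < 1 - A" "r < 1" "0 < r"
    using assms r by (auto simp: A_def B_def)
  have Br: "B * r \<le> r" using AB by (simp add: mult_left_le_one_le)
  have Ar: "A * r \<le> r" using AB by (simp add: mult_left_le_one_le)
  have r2: "r\<^sup>2 \<le> r" using AB by (simp add: power2_eq_square mult_left_le_one_le)
  have 1: "A * r + r\<^sup>2 < r * (1 - B * r)"
  proof -
    have "A + r < 1 - B * r" using AB Br by linarith
    then have "r * (A + r) < r * (1 - B * r)" using AB(7) by (rule mult_strict_left_mono)
    then show ?thesis by (simp add: algebra_simps power2_eq_square)
  qed
  have 2: "(A + 2 * r) * (1 + B * r) + (A * r + r\<^sup>2) * B < (1 - B * r)\<^sup>2"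
  proof -
    have "(A + 2 * r) * (1 + B * r) \<le> (A + 2 * r) * (1 + r)" using AB Br by (intro mult_left_mono) auto
    also have "\<dots> = A + A * r + 2 * r + 2 * r\<^sup>2" by (simp add: algebra_simps power2_eq_square)
    finally have a: "(A + 2 * r) * (1 + B * r) \<le> A + 5 * r" using Ar r2 by linarith
    have "(A * r + r\<^sup>2) * B \<le> (A * r + r\<^sup>2) * 1" using AB by (intro mult_left_mono) auto
    also have "\<dots> \<le> 2 * r" using Ar r2 by simp
    finally have b: "(A * r + r\<^sup>2) * B \<le> 2 * r" .
    have "(1 - x)\<^sup>2 \<ge> 1 - 2 * x" for x :: real by (simp add: power2_eq_square algebra_simps)
    from this[of "B * r"] have "(1 - B * r)\<^sup>2 \<ge> 1 - 2 * (B * r)" .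
    then show ?thesis using a b Br AB by linarith
  qed
  show "attr_cond r (fam_coeffs a b)"
    using 1 2 by (simp add: attr_cond_def fam_coeffs_def A_def B_def)
qed

lemma qconj_inv: "qconj 0 1 1 0 ((p0, p1, p2), (q0, q1, q2)) = ((q2, q1, q0), (p2, p1, p0))"
  by (simp add: qconj_def)

text \<open>\<open>attr_cond\<close> for the map and for its conjugate by 1/z gives one attracting
  fixed point near 0 and one near \<infinity>. Both conditions are open, and \<open>cls\<close> is
  an open map.\<close>

lemma disc_classes_open: "openin M2_topology disc_classes"
proof (subst openin_subopen, intro ballI)
  fix C assume "C \<in> disc_classes"
  then obtain a b where ab: "C = conj_class (fam a b)" "cmod a < 1" "cmod b < 1" by (auto simp: disc_classes_def)
  obtain R1 where R1: "R1 > 0" "\<And>r. 0 < r \<Longrightarrow> r < R1 \<Longrightarrow> attr_cond r (fam_coeffs a b)"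
    using attr_cond_fam[OF ab(2,3)] by blast
  obtain R2 where R2: "R2 > 0" "\<And>r. 0 < r \<Longrightarrow> r < R2 \<Longrightarrow> attr_cond r (fam_coeffs b a)"
    using attr_cond_fam[OF ab(3,2)] by blast
  define r where "r = min 1 (min R1 R2) / 2"
  have r: "0 < r" "r < R1" "r < R2" "r < 1" using R1 R2 by (auto simp: r_def)
  define W where "W = {x \<in> quad_coeff_set. attr_cond r x \<and> attr_cond r (qconj 0 1 1 0 x)}"
  have sc: "qscale 1 y = y" for y by (simp add: qscale_def split: prod.splits)
  have "open {x. attr_cond r (qconj 0 1 1 0 x)}"
    using open_vimage[OF open_attr_cond[of r] continuous_qconj[of 1 0 1 1 0]] by (simp add: sc vimage_def)
  then have "open ({x. attr_cond r x} \<inter> {x. attr_cond r (qconj 0 1 1 0 x)})"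
    by (intro open_Int open_attr_cond)
  moreover have "W = quad_coeff_set \<inter> ({x. attr_cond r x} \<inter> {x. attr_cond r (qconj 0 1 1 0 x)})"
    by (auto simp: W_def)
  ultimately have "openin (top_of_set quad_coeff_set) W" by (metis openin_open_Int)
  then have op: "openin M2_topology (cls ` W)" by (rule cls_open_map)
  have "qconj 0 1 1 0 (fam_coeffs a b) = fam_coeffs b a" by (simp add: fam_coeffs_def qconj_inv)
  then have "fam_coeffs a b \<in> W"
    using R1(2)[OF r(1,2)] R2(2)[OF r(1,3)] fam_mem[OF norm_mult_lt_1[OF ab(2,3)]] by (simp add: W_def)
  then have mem: "C \<in> cls ` W" using ab by (auto simp: cls_def fam_qmap)
  have "cls ` W \<subseteq> disc_classes"
  proof
    fix D assume "D \<in> cls ` W"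
    then obtain x where x: "D = cls x" "x \<in> quad_coeff_set" "attr_cond r x" "attr_cond r (qconj 0 1 1 0 x)"
      by (auto simp: W_def)
    obtain p where p: "cmod p \<le> r" "qmap x (Fin p) = Fin p" "cmod (local_deriv (qmap x) (Fin p)) < 1"
      using attr_cond_fixed_point[OF x(2) r(1) x(3)] .
    have d: "0 * 0 - 1 * 1 \<noteq> (0::complex)" by simp
    have Xi: "qconj 0 1 1 0 x \<in> quad_coeff_set" by (rule qconj_mem[OF d x(2)])
    obtain q where q: "cmod q \<le> r" "qmap (qconj 0 1 1 0 x) (Fin q) = Fin q"
       "cmod (local_deriv (qmap (qconj 0 1 1 0 x)) (Fin q)) < 1"
      using attr_cond_fixed_point[OF Xi r(1) x(4)] .
    have R: "qmap x \<in> rational_maps 2" "qmap (qconj 0 1 1 0 x) \<in> rational_maps 2"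
      using x Xi by (auto simp: rational_maps_2)
    obtain \<psi> where \<psi>: "conjugates \<psi> (qmap (qconj 0 1 1 0 x)) (qmap x)" "\<psi> \<circ> moeb 0 1 1 0 = id"
        "moeb 0 1 1 0 \<circ> \<psi> = id"
      using conjugates_sym[OF conjugates_qmap[OF d x(2)]] .
    define q' where "q' = \<psi> (Fin q)"
    have "qmap x q' = q'" unfolding q'_def using conjugates_apply[OF \<psi>(1), of "Fin q"] q by simp
    moreover have "cmod (local_deriv (qmap x) q') < 1"
      unfolding q'_def using conjugates_multiplier_1[OF \<psi>(1) R(2) q(2)] q by simp
    \<comment> \<open>The radius r < 1 keeps the two points apart: p has modulus at most r, while q'
      is the inverse of such a point.\<close>
    moreover have "q' \<noteq> Fin p"
    proof
      assume "q' = Fin p"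
      then have "moeb 0 1 1 0 (Fin p) = Fin q" using \<psi>(3) unfolding q'_def by (metis comp_apply id_apply)
      then have "p \<noteq> 0" "1 / p = q" by (auto simp: moeb_def ratio_def split: if_splits)
      then have "cmod p * cmod q = 1" by (auto simp: norm_divide)
      moreover have "cmod p * cmod q \<le> r * r" using p(1) q(1) r by (intro mult_mono) auto
      moreover have "r * r < 1 * 1" using r by (intro mult_strict_mono) auto
      ultimately show False by simp
    qed
    ultimately show "D \<in> disc_classes"
      using two_attracting_disc_classes[OF R(1), of "Fin p" q'] p x by (simp add: cls_def)
  qed
  then show "\<exists>T. openin M2_topology T \<and> C \<in> T \<and> T \<subseteq> disc_classes" using op mem by blast
qed

section \<open>The closure of the classes with two attracting fixed points\<close>

lemma fam_approx_closure:
  assumes ab: "a * b \<noteq> 1" and n: "cmod a \<le> 1" "cmod b \<le> 1"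
  shows "conj_class (fam a b) \<in> M2_topology closure_of disc_classes"
proof -
  define t where "t n = 1 - 1 / real (n + 2)" for n
  have t: "0 \<le> t n" "t n < 1" for n by (auto simp: t_def)
  have tl: "t \<longlonglongrightarrow> 1"
  proof -
    have "(\<lambda>n. 1 / real (n + 2)) \<longlonglongrightarrow> 0"
      using LIMSEQ_ignore_initial_segment[OF lim_1_over_n, of 2] by simp
    from tendsto_diff[OF tendsto_const this, of 1] show ?thesis by (simp add: t_def[abs_def])
  qed
  define y where "y n = fam_coeffs (of_real (t n) * a) (of_real (t n) * b)" for n
  have lt: "cmod (of_real (t n) * a) < 1" "cmod (of_real (t n) * b) < 1" for n
    using t[of n] n mult_left_le[of "cmod a" "t n"] mult_left_le[of "cmod b" "t n"] by (auto simp: norm_mult)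
  have "cls (fam_coeffs a b) \<in> M2_topology closure_of disc_classes"
  proof (rule cls_closureI)
    show "fam_coeffs a b \<in> quad_coeff_set" by (rule fam_mem[OF ab])
    show "y n \<in> quad_coeff_set" for n unfolding y_def by (rule fam_mem[OF norm_mult_lt_1[OF lt]])
    show "cls (y n) \<in> disc_classes" for n
      unfolding cls_def y_def fam_qmap[symmetric] disc_classes_def using lt by blast
    have tc: "(\<lambda>n. complex_of_real (t n)) \<longlonglongrightarrow> 1" using tendsto_of_real[OF tl] by simp
    have "(\<lambda>n. complex_of_real (t n) * c) \<longlonglongrightarrow> c" for c
      using tendsto_mult[OF tc tendsto_const, of c] by simp
    then show "y \<longlonglongrightarrow> fam_coeffs a b"
      unfolding y_def[abs_def] fam_coeffs_def by (intro tendsto_intros)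
  qed
  then show ?thesis by (simp add: cls_def fam_qmap)
qed

lemma fam_swap_class:
  assumes ab: "a * b \<noteq> 1"
  shows "conj_class (fam a b) = conj_class (fam b a)"
proof -
  obtain \<phi> where c: "conjugates \<phi> (fam a b) (fam b a)" "\<phi> (Fin 0) = Infty" "\<phi> Infty = Fin 0"
    using fam_swap[OF ab] .
  show ?thesis by (rule conj_class_eqI[OF c(1) fam_rational[OF ab]])
qed

text \<open>With \<open>w = \<lambda>/(\<lambda>-1)\<close>, the multipliers \<open>1 - 1/(w/2 + iN)\<close> and \<open>1 - 1/(w/2 - iN)\<close> complete \<open>\<lambda>\<close> to a
  triple satisfying the fixed point index formula, and both tend to \<open>1\<close> from inside the disc.\<close>
lemma parabolic_approximation:
  assumes l: "Re l > 1"
  obtains a :: "nat \<Rightarrow> complex" where "a \<longlonglongrightarrow> 1" "\<And>n. cmod (a n) < 1" "\<And>n. l * a n \<noteq> 1"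
    "\<And>n. cmod ((2 - l - a n) / (1 - l * a n)) < 1" "\<And>n. conj_class (fam l (a n)) \<in> disc_classes"
proof -
  \<comment> \<open>By the index formula the other two multipliers satisfy 1/(1-a) + 1/(1-c) = w,
    and Re w > 1 leaves room for two summands of real part above 1/2.\<close>
  define w where "w = l / (l - 1)"
  have l1: "l \<noteq> 1" using l by auto
  have w: "w = 1 + 1 / (l - 1)" using l1 by (simp add: w_def field_simps)
  have "Re (l - 1) > 0" using l by simp
  from re_inverse_pos[OF this] have rw: "Re w > 1" by (simp add: w)
  define S where "S n = w / 2 + \<i> * of_nat n" for n :: nat
  define T where "T n = w / 2 - \<i> * of_nat n" for n :: nat
  have ST: "Re (S n) > 1 / 2" "Re (T n) > 1 / 2" for n using rw by (auto simp: S_def T_def)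
  have nz: "S n \<noteq> 0" "T n \<noteq> 0" for n using ST[of n] by auto
  define a where "a n = 1 - 1 / S n" for n
  show ?thesis
  proof
    show an: "cmod (a n) < 1" for n unfolding a_def by (rule norm_one_minus_inverse[OF ST(1)])
    have "filterlim S at_infinity sequentially"
    proof -
      have "filterlim (\<lambda>n. \<i> * of_nat n) at_infinity sequentially"
        by (rule tendsto_mult_filterlim_at_infinity[OF tendsto_const _ tendsto_of_nat]) simp
      from tendsto_add_filterlim_at_infinity[OF tendsto_const this, of "w / 2"]
      show ?thesis by (simp add: S_def[abs_def])
    qed
    then have "(\<lambda>n. inverse (S n)) \<longlonglongrightarrow> 0" by (rule filterlim_compose[OF tendsto_inverse_0])
    from tendsto_diff[OF tendsto_const this, of 1] show "a \<longlonglongrightarrow> 1"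
      by (simp add: a_def[abs_def] inverse_eq_divide)
    have a1: "a n \<noteq> 1" for n using an[of n] by auto
    have sum: "1 / (1 - a n) + 1 / (1 - l) - 1 = - T n" for n
    proof -
      have "1 / (1 - a n) = S n" using nz by (simp add: a_def)
      moreover have "1 / (1 - l) = 1 - w" using l1 by (simp add: w divide_simps)
      ultimately show ?thesis by (simp add: S_def T_def)
    qed
    show la: "l * a n \<noteq> 1" for n
    proof
      assume h: "l * a n = 1"
      have "1 / (1 - a n) + 1 / (1 - l) - 1 = (1 - l * a n) / ((1 - a n) * (1 - l))"
        using a1[of n] l1 by (simp add: divide_simps) (simp add: algebra_simps)
      then show False using sum[of n] nz(2)[of n] h by simp
    qed
    have c: "(2 - l - a n) / (1 - l * a n) = 1 - 1 / T n" for n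
    proof -
      have "1 / ((2 - l - a n) / (1 - l * a n) - 1) = - T n"
        using third_multiplier_identity[OF la l1 a1] sum[of n] by (simp add: add.commute)
      then have "(2 - l - a n) / (1 - l * a n) - 1 = 1 / (- T n)"
        using nz(2)[of n] by (metis div_by_1 divide_divide_eq_right mult_1)
      then show ?thesis by (simp add: algebra_simps)
    qed
    show c1: "cmod ((2 - l - a n) / (1 - l * a n)) < 1" for n
      unfolding c by (rule norm_one_minus_inverse[OF ST(2)])
    show "conj_class (fam l (a n)) \<in> disc_classes" for n
    proof (rule two_attracting_disc_classes)
      define r where "r = Fin ((1 - l) / (1 - a n))"
      note R = fam_third_exists[OF la[of n] l1 a1[of n]]
      show "fam l (a n) \<in> rational_maps 2" by (rule fam_rational[OF la])
      show "fam l (a n) Infty = Infty" by simp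
      show "fam l (a n) r = r" unfolding r_def by (rule R(1))
      show "Infty \<noteq> r" by (simp add: r_def)
      show "cmod (local_deriv (fam l (a n)) Infty) < 1" using fam_deriv(2)[OF la] an by simp
      show "cmod (local_deriv (fam l (a n)) r) < 1"
        using fam_third_fixed(3)[OF la R(1)] R(2) c1 by (simp add: r_def)
    qed
  qed
qed

lemma parabolic_in_closure:
  assumes "Re c > 1"
  shows "conj_class (fam 1 c) \<in> M2_topology closure_of disc_classes"
proof -
  obtain a where a: "a \<longlonglongrightarrow> 1" "\<And>n. c * a n \<noteq> 1" "\<And>n. conj_class (fam c (a n)) \<in> disc_classes"
    using parabolic_approximation[OF assms] by metis
  have c1: "c * 1 \<noteq> 1" using assms by auto
  have "cls (fam_coeffs c 1) \<in> M2_topology closure_of disc_classes"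
  proof (rule cls_closureI)
    show "fam_coeffs c 1 \<in> quad_coeff_set" by (rule fam_mem[OF c1])
    show "fam_coeffs c (a n) \<in> quad_coeff_set" for n by (rule fam_mem[OF a(2)])
    show "cls (fam_coeffs c (a n)) \<in> disc_classes" for n using a(3) by (simp add: cls_def fam_qmap)
    show "(\<lambda>n. fam_coeffs c (a n)) \<longlonglongrightarrow> fam_coeffs c 1"
      unfolding fam_coeffs_def by (intro tendsto_intros a)
  qed
  then show ?thesis using fam_swap_class[OF c1] by (simp add: cls_def fam_qmap)
qed

lemma fam_one_gmap:
  assumes "T \<noteq> 0"
  obtains \<phi> where "conjugates \<phi> (fam (1 - T\<^sup>2) 1) (gmap 1 T)"
proof -
  have e: "T\<^sup>2 = ((1 - T\<^sup>2) * 1 + 1 - 2)\<^sup>2 / (1 - (1 - T\<^sup>2) * 1)"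
    using assms by (simp add: power2_eq_square)
  have n: "(1 - T\<^sup>2) * 1 \<noteq> 1" using assms by simp
  obtain \<phi> where "conjugates \<phi> (fam (1 - T\<^sup>2) 1) (gmap 1 T)" "\<phi> Infty = Infty"
    using fam_conj_gmap[OF one_neq_zero n e] .
  then show ?thesis using that by simp
qed

lemma gmap_class:
  assumes "T \<noteq> 0"
  shows "conj_class (gmap 1 T) = conj_class (fam 1 (1 - T\<^sup>2))"
proof -
  have n: "(1 - T\<^sup>2) * 1 \<noteq> 1" using assms by simp
  obtain \<phi> where c: "conjugates \<phi> (fam (1 - T\<^sup>2) 1) (gmap 1 T)"
    using fam_one_gmap[OF assms] .
  from conj_class_eqI[OF c fam_rational[OF n]] fam_swap_class[OF n] show ?thesis by simp
qed

lemma B2_limit_1: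
  assumes c: "Re c \<ge> 1" "c \<noteq> 1"
  shows "conj_class (fam 1 c) \<in> M2_topology closure_of B2"
proof -
  define y where "y n = c + of_real (1 / real (Suc n))" for n
  have y: "Re (y n) > 1" for n
  proof -
    have "1 / real (Suc n) > 0" by simp
    then show ?thesis using c unfolding y_def by (simp only: plus_complex.sel Re_complex_of_real)
  qed
  have l: "y \<longlonglongrightarrow> c"
    using tendsto_add[OF tendsto_const tendsto_of_real[OF LIMSEQ_Suc[OF lim_1_over_n]], of c] by (simp add: y_def[abs_def])
  have "cls (fam_coeffs 1 c) \<in> M2_topology closure_of B2"
  proof (rule cls_closureI)
    show "fam_coeffs 1 c \<in> quad_coeff_set" using c by (intro fam_mem) simp
    show "fam_coeffs 1 (y n) \<in> quad_coeff_set" for n using y[of n] by (intro fam_mem) auto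
    show "cls (fam_coeffs 1 (y n)) \<in> B2" for n
      unfolding cls_def fam_qmap[symmetric] B2_def using y[of n] by blast
    show "(\<lambda>n. fam_coeffs 1 (y n)) \<longlonglongrightarrow> fam_coeffs 1 c"
      unfolding fam_coeffs_def by (intro tendsto_intros l)
  qed
  then show ?thesis by (simp add: cls_def fam_qmap)
qed

text \<open>At c = 1 the family \<open>fam 1 c\<close> degenerates, but z + 1/z + T stays quadratic
  at T = 0. T runs along the imaginary axis, where 1 - T^2 has real part above 1.\<close>

lemma B2_limit_2: "conj_class (gmap 1 0) \<in> M2_topology closure_of B2"
proof -
  define T where "T n = \<i> * of_real (1 / real (Suc n))" for n
  have T: "T n \<noteq> 0" for n
  proof -
    have "complex_of_real (1 / real (Suc n)) \<noteq> 0"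
      unfolding of_real_eq_0_iff by simp
    then show ?thesis by (simp add: T_def)
  qed
  have re: "Re (1 - (T n)\<^sup>2) > 1" for n
  proof -
    have "Re ((\<i> * complex_of_real x)\<^sup>2) = - (x\<^sup>2)" for x by (simp add: power2_eq_square)
    then have "Re ((T n)\<^sup>2) = - ((1 / real (Suc n))\<^sup>2)" unfolding T_def .
    moreover have "(1 / real (Suc n))\<^sup>2 > 0" by simp
    ultimately show ?thesis by simp
  qed
  have l: "T \<longlonglongrightarrow> 0"
    using tendsto_mult[OF tendsto_const tendsto_of_real[OF LIMSEQ_Suc[OF lim_1_over_n]], of \<i>] by (simp add: T_def[abs_def])
  have "cls (gcoeffs 1 0) \<in> M2_topology closure_of B2"
  proof (rule cls_closureI)
    show "gcoeffs 1 0 \<in> quad_coeff_set" by (rule gcoeffs_mem) simp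
    show "gcoeffs 1 (T n) \<in> quad_coeff_set" for n by (rule gcoeffs_mem) simp
    have "cls (gcoeffs 1 (T n)) = conj_class (fam 1 (1 - (T n)\<^sup>2))" for n
      using gmap_class[OF T] by (simp add: cls_def gmap_def)
    then show "cls (gcoeffs 1 (T n)) \<in> B2" for n unfolding B2_def using re[of n] by auto
    show "(\<lambda>n. gcoeffs 1 (T n)) \<longlonglongrightarrow> gcoeffs 1 0"
      unfolding gcoeffs_def by (intro tendsto_intros l)
  qed
  then show ?thesis by (simp add: cls_def gmap_def)
qed

section \<open>Limits of coefficient vectors with two attracting fixed points\<close>

lemma exists_non_fixed_point: 
  assumes X: "x \<in> quad_coeff_set"
  obtains s where "qmap x s \<noteq> s"
proof -
  obtain p0 p1 p2 q0 q1 q2 where e: "x = ((p0, p1, p2), (q0, q1, q2))" by (metis surj_pair)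
  note X' = X[unfolded e]
  have "\<exists>s. qmap x s \<noteq> s"
  proof (rule ccontr)
    assume "\<not> ?thesis"
    then have all: "qmap x s = s" for s by blast
    have "poly [:p0, p1 - q0, p2 - q1, - q2:] z = poly 0 z" for z
    proof -
      have r: "ratio (p0 + p1 * z + p2 * z\<^sup>2) (q0 + q1 * z + q2 * z\<^sup>2) = Fin z"
        using qmap_at_Fin(1)[OF X', of z] all[of "Fin z"] by (simp add: e)
      then have "q0 + q1 * z + q2 * z\<^sup>2 \<noteq> 0" by (auto simp: ratio_def split: if_splits)
      then have "p0 + p1 * z + p2 * z\<^sup>2 = z * (q0 + q1 * z + q2 * z\<^sup>2)"
        using r by (simp add: ratio_def field_simps)
      then show ?thesis by (simp add: algebra_simps power2_eq_square)
    qed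
    then have "[:p0, p1 - q0, p2 - q1, - q2:] = 0" by (intro poly_eq_poly_eq_iff[THEN iffD1]) auto
    then have z: "p0 = 0" "p1 = q0" "p2 = q1" "q2 = 0" by auto
    show False
    proof (cases "q1 = 0")
      case True
      then show ?thesis using qmap_at_Infty(3)[OF X'] z by simp
    next
      case False
      then show ?thesis using qmap_at_Fin(3)[OF X', of "- q0 / q1"] z
        by (simp add: power2_eq_square)
    qed
  qed
  then show ?thesis using that by blast
qed

text \<open>A point that is not fixed is moved to \<infinity>. Then all fixed points are finite, and
  they are the roots of a cubic whose leading coefficient survives small perturbations.\<close>

lemma class_representative:
  assumes f: "f \<in> rational_maps 2"
  obtains x where "x \<in> quad_coeff_set" "cls x = conj_class f" "snd (snd (snd x)) \<noteq> 0"
proof -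
  obtain y where y: "f = qmap y" "y \<in> quad_coeff_set" using f by (auto simp: rational_maps_2)
  obtain s where s: "qmap y s \<noteq> s" using exists_non_fixed_point[OF y(2)] .
  obtain s1 t1 where P: "(s1, t1) \<noteq> (0, 0)" "s = ratio s1 t1" using ratio_cases .
  obtain u v where uv: "u * (- s1) - v * t1 \<noteq> 0"
  proof (cases "t1 = 0")
    case True then show ?thesis using that[of 1 0] P by simp
  next
    case False then show ?thesis using that[of 0 1] by simp
  qed
  define x where "x = qconj u v t1 (- s1) y"
  have c: "conjugates (moeb u v t1 (- s1)) (qmap y) (qmap x)"
    unfolding x_def by (rule conjugates_qmap[OF uv y(2)])
  have X: "x \<in> quad_coeff_set" unfolding x_def by (rule qconj_mem[OF uv y(2)])
  have "moeb u v t1 (- s1) s = Infty" unfolding P(2) moeb_ratio[OF P(1)] by (simp add: ratio_def)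
  then have "qmap x Infty \<noteq> Infty"
    using conjugates_apply[OF c, of s] conjugates_inj[OF c] s by metis
  moreover obtain p0 p1 p2 q0 q1 q2 where e: "x = ((p0, p1, p2), (q0, q1, q2))" by (metis surj_pair)
  ultimately have "snd (snd (snd x)) \<noteq> 0" using qmap_at_Infty(1)[OF X[unfolded e]] by auto
  moreover have "cls x = conj_class f" unfolding x_def using cls_qconj[OF uv y(2)] y by (simp add: cls_def)
  ultimately show ?thesis using that X by blast
qed

lemma qmap_fixed_iff:
  assumes X: "((p0, p1, p2), (q0, q1, q2)) \<in> quad_coeff_set"
  shows "qmap ((p0, p1, p2), (q0, q1, q2)) (Fin z) = Fin z \<longleftrightarrow>
    p0 + p1 * z + p2 * z\<^sup>2 = z * (q0 + q1 * z + q2 * z\<^sup>2)"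
    (is "?f = _ \<longleftrightarrow> ?P = z * ?Q")
proof
  have f: "?f = ratio ?P ?Q" by (rule qmap_at_Fin(1)[OF X])
  {
    assume "?f = Fin z"
    then have r: "ratio ?P ?Q = Fin z" using f by simp
    then have "?Q \<noteq> 0" by (auto simp: ratio_def split: if_splits)
    then show "?P = z * ?Q" using r by (simp add: ratio_def divide_eq_eq)
  }
  assume e: "?P = z * ?Q"
  then have "?Q \<noteq> 0" using qmap_at_Fin(3)[OF X, of z] by auto
  then show "?f = Fin z" unfolding f e by (simp add: ratio_def)
qed

text \<open>At a fixed point P = z Q reduces the derivative to (P' - z Q')/Q, which is continuous in
  the coefficients and the fixed point together.\<close>

lemma qmap_fixed_deriv:
  assumes X: "((p0, p1, p2), (q0, q1, q2)) \<in> quad_coeff_set"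
    and fx: "qmap ((p0, p1, p2), (q0, q1, q2)) (Fin z) = Fin z"
  shows "q0 + q1 * z + q2 * z\<^sup>2 \<noteq> 0"
    and "local_deriv (qmap ((p0, p1, p2), (q0, q1, q2))) (Fin z) =
       ((p1 + 2 * p2 * z) - z * (q1 + 2 * q2 * z)) / (q0 + q1 * z + q2 * z\<^sup>2)"
proof -
  define Q where "Q = q0 + q1 * z + q2 * z\<^sup>2"
  have e: "p0 + p1 * z + p2 * z\<^sup>2 = z * Q" using fx qmap_fixed_iff[OF X] by (simp add: Q_def)
  then have Q: "Q \<noteq> 0" using qmap_at_Fin(3)[OF X, of z] by (auto simp: Q_def)
  then show "q0 + q1 * z + q2 * z\<^sup>2 \<noteq> 0" by (simp add: Q_def)
  have "local_deriv (qmap ((p0, p1, p2), (q0, q1, q2))) (Fin z) =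
      ((p1 + 2 * p2 * z) * Q - z * Q * (q1 + 2 * q2 * z)) / Q\<^sup>2"
    using qmap_at_Fin(2)[OF X, of z] Q e unfolding Q_def by simp
  also have "\<dots> = ((p1 + 2 * p2 * z) - z * (q1 + 2 * q2 * z)) / Q"
    using Q by (simp add: field_simps power2_eq_square)
  finally show "local_deriv (qmap ((p0, p1, p2), (q0, q1, q2))) (Fin z) =
       ((p1 + 2 * p2 * z) - z * (q1 + 2 * q2 * z)) / (q0 + q1 * z + q2 * z\<^sup>2)" by (simp add: Q_def)
qed

lemma third_fixed_point_multiplier:
  assumes f: "f \<in> rational_maps 2" and p: "f p = p" "f q = q" "f r = r" "p \<noteq> q" "r \<noteq> p" "r \<noteq> q"
  shows "local_deriv f r = (2 - local_deriv f p - local_deriv f q) / (1 - local_deriv f p * local_deriv f q)"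
proof -
  obtain a b \<phi> where n: "a * b \<noteq> 1" "conjugates \<phi> f (fam a b)" "\<phi> p = Fin 0" "\<phi> q = Infty"
    "a = local_deriv f p" "b = local_deriv f q"
    using two_fixed_points_normal_form[OF f p(1,2,4)] .
  have "fam a b (\<phi> r) = \<phi> r" using conjugates_apply[OF n(2), of r] p by simp
  moreover have "\<phi> r \<noteq> Fin 0" "\<phi> r \<noteq> Infty"
    using conjugates_inj[OF n(2)] n(3,4) p(5,6) by metis+
  ultimately have "local_deriv (fam a b) (\<phi> r) = (2 - a - b) / (1 - a * b)"
    by (rule fam_third_fixed(3)[OF n(1)])
  then show ?thesis using conjugates_multiplier_1[OF n(2) f p(3)] n(5,6) by simp
qed

text \<open>The cases by collision in the limit: the two attracting fixed points stay apart; they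
  merge and the third one stays apart; all three merge, which leaves the class of z + 1/z.\<close>

definition closure_alternatives :: "(riemann_sphere \<Rightarrow> riemann_sphere) set \<Rightarrow> bool" where
  "closure_alternatives C \<longleftrightarrow>
     (\<exists>a b. cmod a \<le> 1 \<and> cmod b \<le> 1 \<and> a * b \<noteq> 1 \<and> C = conj_class (fam a b)) \<or>
     (\<exists>c. Re c \<ge> 1 \<and> c \<noteq> 1 \<and> C = conj_class (fam 1 c)) \<or> C = conj_class (gmap 1 0)"

text \<open>If two attracting fixed points collide in the limit, the third fixed point is located by Vieta's
  formula and its multiplier has real part at least \<open>1\<close>.\<close>
lemma closure_alternatives_limit:
  fixes a0 a1 a2 b0 b1 b2 z w :: "nat \<Rightarrow> complex"
  assumes X: "((p0, p1, p2), (q0, q1, q2)) \<in> quad_coeff_set" and q2: "q2 \<noteq> 0"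
    and Xn: "\<And>n. ((a0 n, a1 n, a2 n), (b0 n, b1 n, b2 n)) \<in> quad_coeff_set" and b2: "\<And>n. b2 n \<noteq> 0"
    and l: "a0 \<longlonglongrightarrow> p0" "a1 \<longlonglongrightarrow> p1" "a2 \<longlonglongrightarrow> p2" "b0 \<longlonglongrightarrow> q0" "b1 \<longlonglongrightarrow> q1" "b2 \<longlonglongrightarrow> q2"
    and zw: "z \<longlonglongrightarrow> Z" "w \<longlonglongrightarrow> W" "\<And>n. z n \<noteq> w n"
    and fz: "\<And>n. qmap ((a0 n, a1 n, a2 n), (b0 n, b1 n, b2 n)) (Fin (z n)) = Fin (z n)"
    and fw: "\<And>n. qmap ((a0 n, a1 n, a2 n), (b0 n, b1 n, b2 n)) (Fin (w n)) = Fin (w n)"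
    and dz: "\<And>n. cmod (local_deriv (qmap ((a0 n, a1 n, a2 n), (b0 n, b1 n, b2 n))) (Fin (z n))) < 1"
    and dw: "\<And>n. cmod (local_deriv (qmap ((a0 n, a1 n, a2 n), (b0 n, b1 n, b2 n))) (Fin (w n))) < 1"
  shows "closure_alternatives (conj_class (qmap ((p0, p1, p2), (q0, q1, q2))))"
proof -
  define f where "f = qmap ((p0, p1, p2), (q0, q1, q2))"
  define g where "g n = qmap ((a0 n, a1 n, a2 n), (b0 n, b1 n, b2 n))" for n
  have fR: "f \<in> rational_maps 2" using X by (auto simp: rational_maps_2 f_def)
  have gR: "g n \<in> rational_maps 2" for n using Xn by (auto simp: rational_maps_2 g_def)
  have fixed_limit: "f (Fin U) = Fin U"
    if "u \<longlonglongrightarrow> U" "\<And>n. g n (Fin (u n)) = Fin (u n)" for u U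
  proof -
    have "(\<lambda>n. a0 n + a1 n * u n + a2 n * (u n)\<^sup>2) \<longlonglongrightarrow> p0 + p1 * U + p2 * U\<^sup>2"
      by (intro tendsto_intros l that)
    moreover have "(\<lambda>n. u n * (b0 n + b1 n * u n + b2 n * (u n)\<^sup>2)) \<longlonglongrightarrow> U * (q0 + q1 * U + q2 * U\<^sup>2)"
      by (intro tendsto_intros l that)
    moreover have "a0 n + a1 n * u n + a2 n * (u n)\<^sup>2 = u n * (b0 n + b1 n * u n + b2 n * (u n)\<^sup>2)" for n
      using that(2)[of n] qmap_fixed_iff[OF Xn] by (simp add: g_def)
    ultimately show ?thesis
      unfolding f_def qmap_fixed_iff[OF X] using LIMSEQ_unique by simp
  qed
  have deriv_limit: "(\<lambda>n. local_deriv (g n) (Fin (u n))) \<longlonglongrightarrow> local_deriv f (Fin U)"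
    if "u \<longlonglongrightarrow> U" "\<And>n. g n (Fin (u n)) = Fin (u n)" for u U
  proof -
    note fU = fixed_limit[OF that, unfolded f_def]
    show ?thesis
      unfolding f_def g_def qmap_fixed_deriv(2)[OF X fU] qmap_fixed_deriv(2)[OF Xn that(2)[unfolded g_def]]
      by (intro tendsto_intros l that qmap_fixed_deriv(1)[OF X fU])
  qed
  have fz': "g n (Fin (z n)) = Fin (z n)" and fw': "g n (Fin (w n)) = Fin (w n)" for n
    using fz fw by (simp_all add: g_def)
  note fZ = fixed_limit[OF zw(1) fz'] and fW = fixed_limit[OF zw(2) fw']
  have nZ: "cmod (local_deriv f (Fin Z)) \<le> 1"
    by (rule LIMSEQ_le_const2[OF tendsto_norm[OF deriv_limit[OF zw(1) fz']]])
       (use dz in \<open>auto simp: g_def intro!: less_imp_le\<close>)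
  have nW: "cmod (local_deriv f (Fin W)) \<le> 1"
    by (rule LIMSEQ_le_const2[OF tendsto_norm[OF deriv_limit[OF zw(2) fw']]])
       (use dw in \<open>auto simp: g_def intro!: less_imp_le\<close>)
  show ?thesis
  proof (cases "Z = W")
    case False
    obtain a b \<phi> where n: "a * b \<noteq> 1" "conjugates \<phi> f (fam a b)" "\<phi> (Fin Z) = Fin 0" "\<phi> (Fin W) = Infty"
      "a = local_deriv f (Fin Z)" "b = local_deriv f (Fin W)"
      using two_fixed_points_normal_form[OF fR fZ fW] False by blast
    have "conj_class f = conj_class (fam a b)" using conj_class_eqI[OF n(2) fR] .
    then show ?thesis unfolding closure_alternatives_def f_def[symmetric] using nZ nW n by blast
  next
    case True
    define e1 where "e1 n = a1 n - b0 n" for n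
    define e2 where "e2 n = a2 n - b1 n" for n
    have cub: "a0 n + e1 n * u + e2 n * u\<^sup>2 - b2 n * u ^ 3 = 0" if "g n (Fin u) = Fin u" for n u
      using that qmap_fixed_iff[OF Xn, of n u] unfolding g_def e1_def e2_def
      by (simp add: algebra_simps power2_eq_square power3_eq_cube)
    \<comment> \<open>Divided difference of the fixed point cubic at z and w. In the limit it
      becomes the derivative at Z, so Z is a double root.\<close>
    have dq: "e1 n + e2 n * (z n + w n) - b2 n * ((z n)\<^sup>2 + z n * w n + (w n)\<^sup>2) = 0" for n
    proof -
      have "(z n - w n) * (e1 n + e2 n * (z n + w n) - b2 n * ((z n)\<^sup>2 + z n * w n + (w n)\<^sup>2)) =
        (a0 n + e1 n * z n + e2 n * (z n)\<^sup>2 - b2 n * z n ^ 3) - (a0 n + e1 n * w n + e2 n * (w n)\<^sup>2 - b2 n * w n ^ 3)"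
        by (simp add: algebra_simps power2_eq_square power3_eq_cube)
      also have "\<dots> = 0" using cub[OF fz'] cub[OF fw'] by simp
      finally show ?thesis using zw(3)[of n] by simp
    qed
    have le: "e1 \<longlonglongrightarrow> p1 - q0" "e2 \<longlonglongrightarrow> p2 - q1"
      unfolding e1_def[abs_def] e2_def[abs_def] by (intro tendsto_intros l)+
    have "(\<lambda>n. e1 n + e2 n * (z n + w n) - b2 n * ((z n)\<^sup>2 + z n * w n + (w n)\<^sup>2)) \<longlonglongrightarrow>
       (p1 - q0) + (p2 - q1) * (Z + W) - q2 * (Z\<^sup>2 + Z * W + W\<^sup>2)"
      by (intro tendsto_intros l le zw)
    then have dq0: "(p1 - q0) + (p2 - q1) * (2 * Z) - q2 * (3 * Z\<^sup>2) = 0"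
      unfolding dq True[symmetric] using LIMSEQ_unique[OF _ tendsto_const]
      by (fastforce simp: power2_eq_square algebra_simps)
    define r where "r n = e2 n / b2 n - z n - w n" for n
    define R where "R = (p2 - q1) / q2 - 2 * Z"
    have rl: "r \<longlonglongrightarrow> R"
    proof -
      have "r \<longlonglongrightarrow> (p2 - q1) / q2 - Z - W"
        unfolding r_def[abs_def] by (intro tendsto_intros l le zw q2)
      then show ?thesis by (simp add: R_def True)
    qed
    have fr: "g n (Fin (r n)) = Fin (r n)" for n
    proof -
      have e2: "e2 n = b2 n * (z n + w n + r n)" using b2[of n] by (simp add: r_def field_simps)
      have e1: "e1 n = b2 n * ((z n)\<^sup>2 + z n * w n + (w n)\<^sup>2) - e2 n * (z n + w n)" using dq[of n] by (simp add: algebra_simps)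
      have e0: "a0 n = b2 n * z n ^ 3 - e1 n * z n - e2 n * (z n)\<^sup>2" using cub[OF fz', of n] by (simp add: algebra_simps)
      have "a0 n + e1 n * r n + e2 n * (r n)\<^sup>2 - b2 n * r n ^ 3 = 0"
        unfolding e0 e1 e2 by (simp add: algebra_simps power2_eq_square power3_eq_cube)
      then show ?thesis
        unfolding g_def qmap_fixed_iff[OF Xn] e1_def e2_def
        by (simp add: algebra_simps power2_eq_square power3_eq_cube)
    qed
    note fR' = fixed_limit[OF rl fr]
    have cub0: "p0 + (p1 - q0) * Z + (p2 - q1) * Z\<^sup>2 - q2 * Z ^ 3 = 0"
      using fZ unfolding f_def qmap_fixed_iff[OF X]
      by (simp add: algebra_simps power2_eq_square power3_eq_cube)
    have e2': "p2 - q1 = q2 * (2 * Z + R)" using q2 by (simp add: R_def field_simps)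
    have fact: "p0 + (p1 - q0) * u + (p2 - q1) * u\<^sup>2 - q2 * u ^ 3 = - q2 * (u - Z)\<^sup>2 * (u - R)" for u
    proof -
      have e1': "p1 - q0 = q2 * (3 * Z\<^sup>2) - (p2 - q1) * (2 * Z)" using dq0 by (simp add: algebra_simps)
      have e0': "p0 = q2 * Z ^ 3 - (p1 - q0) * Z - (p2 - q1) * Z\<^sup>2" using cub0 by (simp add: algebra_simps)
      show ?thesis unfolding e0' e1' e2' by (simp add: algebra_simps power2_eq_square power3_eq_cube)
    qed
    have fixed_iff: "f (Fin u) = Fin u \<longleftrightarrow> u = Z \<or> u = R" for u
    proof -
      have "f (Fin u) = Fin u \<longleftrightarrow> p0 + (p1 - q0) * u + (p2 - q1) * u\<^sup>2 - q2 * u ^ 3 = 0"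
        unfolding f_def qmap_fixed_iff[OF X] by (simp add: algebra_simps power2_eq_square power3_eq_cube)
      then show ?thesis unfolding fact using q2 by simp
    qed
    have inf: "f Infty \<noteq> Infty" unfolding f_def qmap_at_Infty(1)[OF X] using q2 by (simp add: ratio_def)
    show ?thesis
    proof (cases "R = Z")
      case True
      have "q = Fin Z" if "f q = q" for q
        using that inf fixed_iff True by (cases q) auto
      from single_fixed_point_normal_form[OF fR fZ this] show ?thesis
        unfolding closure_alternatives_def f_def[symmetric] by simp
    next
      case RZ: False
      obtain a c \<phi> where n: "a * c \<noteq> 1" "conjugates \<phi> f (fam a c)" "\<phi> (Fin Z) = Fin 0" "\<phi> (Fin R) = Infty"
        "a = local_deriv f (Fin Z)" "c = local_deriv f (Fin R)"
        using two_fixed_points_normal_form[OF fR fZ fR'] RZ by blast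
      \<comment> \<open>The vanishing of the derivative of P - z Q at Z says that the multiplier
        there is 1.\<close>
      have "(p1 + 2 * p2 * Z) - Z * (q1 + 2 * q2 * Z) = q0 + q1 * Z + q2 * Z\<^sup>2"
        using dq0 by (simp add: algebra_simps power2_eq_square)
      then have a1: "a = 1"
        unfolding n(5) f_def qmap_fixed_deriv(2)[OF X fZ[unfolded f_def]]
        using qmap_fixed_deriv(1)[OF X fZ[unfolded f_def]] by simp
      have ev: "eventually (\<lambda>n. Re (local_deriv (g n) (Fin (r n))) \<ge> 1) sequentially"
      proof -
        have t: "(\<lambda>n. r n - z n) \<longlonglongrightarrow> R - Z" "(\<lambda>n. r n - w n) \<longlonglongrightarrow> R - W"
          by (intro tendsto_intros rl zw)+
        have nz: "R - Z \<noteq> 0" "R - W \<noteq> 0" using RZ True by auto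
        show ?thesis
          using tendsto_imp_eventually_ne[OF t(1) nz(1)] tendsto_imp_eventually_ne[OF t(2) nz(2)]
        proof eventually_elim
          case (elim n)
          then have "local_deriv (g n) (Fin (r n)) =
             (2 - local_deriv (g n) (Fin (z n)) - local_deriv (g n) (Fin (w n))) /
             (1 - local_deriv (g n) (Fin (z n)) * local_deriv (g n) (Fin (w n)))"
            using zw(3)[of n] by (intro third_fixed_point_multiplier[OF gR fz' fw' fr]) auto
          then show ?case using third_multiplier_re[OF dz[of n] dw[of n]] by (simp add: g_def)
        qed
      qed
      have "Re c \<ge> 1"
        unfolding n(6)
        using tendsto_lowerbound[OF tendsto_Re[OF deriv_limit[OF rl fr]] ev] by simp
      moreover have "c \<noteq> 1" using n(1) a1 by simp
      moreover have "conj_class f = conj_class (fam 1 c)" using conj_class_eqI[OF n(2) fR] a1 by simp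
      ultimately show ?thesis unfolding closure_alternatives_def f_def[symmetric] by blast
    qed
  qed
qed

lemma disc_classes_fixed_points:
  assumes X: "x \<in> quad_coeff_set" and H: "cls x \<in> disc_classes"
  obtains p q where "qmap x p = p" "qmap x q = q" "p \<noteq> q"
    "cmod (local_deriv (qmap x) p) < 1" "cmod (local_deriv (qmap x) q) < 1"
proof -
  obtain a b where ab: "conj_class (fam a b) = conj_class (qmap x)" "cmod a < 1" "cmod b < 1"
    using H by (auto simp: disc_classes_def cls_def)
  have n: "a * b \<noteq> 1" using norm_mult_lt_1[OF ab(2,3)] .
  obtain \<phi> where c: "conjugates \<phi> (fam a b) (qmap x)" using conj_class_eqD[OF ab(1) fam_rational[OF n]] .
  show ?thesis
  proof
    show "qmap x (\<phi> (Fin 0)) = \<phi> (Fin 0)" "qmap x (\<phi> Infty) = \<phi> Infty"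
      using conjugates_apply[OF c, of "Fin 0"] conjugates_apply[OF c, of Infty] by simp_all
    show "\<phi> (Fin 0) \<noteq> \<phi> Infty" using conjugates_inj[OF c] by simp
    show "cmod (local_deriv (qmap x) (\<phi> (Fin 0))) < 1" "cmod (local_deriv (qmap x) (\<phi> Infty)) < 1"
      using conjugates_multiplier_1[OF c fam_rational[OF n]] fam_deriv[OF n] ab by simp_all
  qed
qed

lemma cubic_root_bound:
  fixes z :: complex
  assumes "c3 \<noteq> 0" "c3 * z ^ 3 = c0 + c1 * z + c2 * z\<^sup>2"
  shows "cmod z \<le> 1 + (cmod c0 + cmod c1 + cmod c2) / cmod c3"
proof (cases "cmod z \<le> 1")
  case True
  have "0 \<le> (cmod c0 + cmod c1 + cmod c2) / cmod c3" by simp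
  then show ?thesis using True by linarith
next
  case False
  define m where "m = cmod z"
  have m: "m > 1" using False by (simp add: m_def)
  have m2: "1 \<le> m\<^sup>2" "m \<le> m\<^sup>2"
    using m one_le_power[of m 2] by (simp, simp add: power2_eq_square)
  have "cmod c3 * m ^ 3 = cmod (c0 + c1 * z + c2 * z\<^sup>2)"
    unfolding assms(2)[symmetric] by (simp add: norm_mult norm_power m_def)
  also have "\<dots> \<le> cmod c0 + cmod c1 * m + cmod c2 * m\<^sup>2"
    using norm_triangle_ineq[of "c0 + c1 * z" "c2 * z\<^sup>2"] norm_triangle_ineq[of c0 "c1 * z"]
    by (simp add: norm_mult norm_power m_def)
  also have "\<dots> \<le> cmod c0 * m\<^sup>2 + cmod c1 * m\<^sup>2 + cmod c2 * m\<^sup>2"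
    using m2 mult_left_mono[OF m2(1), of "cmod c0"] mult_left_mono[OF m2(2), of "cmod c1"] by simp
  finally have "m\<^sup>2 * (cmod c3 * m) \<le> m\<^sup>2 * (cmod c0 + cmod c1 + cmod c2)"
    by (simp add: algebra_simps power2_eq_square power3_eq_cube)
  moreover have "m\<^sup>2 > 0" using m by simp
  ultimately have "cmod c3 * m \<le> cmod c0 + cmod c1 + cmod c2" by simp
  then have "m \<le> (cmod c0 + cmod c1 + cmod c2) / cmod c3" using assms(1) by (simp add: field_simps)
  then show ?thesis by (simp add: m_def)
qed

text \<open>Openness of \<open>cls\<close> lifts the approximating classes to vectors near
  \<open>x\<close>; the root bound for the cubic then gives convergent subsequences of the
  attracting fixed points.\<close>

lemma closure_disc_classes_cases:
  assumes C: "C \<in> M2_topology closure_of disc_classes"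
  shows "closure_alternatives C"
proof -
  obtain x0 where "C = cls x0" "x0 \<in> quad_coeff_set"
    using C unfolding in_closure_of topspace_M2 by blast
  then have "C = conj_class (qmap x0)" "qmap x0 \<in> rational_maps 2" by (auto simp: cls_def rational_maps_2)
  then obtain x where x: "x \<in> quad_coeff_set" "cls x = C" "snd (snd (snd x)) \<noteq> 0"
    using class_representative by metis
  obtain p0 p1 p2 q0 q1 q2 where e: "x = ((p0, p1, p2), (q0, q1, q2))" by (metis surj_pair)
  have X: "((p0, p1, p2), (q0, q1, q2)) \<in> quad_coeff_set" and q2: "q2 \<noteq> 0" using x by (auto simp: e)
  \<comment> \<open>The radius |q2| keeps the leading coefficient \<open>b2 n\<close> of the cubic
    nonzero.\<close>
  have "\<exists>y. y \<in> quad_coeff_set \<and> dist y x < min (1 / Suc n) (cmod q2) \<and> cls y \<in> disc_classes" for n :: nat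
  proof -
    define d where "d = min (1 / real (Suc n)) (cmod q2)"
    have d: "d > 0" using q2 by (simp add: d_def)
    have "openin (top_of_set quad_coeff_set) (quad_coeff_set \<inter> ball x d)" by (rule openin_open_Int) simp
    then have "openin M2_topology (cls ` (quad_coeff_set \<inter> ball x d))" by (rule cls_open_map)
    moreover have "C \<in> cls ` (quad_coeff_set \<inter> ball x d)" using x d by force
    ultimately have "\<exists>D. D \<in> disc_classes \<and> D \<in> cls ` (quad_coeff_set \<inter> ball x d)"
      using C[unfolded in_closure_of, THEN conjunct2, rule_format] by (metis (lifting))
    then obtain D where "D \<in> disc_classes" "D \<in> cls ` (quad_coeff_set \<inter> ball x d)" by (elim exE conjE)
    then obtain y where y: "y \<in> quad_coeff_set" "dist x y < d" "cls y \<in> disc_classes"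
      by (elim imageE IntE) (simp add: mem_ball)
    have "dist y x < d" using y(2) by (simp only: dist_commute)
    with y show ?thesis unfolding d_def by blast
  qed
  then obtain y where y: "\<And>n. y n \<in> quad_coeff_set" "\<And>n. dist (y n) x < min (1 / Suc n) (cmod q2)" "\<And>n. cls (y n) \<in> disc_classes"
    by metis
  have yl: "y \<longlonglongrightarrow> x"
  proof (rule metric_LIMSEQ_I)
    fix d :: real assume "d > 0"
    then obtain N where N: "1 / real (Suc N) < d" using nat_approx_posE by blast
    show "\<exists>N. \<forall>n\<ge>N. dist (y n) x < d"
    proof (intro exI allI impI)
      fix n assume "N \<le> n"
      then have "1 / real (Suc n) \<le> 1 / real (Suc N)" by (simp add: frac_le)
      then show "dist (y n) x < d" using y(2)[of n] N by simp
    qed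
  qed
  define a0 where "a0 n = fst (fst (y n))" for n
  define a1 where "a1 n = fst (snd (fst (y n)))" for n
  define a2 where "a2 n = snd (snd (fst (y n)))" for n
  define b0 where "b0 n = fst (snd (y n))" for n
  define b1 where "b1 n = fst (snd (snd (y n)))" for n
  define b2 where "b2 n = snd (snd (snd (y n)))" for n
  note defs = a0_def a1_def a2_def b0_def b1_def b2_def
  have ye: "y n = ((a0 n, a1 n, a2 n), (b0 n, b1 n, b2 n))" for n by (simp add: defs)
  have l: "a0 \<longlonglongrightarrow> p0" "a1 \<longlonglongrightarrow> p1" "a2 \<longlonglongrightarrow> p2" "b0 \<longlonglongrightarrow> q0" "b1 \<longlonglongrightarrow> q1" "b2 \<longlonglongrightarrow> q2"
    using tendsto_fst[OF tendsto_fst[OF yl]] tendsto_fst[OF tendsto_snd[OF tendsto_fst[OF yl]]]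
      tendsto_snd[OF tendsto_snd[OF tendsto_fst[OF yl]]] tendsto_fst[OF tendsto_snd[OF yl]]
      tendsto_fst[OF tendsto_snd[OF tendsto_snd[OF yl]]] tendsto_snd[OF tendsto_snd[OF tendsto_snd[OF yl]]]
    unfolding defs e by simp_all
  have b2: "b2 n \<noteq> 0" for n
  proof
    assume h: "b2 n = 0"
    have "dist (b2 n) q2 \<le> dist (snd (snd (y n))) (snd (snd x))"
      unfolding b2_def e using dist_snd_le[of "snd (snd (y n))" "snd (snd x)"] by (simp add: e)
    also have "\<dots> \<le> dist (snd (y n)) (snd x)" by (rule dist_snd_le)
    also have "\<dots> \<le> dist (y n) x" by (rule dist_snd_le)
    finally show False using y(2)[of n] h by (simp add: dist_norm)
  qed
  have "\<exists>z w. z \<noteq> w \<and> qmap (y n) (Fin z) = Fin z \<and> qmap (y n) (Fin w) = Fin w \<and>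
      cmod (local_deriv (qmap (y n)) (Fin z)) < 1 \<and> cmod (local_deriv (qmap (y n)) (Fin w)) < 1" for n
  proof -
    obtain p q where pq: "qmap (y n) p = p" "qmap (y n) q = q" "p \<noteq> q"
      "cmod (local_deriv (qmap (y n)) p) < 1" "cmod (local_deriv (qmap (y n)) q) < 1"
      using disc_classes_fixed_points[OF y(1) y(3)] .
    have "qmap (y n) Infty \<noteq> Infty"
      using qmap_at_Infty(1)[OF y(1)[of n, unfolded ye]] b2[of n] by (simp add: ye ratio_def)
    then have "p \<noteq> Infty" "q \<noteq> Infty" using pq by auto
    then show ?thesis using pq by (cases p; cases q) auto
  qed
  then obtain z w where zw: "\<And>n. z n \<noteq> w n" "\<And>n. qmap (y n) (Fin (z n)) = Fin (z n)"
     "\<And>n. qmap (y n) (Fin (w n)) = Fin (w n)"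
     "\<And>n. cmod (local_deriv (qmap (y n)) (Fin (z n))) < 1" "\<And>n. cmod (local_deriv (qmap (y n)) (Fin (w n))) < 1"
    by metis
  define bd where "bd n = 1 + (cmod (a0 n) + cmod (a1 n - b0 n) + cmod (a2 n - b1 n)) / cmod (b2 n)" for n
  have "bd \<longlonglongrightarrow> 1 + (cmod p0 + cmod (p1 - q0) + cmod (p2 - q1)) / cmod q2"
    unfolding bd_def[abs_def] using q2 by (intro tendsto_intros l) simp
  then have "bounded (range bd)" by (rule convergent_imp_bounded)
  then obtain B where B: "\<And>n. bd n \<le> B" unfolding bounded_iff by (metis abs_le_D1 rangeI real_norm_def)
  have root: "cmod u \<le> B" if "qmap (y n) (Fin u) = Fin u" for n u
  proof -
    have "b2 n * u ^ 3 = a0 n + (a1 n - b0 n) * u + (a2 n - b1 n) * u\<^sup>2"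
      using that qmap_fixed_iff[OF y(1)[of n, unfolded ye], of u] unfolding ye
      by (simp add: algebra_simps power2_eq_square power3_eq_cube)
    from cubic_root_bound[OF b2 this] show ?thesis using B[of n] by (simp add: bd_def)
  qed
  have K: "compact (cball (0::complex) B \<times> cball (0::complex) B)" by (intro compact_Times) auto
  have "\<forall>n. (z n, w n) \<in> cball 0 B \<times> cball 0 B" using root zw(2,3) by auto
  from compact_def[THEN iffD1, OF K, THEN spec, of "\<lambda>n. (z n, w n)", THEN mp, OF this]
  obtain L r where r: "strict_mono r" "((\<lambda>n. (z n, w n)) \<circ> r) \<longlonglongrightarrow> L"
    by (elim bexE exE conjE)
  have zl: "(\<lambda>n. z (r n)) \<longlonglongrightarrow> fst L" "(\<lambda>n. w (r n)) \<longlonglongrightarrow> snd L"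
    using tendsto_fst[OF r(2)] tendsto_snd[OF r(2)] by (simp_all add: comp_def)
  have lr: "(\<lambda>n. a0 (r n)) \<longlonglongrightarrow> p0" "(\<lambda>n. a1 (r n)) \<longlonglongrightarrow> p1" "(\<lambda>n. a2 (r n)) \<longlonglongrightarrow> p2"
    "(\<lambda>n. b0 (r n)) \<longlonglongrightarrow> q0" "(\<lambda>n. b1 (r n)) \<longlonglongrightarrow> q1" "(\<lambda>n. b2 (r n)) \<longlonglongrightarrow> q2"
    using l[THEN LIMSEQ_subseq_LIMSEQ, OF r(1)] by (simp_all add: comp_def)
  have "closure_alternatives (conj_class (qmap ((p0, p1, p2), (q0, q1, q2))))"
    by (rule closure_alternatives_limit[OF X q2 _ b2 lr zl])
       (use y(1) zw in \<open>simp_all add: ye\<close>)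
  then show ?thesis using x(2) by (simp add: cls_def e)
qed

section \<open>Critical orbits in the central component\<close>

definition fam_fun :: "complex \<Rightarrow> complex \<Rightarrow> complex \<Rightarrow> complex" where
  "fam_fun a b z = (a * z + z\<^sup>2) / (1 + b * z)"

lemma fam_F: "1 + b * z \<noteq> 0 \<Longrightarrow> fam a b (Fin z) = Fin (fam_fun a b z)"
  by (simp add: fam_Fin ratio_def fam_fun_def)

text \<open>The condition at the pole matters: division by 0 would give \<open>fam_fun\<close> the
  value 0 there, inside the disc, while the map sends the pole to the fixed point
  \<infinity>.\<close>

primrec preim :: "complex \<Rightarrow> complex \<Rightarrow> real \<Rightarrow> nat \<Rightarrow> complex set" where
  "preim a b r 0 = ball 0 r"
| "preim a b r (Suc n) = {z. 1 + b * z \<noteq> 0 \<and> fam_fun a b z \<in> preim a b r n}"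

lemma preim_tendsto_0:
  assumes k: "0 \<le> k" "k < 1" and c: "\<And>z. cmod z < r \<Longrightarrow> 1 + b * z \<noteq> 0 \<and> cmod (fam_fun a b z) \<le> k * cmod z"
    and z: "z \<in> preim a b r n"
  shows "(\<lambda>j. (fam a b ^^ j) (Fin z)) \<longlonglongrightarrow> Fin 0"
  using z
proof (induction n arbitrary: z)
  case 0
  then have z: "cmod z < r" by simp
  define w where "w j = (fam_fun a b ^^ j) z" for j
  have w: "cmod (w j) \<le> k ^ j * cmod z \<and> cmod (w j) < r \<and> (fam a b ^^ j) (Fin z) = Fin (w j)" for j
  proof (induction j)
    case 0
    then show ?case using z by (simp add: w_def)
  next
    case (Suc j)
    then have h: "1 + b * w j \<noteq> 0" "cmod (fam_fun a b (w j)) \<le> k * cmod (w j)" using c by auto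
    have "k * cmod (w j) \<le> k * (k ^ j * cmod z)" using Suc k by (intro mult_left_mono) auto
    moreover have "k * cmod (w j) \<le> 1 * cmod (w j)" using k by (intro mult_right_mono) auto
    ultimately show ?case using Suc h fam_F[OF h(1)] by (simp add: w_def)
  qed
  have "(\<lambda>j. k ^ j * cmod z) \<longlonglongrightarrow> 0"
    using tendsto_mult[OF LIMSEQ_realpow_zero[OF k] tendsto_const, of "cmod z"] by simp
  then have "w \<longlonglongrightarrow> 0" by (rule Lim_null_comparison[rotated]) (use w in auto)
  then show ?case using tendsto_Fin[of w 0] w by simp
next
  case (Suc n)
  then have h: "1 + b * z \<noteq> 0" "fam_fun a b z \<in> preim a b r n" by auto
  have "(\<lambda>j. (fam a b ^^ j) (Fin (fam_fun a b z))) \<longlonglongrightarrow> Fin 0" by (rule Suc.IH[OF h(2)])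
  then have "(\<lambda>j. (fam a b ^^ Suc j) (Fin z)) \<longlonglongrightarrow> Fin 0"
    unfolding funpow_Suc_right comp_apply fam_F[OF h(1)] .
  then show ?case by (rule LIMSEQ_imp_Suc)
qed

text \<open>Clearing the denominator adds no solution: a root at the pole would also equal -a, hence
  a b = 1.\<close>

lemma fam_quadratic_root:
  assumes ab: "a * b \<noteq> (1::complex)" and e: "z\<^sup>2 + (a - b * u) * z = u"
  shows "1 + b * z \<noteq> 0" "fam_fun a b z = u"
proof -
  have e': "a * z + z\<^sup>2 = u * (1 + b * z)" using e by (simp add: algebra_simps)
  show nz: "1 + b * z \<noteq> 0"
  proof
    assume h: "1 + b * z = 0"
    then have "z * (a + z) = 0" using e' by (simp add: algebra_simps power2_eq_square)
    moreover have "z \<noteq> 0" using h by auto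
    ultimately have "z = - a" by (simp add: add_eq_0_iff)
    then show False using h ab by (simp add: mult.commute)
  qed
  show "fam_fun a b z = u" unfolding fam_fun_def e' using nz by simp
qed

text \<open>If no critical point is attracted to \<open>0\<close>, then the branches of \<open>f\<^sup>-\<^sup>n\<close> fixing \<open>0\<close>, precomposed with
  multiplication by \<open>a\<^sup>n\<close>, extend to discs of radius \<open>r / |a|\<^sup>n\<close> and have derivative \<open>1\<close> at \<open>0\<close>.\<close>
lemma inverse_branches:
  assumes ab: "a * b \<noteq> 1" and a0: "a \<noteq> 0" and r: "0 < r"
    and nocrit: "\<forall>n. \<forall>z\<in>preim a b r n. a + 2 * z + b * z\<^sup>2 \<noteq> 0"
  shows "\<exists>\<psi>. \<psi> holomorphic_on ball 0 (r / cmod a ^ n) \<and> (\<forall>w\<in>ball 0 (r / cmod a ^ n). \<psi> w \<in> preim a b r n) \<and>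
     \<psi> 0 = 0 \<and> (\<psi> has_field_derivative 1) (at 0)"
proof (induction n)
  case 0
  show ?case by (rule exI[of _ "\<lambda>w. w"]) (auto intro!: holomorphic_intros derivative_eq_intros)
next
  case (Suc n)
  define s where "s = r / cmod a ^ n"
  define S where "S = ball (0::complex) (r / cmod a ^ Suc n)"
  obtain \<psi> where \<psi>: "\<psi> holomorphic_on ball 0 s" "\<And>w. w \<in> ball 0 s \<Longrightarrow> \<psi> w \<in> preim a b r n" "\<psi> 0 = 0"
     "(\<psi> has_field_derivative 1) (at 0)" using Suc unfolding s_def by blast
  define u where "u w = \<psi> (a * w)" for w
  have aS: "a * w \<in> ball 0 s" if "w \<in> S" for w
    using that a0 by (simp add: S_def s_def norm_mult field_simps)
  have hu: "u holomorphic_on S"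
    unfolding u_def[abs_def]
    by (rule holomorphic_on_compose_gen[of "\<lambda>w. a * w" S \<psi> "ball 0 s", unfolded comp_def])
       (use aS \<psi>(1) in \<open>auto intro!: holomorphic_intros\<close>)
  have u0: "u 0 = 0" by (simp add: u_def \<psi>)
  have du: "(u has_field_derivative a) (at 0)"
  proof -
    have "((\<lambda>w. a * w) has_field_derivative a) (at 0)" by (auto intro!: derivative_eq_intros)
    from DERIV_chain2[OF _ this, of \<psi> 1] show ?thesis using \<psi>(4) by (simp add: u_def[abs_def])
  qed
  have uA: "u w \<in> preim a b r n" if "w \<in> S" for w using \<psi>(2)[OF aS[OF that]] by (simp add: u_def)
  \<comment> \<open>Discriminant of the equation for the preimages of u(w). At a zero the two
    preimages coincide in a critical point, which \<open>nocrit\<close> forbids; so a holomorphic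
    square root exists on the disc.\<close>
  define \<Delta> where "\<Delta> w = (a - b * u w)\<^sup>2 + 4 * u w" for w
  have nz: "\<Delta> w \<noteq> 0" if "w \<in> S" for w
  proof
    assume "\<Delta> w = 0"
    define z where "z = - (a - b * u w) / 2"
    have d: "a - b * u w = - 2 * z" by (simp add: z_def)
    have "4 * u w = - ((a - b * u w)\<^sup>2)" using \<open>\<Delta> w = 0\<close> by (simp add: \<Delta>_def add_eq_0_iff)
    then have uz: "u w = - z\<^sup>2" unfolding d by (simp add: power2_eq_square)
    then have "z\<^sup>2 + (a - b * u w) * z = u w" unfolding d by (simp add: power2_eq_square)
    from fam_quadratic_root[OF ab this] uA[OF that] have "z \<in> preim a b r (Suc n)" by simp
    moreover have "a + 2 * z + b * z\<^sup>2 = 0"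
    proof -
      have "a + 2 * z + b * z\<^sup>2 = (a - b * u w) + 2 * z" unfolding uz by simp
      then show ?thesis unfolding d by simp
    qed
    ultimately show False using nocrit by blast
  qed
  have S0: "0 \<in> S" using r a0 by (simp add: S_def)
  have openS: "open S" by (simp add: S_def)
  have scS: "simply_connected S" unfolding S_def by (intro convex_imp_simply_connected) simp
  have "\<Delta> holomorphic_on S" unfolding \<Delta>_def[abs_def] by (intro holomorphic_intros hu)
  then obtain h0 where h0: "h0 holomorphic_on S" "\<And>w. w \<in> S \<Longrightarrow> \<Delta> w = (h0 w)\<^sup>2"
    using scS nz unfolding simply_connected_eq_holomorphic_sqrt[OF openS] by blast
  have "(h0 0)\<^sup>2 = a\<^sup>2" using h0(2)[OF S0] by (simp add: \<Delta>_def u0)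
  then have "h0 0 = a \<or> h0 0 = - a" by (simp add: power2_eq_iff)
  \<comment> \<open>The root with value a at 0 selects the branch that fixes 0.\<close>
  then obtain h where h: "h holomorphic_on S" "\<And>w. w \<in> S \<Longrightarrow> \<Delta> w = (h w)\<^sup>2" "h 0 = a"
  proof
    assume "h0 0 = a" then show ?thesis using that h0 by blast
  next
    assume "h0 0 = - a"
    then show ?thesis using that[of "\<lambda>w. - h0 w"] h0 by (auto intro: holomorphic_intros)
  qed
  define \<eta> where "\<eta> w = (h w - (a - b * u w)) / 2" for w
  have h\<eta>: "\<eta> holomorphic_on S" unfolding \<eta>_def[abs_def] by (intro holomorphic_intros h hu) simp
  have q: "(\<eta> w)\<^sup>2 + (a - b * u w) * \<eta> w = u w" if "w \<in> S" for w
  proof -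
    have hh: "h w = 2 * \<eta> w + (a - b * u w)" by (simp add: \<eta>_def field_simps)
    have "4 * ((\<eta> w)\<^sup>2 + (a - b * u w) * \<eta> w) = (h w)\<^sup>2 - (a - b * u w)\<^sup>2"
      unfolding hh by (simp add: power2_eq_square algebra_simps)
    also have "\<dots> = 4 * u w" unfolding h(2)[OF that, symmetric] \<Delta>_def by simp
    finally have "4 * ((\<eta> w)\<^sup>2 + (a - b * u w) * \<eta> w) = 4 * u w" .
    then show ?thesis by (metis mult_left_cancel zero_neq_numeral)
  qed
  have \<eta>0: "\<eta> 0 = 0" by (simp add: \<eta>_def h u0)
  obtain D where D: "(\<eta> has_field_derivative D) (at 0)"
    using holomorphic_on_imp_differentiable_at[OF h\<eta> openS S0] by (auto simp: field_differentiable_def)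
  \<comment> \<open>Differentiating the quadratic identity at 0 yields a D = a without
    differentiating the square root.\<close>
  have "((\<lambda>w. (\<eta> w)\<^sup>2 + (a - b * u w) * \<eta> w - u w) has_field_derivative a * D - a) (at 0)"
    by (rule derivative_eq_intros D du refl | simp add: \<eta>0 u0)+
  moreover have "((\<lambda>w. (\<eta> w)\<^sup>2 + (a - b * u w) * \<eta> w - u w) has_field_derivative 0) (at 0)"
    by (rule has_field_derivative_transform_within_open[OF DERIV_const[of 0] openS S0]) (simp add: q)
  ultimately have "a * D - a = 0" by (rule DERIV_unique)
  then have "D = 1" using a0 by (simp add: right_diff_distrib[symmetric, of a D 1, simplified])
  show ?case
  proof (intro exI conjI ballI)
    show "\<eta> holomorphic_on ball 0 (r / cmod a ^ Suc n)" using h\<eta> by (simp add: S_def)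
    show "\<eta> 0 = 0" by (rule \<eta>0)
    show "(\<eta> has_field_derivative 1) (at 0)" using D \<open>D = 1\<close> by simp
    fix w :: complex assume "w \<in> ball 0 (r / cmod a ^ Suc n)"
    then have w: "w \<in> S" by (simp add: S_def)
    from fam_quadratic_root[OF ab q[OF w]] uA[OF w] show "\<eta> w \<in> preim a b r (Suc n)" by simp
  qed
qed

text \<open>Otherwise all branches of \<open>inverse_branches\<close> exist. Their values stay in a
  disc of radius R, because \<infinity> is attracting too, while their domains grow like 1/|a|^n;
  Cauchy's estimate contradicts the derivative 1 at 0.\<close>

lemma fam_critical_to_zero:
  assumes na: "cmod a < 1" and nb: "cmod b < 1"
  obtains c where "critical_point (fam a b) c" "(\<lambda>k. (fam a b ^^ k) c) \<longlonglongrightarrow> Fin 0"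
proof -
  have ab: "a * b \<noteq> 1" by (rule norm_mult_lt_1[OF assms])
  show ?thesis
  proof (cases "a = 0")
    case True
    have "(fam a b ^^ k) (Fin 0) = Fin 0" for k by (induction k) auto
    then show ?thesis using that[of "Fin 0"] fam_critical[OF ab, of 0] True by simp
  next
    case a0: False
    \<comment> \<open>Any r > 0 with 2 r < 1 - |a| makes the contraction factor (|a| + r)/(1 - r)
      less than 1.\<close>
    define r where "r = (1 - cmod a) / 4"
    have "4 * r = 1 - cmod a" by (simp add: r_def)
    then have r: "0 < r" "r \<le> 1 / 4" "cmod a + 4 * r = 1" using na norm_ge_zero[of a] by linarith+
    define k where "k = (cmod a + r) / (1 - r)"
    have k: "0 \<le> k" "k < 1" using r by (auto simp: k_def divide_less_eq)
    have contr: "1 + b * z \<noteq> 0 \<and> cmod (fam_fun a b z) \<le> k * cmod z" if z: "cmod z < r" for z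
    proof -
      have "cmod (b * z) \<le> 1 * cmod z" unfolding norm_mult using nb by (intro mult_right_mono) auto
      then have "1 - r \<le> cmod (1 + b * z)"
        using norm_diff_ineq[of 1 "b * z"] z by simp
      then have d: "0 < 1 - r" "1 - r \<le> cmod (1 + b * z)" using r by auto
      have "cmod (a + z) \<le> cmod a + r" using norm_triangle_ineq[of a z] z by simp
      have "fam_fun a b z = (a + z) / (1 + b * z) * z" by (simp add: fam_fun_def algebra_simps power2_eq_square)
      then have "cmod (fam_fun a b z) = cmod (a + z) / cmod (1 + b * z) * cmod z" by (simp add: norm_mult norm_divide)
      also have "\<dots> \<le> k * cmod z"
        unfolding k_def using d r \<open>cmod (a + z) \<le> cmod a + r\<close> by (intro mult_right_mono frac_le) auto
      finally show ?thesis using d by auto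
    qed
    show ?thesis
    proof (cases "\<exists>n z. z \<in> preim a b r n \<and> a + 2 * z + b * z\<^sup>2 = 0")
      case True
      then obtain n z where z: "z \<in> preim a b r n" "a + 2 * z + b * z\<^sup>2 = 0" by blast
      then show ?thesis using that[of "Fin z"] preim_tendsto_0[OF k contr z(1)] fam_critical[OF ab] by blast
    next
      case False
      then have nocrit: "\<forall>n. \<forall>z\<in>preim a b r n. a + 2 * z + b * z\<^sup>2 \<noteq> 0" by blast
      \<comment> \<open>From modulus R on, |1 + b z| \<le> |a + z|, so the map does not decrease the
        modulus, and preimages of points inside stay inside.\<close>
      define R where "R = 2 / (1 - cmod b)"
      have R: "R \<ge> 2" using nb by (simp add: R_def field_simps)
      have esc: "cmod z \<le> cmod (fam_fun a b z)" if z: "R \<le> cmod z" "1 + b * z \<noteq> 0" for z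
      proof -
        have "2 \<le> cmod z * (1 - cmod b)" using z(1) nb by (simp add: R_def field_simps)
        then have "cmod b * cmod z + 1 \<le> cmod z - 1" by (simp add: algebra_simps)
        also have "\<dots> \<le> cmod (a + z)" using norm_diff_ineq[of z a] na by (simp add: add.commute)
        finally have "cmod (1 + b * z) \<le> cmod (a + z)"
          using norm_triangle_ineq[of 1 "b * z"] by (simp add: norm_mult)
        then have "cmod z * cmod (1 + b * z) \<le> cmod z * cmod (a + z)" by (intro mult_left_mono) auto
        also have "\<dots> = cmod (a * z + z\<^sup>2)" by (simp add: norm_mult[symmetric] algebra_simps power2_eq_square)
        finally show ?thesis using z(2) by (simp add: fam_fun_def norm_divide le_divide_eq)
      qed
      have bd: "cmod z < R" if "z \<in> preim a b r n" for z n
        using that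
      proof (induction n arbitrary: z)
        case 0 then show ?case using r R by simp
      next
        case (Suc n)
        then show ?case using esc[of z] by (force simp: not_less[symmetric])
      qed
      have le: "r \<le> 2 * R * cmod a ^ n" for n
      proof -
        obtain \<psi> where \<psi>: "\<psi> holomorphic_on ball 0 (r / cmod a ^ n)" "\<And>w. w \<in> ball 0 (r / cmod a ^ n) \<Longrightarrow> \<psi> w \<in> preim a b r n"
            "(\<psi> has_field_derivative 1) (at 0)"
          using inverse_branches[where n = n, OF ab a0 r(1) nocrit] by blast
        define \<rho> where "\<rho> = r / cmod a ^ n / 2"
        have "0 < r / cmod a ^ n" using r a0 by simp
        moreover have "0 < x / 2 \<and> x / 2 < x" if "0 < x" for x :: real using that by simp
        ultimately have \<rho>: "0 < \<rho>" "\<rho> < r / cmod a ^ n" unfolding \<rho>_def by blast+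
        have "norm ((deriv ^^ 1) \<psi> 0) \<le> fact 1 * R / \<rho> ^ 1"
        proof (rule Cauchy_higher_deriv_bound)
          show "\<psi> holomorphic_on ball 0 \<rho>" using \<psi>(1) \<rho> by (elim holomorphic_on_subset) auto
          show "continuous_on (cball 0 \<rho>) \<psi>"
            using holomorphic_on_imp_continuous_on[OF \<psi>(1)] \<rho> by (elim continuous_on_subset) auto
          show "\<psi> w \<in> ball 0 R" if "w \<in> ball 0 \<rho>" for w
            using bd[OF \<psi>(2), of w] that \<rho> by simp
        qed (use \<rho> in auto)
        then have "1 \<le> R / \<rho>" using DERIV_imp_deriv[OF \<psi>(3)] by simp
        then have "\<rho> \<le> R" using \<rho> by (simp add: field_simps)
        then show ?thesis using a0 by (simp add: \<rho>_def field_simps)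
      qed
      have "(\<lambda>n. 2 * R * cmod a ^ n) \<longlonglongrightarrow> 2 * R * 0"
        by (intro tendsto_intros LIMSEQ_realpow_zero) (use na in auto)
      then have "r \<le> 2 * R * 0" by (rule LIMSEQ_le_const) (use le in blast)
      then show ?thesis using r by simp
    qed
  qed
qed

lemma fam_critical_to_Infty:
  assumes na: "cmod a < 1" and nb: "cmod b < 1"
  obtains c where "critical_point (fam a b) c" "(\<lambda>k. (fam a b ^^ k) c) \<longlonglongrightarrow> Infty"
proof -
  have ba: "b * a \<noteq> 1" by (rule norm_mult_lt_1[OF nb na])
  obtain c where c: "critical_point (fam b a) c" "(\<lambda>k. (fam b a ^^ k) c) \<longlonglongrightarrow> Fin 0"
    using fam_critical_to_zero[OF nb na] .
  obtain \<phi> where p: "conjugates \<phi> (fam b a) (fam a b)" "\<phi> (Fin 0) = Infty" "\<phi> Infty = Fin 0"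
    using fam_swap[OF ba] .
  show ?thesis
    using that[of "\<phi> c"] conjugates_critical[OF p(1) fam_rational[OF ba]] c conjugates_tendsto[OF p(1) c(2)] p(2) by simp
qed

text \<open>Two different roots of the critical equation have sum -2/b. The case b = 0 is separate
  because \<infinity> is then itself critical.\<close>

lemma fam_at_most_two_critical:
  assumes ab: "a * b \<noteq> 1" and c: "critical_point (fam a b) c1" "critical_point (fam a b) c2" "critical_point (fam a b) c"
    and ne: "c1 \<noteq> c2"
  shows "c = c1 \<or> c = c2"
proof (cases "b = 0")
  case True
  have "x = Infty \<or> x = Fin (- a / 2)" if "critical_point (fam a b) x" for x
  proof (cases x)
    case (Fin z)
    then have "a + 2 * z = 0" using that fam_critical[OF ab, of z] True by simp
    then have "z = - a / 2" by (simp add: field_simps add_eq_0_iff)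
    then show ?thesis using Fin by simp
  qed simp
  then show ?thesis using c ne by metis
next
  case False
  have fin: "\<exists>z. x = Fin z \<and> a + 2 * z + b * z\<^sup>2 = 0" if "critical_point (fam a b) x" for x
    using that fam_critical[OF ab] fam_deriv(2)[OF ab] False by (cases x) (auto simp: critical_point_def)
  obtain z1 where z1: "c1 = Fin z1" "a + 2 * z1 + b * z1\<^sup>2 = 0" using fin[OF c(1)] by blast
  obtain z2 where z2: "c2 = Fin z2" "a + 2 * z2 + b * z2\<^sup>2 = 0" using fin[OF c(2)] by blast
  obtain z where z: "c = Fin z" "a + 2 * z + b * z\<^sup>2 = 0" using fin[OF c(3)] by blast
  have s: "2 + b * (x + y) = 0" if "a + 2 * x + b * x\<^sup>2 = 0" "a + 2 * y + b * y\<^sup>2 = 0" "x \<noteq> y" for x y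
  proof -
    have "(x - y) * (2 + b * (x + y)) = (a + 2 * x + b * x\<^sup>2) - (a + 2 * y + b * y\<^sup>2)"
      by (simp add: algebra_simps power2_eq_square)
    then show ?thesis using that by simp
  qed
  show ?thesis
  proof (rule ccontr)
    assume nt: "\<not> (c = c1 \<or> c = c2)"
    then have "2 + b * (z + z1) = 0" "2 + b * (z2 + z1) = 0"
      using s z1 z2 z ne by auto
    moreover have "b * (z - z2) = (2 + b * (z + z1)) - (2 + b * (z2 + z1))" by (simp add: algebra_simps)
    ultimately have "b * (z - z2) = 0" by simp
    then show False using False nt z z2 by simp
  qed
qed

lemma fam_fixed_attracted:
  assumes na: "cmod a < 1" and nb: "cmod b < 1"
  shows "fixed_attracted (fam a b)"
  unfolding fixed_attracted_def
proof (intro allI impI)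
  have ab: "a * b \<noteq> 1" by (rule norm_mult_lt_1[OF assms])
  fix c assume c: "critical_point (fam a b) c"
  obtain c1 where c1: "critical_point (fam a b) c1" "(\<lambda>k. (fam a b ^^ k) c1) \<longlonglongrightarrow> Fin 0"
    using fam_critical_to_zero[OF assms] .
  obtain c2 where c2: "critical_point (fam a b) c2" "(\<lambda>k. (fam a b ^^ k) c2) \<longlonglongrightarrow> Infty"
    using fam_critical_to_Infty[OF assms] .
  have "c1 \<noteq> c2" using LIMSEQ_unique[OF c1(2)] c2(2) by auto
  from fam_at_most_two_critical[OF ab c1(1) c2(1) c this]
  show "\<exists>p. fam a b p = p \<and> cmod (local_deriv (fam a b) p) < 1 \<and> (\<lambda>k. (fam a b ^^ k) c) \<longlonglongrightarrow> p"
  proof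
    assume "c = c1" then show ?thesis using c1 fam_deriv(1)[OF ab] na by (intro exI[of _ "Fin 0"]) simp
  next
    assume "c = c2" then show ?thesis using c2 fam_deriv(2)[OF ab] nb by (intro exI[of _ Infty]) simp
  qed
qed

lemma disc_classes_fixed_attracted:
  assumes "conj_class f \<in> disc_classes" "f \<in> rational_maps 2"
  shows "fixed_attracted f"
proof -
  obtain a b where ab: "conj_class (fam a b) = conj_class f" "cmod a < 1" "cmod b < 1"
    using assms by (auto simp: disc_classes_def)
  have n: "a * b \<noteq> 1" using norm_mult_lt_1[OF ab(2,3)] .
  obtain \<phi> where c: "conjugates \<phi> (fam a b) f" using conj_class_eqD[OF ab(1) fam_rational[OF n]] .
  show ?thesis by (rule conjugates_fixed_attracted[OF c fam_rational[OF n] fam_fixed_attracted[OF ab(2,3)]])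
qed

section \<open>Orbits in the normal form \<open>gmap\<close>\<close>

text \<open>\<open>gfun b T 0\<close> is the default value T/b, whereas the map sends 0 to
  \<infinity>; the two orbits are compared only while 0 is avoided.\<close>

lemma gmap_orbit:
  assumes b: "b \<noteq> 0"
  shows "(\<And>i. i < k \<Longrightarrow> (gfun b T ^^ i) z \<noteq> 0) \<Longrightarrow> (gmap b T ^^ k) (Fin z) = Fin ((gfun b T ^^ k) z)"
  by (induction k) (simp_all add: gmap_simps[OF b])

lemma gmap_orbit_finite:
  assumes b: "b \<noteq> 0" and fin: "\<And>i. (gmap b T ^^ i) (Fin z) \<noteq> Infty"
  shows "(gmap b T ^^ k) (Fin z) = Fin ((gfun b T ^^ k) z)" and "(gfun b T ^^ k) z \<noteq> 0"
proof -
  have *: "(gmap b T ^^ k) (Fin z) = Fin ((gfun b T ^^ k) z) \<and> (gfun b T ^^ k) z \<noteq> 0" for k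
  proof (induction k)
    case 0
    then show ?case using fin[of 1] gmap_simps[OF b] by (cases "z = 0") auto
  next
    case (Suc k)
    then have "(gmap b T ^^ Suc k) (Fin z) = Fin ((gfun b T ^^ Suc k) z)" by (simp add: gmap_simps[OF b])
    moreover have "(gfun b T ^^ Suc k) z \<noteq> 0"
    proof
      assume "(gfun b T ^^ Suc k) z = 0"
      then have "(gmap b T ^^ Suc (Suc k)) (Fin z) = Infty"
        using calculation gmap_simps[OF b] by simp
      then show False using fin by blast
    qed
    ultimately show ?case by blast
  qed
  then show "(gmap b T ^^ k) (Fin z) = Fin ((gfun b T ^^ k) z)" "(gfun b T ^^ k) z \<noteq> 0" by blast+
qed

lemma gmap_funpow_Infty: "b \<noteq> 0 \<Longrightarrow> (gmap b T ^^ k) Infty = Infty"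
  by (induction k) (simp_all add: gmap_simps)

lemma Re_one_over: "Re (1 / z) = Re z / (cmod z)\<^sup>2"
  by (simp add: Re_divide cmod_power2)

lemma Im_one_over: "Im (1 / z) = - Im z / (cmod z)\<^sup>2"
  by (simp add: Im_divide cmod_power2)

lemma G1: "gfun 1 T z = z + 1 / z + T"
  by (simp add: gfun_def)

section \<open>Boundary maps are not hyperbolic\<close>

text \<open>If the real part stays bounded along the orbit, then \<open>Re z / |z|\<^sup>2\<close> is summable, so \<open>|z|\<close> is unbounded
  anyway.\<close>
lemma half_plane_orbit:
  assumes T: "Re T \<ge> 0" and z: "Re z > 0"
  shows "Re ((gfun 1 T ^^ k) z) > 0" and "filterlim (\<lambda>k. (gfun 1 T ^^ k) z) at_infinity sequentially"
proof -
  define y where "y k = (gfun 1 T ^^ k) z" for k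
  have step: "Re (y (Suc k)) = Re (y k) + Re (y k) / (cmod (y k))\<^sup>2 + Re T" for k
    by (simp add: y_def G1 Re_one_over)
  have pos: "Re (y k) > 0" for k
  proof (induction k)
    case 0
    then show ?case using z by (simp add: y_def)
  next
    case (Suc k)
    then have "Re (y k) / (cmod (y k))\<^sup>2 \<ge> 0" by simp
    then show ?case using Suc T unfolding step by linarith
  qed
  then show "Re ((gfun 1 T ^^ k) z) > 0" by (simp add: y_def)
  have mono: "Re (y k) + Re (y k) / (cmod (y k))\<^sup>2 \<le> Re (y (Suc k))" for k using T unfolding step by simp
  have inc: "incseq (\<lambda>k. Re (y k))"
  proof (rule incseq_SucI)
    fix k
    have "Re (y k) / (cmod (y k))\<^sup>2 \<ge> 0" using pos[of k] by simp
    then show "Re (y k) \<le> Re (y (Suc k))" using mono[of k] by linarith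
  qed
  have "filterlim (\<lambda>k. cmod (y k)) at_top sequentially"
  proof (cases "\<exists>B. \<forall>k. Re (y k) \<le> B")
    case True
    then obtain B where B: "\<And>k. Re (y k) \<le> B" by blast
    obtain L where L: "(\<lambda>k. Re (y k)) \<longlonglongrightarrow> L" using incseq_convergent[OF inc] B by metis
    have d0: "(\<lambda>k. Re (y (Suc k)) - Re (y k)) \<longlonglongrightarrow> 0"
      using tendsto_diff[OF LIMSEQ_Suc[OF L] L] by simp
    have le: "norm (Re (y 0) / (cmod (y k))\<^sup>2) \<le> Re (y (Suc k)) - Re (y k)" for k
    proof -
      have "Re (y 0) \<le> Re (y k)" using incseqD[OF inc, of 0 k] by simp
      then have "Re (y 0) / (cmod (y k))\<^sup>2 \<le> Re (y k) / (cmod (y k))\<^sup>2" by (intro divide_right_mono) auto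
      moreover have "Re (y 0) / (cmod (y k))\<^sup>2 \<ge> 0" using pos[of 0] by simp
      ultimately show ?thesis using mono[of k] by simp
    qed
    have "(\<lambda>k. Re (y 0) / (cmod (y k))\<^sup>2) \<longlonglongrightarrow> 0"
      by (rule Lim_null_comparison[OF _ d0]) (use le in auto)
    then have l0: "(\<lambda>k. 1 / (cmod (y k))\<^sup>2) \<longlonglongrightarrow> 0"
      using tendsto_mult[OF tendsto_const, of _ 0 _ "1 / Re (y 0)"] pos[of 0] by fastforce
    show ?thesis
      unfolding filterlim_at_top
    proof
      fix Z :: real
      define Z' where "Z' = max Z 1"
      have Z': "Z' > 0" by (simp add: Z'_def)
      have "eventually (\<lambda>k. 1 / (cmod (y k))\<^sup>2 < 1 / Z'\<^sup>2) sequentially"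
        using order_tendstoD(2)[OF l0, of "1 / Z'\<^sup>2"] Z' by simp
      then show "eventually (\<lambda>k. Z \<le> cmod (y k)) sequentially"
      proof eventually_elim
        case (elim k)
        have yk: "(cmod (y k))\<^sup>2 > 0" using pos[of k] by auto
        have "Z'\<^sup>2 < (cmod (y k))\<^sup>2" using elim yk Z' by (simp add: field_simps)
        then have "Z' < cmod (y k)" by (rule power2_less_imp_less) simp
        then show ?case by (simp add: Z'_def)
      qed
    qed
  next
    case False
    show ?thesis
      unfolding filterlim_at_top eventually_sequentially
    proof
      fix Z :: real
      obtain N where N: "Re (y N) > Z" using False not_le by blast
      show "\<exists>N. \<forall>n\<ge>N. Z \<le> cmod (y n)"
      proof (intro exI allI impI)
        fix n assume "N \<le> n"
        then have "Re (y N) \<le> Re (y n)" using incseqD[OF inc] by blast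
        then show "Z \<le> cmod (y n)" using N complex_Re_le_cmod[of "y n"] by linarith
      qed
    qed
  qed
  then show "filterlim (\<lambda>k. (gfun 1 T ^^ k) z) at_infinity sequentially"
    unfolding filterlim_at_infinity_conv_norm_at_top y_def .
qed

lemma half_plane_to_Infty:
  assumes T: "Re T \<ge> 0" and z: "Re z > 0"
  shows "(\<lambda>k. (gmap 1 T ^^ k) (Fin z)) \<longlonglongrightarrow> Infty"
proof -
  have "(gfun 1 T ^^ i) z \<noteq> 0" for i using half_plane_orbit(1)[OF assms, of i] by auto
  then have "(gmap 1 T ^^ k) (Fin z) = Fin ((gfun 1 T ^^ k) z)" for k by (intro gmap_orbit) auto
  then show ?thesis using half_plane_orbit(2)[OF assms] by (simp add: tendsto_Infty_iff)
qed

text \<open>The period in \<open>attracting_cycle\<close> may be a multiple of the minimal one, so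
  the multiplier seen there is a power of the multiplier at \<open>x\<close>.\<close>

lemma attracting_cycle_fixed:
  assumes h: "\<And>y. holo_at f y" and A: "attracting_cycle f A" "x \<in> A" "f x = x"
  shows "cmod (local_deriv f x) < 1" and "A = {x}"
proof -
  obtain p n where p: "n > 0" "(f ^^ n) p = p" "cmod (local_deriv (f ^^ n) p) < 1"
      "A = (\<lambda>i. (f ^^ i) p) ` {..<n}"
    using A(1) by (auto simp: attracting_cycle_def)
  obtain i where i: "i < n" "x = (f ^^ i) p" using A(2) p(4) by auto
  have fx: "(f ^^ k) x = x" for k using A(3) by (induction k) auto
  have "p = (f ^^ (n - i)) ((f ^^ i) p)"
    using p(2) i(1) by (metis funpow_add comp_apply le_add_diff_inverse2 less_imp_le)
  then have px: "p = x" using fx i(2) by metis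
  have "cmod (local_deriv f x) ^ n < 1"
    using p(3) local_deriv_funpow_fixed[OF h A(3), of n] by (simp add: px norm_power)
  then show "cmod (local_deriv f x) < 1" using one_le_power[of "cmod (local_deriv f x)" n] by linarith
  show "A = {x}" using p(1,4) fx px by auto
qed

lemma tendsto_infdist_zero_mem:
  fixes A :: "riemann_sphere set"
  assumes A: "finite A" "A \<noteq> {}" and l: "y \<longlonglongrightarrow> x" "(\<lambda>k. infdist (y k) A) \<longlonglongrightarrow> 0"
  shows "x \<in> A"
proof -
  have "infdist x A = 0" using LIMSEQ_unique[OF tendsto_infdist[OF l(1)] l(2)] .
  then show ?thesis using in_closed_iff_infdist_zero[OF finite_imp_closed[OF A(1)] A(2)] by blast
qed

text \<open>The orbit of the critical point 1 converges to \<open>Infty\<close>, which would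
  therefore lie in an attracting cycle; but its multiplier is 1.\<close>

lemma parabolic_not_hyperbolic:
  assumes T: "Re T \<ge> 0"
  shows "\<not> hyperbolic (gmap 1 T)"
proof
  assume "hyperbolic (gmap 1 T)"
  then obtain A where A: "attracting_cycle (gmap 1 T) A" "(\<lambda>k. infdist ((gmap 1 T ^^ k) (Fin 1)) A) \<longlonglongrightarrow> 0"
    unfolding hyperbolic_def using gmap_critical[of 1 T "Fin 1"] by auto
  have "Infty \<in> A"
    using tendsto_infdist_zero_mem[OF _ _ half_plane_to_Infty[OF T] A(2)] attracting_cycle_finite[OF A(1)] by simp
  from attracting_cycle_fixed(1)[OF gmap_holo A(1) this] show False
    by (simp add: gmap_simps gmap_deriv)
qed

lemma G_iter_tendsto:
  assumes "b \<noteq> 0" "(bs \<longlongrightarrow> b) net" "(Ts \<longlongrightarrow> T) net" "(zs \<longlongrightarrow> z) net" "\<forall>i<n. (gfun b T ^^ i) z \<noteq> 0"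
  shows "((\<lambda>j. (gfun (bs j) (Ts j) ^^ n) (zs j)) \<longlongrightarrow> (gfun b T ^^ n) z) net"
  using assms(5)
proof (induction n)
  case 0
  then show ?case using assms by simp
next
  case (Suc n)
  then have l: "((\<lambda>j. (gfun (bs j) (Ts j) ^^ n) (zs j)) \<longlongrightarrow> (gfun b T ^^ n) z) net" and nz: "(gfun b T ^^ n) z \<noteq> 0" by auto
  show ?case
    unfolding funpow.simps comp_apply gfun_def[of _ _ "(gfun _ _ ^^ n) _"]
    by (intro tendsto_intros l nz assms(1-3))
qed

lemma G_iter_eventually:
  assumes "b \<noteq> 0" "(bs \<longlongrightarrow> b) net" "(Ts \<longlongrightarrow> T) net" "(zs \<longlongrightarrow> z) net" "\<forall>i<n. (gfun b T ^^ i) z \<noteq> 0"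
  shows "eventually (\<lambda>j. \<forall>i<n. (gfun (bs j) (Ts j) ^^ i) (zs j) \<noteq> 0) net"
proof -
  have "eventually (\<lambda>j. \<forall>i\<in>{..<n}. (gfun (bs j) (Ts j) ^^ i) (zs j) \<noteq> 0) net"
  proof (rule eventually_ball_finite)
    show "\<forall>i\<in>{..<n}. eventually (\<lambda>j. (gfun (bs j) (Ts j) ^^ i) (zs j) \<noteq> 0) net"
    proof
      fix i assume "i \<in> {..<n}"
      then have i: "\<forall>j<i. (gfun b T ^^ j) z \<noteq> 0" "(gfun b T ^^ i) z \<noteq> 0" using assms(5) by auto
      show "eventually (\<lambda>j. (gfun (bs j) (Ts j) ^^ i) (zs j) \<noteq> 0) net"
        by (rule tendsto_imp_eventually_ne[OF G_iter_tendsto[OF assms(1-4) i(1)] i(2)])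
    qed
  qed simp
  then show ?thesis by (auto elim: eventually_mono)
qed

text \<open>A small disc around a point of the cycle is mapped into itself by all nearby maps.\<close>
lemma attraction_persists:
  assumes b0: "b \<noteq> 0" and n: "n > 0" and reg: "\<forall>i<n. (gfun b T ^^ i) p \<noteq> 0" and per: "(gfun b T ^^ n) p = p"
    and der: "((gfun b T ^^ n) has_field_derivative d) (at p)" "cmod d < 1"
    and c: "\<And>r. r > 0 \<Longrightarrow> \<exists>k. (\<forall>i<k. (gfun b T ^^ i) c \<noteq> 0) \<and> dist ((gfun b T ^^ k) c) p < r"
    and bs: "bs \<longlonglongrightarrow> b" and Ts: "Ts \<longlonglongrightarrow> T"
  obtains M where "eventually (\<lambda>j. \<forall>x. ((\<lambda>k. (gmap (bs j) (Ts j) ^^ k) (Fin c)) \<longlonglongrightarrow> x) \<longrightarrow> x \<in> Fin ` cball 0 M) sequentially"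
proof -
  define \<kappa> where "\<kappa> = (1 + cmod d) / 2"
  have \<kappa>: "cmod d < \<kappa>" "\<kappa> < 1" "0 < \<kappa>" using der(2) by (auto simp: \<kappa>_def add_pos_nonneg)
  have "((\<lambda>z. ((gfun b T ^^ n) z - (gfun b T ^^ n) p) / (z - p)) \<longlongrightarrow> d) (at p)"
    using der(1) by (simp add: has_field_derivative_iff)
  then have "((\<lambda>z. cmod (((gfun b T ^^ n) z - p) / (z - p))) \<longlongrightarrow> cmod d) (at p)"
    unfolding per by (rule tendsto_norm)
  from order_tendstoD(2)[OF this \<kappa>(1)] obtain \<delta>1 where
    \<delta>1: "\<delta>1 > 0" "\<And>z. z \<noteq> p \<Longrightarrow> dist z p < \<delta>1 \<Longrightarrow> cmod (((gfun b T ^^ n) z - p) / (z - p)) < \<kappa>"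
    unfolding eventually_at by auto
  have "eventually (\<lambda>z. \<forall>i<n. (gfun b T ^^ i) z \<noteq> 0) (nhds p)"
    by (rule G_iter_eventually[OF b0 tendsto_const tendsto_const filterlim_ident reg])
  then obtain \<delta>2 where \<delta>2: "\<delta>2 > 0" "\<And>z. dist z p < \<delta>2 \<Longrightarrow> \<forall>i<n. (gfun b T ^^ i) z \<noteq> 0"
    unfolding eventually_nhds_metric by auto
  define r where "r = min \<delta>1 \<delta>2 / 2"
  have r: "r > 0" "r < \<delta>1" "r < \<delta>2" using \<delta>1 \<delta>2 by (auto simp: r_def)
  have contr: "cmod ((gfun b T ^^ n) z - p) < r" if "dist z p \<le> r" for z
  proof (cases "z = p")
    case True then show ?thesis using per r by simp
  next
    case False
    then have "cmod (((gfun b T ^^ n) z - p) / (z - p)) < \<kappa>" using \<delta>1(2)[OF False] that r by simp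
    then have "cmod ((gfun b T ^^ n) z - p) < \<kappa> * cmod (z - p)" using False by (simp add: norm_divide divide_less_eq)
    also have "\<dots> \<le> 1 * r" using that \<kappa> r by (intro mult_mono) (auto simp: dist_norm)
    finally show ?thesis by simp
  qed
  \<comment> \<open>Compactness replaces explicit estimates: bad points for a sequence of parameters
    would accumulate in the closed disc, which the limit map sends strictly inside.\<close>
  define good where "good j \<longleftrightarrow> (\<forall>z\<in>cball p r. (\<forall>i<n. (gfun (bs j) (Ts j) ^^ i) z \<noteq> 0) \<and> (gfun (bs j) (Ts j) ^^ n) z \<in> cball p r)" for j
  have "eventually good sequentially"
  proof (rule ccontr)
    assume ng: "\<not> eventually good sequentially"
    obtain s :: "nat \<Rightarrow> nat" where s: "strict_mono s" "\<And>j. \<not> good (s j)"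
      using not_eventually_sequentiallyD[OF ng] by blast
    have "\<exists>z. z \<in> cball p r \<and> \<not> ((\<forall>i<n. (gfun (bs (s j)) (Ts (s j)) ^^ i) z \<noteq> 0) \<and> (gfun (bs (s j)) (Ts (s j)) ^^ n) z \<in> cball p r)" for j
      using s(2)[of j] unfolding good_def by blast
    then obtain z where z: "\<And>j. z j \<in> cball p r"
      "\<And>j. \<not> ((\<forall>i<n. (gfun (bs (s j)) (Ts (s j)) ^^ i) (z j) \<noteq> 0) \<and> (gfun (bs (s j)) (Ts (s j)) ^^ n) (z j) \<in> cball p r)" by metis
    have "\<forall>j. z j \<in> cball p r" using z(1) by blast
    from compact_def[THEN iffD1, OF compact_cball, THEN spec, THEN mp, OF this]
    obtain l t where t: "l \<in> cball p r" "strict_mono t" "(z \<circ> t) \<longlonglongrightarrow> l" by (elim bexE exE conjE)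
    have lim: "(\<lambda>j. bs (s (t j))) \<longlonglongrightarrow> b" "(\<lambda>j. Ts (s (t j))) \<longlonglongrightarrow> T" "(\<lambda>j. z (t j)) \<longlonglongrightarrow> l"
      using LIMSEQ_subseq_LIMSEQ[OF LIMSEQ_subseq_LIMSEQ[OF bs s(1)] t(2)]
        LIMSEQ_subseq_LIMSEQ[OF LIMSEQ_subseq_LIMSEQ[OF Ts s(1)] t(2)] t(3) by (simp_all only: comp_def)
    have lr: "\<forall>i<n. (gfun b T ^^ i) l \<noteq> 0" using t(1) r \<delta>2(2)[of l] by (simp add: dist_commute)
    have "(\<lambda>j. cmod ((gfun (bs (s (t j))) (Ts (s (t j))) ^^ n) (z (t j)) - p)) \<longlonglongrightarrow> cmod ((gfun b T ^^ n) l - p)"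
      by (intro tendsto_intros G_iter_tendsto[OF b0 lim lr])
    from order_tendstoD(2)[OF this] contr[of l] t(1)
    have "eventually (\<lambda>j. cmod ((gfun (bs (s (t j))) (Ts (s (t j))) ^^ n) (z (t j)) - p) < r) sequentially"
      by (simp add: dist_commute)
    then have "eventually (\<lambda>j. False) sequentially"
      using G_iter_eventually[OF b0 lim lr]
    proof eventually_elim
      case (elim j)
      then show ?case using z(2)[of "t j"] by (simp add: dist_norm norm_minus_commute)
    qed
    then show False by simp
  qed
  obtain k where k: "\<forall>i<k. (gfun b T ^^ i) c \<noteq> 0" "dist ((gfun b T ^^ k) c) p < r" using c[OF r(1)] by blast
  have "(\<lambda>j. dist ((gfun (bs j) (Ts j) ^^ k) c) p) \<longlonglongrightarrow> dist ((gfun b T ^^ k) c) p"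
    by (intro tendsto_intros G_iter_tendsto[OF b0 bs Ts tendsto_const k(1)])
  from order_tendstoD(2)[OF this k(2)]
  have ev1: "eventually (\<lambda>j. dist ((gfun (bs j) (Ts j) ^^ k) c) p < r) sequentially" .
  have ev2: "eventually (\<lambda>j. \<forall>i<k. (gfun (bs j) (Ts j) ^^ i) c \<noteq> 0) sequentially"
    by (rule G_iter_eventually[OF b0 bs Ts tendsto_const k(1)])
  have ev3: "eventually (\<lambda>j. bs j \<noteq> 0) sequentially" by (rule tendsto_imp_eventually_ne[OF bs b0])
  have cl: "closed (Fin ` cball p r)"
    by (intro compact_imp_closed compact_continuous_image continuous_at_imp_continuous_on ballI isCont_Fin) auto
  have sub: "Fin ` cball p r \<subseteq> Fin ` cball 0 (cmod p + r)"
  proof (rule image_mono, rule subsetI)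
    fix u assume "u \<in> cball p r"
    then have "cmod (u - p) \<le> r" by (simp add: dist_norm norm_minus_commute)
    then show "u \<in> cball 0 (cmod p + r)" using norm_triangle_ineq[of p "u - p"] by simp
  qed
  show ?thesis
  proof (rule that[of "cmod p + r"])
    show "eventually (\<lambda>j. \<forall>x. ((\<lambda>k. (gmap (bs j) (Ts j) ^^ k) (Fin c)) \<longlonglongrightarrow> x) \<longrightarrow> x \<in> Fin ` cball 0 (cmod p + r)) sequentially"
      using \<open>eventually good sequentially\<close> ev1 ev2 ev3
    proof eventually_elim
      case (elim j)
      define f where "f = gmap (bs j) (Ts j)"
      have fk: "(f ^^ k) (Fin c) = Fin ((gfun (bs j) (Ts j) ^^ k) c)"
        unfolding f_def using elim by (intro gmap_orbit) auto
      have step: "(f ^^ n) y \<in> Fin ` cball p r" if y: "y \<in> Fin ` cball p r" for y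
      proof -
        obtain u where u: "y = Fin u" "u \<in> cball p r" using y by blast
        have "(f ^^ n) (Fin u) = Fin ((gfun (bs j) (Ts j) ^^ n) u)"
          unfolding f_def using elim(1,4) u(2) by (intro gmap_orbit) (auto simp: good_def)
        then show ?thesis using elim(1) u unfolding good_def by blast
      qed
      \<comment> \<open>Only every n-th iterate is known to return to the disc, but a limit of the
        whole orbit is also the limit of this subsequence.\<close>
      have mem: "(f ^^ (k + m * n)) (Fin c) \<in> Fin ` cball p r" for m
      proof (induction m)
        case 0
        then show ?case using fk elim(2) by (auto simp: dist_commute)
      next
        case (Suc m)
        have "k + Suc m * n = n + (k + m * n)" by simp
        then have "(f ^^ (k + Suc m * n)) (Fin c) = (f ^^ n) ((f ^^ (k + m * n)) (Fin c))"
          by (simp only: funpow_add comp_apply)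
        then show ?case using step[OF Suc] by simp
      qed
      show ?case
      proof (intro allI impI)
        fix x assume "(\<lambda>k. (gmap (bs j) (Ts j) ^^ k) (Fin c)) \<longlonglongrightarrow> x"
        then have l: "(\<lambda>k. (f ^^ k) (Fin c)) \<longlonglongrightarrow> x" by (simp only: f_def)
        have "strict_mono (\<lambda>m. k + m * n)" using n by (auto intro!: strict_monoI)
        from LIMSEQ_subseq_LIMSEQ[OF l this]
        have lm: "(\<lambda>m. (f ^^ (k + m * n)) (Fin c)) \<longlonglongrightarrow> x" by (simp only: comp_def)
        have "x \<in> Fin ` cball p r" by (rule closed_sequentially[OF cl mem lm])
        then show "x \<in> Fin ` cball 0 (cmod p + r)" using sub by blast
      qed
    qed
  qed
qed

lemma gmap_local_deriv_iter:
  assumes b: "b \<noteq> 0" and reg: "\<forall>i<n. (gfun b T ^^ i) p \<noteq> 0"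
  shows "((gfun b T ^^ n) has_field_derivative local_deriv (gmap b T ^^ n) (Fin p)) (at p)"
proof -
  define f where "f = gmap b T ^^ n"
  have fp: "f (Fin p) = Fin ((gfun b T ^^ n) p)" unfolding f_def using reg by (intro gmap_orbit[OF b]) auto
  have "holo_at f (Fin p)" unfolding f_def by (rule holo_at_funpow[OF gmap_holo[OF b]])
  from holo_at_has_derivative[OF this]
  have D: "((\<lambda>z. chart (f (Fin p)) (f (inv_chart (Fin p) z))) has_field_derivative local_deriv f (Fin p)) (at p)"
    by (simp add: chart_def)
  have "eventually (\<lambda>z. \<forall>i<n. (gfun b T ^^ i) z \<noteq> 0) (nhds p)"
    by (rule G_iter_eventually[OF b tendsto_const tendsto_const filterlim_ident reg])
  then have "eventually (\<lambda>z. chart (f (Fin p)) (f (inv_chart (Fin p) z)) = (gfun b T ^^ n) z) (nhds p)"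
  proof eventually_elim
    case (elim z)
    then have "f (Fin z) = Fin ((gfun b T ^^ n) z)" unfolding f_def by (intro gmap_orbit[OF b]) auto
    then show ?case by (simp add: fp inv_chart_def chart_def)
  qed
  from DERIV_cong_ev[OF refl this refl] D show ?thesis by (simp add: f_def)
qed

text \<open>For T \<noteq> 0 the root is taken of u/T^2, which tends to 1, away from the branch cut;
  at T = 0 the moduli alone give convergence.\<close>

lemma sqrt_sequence:
  fixes u :: "nat \<Rightarrow> complex"
  assumes "u \<longlonglongrightarrow> T\<^sup>2"
  obtains S where "S \<longlonglongrightarrow> T" "\<And>j. (S j)\<^sup>2 = u j"
proof (cases "T = 0")
  case True
  have "(\<lambda>j. sqrt (cmod (u j))) \<longlonglongrightarrow> sqrt (cmod (T\<^sup>2))" by (intro tendsto_intros assms)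
  moreover have "cmod (csqrt z) = sqrt (cmod z)" for z
    by (metis norm_ge_zero norm_power power2_csqrt real_sqrt_unique)
  ultimately have "(\<lambda>j. cmod (csqrt (u j))) \<longlonglongrightarrow> 0" using True by simp
  then have "(\<lambda>j. csqrt (u j)) \<longlonglongrightarrow> T" unfolding True by (rule tendsto_norm_zero_cancel)
  then show ?thesis using that[of "\<lambda>j. csqrt (u j)"] by simp
next
  case False
  have "(\<lambda>j. u j / T\<^sup>2) \<longlonglongrightarrow> T\<^sup>2 / T\<^sup>2" by (intro tendsto_intros assms) (use False in simp)
  then have l: "(\<lambda>j. u j / T\<^sup>2) \<longlonglongrightarrow> 1" using False by simp
  have "isCont csqrt 1" by (rule continuous_at_csqrt) (auto simp: complex_nonpos_Reals_iff)
  from isCont_tendsto_compose[OF this l] have "(\<lambda>j. csqrt (u j / T\<^sup>2)) \<longlonglongrightarrow> 1" by simp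
  from tendsto_mult[OF tendsto_const this, of T] have "(\<lambda>j. T * csqrt (u j / T\<^sup>2)) \<longlonglongrightarrow> T" by simp
  moreover have "(T * csqrt (u j / T\<^sup>2))\<^sup>2 = u j" for j using False by (simp add: power_mult_distrib)
  ultimately show ?thesis using that by blast
qed

lemma neutral_Infty_cycle:
  assumes b: "cmod b = 1" and A: "attracting_cycle (gmap b T) A"
  shows "Infty \<notin> A"
proof
  have b0: "b \<noteq> 0" using b by auto
  assume "Infty \<in> A"
  from attracting_cycle_fixed(1)[OF gmap_holo[OF b0] A this] show False
    using gmap_simps[OF b0] gmap_deriv[OF b0] b by simp
qed

text \<open>\<open>Infty\<close> is neutral, hence in no attracting cycle. So the cycle and the
  critical orbit stay in the plane minus 0, where \<open>attraction_persists\<close>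
  applies.\<close>

lemma hyperbolic_critical_bounded:
  assumes b: "cmod b = 1" and h: "hyperbolic (gmap b T)" and c: "c = 1 \<or> c = -1"
    and bs: "bs \<longlonglongrightarrow> b" and Ts: "Ts \<longlonglongrightarrow> T"
  obtains M where "eventually (\<lambda>j. \<forall>x. ((\<lambda>k. (gmap (bs j) (Ts j) ^^ k) (Fin c)) \<longlonglongrightarrow> x) \<longrightarrow> x \<in> Fin ` cball 0 M) sequentially"
proof -
  define f where "f = gmap b T"
  have b0: "b \<noteq> 0" using b by auto
  have fh: "holo_at f y" for y unfolding f_def by (rule gmap_holo[OF b0])
  have "critical_point f (Fin c)" unfolding f_def gmap_critical[OF b0] using c by auto
  then obtain A where A: "attracting_cycle f A" "(\<lambda>k. infdist ((f ^^ k) (Fin c)) A) \<longlonglongrightarrow> 0"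
    using h by (auto simp: hyperbolic_def f_def)
  have Af: "finite A" "A \<noteq> {}" using attracting_cycle_finite[OF A(1)] by auto
  have IA: "Infty \<notin> A" using neutral_Infty_cycle[OF b] A(1) by (simp add: f_def)
  have fI: "(f ^^ k) Infty = Infty" for k unfolding f_def by (rule gmap_funpow_Infty[OF b0])
  obtain p0 n where p0: "n > 0" "(f ^^ n) p0 = p0" "cmod (local_deriv (f ^^ n) p0) < 1"
      "A = (\<lambda>i. (f ^^ i) p0) ` {..<n}"
    using A(1) by (auto simp: attracting_cycle_def)
  have per: "(f ^^ (m * n)) p0 = p0" for m
  proof (induction m)
    case (Suc m)
    then show ?case by (simp add: funpow_add p0(2))
  qed simp
  have fin_p0: "(f ^^ i) p0 \<noteq> Infty" for i
  proof
    assume h: "(f ^^ i) p0 = Infty"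
    have "i \<le> i * n" using p0(1) by simp
    then have "(f ^^ (i * n)) p0 = (f ^^ (i * n - i)) ((f ^^ i) p0)"
      by (metis funpow_add comp_apply le_add_diff_inverse2)
    then have "p0 = Infty" using per h fI by simp
    then show False using IA p0(1,4) by force
  qed
  obtain p where p: "p0 = Fin p" using fin_p0[of 0] by (cases p0) auto
  have orb_p: "(f ^^ k) (Fin p) = Fin ((gfun b T ^^ k) p)" "(gfun b T ^^ k) p \<noteq> 0" for k
    using gmap_orbit_finite[OF b0, of T p k] fin_p0 unfolding f_def p by blast+
  have fin_c: "(f ^^ i) (Fin c) \<noteq> Infty" for i
  proof
    assume h: "(f ^^ i) (Fin c) = Infty"
    have "(f ^^ (k + i)) (Fin c) = Infty" for k using h fI by (simp add: funpow_add)
    then have "(\<lambda>k. (f ^^ (k + i)) (Fin c)) \<longlonglongrightarrow> Infty" by simp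
    moreover have "(\<lambda>k. infdist ((f ^^ (k + i)) (Fin c)) A) \<longlonglongrightarrow> 0"
      by (rule LIMSEQ_ignore_initial_segment[OF A(2)])
    ultimately have "Infty \<in> A" by (rule tendsto_infdist_zero_mem[OF Af])
    then show False using IA by blast
  qed
  have orb_c: "(f ^^ k) (Fin c) = Fin ((gfun b T ^^ k) c)" "(gfun b T ^^ k) c \<noteq> 0" for k
    using gmap_orbit_finite[OF b0, of T c k] fin_c unfolding f_def by blast+
  \<comment> \<open>A limit point of the critical orbit is some \<open>(f ^^ i) p0\<close>; n - i
    further steps carry nearby orbit points close to p itself.\<close>
  have close: "\<exists>k. (\<forall>i<k. (gfun b T ^^ i) c \<noteq> 0) \<and> dist ((gfun b T ^^ k) c) p < r" if r: "r > 0" for r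
  proof -
    have "\<forall>k. (f ^^ k) (Fin c) \<in> UNIV" by simp
    from compact_def[THEN iffD1, OF compact_sphere, THEN spec, THEN mp, OF this]
    obtain y s where s: "strict_mono s" "((\<lambda>k. (f ^^ k) (Fin c)) \<circ> s) \<longlonglongrightarrow> y" by (elim bexE exE conjE)
    have l: "(\<lambda>j. (f ^^ s j) (Fin c)) \<longlonglongrightarrow> y" using s(2) by (simp only: comp_def)
    have "(\<lambda>j. infdist ((f ^^ s j) (Fin c)) A) \<longlonglongrightarrow> 0"
      using LIMSEQ_subseq_LIMSEQ[OF A(2) s(1)] by (simp only: comp_def)
    from tendsto_infdist_zero_mem[OF Af l this] obtain i where i: "i < n" "y = (f ^^ i) p0" using p0(4) by auto
    have "isCont (f ^^ (n - i)) y" using holo_at_funpow[OF fh, of "n - i" y] by (simp add: holo_at_def)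
    from isCont_tendsto_compose[OF this l]
    have "(\<lambda>j. (f ^^ (n - i)) ((f ^^ s j) (Fin c))) \<longlonglongrightarrow> (f ^^ (n - i)) y" .
    moreover have "(f ^^ (n - i)) y = Fin p"
      unfolding i(2) using i(1) p0(2) p by (metis funpow_add comp_apply le_add_diff_inverse2 less_imp_le)
    moreover have "(f ^^ (n - i)) ((f ^^ s j) (Fin c)) = Fin ((gfun b T ^^ (n - i + s j)) c)" for j
      unfolding orb_c(1)[symmetric] by (simp add: funpow_add)
    ultimately have "(\<lambda>j. Fin ((gfun b T ^^ (n - i + s j)) c)) \<longlonglongrightarrow> Fin p" by simp
    then have "(\<lambda>j. (gfun b T ^^ (n - i + s j)) c) \<longlonglongrightarrow> p" by (simp only: tendsto_Fin_iff)
    from tendstoD[OF this r] obtain j where "dist ((gfun b T ^^ (n - i + s j)) c) p < r"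
      by (auto simp: eventually_sequentially)
    then show ?thesis using orb_c(2) by blast
  qed
  have reg: "\<forall>i<n. (gfun b T ^^ i) p \<noteq> 0" using orb_p(2) by blast
  have pp: "(gfun b T ^^ n) p = p" using orb_p(1)[of n] p0(2) p by simp
  have d: "cmod (local_deriv (gmap b T ^^ n) (Fin p)) < 1" using p0(3) by (simp add: p f_def)
  show ?thesis
    by (rule attraction_persists[OF b0 p0(1) reg pp gmap_local_deriv_iter[OF b0 reg] d close bs Ts that])
qed

text \<open>Scaling both multipliers by t < 1 moves the map into the bidisc, where one of the
  critical orbits tends to \<infinity>. Which one is unknown, so the bound of
  \<open>hyperbolic_critical_bounded\<close> is established for both.\<close>

lemma indifferent_not_hyperbolic:
  assumes a: "cmod a \<le> 1" and b: "cmod b = 1" and ab: "a * b \<noteq> 1"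
  shows "\<not> hyperbolic (fam a b)"
proof
  assume h: "hyperbolic (fam a b)"
  have b0: "b \<noteq> 0" using b by auto
  define u where "u x y = (x * y + y - 2)\<^sup>2 / (1 - x * y)" for x y :: complex
  define T where "T = csqrt (u a b)"
  have T: "T\<^sup>2 = u a b" by (simp add: T_def)
  obtain \<phi> where p: "conjugates \<phi> (fam a b) (gmap b T)" "\<phi> Infty = Infty"
    using fam_conj_gmap[OF b0 ab T[unfolded u_def]] .
  have hg: "hyperbolic (gmap b T)" by (rule conjugates_hyperbolic[OF p(1) fam_rational[OF ab] h])
  define t where "t j = 1 - 1 / real (j + 2)" for j
  have t: "0 < t j" "t j < 1" for j by (auto simp: t_def)
  have tl: "t \<longlonglongrightarrow> 1"
  proof -
    have "(\<lambda>n. 1 / real (n + 2)) \<longlonglongrightarrow> 0"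
      using LIMSEQ_ignore_initial_segment[OF lim_1_over_n, of 2] by simp
    from tendsto_diff[OF tendsto_const this, of 1] show ?thesis by (simp add: t_def[abs_def])
  qed
  define as bs where "as j = of_real (t j) * a" and "bs j = of_real (t j) * b" for j
  have tc: "(\<lambda>n. complex_of_real (t n)) \<longlonglongrightarrow> 1" using tendsto_of_real[OF tl] by simp
  have al: "as \<longlonglongrightarrow> a" and bl: "bs \<longlonglongrightarrow> b"
    using tendsto_mult[OF tc tendsto_const, of a] tendsto_mult[OF tc tendsto_const, of b]
    by (simp_all add: as_def[abs_def] bs_def[abs_def])
  have lt: "cmod (as j) < 1" "cmod (bs j) < 1" "bs j \<noteq> 0" for j
  proof -
    have "t j * cmod a \<le> t j" using mult_left_le[OF a, of "t j"] t[of j] by simp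
    moreover have "cmod (as j) = t j * cmod a" using t[of j] by (simp add: as_def norm_mult)
    ultimately show "cmod (as j) < 1" using t(2)[of j] by linarith
    show "cmod (bs j) < 1" "bs j \<noteq> 0"
      using t[of j] b0 b by (auto simp: bs_def norm_mult)
  qed
  have ul: "(\<lambda>j. u (as j) (bs j)) \<longlonglongrightarrow> T\<^sup>2"
    unfolding T u_def by (intro tendsto_intros al bl) (use ab in simp)
  obtain Ts where Ts: "Ts \<longlonglongrightarrow> T" "\<And>j. (Ts j)\<^sup>2 = u (as j) (bs j)" using sqrt_sequence[OF ul] by blast
  obtain M1 where M1: "eventually (\<lambda>j. \<forall>x. ((\<lambda>k. (gmap (bs j) (Ts j) ^^ k) (Fin 1)) \<longlonglongrightarrow> x) \<longrightarrow> x \<in> Fin ` cball 0 M1) sequentially"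
    by (rule hyperbolic_critical_bounded[OF b hg _ bl Ts(1), of 1]) auto
  obtain M2 where M2: "eventually (\<lambda>j. \<forall>x. ((\<lambda>k. (gmap (bs j) (Ts j) ^^ k) (Fin (-1))) \<longlonglongrightarrow> x) \<longrightarrow> x \<in> Fin ` cball 0 M2) sequentially"
    by (rule hyperbolic_critical_bounded[OF b hg _ bl Ts(1), of "-1"]) auto
  obtain j where j1: "\<forall>x. ((\<lambda>k. (gmap (bs j) (Ts j) ^^ k) (Fin 1)) \<longlonglongrightarrow> x) \<longrightarrow> x \<in> Fin ` cball 0 M1"
    and j2: "\<forall>x. ((\<lambda>k. (gmap (bs j) (Ts j) ^^ k) (Fin (-1))) \<longlonglongrightarrow> x) \<longrightarrow> x \<in> Fin ` cball 0 M2"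
    using eventually_conj[OF M1 M2] unfolding eventually_sequentially by blast
  have abj: "as j * bs j \<noteq> 1" by (rule norm_mult_lt_1[OF lt(1,2)])
  obtain \<psi> where s: "conjugates \<psi> (fam (as j) (bs j)) (gmap (bs j) (Ts j))" "\<psi> Infty = Infty"
    using fam_conj_gmap[OF lt(3) abj Ts(2)[of j, unfolded u_def]] .
  obtain c where c: "critical_point (fam (as j) (bs j)) c" "(\<lambda>k. (fam (as j) (bs j) ^^ k) c) \<longlonglongrightarrow> Infty"
    using fam_critical_to_Infty[OF lt(1,2)] .
  have l: "(\<lambda>k. (gmap (bs j) (Ts j) ^^ k) (\<psi> c)) \<longlonglongrightarrow> Infty" using conjugates_tendsto[OF s(1) c(2)] s(2) by simp
  have "critical_point (gmap (bs j) (Ts j)) (\<psi> c)" using conjugates_critical[OF s(1) fam_rational[OF abj]] c(1) by simp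
  then have "\<psi> c = Fin 1 \<or> \<psi> c = Fin (-1)" unfolding gmap_critical[OF lt(3)] .
  then show False
  proof
    assume "\<psi> c = Fin 1"
    then have "Infty \<in> Fin ` cball 0 M1" using j1 l by simp
    then show False by auto
  next
    assume "\<psi> c = Fin (-1)"
    then have "Infty \<in> Fin ` cball 0 M2" using j2 l by simp
    then show False by auto
  qed
qed

text \<open>A periodic critical point would survive the perturbation into \<open>\<^bold>H\<close>, where both critical
  orbits must converge to the fixed points near \<open>\<infinity>\<close>.\<close>
lemma critical_not_periodic:
  assumes T: "Re (T\<^sup>2) < 0" and n: "n > 0" and reg: "\<forall>i<n. (gfun 1 T ^^ i) (-1) \<noteq> 0"
  shows "(gfun 1 T ^^ n) (-1) \<noteq> -1"
proof
  assume per: "(gfun 1 T ^^ n) (-1) = -1"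
  have T0: "T \<noteq> 0" using T by auto
  define l where "l = 1 - T\<^sup>2"
  have l: "Re l > 1" using T by (simp add: l_def)
  obtain a where a: "a \<longlonglongrightarrow> 1" "\<And>j. cmod (a j) < 1" "\<And>j. l * a j \<noteq> 1" "\<And>j. conj_class (fam l (a j)) \<in> disc_classes"
    using parabolic_approximation[OF l] by metis
  define u where "u j = (l * a j + a j - 2)\<^sup>2 / (1 - l * a j)" for j
  have "u \<longlonglongrightarrow> (l * 1 + 1 - 2)\<^sup>2 / (1 - l * 1)"
    unfolding u_def[abs_def] by (intro tendsto_intros a(1)) (use T0 in \<open>simp add: l_def\<close>)
  moreover have "(l * 1 + 1 - 2)\<^sup>2 / (1 - l * 1) = T\<^sup>2" using T0 by (simp add: l_def power2_eq_square)
  ultimately have ul: "u \<longlonglongrightarrow> T\<^sup>2" by simp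
  obtain Ts where Ts: "Ts \<longlonglongrightarrow> T" "\<And>j. (Ts j)\<^sup>2 = u j" using sqrt_sequence[OF ul] by blast
  have one: "(1::complex) \<noteq> 0" by simp
  have d0: "local_deriv (gmap 1 T ^^ n) (Fin (-1)) = 0"
  proof -
    obtain m where m: "n = Suc m" using n by (cases n) auto
    have "local_deriv (gmap 1 T) (Fin (-1)) = 0" using gmap_critical[OF one, of T "Fin (-1)"] by (simp add: critical_point_def)
    moreover have "local_deriv ((gmap 1 T ^^ m) \<circ> gmap 1 T) (Fin (-1)) =
        local_deriv (gmap 1 T ^^ m) (gmap 1 T (Fin (-1))) * local_deriv (gmap 1 T) (Fin (-1))"
      by (rule holo_at_compose(2)[OF gmap_holo[OF one] holo_at_funpow[OF gmap_holo[OF one]]])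
    ultimately show ?thesis unfolding m funpow_Suc_right by simp
  qed
  have dn: "cmod (local_deriv (gmap 1 T ^^ n) (Fin (-1))) < 1" by (simp add: d0)
  have close: "\<exists>k. (\<forall>i<k. (gfun 1 T ^^ i) (-1) \<noteq> 0) \<and> dist ((gfun 1 T ^^ k) (-1)) (-1) < r" if "r > 0" for r
    using that by (intro exI[of _ 0]) simp
  obtain M where M: "eventually (\<lambda>j. \<forall>x. ((\<lambda>k. (gmap (a j) (Ts j) ^^ k) (Fin (-1))) \<longlonglongrightarrow> x) \<longrightarrow> x \<in> Fin ` cball 0 M) sequentially"
    by (rule attraction_persists[OF one n reg per gmap_local_deriv_iter[OF one reg] dn close a(1) Ts(1)])
  have "eventually (\<lambda>j. a j \<noteq> 0) sequentially" by (rule tendsto_imp_eventually_ne[OF a(1)]) simp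
  from eventually_conj[OF M this] obtain N where N: "\<And>j. j \<ge> N \<Longrightarrow> a j \<noteq> 0"
    "\<And>j. j \<ge> N \<Longrightarrow> \<forall>x. ((\<lambda>k. (gmap (a j) (Ts j) ^^ k) (Fin (-1))) \<longlonglongrightarrow> x) \<longrightarrow> x \<in> Fin ` cball 0 M"
    unfolding eventually_sequentially by blast
  \<comment> \<open>The attracting fixed point reached from -1 stays bounded. Bounded solutions of
    this equation tend to -1/T, the finite fixed point of the limit map, whose multiplier 1 - T^2
    has modulus above 1.\<close>
  have "\<exists>w. cmod w \<le> M \<and> (1 - a j) * w\<^sup>2 + Ts j * w + 1 = 0 \<and> w \<noteq> 0 \<and> cmod (1 - 1 / w\<^sup>2) < 1" if j: "j \<ge> N" for j
  proof -
    note aj = N(1)[OF j]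
    obtain \<psi> where s: "conjugates \<psi> (fam l (a j)) (gmap (a j) (Ts j))" "\<psi> Infty = Infty"
      using fam_conj_gmap[OF aj a(3) Ts(2)[of j, unfolded u_def]] .
    have fa: "fixed_attracted (gmap (a j) (Ts j))"
      by (rule conjugates_fixed_attracted[OF s(1) fam_rational[OF a(3)] disc_classes_fixed_attracted[OF a(4) fam_rational[OF a(3)]]])
    have "critical_point (gmap (a j) (Ts j)) (Fin (-1))" using gmap_critical[OF aj] by simp
    then obtain p where p: "gmap (a j) (Ts j) p = p" "cmod (local_deriv (gmap (a j) (Ts j)) p) < 1"
      "(\<lambda>k. (gmap (a j) (Ts j) ^^ k) (Fin (-1))) \<longlonglongrightarrow> p" using fa unfolding fixed_attracted_def by blast
    have "p \<in> Fin ` cball 0 M" using N(2)[OF j] p(3) by blast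
    then obtain w where w: "p = Fin w" "cmod w \<le> M" by auto
    have w0: "w \<noteq> 0" using p(1) gmap_simps[OF aj] w by auto
    have "w = (w + 1 / w + Ts j) / a j" using p(1) gmap_simps(3)[OF aj w0] w by (simp add: gfun_def)
    then have "a j * w\<^sup>2 = w\<^sup>2 + 1 + Ts j * w" using w0 aj by (simp add: field_simps power2_eq_square)
    then have e: "(1 - a j) * w\<^sup>2 + Ts j * w + 1 = 0" by (simp add: algebra_simps)
    have "cmod (1 - 1 / w\<^sup>2) / cmod (a j) < 1" using p(2) gmap_deriv(2)[OF aj w0] w by (simp add: norm_divide)
    then have "cmod (1 - 1 / w\<^sup>2) < cmod (a j)" using aj by (simp add: divide_less_eq)
    then show ?thesis using e w0 w(2) a(2)[of j] by (intro exI[of _ w]) linarith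
  qed
  then have "\<forall>j. \<exists>w. cmod w \<le> M \<and> (1 - a (j + N)) * w\<^sup>2 + Ts (j + N) * w + 1 = 0 \<and> w \<noteq> 0 \<and> cmod (1 - 1 / w\<^sup>2) < 1" by simp
  then obtain w where w: "\<And>j. cmod (w j) \<le> M" "\<And>j. (1 - a (j + N)) * (w j)\<^sup>2 + Ts (j + N) * w j + 1 = 0"
    "\<And>j. w j \<noteq> 0" "\<And>j. cmod (1 - 1 / (w j)\<^sup>2) < 1" by metis
  have al: "(\<lambda>j. a (j + N)) \<longlonglongrightarrow> 1" and Tl: "(\<lambda>j. Ts (j + N)) \<longlonglongrightarrow> T"
    by (rule LIMSEQ_ignore_initial_segment[OF a(1)], rule LIMSEQ_ignore_initial_segment[OF Ts(1)])
  have "(\<lambda>j. cmod (1 - a (j + N)) * M\<^sup>2) \<longlonglongrightarrow> cmod (1 - 1) * M\<^sup>2" by (intro tendsto_intros al)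
  then have z: "(\<lambda>j. cmod (1 - a (j + N)) * M\<^sup>2) \<longlonglongrightarrow> 0" by simp
  have "(\<lambda>j. (1 - a (j + N)) * (w j)\<^sup>2) \<longlonglongrightarrow> 0"
  proof (rule Lim_null_comparison[OF _ z], rule always_eventually, rule allI)
    fix j
    have "cmod (w j) ^ 2 \<le> M\<^sup>2" using w(1) by (intro power_mono) auto
    then show "norm ((1 - a (j + N)) * (w j)\<^sup>2) \<le> cmod (1 - a (j + N)) * M\<^sup>2"
      unfolding norm_mult norm_power by (rule mult_left_mono) simp
  qed
  from tendsto_minus[OF tendsto_add[OF this tendsto_const, of 1]]
  have "(\<lambda>j. - ((1 - a (j + N)) * (w j)\<^sup>2 + 1)) \<longlonglongrightarrow> - 1" by simp
  moreover have "- ((1 - a (j + N)) * (w j)\<^sup>2 + 1) = Ts (j + N) * w j" for j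
    using w(2)[of j] by (simp add: algebra_simps add_eq_0_iff)
  ultimately have "(\<lambda>j. Ts (j + N) * w j) \<longlonglongrightarrow> - 1" by simp
  from tendsto_divide[OF this Tl T0] have "(\<lambda>j. Ts (j + N) * w j / Ts (j + N)) \<longlonglongrightarrow> - 1 / T" .
  moreover have "eventually (\<lambda>j. Ts (j + N) * w j / Ts (j + N) = w j) sequentially"
    using tendsto_imp_eventually_ne[OF Tl T0] by eventually_elim simp
  ultimately have wl: "w \<longlonglongrightarrow> - 1 / T" by (rule Lim_transform_eventually)
  have "(\<lambda>j. cmod (1 - 1 / (w j)\<^sup>2)) \<longlonglongrightarrow> cmod (1 - 1 / (- 1 / T)\<^sup>2)"
    by (intro tendsto_intros wl) (use T0 in simp)
  then have "cmod (1 - 1 / (- 1 / T)\<^sup>2) \<le> 1"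
    by (rule LIMSEQ_le_const2) (use w(4) in \<open>auto intro!: less_imp_le\<close>)
  moreover have "1 - 1 / (- 1 / T)\<^sup>2 = l" using T0 by (simp add: l_def power2_eq_square)
  ultimately show False using l complex_Re_le_cmod[of l] by simp
qed

section \<open>Julia sets\<close>

lemma Fatou_backward:
  assumes c: "\<And>y. isCont f y" and x: "f x \<in> Fatou_set f"
  shows "x \<in> Fatou_set f"
proof -
  obtain U where U: "open U" "f x \<in> U" "normal_on U (range (\<lambda>n. f ^^ n))"
    using x by (auto simp: Fatou_set_def)
  define V where "V = f -` U"
  have V: "open V" "x \<in> V"
    unfolding V_def using U(1,2) by (auto intro!: open_vimage simp: c continuous_at_imp_continuous_on)
  have "normal_on V (range (\<lambda>n. f ^^ n))"
    unfolding normal_on_def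
  proof (intro allI impI)
    fix t :: "nat \<Rightarrow> riemann_sphere \<Rightarrow> riemann_sphere"
    assume "range t \<subseteq> range (\<lambda>n. f ^^ n)"
    then have "\<forall>k. \<exists>m. t k = f ^^ m" by auto
    then obtain m where m: "\<And>k. t k = f ^^ m k" by metis
    show "\<exists>r g. strict_mono r \<and> (\<forall>K. compact K \<and> K \<subseteq> V \<longrightarrow> uniform_limit K (t \<circ> r) g sequentially)"
    \<comment> \<open>The identity is the one iterate not written as an iterate after f: infinitely
      many copies form a constant subsequence, finitely many are dropped.\<close>
    proof (cases "infinite {k. m k = 0}")
      case True
      then obtain r :: "nat \<Rightarrow> nat" where r: "strict_mono r" "\<And>n. r n \<in> {k. m k = 0}"
        using infinite_enumerate by blast
      have "t \<circ> r = (\<lambda>n. id)" using r(2) m by (auto simp: fun_eq_iff)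
      then have "uniform_limit K (t \<circ> r) id sequentially" for K by (simp add: uniform_limit_const)
      then show ?thesis using r(1) by blast
    next
      case False
      then have "finite {k. m k = 0}" by simp
      then obtain N where "\<forall>k\<in>{k. m k = 0}. k < N" unfolding finite_nat_set_iff_bounded by blast
      then have N: "\<And>k. m k = 0 \<Longrightarrow> k < N" by blast
      have pos: "m (k + N) > 0" for k using N[of "k + N"] by (cases "m (k + N)") auto
      define s where "s k = f ^^ (m (k + N) - 1)" for k
      have s: "t (k + N) y = s k (f y)" for k y
      proof -
        have "m (k + N) = Suc (m (k + N) - 1)" using pos[of k] by simp
        then show ?thesis unfolding m s_def by (metis comp_apply funpow_Suc_right)
      qed
      have "range s \<subseteq> range (\<lambda>n. f ^^ n)" by (auto simp: s_def)
      then obtain r g where r: "strict_mono r" and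
        g: "\<And>K. compact K \<Longrightarrow> K \<subseteq> U \<Longrightarrow> uniform_limit K (s \<circ> r) g sequentially"
        using U(3) unfolding normal_on_def by meson
      show ?thesis
      proof (intro exI conjI allI impI)
        show "strict_mono (\<lambda>n. r n + N)" using r by (auto simp: strict_mono_def)
        fix K assume K: "compact K \<and> K \<subseteq> V"
        have "compact (f ` K)"
          using K by (intro compact_continuous_image continuous_at_imp_continuous_on) (auto simp: c)
        moreover have "f ` K \<subseteq> U" using K by (auto simp: V_def)
        ultimately have u: "uniform_limit (f ` K) (s \<circ> r) g sequentially" by (rule g)
        show "uniform_limit K (t \<circ> (\<lambda>n. r n + N)) (g \<circ> f) sequentially"
        proof (rule uniform_limitI)
          fix e :: real assume "e > 0"
          from uniform_limitD[OF u this]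
          show "\<forall>\<^sub>F n in sequentially. \<forall>y\<in>K. dist ((t \<circ> (\<lambda>n. r n + N)) n y) ((g \<circ> f) y) < e"
            by eventually_elim (simp add: s)
        qed
      qed
    qed
  qed
  then show ?thesis using V unfolding Fatou_set_def by blast
qed

lemma Julia_forward:
  "(\<And>y. isCont f y) \<Longrightarrow> x \<in> Julia_set f \<Longrightarrow> f x \<in> Julia_set f"
  unfolding Julia_set_def using Fatou_backward by auto

text \<open>A continuous limit of iterates near x would be \<open>Infty\<close> at x, yet by uniform
  convergence close to \<open>Fin w\<close> at points tending to x. Iterates are counted from 1 so
  that x = 0, a preimage of \<infinity>, is covered.\<close>

lemma Julia_by_backward_orbit:
  assumes h: "\<And>k. (f ^^ Suc k) x = Infty" and y: "y \<longlonglongrightarrow> x" and fy: "\<And>k. (f ^^ Suc k) (y k) = Fin w"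
    and c: "\<And>y. isCont f y"
  shows "x \<in> Julia_set f"
proof (rule ccontr)
  assume "x \<notin> Julia_set f"
  then obtain U where U: "open U" "x \<in> U" "normal_on U (range (\<lambda>n. f ^^ n))"
    by (auto simp: Julia_set_def Fatou_set_def)
  have "range (\<lambda>k. f ^^ Suc k) \<subseteq> range (\<lambda>n. f ^^ n)" by blast
  then obtain r g where r: "strict_mono r" and
     g: "\<And>K. compact K \<Longrightarrow> K \<subseteq> U \<Longrightarrow> uniform_limit K ((\<lambda>k. f ^^ Suc k) \<circ> r) g sequentially"
    using U(3) unfolding normal_on_def by meson
  obtain d where d: "d > 0" "cball x d \<subseteq> U"
    using U(1,2) unfolding open_contains_cball by blast
  define K where "K = cball x d"
  have "eventually (\<lambda>k. dist (y k) x < d) sequentially" by (rule tendstoD[OF y d(1)])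
  then obtain N where N: "\<And>k. k \<ge> N \<Longrightarrow> dist (y k) x < d"
    unfolding eventually_sequentially by blast
  have "compact K"
    using compact_Int_closed[OF compact_sphere closed_cball[of x d]] by (simp add: K_def)
  moreover have "K \<subseteq> U" unfolding K_def by (rule d(2))
  ultimately have u: "uniform_limit K ((\<lambda>k. f ^^ Suc k) \<circ> r) g sequentially" by (rule g)
  have ct: "continuous_on K (f ^^ n)" for n
  proof (induction n)
    case 0 then show ?case by (simp add: continuous_on_id id_def)
  next
    case (Suc n)
    have "continuous_on UNIV f" using c by (simp add: continuous_at_imp_continuous_on)
    then show ?case using continuous_on_compose[OF Suc] continuous_on_subset by (metis funpow.simps(2) subset_UNIV)
  qed
  have gc: "continuous_on K g"
    by (rule uniform_limit_theorem[OF _ u]) (auto simp: ct simp del: funpow.simps)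
  have xK: "x \<in> K" using d(1) by (simp add: K_def)
  have "(\<lambda>n. ((\<lambda>k. f ^^ Suc k) \<circ> r) n x) \<longlonglongrightarrow> g x" by (rule tendsto_uniform_limitI[OF u xK])
  then have "(\<lambda>n. Infty) \<longlonglongrightarrow> g x" by (simp only: comp_apply h)
  then have gx: "g x = Infty" using LIMSEQ_unique tendsto_const by metis
  have yl: "(\<lambda>n. y (r n)) \<longlonglongrightarrow> x" using LIMSEQ_subseq_LIMSEQ[OF y r] by (simp only: comp_def)
  have inK: "y (r n) \<in> K" if "n \<ge> N" for n
  proof -
    have "N \<le> r n" using that seq_suble[OF r, of n] by linarith
    from N[OF this] show ?thesis unfolding K_def by (simp add: dist_commute)
  qed
  have "(\<lambda>n. g (y (r n))) \<longlonglongrightarrow> g x"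
    by (rule continuous_on_tendsto_compose[OF gc yl xK])
       (use inK in \<open>auto simp: eventually_sequentially\<close>)
  then have l: "(\<lambda>n. dist (g (y (r n))) Infty) \<longlonglongrightarrow> 0" unfolding gx by (rule tendsto_dist_iff[THEN iffD1])
  define e where "e = dist (Fin w) Infty"
  have e: "e > 0" by (simp add: e_def)
  have "eventually (\<lambda>n. dist (g (y (r n))) Infty < e / 2) sequentially"
    using order_tendstoD(2)[OF l, of "e / 2"] e by simp
  moreover have "eventually (\<lambda>n. \<forall>y\<in>K. dist (((\<lambda>k. f ^^ Suc k) \<circ> r) n y) (g y) < e / 2) sequentially"
    using uniform_limitD[OF u, of "e / 2"] e by simp
  moreover have "eventually (\<lambda>n. n \<ge> N) sequentially" by (rule eventually_ge_at_top)
  ultimately have "eventually (\<lambda>n. False) sequentially"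
  proof eventually_elim
    case (elim n)
    have "dist ((f ^^ Suc (r n)) (y (r n))) (g (y (r n))) < e / 2"
      using bspec[OF elim(2) inK[OF elim(3)]] by (simp only: comp_apply)
    then have "dist (Fin w) (g (y (r n))) < e / 2" unfolding fy .
    then have "dist (Fin w) Infty < e"
      using elim(1) dist_triangle_half_r[of "g (y (r n))" "Fin w" e Infty] by (simp add: dist_commute)
    then show ?case by (simp add: e_def)
  qed
  then show False by simp
qed

lemma G1_inverse: "gfun 1 T (1 / z) = gfun 1 T z"
  by (simp add: G1)

text \<open>The two preimages are mutually inverse, so one of them lies outside the open unit
  disc.\<close>

lemma G1_preimage:
  obtains z where "z \<noteq> 0" "gfun 1 T z = w" "cmod z \<ge> 1"
proof -
  define s where "s = csqrt ((w - T)\<^sup>2 - 4)"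
  define z1 z2 where "z1 = ((w - T) + s) / 2" and "z2 = ((w - T) - s) / 2"
  have "z1 * z2 = ((w - T)\<^sup>2 - s\<^sup>2) / 4" by (simp add: z1_def z2_def field_simps power2_eq_square)
  then have p: "z1 * z2 = 1" by (simp add: s_def)
  have s: "z1 + z2 = w - T" by (simp add: z1_def z2_def field_simps)
  have nz: "z1 \<noteq> 0" "z2 \<noteq> 0" using p by auto
  have "1 / z1 = z2" "1 / z2 = z1" using p nz by (simp_all add: field_simps)
  then have g: "gfun 1 T z1 = w" "gfun 1 T z2 = w" using s by (simp_all add: G1 algebra_simps)
  have "cmod z1 * cmod z2 = 1" using p by (metis norm_mult norm_one)
  then have "cmod z1 \<ge> 1 \<or> cmod z2 \<ge> 1"
    by (metis mult_strict_mono' norm_ge_zero not_le mult_1 less_irrefl)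
  then show ?thesis using that nz g by blast
qed

text \<open>Along the branch of the inverse with values outside the unit disc the imaginary part drops by at least
  \<open>Im T\<close> once it is nonpositive: this is the repelling direction at \<open>\<infinity>\<close>.\<close>
lemma backward_orbit:
  assumes T: "Im T > 0"
  obtains X where "\<And>k. X k \<noteq> 0" "\<And>k. gfun 1 T (X (Suc k)) = X k" "filterlim X at_infinity sequentially"
proof -
  have step: "\<exists>z'. (z' \<noteq> 0 \<and> Im z' < 0) \<and> gfun 1 T z' = z \<and> Im z' < Im z - Im T" if z: "z \<noteq> 0 \<and> Im z < 0" for z
  proof -
    obtain z' where z': "z' \<noteq> 0" "gfun 1 T z' = z" "cmod z' \<ge> 1" using G1_preimage .
    have m: "1 \<le> (cmod z')\<^sup>2" using z'(3) by (rule one_le_power)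
    have "Im z' - Im z' / (cmod z')\<^sup>2 + Im T = Im z" using z'(2) by (auto simp: G1 Im_one_over)
    then have e: "Im z' - Im z' / (cmod z')\<^sup>2 = Im z - Im T" by simp
    have neg: "Im z' < 0"
    proof (rule ccontr)
      assume "\<not> ?thesis"
      then have "Im z' / (cmod z')\<^sup>2 \<le> Im z'" using m by (simp add: divide_le_eq mult_left_le) (metis mult_left_mono mult.right_neutral not_less)
      then show False using e z T by linarith
    qed
    moreover have "(cmod z')\<^sup>2 > 0" using m by linarith
    ultimately have "Im z' / (cmod z')\<^sup>2 < 0" by (rule divide_neg_pos)
    then have "Im z' < Im z - Im T" using e by linarith
    then show ?thesis using neg z' by blast
  qed
  define X where "X = rec_nat (- \<i>) (\<lambda>_ z. SOME z'. (z' \<noteq> 0 \<and> Im z' < 0) \<and> gfun 1 T z' = z \<and> Im z' < Im z - Im T)"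
  have XS: "X (Suc k) = (SOME z'. (z' \<noteq> 0 \<and> Im z' < 0) \<and> gfun 1 T z' = X k \<and> Im z' < Im (X k) - Im T)" for k
    by (simp add: X_def)
  have X: "X k \<noteq> 0 \<and> Im (X k) < 0" for k
  proof (induction k)
    case 0 then show ?case by (simp add: X_def)
  next
    case (Suc k)
    then show ?case using someI_ex[OF step[OF Suc]] unfolding XS by blast
  qed
  have X2: "gfun 1 T (X (Suc k)) = X k" "Im (X (Suc k)) < Im (X k) - Im T" for k
    using someI_ex[OF step[OF X[of k]]] unfolding XS by blast+
  have lin: "Im (X k) \<le> - (of_nat k * Im T)" for k
  proof (induction k)
    case 0 then show ?case using X[of 0] by simp
  next
    case (Suc k) then show ?case using X2(2)[of k] by (simp add: algebra_simps)
  qed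
  have "filterlim (\<lambda>k. real k * Im T) at_top sequentially"
    by (rule filterlim_at_top_mult_tendsto_pos[OF tendsto_const T filterlim_real_sequentially])
  then have "filterlim (\<lambda>k. cmod (X k)) at_top sequentially"
  proof (rule filterlim_at_top_mono, intro always_eventually allI)
    fix k show "real k * Im T \<le> cmod (X k)" using lin[of k] abs_Im_le_cmod[of "X k"] by linarith
  qed
  then have "filterlim X at_infinity sequentially" unfolding filterlim_at_infinity_conv_norm_at_top .
  then show ?thesis using that X X2(1) by blast
qed

lemma gmap_cont: "b \<noteq> 0 \<Longrightarrow> isCont (gmap b T) y"
  by (rule rational_maps_2_cont[OF gmap_rational])

text \<open>0 is the other preimage of \<infinity>. Inverting a backward orbit that tends to
  \<infinity> gives points that tend to 0 and have the same images.\<close>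

lemma Julia_Infty_zero:
  assumes T: "Im T > 0"
  shows "Infty \<in> Julia_set (gmap 1 T)" "Fin 0 \<in> Julia_set (gmap 1 T)"
proof -
  have one: "(1::complex) \<noteq> 0" by simp
  obtain X where X: "\<And>k. X k \<noteq> 0" "\<And>k. gfun 1 T (X (Suc k)) = X k" "filterlim X at_infinity sequentially"
    using backward_orbit[OF T] by blast
  have orb: "(gmap 1 T ^^ k) (Fin (X k)) = Fin (X 0)" for k
  proof (induction k)
    case (Suc k)
    then show ?case unfolding funpow_Suc_right comp_apply gmap_simps(3)[OF one X(1)] X(2) .
  qed simp
  have XS: "filterlim (\<lambda>k. X (Suc k)) at_infinity sequentially"
    using X(3) by (simp add: filterlim_sequentially_Suc)
  show "Infty \<in> Julia_set (gmap 1 T)"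
  proof (rule Julia_by_backward_orbit[OF _ _ _ gmap_cont[OF one]])
    show "(gmap 1 T ^^ Suc k) Infty = Infty" for k by (rule gmap_funpow_Infty[OF one])
    show "(\<lambda>k. Fin (X (Suc k))) \<longlonglongrightarrow> Infty" unfolding tendsto_Infty_iff by (rule XS)
    show "(gmap 1 T ^^ Suc k) (Fin (X (Suc k))) = Fin (X 0)" for k by (rule orb)
  qed
  show "Fin 0 \<in> Julia_set (gmap 1 T)"
  proof (rule Julia_by_backward_orbit[OF _ _ _ gmap_cont[OF one]])
    show "(gmap 1 T ^^ Suc k) (Fin 0) = Infty" for k
      unfolding funpow_Suc_right comp_apply gmap_simps(2)[OF one] by (rule gmap_funpow_Infty[OF one])
    have "(\<lambda>k. inverse (X (Suc k))) \<longlonglongrightarrow> 0" by (rule filterlim_compose[OF tendsto_inverse_0 XS])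
    then show "(\<lambda>k. Fin (1 / X (Suc k))) \<longlonglongrightarrow> Fin 0" by (intro tendsto_Fin) (simp add: inverse_eq_divide)
    show "(gmap 1 T ^^ Suc k) (Fin (1 / X (Suc k))) = Fin (X 0)" for k
    proof -
      have nz: "1 / X (Suc k) \<noteq> 0" using X(1) by simp
      show ?thesis
        unfolding funpow_Suc_right comp_apply gmap_simps(3)[OF one nz] G1_inverse X(2) by (rule orb)
    qed
  qed
qed

section \<open>The parabolic basin\<close>

text \<open>An attracting petal at \<infinity>: above height 2 / Im T the term 1/z costs at most
  half of the gain Im T per step.\<close>

definition upper :: "complex \<Rightarrow> complex set" where
  "upper T = {z. Im z > 2 / Im T}"

text \<open>0 is excluded because \<open>gfun 1 T\<close> has the default value T there, while the
  map sends it to the parabolic point \<infinity>.\<close>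

primrec basin_n :: "complex \<Rightarrow> nat \<Rightarrow> complex set" where
  "basin_n T 0 = upper T"
| "basin_n T (Suc n) = {z. z \<noteq> 0 \<and> gfun 1 T z \<in> basin_n T n}"

definition basin :: "complex \<Rightarrow> complex set" where
  "basin T = (\<Union>n. basin_n T n)"

lemma upper_step:
  assumes T: "Im T > 0" and z: "z \<in> upper T"
  shows "z \<noteq> 0" "Im (gfun 1 T z) \<ge> Im z + Im T / 2"
proof -
  have z': "Im z > 2 / Im T" "Im z > 0" using T z by (auto simp: upper_def intro: less_trans[rotated])
  then show z0: "z \<noteq> 0" by auto
  have "(Im z)\<^sup>2 \<le> (cmod z)\<^sup>2" by (simp add: cmod_power2)
  then have "Im z / (cmod z)\<^sup>2 \<le> Im z / (Im z)\<^sup>2" using z' by (intro frac_le) auto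
  also have "\<dots> = 1 / Im z" using z' by (simp add: power2_eq_square)
  also have "\<dots> \<le> Im T / 2" using z' T by (simp add: field_simps)
  finally show "Im (gfun 1 T z) \<ge> Im z + Im T / 2" by (simp add: G1 Im_one_over)
qed

lemma upper_invariant: "Im T > 0 \<Longrightarrow> z \<in> upper T \<Longrightarrow> gfun 1 T z \<in> upper T"
  using upper_step(2)[of T z] by (simp add: upper_def)

lemma basin_step:
  assumes "Im T > 0" "z \<in> basin T"
  shows "z \<noteq> 0" "gfun 1 T z \<in> basin T"
proof -
  obtain n where n: "z \<in> basin_n T n" using assms(2) by (auto simp: basin_def)
  have "z \<noteq> 0 \<and> gfun 1 T z \<in> basin T"
  proof (cases n)
    case 0
    then have "z \<in> upper T" using n by simp
    then have "gfun 1 T z \<in> basin_n T 0" "z \<noteq> 0" using upper_invariant upper_step(1) assms(1) by auto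
    then show ?thesis unfolding basin_def by blast
  next
    case (Suc m)
    then have "gfun 1 T z \<in> basin_n T m" "z \<noteq> 0" using n by auto
    then show ?thesis unfolding basin_def by blast
  qed
  then show "z \<noteq> 0" "gfun 1 T z \<in> basin T" by auto
qed

lemma basin_preimage: "z \<noteq> 0 \<Longrightarrow> gfun 1 T z \<in> basin T \<Longrightarrow> z \<in> basin T"
proof -
  assume z: "z \<noteq> 0" "gfun 1 T z \<in> basin T"
  then obtain n where "gfun 1 T z \<in> basin_n T n" by (auto simp: basin_def)
  then have "z \<in> basin_n T (Suc n)" using z by simp
  then show "z \<in> basin T" unfolding basin_def by blast
qed

lemma upper_subset_basin: "upper T \<subseteq> basin T"
proof -
  have "basin_n T 0 \<subseteq> basin T" unfolding basin_def by blast
  then show ?thesis by simp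
qed

lemma open_upper: "open (upper T)"
  unfolding upper_def by (intro open_Collect_less continuous_intros)

lemma G1_continuous: "continuous_on (- {0}) (gfun 1 T)"
  unfolding gfun_def[abs_def] by (intro continuous_intros) auto

lemma open_G1_preimage: "open V \<Longrightarrow> open {z. z \<noteq> 0 \<and> gfun 1 T z \<in> V}"
proof -
  assume "open V"
  then have "open (gfun 1 T -` V \<inter> - {0})"
    using continuous_on_open_vimage[of "- {0}" "gfun 1 T"] G1_continuous by blast
  also have "gfun 1 T -` V \<inter> - {0} = {z. z \<noteq> 0 \<and> gfun 1 T z \<in> V}" by auto
  finally show ?thesis .
qed

lemma open_basin: "open (basin T)"
proof -
  have "open (basin_n T n)" for n
    by (induction n) (simp_all add: open_upper open_G1_preimage)
  then show ?thesis unfolding basin_def by blast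
qed

lemma G1_funpow_basin:
  assumes "\<And>i. i < k \<Longrightarrow> (gfun 1 T ^^ i) z \<noteq> 0" "(gfun 1 T ^^ k) z \<in> basin T"
  shows "z \<in> basin T"
  using assms
proof (induction k)
  case (Suc k)
  from Suc.prems(2) have "gfun 1 T ((gfun 1 T ^^ k) z) \<in> basin T" by simp
  then have "(gfun 1 T ^^ k) z \<in> basin T" using Suc.prems(1)[of k] basin_preimage by simp
  then show ?case using Suc by simp
qed simp

text \<open>Once |z| \<ge> 2 / Im T, each step raises the imaginary part by at least Im T / 2, in
  whatever direction the orbit escapes; so it ends up in \<open>upper T\<close>.\<close>

lemma escaping_in_basin:
  assumes T: "Im T > 0" and nz: "\<And>i. (gfun 1 T ^^ i) z \<noteq> 0"
    and l: "filterlim (\<lambda>k. (gfun 1 T ^^ k) z) at_infinity sequentially"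
  shows "z \<in> basin T"
proof -
  define y where "y k = (gfun 1 T ^^ k) z" for k
  have "filterlim (\<lambda>k. cmod (y k)) at_top sequentially"
    using l unfolding filterlim_at_infinity_conv_norm_at_top y_def .
  then have "eventually (\<lambda>k. 2 / Im T \<le> cmod (y k)) sequentially" unfolding filterlim_at_top by blast
  then obtain N where N: "\<And>k. k \<ge> N \<Longrightarrow> 2 / Im T \<le> cmod (y k)" unfolding eventually_sequentially by blast
  have step: "Im (y (Suc k)) \<ge> Im (y k) + Im T / 2" if k: "k \<ge> N" for k
  proof -
    have yk: "cmod (y k) > 0" using nz[of k] by (simp add: y_def)
    have "cmod (1 / y k) \<le> Im T / 2" using N[OF k] T yk by (simp add: norm_divide field_simps)
    then have "\<bar>Im (1 / y k)\<bar> \<le> Im T / 2" using abs_Im_le_cmod[of "1 / y k"] by linarith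
    moreover have "Im (y (Suc k)) = Im (y k) + Im (1 / y k) + Im T" by (simp add: y_def G1)
    ultimately show ?thesis by linarith
  qed
  have lin: "Im (y (N + j)) \<ge> Im (y N) + real j * (Im T / 2)" for j
  proof (induction j)
    case (Suc j)
    moreover have "real (Suc j) * (Im T / 2) = real j * (Im T / 2) + Im T / 2" by (simp add: field_simps)
    moreover have "Im (y (N + Suc j)) \<ge> Im (y (N + j)) + Im T / 2" using step[of "N + j"] by simp
    ultimately show ?case by linarith
  qed simp
  obtain j where j: "(2 / Im T - Im (y N)) / (Im T / 2) < real j" using reals_Archimedean2 by blast
  then have "2 / Im T < Im (y N) + real j * (Im T / 2)" using T by (simp add: field_simps)
  then have "y (N + j) \<in> upper T" using lin[of j] by (simp add: upper_def)
  then show ?thesis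
    using G1_funpow_basin[of "N + j" T z] nz upper_subset_basin by (auto simp: y_def)
qed

lemma right_half_plane_basin:
  assumes "Im T > 0" "Re T \<ge> 0" "Re z > 0"
  shows "z \<in> basin T"
proof (rule escaping_in_basin[OF assms(1)])
  show "(gfun 1 T ^^ i) z \<noteq> 0" for i using half_plane_orbit(1)[OF assms(2,3), of i] by auto
  show "filterlim (\<lambda>k. (gfun 1 T ^^ k) z) at_infinity sequentially" by (rule half_plane_orbit(2)[OF assms(2,3)])
qed

text \<open>Reduces Re T \<le> 0 to Re T \<ge> 0 by reflection in the imaginary axis.\<close>

lemma G1_reflect: "gfun 1 (- cnj T) (- cnj z) = - cnj (gfun 1 T z)"
  by (simp add: G1)

lemma basin_reflect: "z \<in> basin T \<Longrightarrow> - cnj z \<in> basin (- cnj T)"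
proof -
  have *: "z \<in> basin_n T n \<Longrightarrow> - cnj z \<in> basin_n (- cnj T) n" for n
  proof (induction n arbitrary: z)
    case 0
    then show ?case by (simp add: upper_def)
  next
    case (Suc n)
    then show ?case using Suc.IH[of "gfun 1 T z"] by (simp add: G1_reflect)
  qed
  assume "z \<in> basin T"
  then show "- cnj z \<in> basin (- cnj T)" unfolding basin_def using * by blast
qed

lemma left_half_plane_basin:
  assumes "Im T > 0" "Re T \<le> 0" "Re z < 0"
  shows "z \<in> basin T"
proof -
  have "- cnj z \<in> basin (- cnj T)" using assms by (intro right_half_plane_basin) auto
  from basin_reflect[OF this] show ?thesis by simp
qed

section \<open>The basin: Fatou points, preimage components, connectedness\<close>

text \<open>A sequence of iterates either repeats one exponent infinitely often or has exponents
  tending to infinity.\<close>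

lemma normal_onI_uniform:
  assumes u: "\<And>K. compact K \<Longrightarrow> K \<subseteq> U \<Longrightarrow> uniform_limit K (\<lambda>n. f ^^ n) g sequentially"
  shows "normal_on U (range (\<lambda>n. f ^^ n))"
  unfolding normal_on_def
proof (intro allI impI)
  fix t :: "nat \<Rightarrow> riemann_sphere \<Rightarrow> riemann_sphere"
  assume "range t \<subseteq> range (\<lambda>n. f ^^ n)"
  then have "\<forall>k. \<exists>m. t k = f ^^ m" by auto
  then obtain m where m: "\<And>k. t k = f ^^ m k" by metis
  show "\<exists>r g. strict_mono r \<and> (\<forall>K. compact K \<and> K \<subseteq> U \<longrightarrow> uniform_limit K (t \<circ> r) g sequentially)"
  proof (cases "\<exists>v. infinite {k. m k = v}")
    case True
    then obtain v where "infinite {k. m k = v}" by blast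
    then obtain r :: "nat \<Rightarrow> nat" where r: "strict_mono r" "\<And>n. r n \<in> {k. m k = v}"
      using infinite_enumerate by blast
    have "t \<circ> r = (\<lambda>n. f ^^ v)" using r(2) m by (auto simp: fun_eq_iff)
    then have "uniform_limit K (t \<circ> r) (f ^^ v) sequentially" for K by (simp add: uniform_limit_const)
    then show ?thesis using r(1) by blast
  next
    case False
    have "filterlim m at_top sequentially"
      unfolding filterlim_at_top
    proof
      fix Z
      have "finite (\<Union>v\<in>{..<Z}. {k. m k = v})" using False by (intro finite_UN_I) auto
      moreover have "(\<Union>v\<in>{..<Z}. {k. m k = v}) = {k. m k < Z}" by auto
      ultimately have "finite {k. \<not> Z \<le> m k}" by (simp add: not_le)
      then show "eventually (\<lambda>k. Z \<le> m k) sequentially"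
        unfolding cofinite_eq_sequentially[symmetric] eventually_cofinite .
    qed
    show ?thesis
    proof (intro exI conjI allI impI)
      show "strict_mono (\<lambda>n::nat. n)" by (simp add: strict_mono_def)
      fix K assume K: "compact K \<and> K \<subseteq> U"
      show "uniform_limit K (t \<circ> (\<lambda>n. n)) g sequentially"
      proof (rule uniform_limitI)
        fix e :: real assume "e > 0"
        have "uniform_limit K (\<lambda>n. f ^^ n) g sequentially" using K u by blast
        from uniform_limitD[OF this \<open>e > 0\<close>]
        have "eventually (\<lambda>n. \<forall>x\<in>K. dist ((f ^^ n) x) (g x) < e) sequentially" .
        from eventually_compose_filterlim[OF this \<open>filterlim m at_top sequentially\<close>]
        show "\<forall>\<^sub>F n in sequentially. \<forall>x\<in>K. dist ((t \<circ> (\<lambda>n. n)) n x) (g x) < e" by (simp add: m)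
      qed
    qed
  qed
qed

lemma basin_Fatou:
  assumes T: "Im T > 0" and z: "z \<in> basin T"
  shows "Fin z \<in> Fatou_set (gmap 1 T)"
proof -
  have one: "(1::complex) \<noteq> 0" by simp
  have up: "Fin z \<in> Fatou_set (gmap 1 T)" if z: "z \<in> upper T" for z
  proof -
    have "normal_on (Fin ` upper T) (range (\<lambda>n. gmap 1 T ^^ n))"
    proof (rule normal_onI_uniform[where g = "\<lambda>_. Infty"])
      fix K assume "compact K" and K: "K \<subseteq> Fin ` upper T"
      show "uniform_limit K (\<lambda>n. gmap 1 T ^^ n) (\<lambda>_. Infty) sequentially"
      proof (rule uniform_limitI)
        fix e :: real assume "e > 0"
        have "((\<lambda>z. Fin z) \<longlongrightarrow> Infty) at_infinity" unfolding tendsto_Infty_iff by (rule filterlim_ident)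
        from tendstoD[OF this \<open>e > 0\<close>] obtain B where B: "\<And>z. cmod z \<ge> B \<Longrightarrow> dist (Fin z) Infty < e"
          unfolding eventually_at_infinity by blast
        obtain N :: nat where N: "B / (Im T / 2) < real N" using reals_Archimedean2 by blast
        have "\<forall>x\<in>K. dist ((gmap 1 T ^^ n) x) Infty < e" if n: "n \<ge> N" for n
        proof
          fix x assume "x \<in> K"
          then obtain w where w: "x = Fin w" "w \<in> upper T" using K by auto
          have orb: "(gfun 1 T ^^ k) w \<in> upper T \<and> Im ((gfun 1 T ^^ k) w) \<ge> Im w + real k * (Im T / 2)" for k
          proof (induction k)
            case 0 then show ?case using w by simp
          next
            case (Suc k)
            have "real (Suc k) * (Im T / 2) = real k * (Im T / 2) + Im T / 2" by (simp add: field_simps)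
            moreover have "(gfun 1 T ^^ Suc k) w \<in> upper T" "Im ((gfun 1 T ^^ Suc k) w) \<ge> Im ((gfun 1 T ^^ k) w) + Im T / 2"
              using Suc upper_invariant[OF T, of "(gfun 1 T ^^ k) w"] upper_step(2)[OF T, of "(gfun 1 T ^^ k) w"] by simp_all
            ultimately show ?case using Suc by linarith
          qed
          have nz: "(gfun 1 T ^^ k) w \<noteq> 0" for k using orb[of k] upper_step(1)[OF T] by blast
          have "Im w > 0" using w(2) T by (auto simp: upper_def intro: less_trans[rotated])
          then have "Im ((gfun 1 T ^^ n) w) \<ge> real n * (Im T / 2)" using orb[of n] by linarith
          moreover have "real N * (Im T / 2) \<le> real n * (Im T / 2)" using n T by (intro mult_right_mono) auto
          moreover have "B < real N * (Im T / 2)" using N T by (simp add: field_simps)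
          ultimately have "cmod ((gfun 1 T ^^ n) w) \<ge> B" using abs_Im_le_cmod[of "(gfun 1 T ^^ n) w"] by linarith
          from B[OF this] show "dist ((gmap 1 T ^^ n) x) Infty < e"
            using gmap_orbit[OF one, of n T w] nz w by simp
        qed
        then show "\<forall>\<^sub>F n in sequentially. \<forall>x\<in>K. dist ((gmap 1 T ^^ n) x) Infty < e"
          unfolding eventually_sequentially by blast
      qed
    qed
    moreover have "open (Fin ` upper T)" by (rule open_Fin_image[OF open_upper])
    ultimately show ?thesis using z unfolding Fatou_set_def by blast
  qed
  have "z \<in> basin_n T n \<Longrightarrow> Fin z \<in> Fatou_set (gmap 1 T)" for n
  proof (induction n arbitrary: z)
    case 0 then show ?case using up by simp
  next
    case (Suc n)
    then have "z \<noteq> 0" "Fin (gfun 1 T z) \<in> Fatou_set (gmap 1 T)" by auto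
    then have "gmap 1 T (Fin z) \<in> Fatou_set (gmap 1 T)" using gmap_simps(3)[OF one] by simp
    then show ?case by (rule Fatou_backward[OF gmap_cont[OF one]])
  qed
  then show ?thesis using z unfolding basin_def by blast
qed

lemma G1_nonconstant:
  assumes "open V" "V \<noteq> {}" "0 \<notin> V"
  shows "\<not> gfun 1 T constant_on V"
proof
  assume "gfun 1 T constant_on V"
  then obtain c where c: "\<And>y. y \<in> V \<Longrightarrow> gfun 1 T y = c" by (auto simp: constant_on_def)
  have "V \<subseteq> {y. poly [:1, T - c, 1:] y = 0}"
  proof
    fix y assume y: "y \<in> V"
    then have y0: "y \<noteq> 0" using assms(3) by auto
    have "y + 1 / y + T = c" using c[OF y] by (simp add: G1)
    then have "y * y + 1 + T * y = c * y" using y0 by (simp add: field_simps)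
    then show "y \<in> {y. poly [:1, T - c, 1:] y = 0}" by (simp add: algebra_simps)
  qed
  moreover have "finite {y. poly [:1, T - c, 1:] y = 0}" by (rule poly_roots_finite) simp
  ultimately have "finite V" by (rule finite_subset)
  then show False using finite_imp_not_open assms by blast
qed

lemma G1_holomorphic: "0 \<notin> V \<Longrightarrow> gfun 1 T holomorphic_on V"
  unfolding gfun_def[abs_def] by (intro holomorphic_intros) auto

text \<open>\<open>gfun\<close> is proper, so it maps components of the preimage of a connected open set onto that set.\<close>
lemma component_onto:
  assumes V: "open V" "connected V" and z: "z \<noteq> 0" "gfun 1 T z \<in> V"
  shows "gfun 1 T ` connected_component_set {y. y \<noteq> 0 \<and> gfun 1 T y \<in> V} z = V"
proof -
  define P where "P = {y. y \<noteq> 0 \<and> gfun 1 T y \<in> V}"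
  define W where "W = connected_component_set P z"
  have oP: "open P" unfolding P_def by (rule open_G1_preimage[OF V(1)])
  have zP: "z \<in> P" using z by (simp add: P_def)
  have W: "open W" "connected W" "W \<subseteq> P" "z \<in> W"
    unfolding W_def using open_connected_component[OF oP] connected_component_subset zP by auto
  have W0: "0 \<notin> W" using W(3) by (auto simp: P_def)
  have op: "open (gfun 1 T ` W)"
    by (rule open_mapping_thm[OF G1_holomorphic[OF W0] W(1,2,1) order_refl G1_nonconstant]) (use W W0 in auto)
  have sub: "gfun 1 T ` W \<subseteq> V" using W(3) by (auto simp: P_def)
  have cl: "w \<in> gfun 1 T ` W" if w: "w \<in> V" "w \<in> closure (gfun 1 T ` W)" for w
  proof -
    obtain v where v: "\<And>n. v n \<in> gfun 1 T ` W" "v \<longlonglongrightarrow> w" using w(2) unfolding closure_sequential by blast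
    have "\<exists>y. y \<in> W \<and> gfun 1 T y = v n" for n using v(1)[of n] by (elim imageE) auto
    then obtain y where y: "\<And>n. y n \<in> W" "\<And>n. gfun 1 T (y n) = v n" by metis
    have "bounded (range (\<lambda>n. v n - T))"
      using convergent_imp_bounded[OF tendsto_diff[OF v(2) tendsto_const]] .
    then obtain B where B: "\<And>n. cmod (v n - T) \<le> B" unfolding bounded_iff by auto
    \<comment> \<open>Applied to y and to 1/y, which solve the same equation: the preimages stay in
      a compact part of the plane minus 0.\<close>
    have bd: "cmod u \<le> B + 1" if "u + 1 / u = v n - T" "u \<noteq> 0" for u n
    proof (cases "cmod u \<le> 1")
      case True
      have "0 \<le> B" using B[of n] norm_ge_zero order_trans by blast
      then show ?thesis using True by simp
    next
      case False
      then have "cmod (1 / u) \<le> 1" by (simp add: norm_divide divide_le_eq)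
      moreover have "u = (v n - T) - 1 / u" using that by (simp add: algebra_simps)
      ultimately show ?thesis using norm_triangle_ineq4[of "v n - T" "1 / u"] B[of n] by simp
    qed
    have yn0: "y n \<noteq> 0" for n using y(1) W0 by metis
    have yv: "y n + 1 / y n = v n - T" for n using y(2)[of n] by (simp add: G1 algebra_simps)
    have b1: "cmod (y n) \<le> B + 1" for n by (rule bd[OF yv yn0])
    have b2: "cmod (1 / y n) \<le> B + 1" for n
      by (rule bd[of _ n]) (use yv[of n] yn0[of n] in \<open>simp_all add: add.commute\<close>)
    have "\<forall>n. y n \<in> cball 0 (B + 1)" using b1 by simp
    from compact_def[THEN iffD1, OF compact_cball, THEN spec, THEN mp, OF this]
    obtain l r where r: "strict_mono r" "(y \<circ> r) \<longlonglongrightarrow> l" by (elim bexE exE conjE)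
    have yl: "(\<lambda>n. y (r n)) \<longlonglongrightarrow> l" using r(2) by (simp only: comp_def)
    have l0: "l \<noteq> 0"
    proof
      assume "l = 0"
      have "1 \<le> (B + 1) * cmod (y n)" for n using b2[of n] yn0[of n] by (simp add: norm_divide field_simps)
      then have "1 \<le> (B + 1) * cmod l"
        by (intro LIMSEQ_le_const[OF tendsto_mult[OF tendsto_const tendsto_norm[OF yl]]]) auto
      then show False using \<open>l = 0\<close> by simp
    qed
    have "(\<lambda>n. gfun 1 T (y (r n))) \<longlonglongrightarrow> gfun 1 T l" unfolding G1 by (intro tendsto_intros yl l0)
    moreover have "(\<lambda>n. gfun 1 T (y (r n))) \<longlonglongrightarrow> w"
      unfolding y(2) using LIMSEQ_subseq_LIMSEQ[OF v(2) r(1)] by (simp only: comp_def)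
    ultimately have Gl: "gfun 1 T l = w" by (rule LIMSEQ_unique)
    then have lP: "l \<in> P" using w(1) l0 by (simp add: P_def)
    \<comment> \<open>A component is closed in P, so the limit point belongs to W.\<close>
    obtain C where C: "closed C" "W = P \<inter> C"
      using closedin_connected_component[of P z] unfolding W_def closedin_closed by blast
    have "\<And>n. y (r n) \<in> C" using y(1) C(2) by blast
    then have "l \<in> C" using closed_sequentially[OF C(1) _ yl] by blast
    then show ?thesis using lP C(2) Gl by blast
  qed
  have "openin (top_of_set V) (gfun 1 T ` W)" using op sub by (simp add: openin_open_eq[OF V(1)])
  moreover have "closedin (top_of_set V) (gfun 1 T ` W)"
  proof -
    have e: "gfun 1 T ` W = V \<inter> closure (gfun 1 T ` W)"
    proof (rule subset_antisym[OF Int_greatest[OF sub closure_subset]], rule subsetI)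
      fix w assume "w \<in> V \<inter> closure (gfun 1 T ` W)"
      then show "w \<in> gfun 1 T ` W" using cl[of w] by simp
    qed
    show ?thesis by (subst e, rule closedin_closed_Int) simp
  qed
  ultimately have "gfun 1 T ` W = {} \<or> gfun 1 T ` W = V"
    using connected_clopen[THEN iffD1, OF V(2), THEN spec, of "gfun 1 T ` W"] by blast
  moreover have "gfun 1 T ` W \<noteq> {}" using W(4) by auto
  ultimately have "gfun 1 T ` W = V" by blast
  then show ?thesis unfolding W_def P_def .
qed

text \<open>Each component of the preimage of the component of \<open>H\<close> contains the critical point \<open>c\<close>.\<close>
lemma basin_connected:
  assumes T: "Im T > 0" and c: "c = 1 \<or> c = -1"
    and H: "connected H" "H \<subseteq> basin T" "c \<in> H" "u \<in> H" "u \<in> upper T"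
  shows "connected (basin T)"
proof -
  define V where "V = connected_component_set (basin T) u"
  have uB: "u \<in> basin T" using H by blast
  have V: "open V" "connected V" "V \<subseteq> basin T" "u \<in> V"
    unfolding V_def using open_connected_component[OF open_basin] uB
    by (simp_all add: connected_component_subset)
  have "convex (upper T)"
  proof -
    have "upper T = {z. inner \<i> z > 2 / Im T}" by (simp add: upper_def inner_complex_def)
    then show ?thesis by (simp only: convex_halfspace_gt)
  qed
  then have uV: "upper T \<subseteq> V"
    unfolding V_def by (intro connected_component_maximal convex_connected H upper_subset_basin)
  have cV: "c \<in> V" using connected_component_maximal[OF H(4,1,2)] H(3) unfolding V_def by blast
  have V0: "V \<subseteq> - {0}" using V(3) basin_step(1)[OF T] by blast
  have "connected (gfun 1 T ` V)"
    by (rule connected_continuous_image[OF continuous_on_subset[OF G1_continuous V0] V(2)])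
  moreover have "gfun 1 T ` V \<subseteq> basin T" using V(3) basin_step(2)[OF T] by blast
  moreover have "gfun 1 T u \<in> V" using upper_invariant[OF T H(5)] uV by blast
  moreover have "connected_component_set (basin T) (gfun 1 T u) = V"
    using connected_component_eq[of "gfun 1 T u" "basin T" u] calculation(3) unfolding V_def by simp
  ultimately have GV: "gfun 1 T ` V \<subseteq> V"
    using connected_component_maximal[of "gfun 1 T u" "gfun 1 T ` V" "basin T"] V(4) by blast
  have "z \<in> basin_n T n \<Longrightarrow> z \<in> V" for n z
  proof (induction n arbitrary: z)
    case 0 then show ?case using uV by auto
  next
    case (Suc n)
    then have z: "z \<noteq> 0" "gfun 1 T z \<in> V" by auto
    define P where "P = {y. y \<noteq> 0 \<and> gfun 1 T y \<in> V}"
    define W where "W = connected_component_set P z"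
    have onto: "gfun 1 T ` W = V" unfolding W_def P_def by (rule component_onto[OF V(1,2) z])
    have zP: "z \<in> P" using z by (simp add: P_def)
    have W: "connected W" "W \<subseteq> P" "z \<in> W"
      unfolding W_def using connected_component_subset zP by auto
    have "gfun 1 T c \<in> V" using GV cV by blast
    then obtain y where y: "y \<in> W" "gfun 1 T y = gfun 1 T c" using onto by (metis imageE)
    have y0: "y \<noteq> 0" using y(1) W(2) by (auto simp: P_def)
    have cc: "c * c = 1" "c \<noteq> 0" "1 / c = c" using c by auto
    \<comment> \<open>The critical value has c as its only preimage, so W contains c and is absorbed
      by V.\<close>
    have "y + 1 / y = c + c" using y(2) cc by (simp add: G1)
    then have "y * y + 1 = (c + c) * y" using y0 by (simp add: field_simps)
    then have "(y - c) * (y - c) = 0" using cc by (simp add: algebra_simps)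
    then have "y = c" by simp
    have "P \<subseteq> basin T" using V(3) basin_preimage by (auto simp: P_def)
    then have WB: "W \<subseteq> basin T" using W(2) by blast
    have "connected_component_set (basin T) c = V"
      using connected_component_eq[of c "basin T" u] cV unfolding V_def by simp
    then have "W \<subseteq> V" using connected_component_maximal[of c W "basin T"] y(1) \<open>y = c\<close> W(1) WB by simp
    then show ?case using W(3) by blast
  qed
  then have "basin T \<subseteq> V" unfolding basin_def by blast
  then show ?thesis using V(2,3) by (simp add: subset_antisym)
qed

section \<open>Square roots on the Julia set and disconnectedness\<close>

text \<open>A finite coordinate on the sphere minus p that vanishes at \<infinity>. The Julia set
  contains \<infinity>, so z itself would not serve.\<close>

definition pole_fun :: "complex \<Rightarrow> riemann_sphere \<Rightarrow> complex" where
  "pole_fun p x = (case x of Fin z \<Rightarrow> 1 / (z - p) | Infty \<Rightarrow> 0)"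

lemma pole_fun_continuous:
  assumes "Fin p \<notin> S"
  shows "continuous_on S (pole_fun p)"
proof (rule continuous_at_imp_continuous_on, rule ballI)
  fix x assume x: "x \<in> S"
  have e: "pole_fun p = (\<lambda>x. chart Infty (moeb 1 (- p) 0 1 x))"
    by (auto simp: fun_eq_iff pole_fun_def moeb_def chart_def split: riemann_sphere.splits)
  have "isCont (moeb 1 (- p) 0 1) x" by (rule rational_maps_1_cont[OF rational_maps_1I]) simp
  moreover have "moeb 1 (- p) 0 1 x \<in> chart_dom Infty"
    using x assms by (cases x) (auto simp: chart_dom_def moeb_def ratio_def)
  ultimately show "isCont (pole_fun p) x"
    unfolding e isCont_def by (rule tendsto_chart)
qed

text \<open>Moving a point along \<gamma> from v to v' deforms the constant 1 into (x - v')/(x - v)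
  through (x - \<gamma>(t))/(x - v), which has no zero off the path. The end of the homotopy
  therefore has a continuous logarithm.\<close>

lemma sqrt_off_path:
  assumes J: "\<And>x. x \<in> J \<Longrightarrow> x \<notin> Fin ` path_image \<gamma>" and \<gamma>: "path \<gamma>" "pathstart \<gamma> = v" "pathfinish \<gamma> = v'"
  obtains r where "continuous_on J r" "\<forall>x\<in>J. r x \<noteq> 0"
    "\<forall>x\<in>J. (r x)\<^sup>2 = 1 + (v - v') * pole_fun v x"

proof -
  define K where "K = pole_fun v ` J"
  define h where "h = (\<lambda>p::real \<times> complex. 1 + (v - \<gamma> (fst p)) * snd p)"
  have nz: "1 + (v - \<gamma> t) * pole_fun v x \<noteq> 0" if "t \<in> {0..1}" "x \<in> J" for t x
  proof (cases x)
    case (Fin z)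
    have "\<gamma> t \<in> path_image \<gamma>" "v \<in> path_image \<gamma>"
      using that(1) pathstart_in_path_image[of \<gamma>] \<gamma>(2) by (auto simp: path_image_def)
    then have "z \<noteq> \<gamma> t" "z \<noteq> v" using J[OF that(2)] Fin by auto
    then show ?thesis by (simp add: Fin pole_fun_def field_simps)
  qed (simp add: pole_fun_def)
  have "continuous_on ({0..1} \<times> K) h"
  proof -
    have "continuous_on ({0..1} \<times> K) (\<lambda>p. \<gamma> (fst p))"
      using \<gamma>(1) unfolding path_def by (rule continuous_on_compose2[OF _ continuous_on_fst[OF continuous_on_id]]) auto
    then show ?thesis unfolding h_def by (intro continuous_intros)
  qed
  moreover have "h \<in> {0..1} \<times> K \<rightarrow> - {0}" using nz by (auto simp: h_def K_def)
  ultimately have "homotopic_with_canon (\<lambda>x. True) K (- {0}) (\<lambda>k. h (0, k)) (\<lambda>k. h (1, k))"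
    unfolding homotopic_with_def by (intro exI[of _ h]) (simp add: continuous_map_iff_continuous2 image_subset_iff_funcset)
  moreover have "h (0, k) = 1" "h (1, k) = 1 + (v - v') * k" for k
    using \<gamma> by (simp_all add: h_def pathstart_def pathfinish_def)
  ultimately have "homotopic_with_canon (\<lambda>x. True) K (- {0}) (\<lambda>k. 1) (\<lambda>k. 1 + (v - v') * k)" by simp
  then have "homotopic_with_canon (\<lambda>x. True) K (- {0}) (\<lambda>k. 1 + (v - v') * k) (\<lambda>k. 1)"
    by (simp only: homotopic_with_sym)
  then have ex: "\<exists>a. homotopic_with_canon (\<lambda>x. True) K (- {0}) (\<lambda>k. 1 + (v - v') * k) (\<lambda>t. a)"
    by (rule exI)
  from inessential_eq_continuous_logarithm[THEN iffD1, OF ex]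
  obtain L where L: "continuous_on K L" "\<forall>k\<in>K. 1 + (v - v') * k = exp (L k)"
    by (elim exE conjE)
  have "v \<in> path_image \<gamma>" using pathstart_in_path_image[of \<gamma>] \<gamma>(2) by simp
  then have "Fin v \<notin> J" using J by blast
  then have pc: "continuous_on J (pole_fun v)" by (rule pole_fun_continuous)
  show ?thesis
  proof
    show "continuous_on J (\<lambda>x. exp (L (pole_fun v x) / 2))"
      by (intro continuous_intros continuous_on_compose2[OF L(1) pc]) (auto simp: K_def)
    show "\<forall>x\<in>J. (exp (L (pole_fun v x) / 2))\<^sup>2 = 1 + (v - v') * pole_fun v x"
    proof
      fix x assume "x \<in> J"
      then have "pole_fun v x \<in> K" by (simp add: K_def)
      with L(2) have "1 + (v - v') * pole_fun v x = exp (L (pole_fun v x))" by (rule bspec)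
      then show "(exp (L (pole_fun v x) / 2))\<^sup>2 = 1 + (v - v') * pole_fun v x"
        by (simp add: exp_double[symmetric])
    qed
  qed auto
qed

text \<open>With \<open>v\<close>, \<open>v'\<close> the critical values, \<open>m(y) = (y+c)/(y-c)\<close> satisfies \<open>m\<^sup>2 = (f - v')/(f - v)\<close>. A
  continuous square root of \<open>(x - v')/(x - v)\<close> on the Julia set therefore yields a continuous sign on
  it, which separates \<open>0\<close> from \<open>\<infinity>\<close>.\<close>
lemma Julia_disconnected:
  assumes T: "Im T > 0" and c: "c = 1 \<or> c = -1"
    and H: "connected H" "H \<subseteq> basin T" "c \<in> H" "u \<in> H" "u \<in> upper T" and c': "- c \<in> basin T"
  shows "\<not> connected (Julia_set (gmap 1 T))"
proof
  define f where "f = gmap 1 T"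
  define J where "J = Julia_set f"
  have one: "(1::complex) \<noteq> 0" by simp
  assume "connected (Julia_set (gmap 1 T))"
  then have cJ: "connected J" by (simp add: J_def f_def)
  have JI: "Infty \<in> J" "Fin 0 \<in> J" using Julia_Infty_zero[OF T] by (simp_all add: J_def f_def)
  have fc: "isCont f y" for y unfolding f_def by (rule gmap_cont[OF one])
  have fJ: "f x \<in> J" if "x \<in> J" for x using Julia_forward[of f x] fc that by (simp add: J_def)
  have JB: "Fin z \<notin> J" if "z \<in> basin T" for z
    using basin_Fatou[OF T that] by (simp add: J_def f_def Julia_set_def)
  define v v' where "v = gfun 1 T c" and "v' = gfun 1 T (- c)"
  have vB: "v \<in> basin T" "v' \<in> basin T"
    using basin_step(2)[OF T] c' H unfolding v_def v'_def by blast+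
  have "path_connected (basin T)"
    by (rule connected_open_path_connected[OF open_basin basin_connected[OF T c H]])
  then obtain \<gamma> where \<gamma>: "path \<gamma>" "path_image \<gamma> \<subseteq> basin T" "pathstart \<gamma> = v" "pathfinish \<gamma> = v'"
    using vB unfolding path_connected_def by blast
  have off: "x \<notin> Fin ` path_image \<gamma>" if "x \<in> J" for x using JB \<gamma>(2) that by blast
  obtain r where r': "continuous_on J r" "\<forall>x\<in>J. r x \<noteq> 0" "\<forall>x\<in>J. (r x)\<^sup>2 = 1 + (v - v') * pole_fun v x"
    by (rule sqrt_off_path[OF off \<gamma>(1,3,4)])
  have r: "continuous_on J r" "\<And>x. x \<in> J \<Longrightarrow> r x \<noteq> 0" "\<And>x. x \<in> J \<Longrightarrow> (r x)\<^sup>2 = 1 + (v - v') * pole_fun v x"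
    using r' by auto
  have cc: "c * c = 1" "c \<noteq> 0" "1 / c = c" using c by auto
  have vv: "v = 2 * c + T" "v' = - 2 * c + T"
    using c by (auto simp: v_def v'_def G1)
  \<comment> \<open>This is (x + c)/(x - c), written so that it also makes sense at
    \<infinity>.\<close>
  define m where "m x = 1 + 2 * c * pole_fun c x" for x
  have cJ': "Fin c \<notin> J" using JB H(2,3) by blast
  have mc: "continuous_on J m" unfolding m_def by (intro continuous_intros pole_fun_continuous cJ')
  have m2: "(m x)\<^sup>2 = 1 + (v - v') * pole_fun v (f x)" if x: "x \<in> J" for x
  proof (cases x)
    case Infty
    then show ?thesis by (simp add: m_def pole_fun_def f_def gmap_simps[OF one])
  next
    case (Fin z)
    show ?thesis
    proof (cases "z = 0")
      case True
      then show ?thesis using c by (auto simp: m_def pole_fun_def f_def gmap_simps[OF one] Fin)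
    next
      case z0: False
      have zc: "z - c \<noteq> 0" using cJ' x Fin by auto
      have "(z - c)\<^sup>2 = z * z - 2 * c * z + 1" using cc(1) by (simp add: power2_eq_square algebra_simps)
      then have "gfun 1 T z - v = (z - c)\<^sup>2 / z"
        unfolding vv using z0 by (simp add: G1 field_simps)
      then have "1 + (v - v') * pole_fun v (f x) = 1 + 4 * c * (z / (z - c)\<^sup>2)"
        using z0 by (simp add: f_def Fin gmap_simps(3)[OF one z0] pole_fun_def vv)
      also have "\<dots> = ((z - c)\<^sup>2 + 4 * c * z) / (z - c)\<^sup>2" using zc by (simp add: field_simps)
      also have "(z - c)\<^sup>2 + 4 * c * z = (z + c)\<^sup>2" by (simp add: power2_eq_square algebra_simps)
      also have "(z + c)\<^sup>2 / (z - c)\<^sup>2 = (m x)\<^sup>2"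
      proof -
        have "m x = (z + c) / (z - c)" using zc by (simp add: m_def pole_fun_def Fin field_simps)
        then show ?thesis by (simp add: power_divide)
      qed
      finally show ?thesis by simp
    qed
  qed
  define \<rho> where "\<rho> x = m x / r (f x)" for x
  have "continuous_on J f" by (intro continuous_at_imp_continuous_on ballI fc)
  then have rf: "continuous_on J (\<lambda>x. r (f x))"
    by (rule continuous_on_compose2[OF r(1)]) (use fJ in blast)
  have "continuous_on J \<rho>" unfolding \<rho>_def by (intro continuous_intros mc rf) (use r(2) fJ in blast)
  from connected_continuous_image[OF this cJ] have cr: "connected (\<rho> ` J)" .
  have "(\<rho> x)\<^sup>2 = 1" if x: "x \<in> J" for x
  proof -
    have "(\<rho> x)\<^sup>2 = (m x)\<^sup>2 / (r (f x))\<^sup>2" by (simp add: \<rho>_def power_divide)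
    moreover have "(r (f x))\<^sup>2 = (m x)\<^sup>2" using r(3)[OF fJ[OF x]] m2[OF x] by simp
    moreover have "(r (f x))\<^sup>2 \<noteq> 0" using r(2)[OF fJ[OF x]] by simp
    ultimately show ?thesis by simp
  qed
  then have "\<rho> ` J \<subseteq> {1, -1}" by (auto simp: power2_eq_1_iff)
  then have "finite (\<rho> ` J)" by (rule finite_subset) simp
  then have "\<exists>a. \<rho> ` J = {a}" using cr JI(1) connected_finite_iff_sing[of "\<rho> ` J"] by blast
  \<comment> \<open>0 and \<infinity> have the same image, so the two signs differ exactly as m
    does, which is 1 at \<infinity> and -1 at 0.\<close>
  then have "\<rho> Infty = \<rho> (Fin 0)" using JI by (metis imageI singletonD)
  moreover have "\<rho> Infty = 1 / r Infty" by (simp add: \<rho>_def m_def pole_fun_def f_def gmap_simps[OF one])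
  moreover have "\<rho> (Fin 0) = - 1 / r Infty" using c by (auto simp: \<rho>_def m_def pole_fun_def f_def gmap_simps[OF one])
  ultimately show False using r(2)[OF JI(1)] by simp
qed

text \<open>The right half-plane lies in the basin, contains the critical point 1 and reaches into
  \<open>upper T\<close>, for instance at height 3 / Im T.\<close>

lemma Julia_disconnected_right:
  assumes T: "Im T > 0" "Re T \<ge> 0" and c': "-1 \<in> basin T"
  shows "\<not> connected (Julia_set (gmap 1 T))"
proof (rule Julia_disconnected[OF T(1), where c = 1 and H = "{z. Re z > 0}" and u = "Complex 1 (3 / Im T)"])
  have "{z. Re z > 0} = {z. inner 1 z > 0}" by (simp add: inner_complex_def)
  then show "connected {z. Re z > 0}" by (simp only: convex_connected convex_halfspace_gt)
  show "{z. Re z > 0} \<subseteq> basin T" using right_half_plane_basin[OF T] by blast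
  show "Complex 1 (3 / Im T) \<in> upper T" using T by (simp add: upper_def divide_strict_right_mono)
qed (use c' in auto)

lemma Julia_disconnected_left:
  assumes T: "Im T > 0" "Re T \<le> 0" and c': "1 \<in> basin T"
  shows "\<not> connected (Julia_set (gmap 1 T))"
proof (rule Julia_disconnected[OF T(1), where c = "-1" and H = "{z. Re z < 0}" and u = "Complex (-1) (3 / Im T)"])
  have "{z. Re z < 0} = {z. inner 1 z < 0}" by (simp add: inner_complex_def)
  then show "connected {z. Re z < 0}" by (simp only: convex_connected convex_halfspace_lt)
  show "{z. Re z < 0} \<subseteq> basin T" using left_half_plane_basin[OF T] by blast
  show "Complex (-1) (3 / Im T) \<in> upper T" using T by (simp add: upper_def divide_strict_right_mono)
qed (use c' in auto)

section \<open>The critical orbit over the sector\<close>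

text \<open>One of the two sheets over the half-plane Re c > 1 under c = 1 - T^2. Its convexity
  provides the simple connectedness that the square root in \<open>preimages_of_critical\<close>
  requires.\<close>

definition sector :: "complex set" where
  "sector = {T. Im T > 0 \<and> Re (T\<^sup>2) < 0}"

lemma sector_alt: "sector = {T. Re T < Im T} \<inter> {T. - Re T < Im T}"
proof -
  have "x * x < y * y \<and> 0 < y \<longleftrightarrow> x < y \<and> - x < y" for x y :: real
    using abs_le_square_iff[of y x] by (auto simp: power2_eq_square)
  then show ?thesis by (auto simp: sector_def power2_eq_square)
qed

lemma sector_open: "open sector"
  unfolding sector_alt by (intro open_Int open_Collect_less continuous_intros)

lemma sector_convex: "convex sector"
proof -
  have "{T. Re T < Im T} = {T. inner (Complex (-1) 1) T > 0}" "{T. - Re T < Im T} = {T. inner (Complex 1 1) T > 0}"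
    by (auto simp: inner_complex_def)
  then show ?thesis unfolding sector_alt by (simp only: convex_Int convex_halfspace_gt)
qed

text \<open>Homogeneous coordinates let the orbit pass through \<infinity>, and both entries are
  entire in T, with no common zero by \<open>PQ_nz\<close>.\<close>

primrec crit_pq :: "complex \<Rightarrow> nat \<Rightarrow> complex \<times> complex" where
  "crit_pq T 0 = (-1, 1)"
| "crit_pq T (Suc n) = ((fst (crit_pq T n))\<^sup>2 + T * fst (crit_pq T n) * snd (crit_pq T n) + (snd (crit_pq T n))\<^sup>2,
     fst (crit_pq T n) * snd (crit_pq T n))"

text \<open>Numerator and denominator of the \<open>n\<close>-th point of the orbit of the critical point \<open>-1\<close>.\<close>
definition crit_num :: "nat \<Rightarrow> complex \<Rightarrow> complex" where "crit_num n T = fst (crit_pq T n)"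
definition crit_den :: "nat \<Rightarrow> complex \<Rightarrow> complex" where "crit_den n T = snd (crit_pq T n)"

lemma PQ_simps: "crit_num 0 T = -1" "crit_den 0 T = 1"
  "crit_num (Suc n) T = (crit_num n T)\<^sup>2 + T * crit_num n T * crit_den n T + (crit_den n T)\<^sup>2" "crit_den (Suc n) T = crit_num n T * crit_den n T"
  by (simp_all add: crit_num_def crit_den_def)

lemma PQ_nz: "(crit_num n T, crit_den n T) \<noteq> (0, 0)"
  by (induction n) (auto simp: PQ_simps)

lemma PQ_orbit: "(gmap 1 T ^^ n) (Fin (-1)) = ratio (crit_num n T) (crit_den n T)"
proof (induction n)
  case 0 then show ?case by (simp add: PQ_simps ratio_def)
next
  case (Suc n)
  have one: "(1::complex) \<noteq> 0" by simp
  show ?case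
    using Suc qmap_ratio[OF gcoeffs_mem[OF one, of T] PQ_nz[of n T]]
    by (simp add: gmap_def gcoeffs_def PQ_simps add_ac)
qed

lemma PQ_holomorphic: "crit_num n holomorphic_on S" "crit_den n holomorphic_on S"
proof -
  have "crit_num n holomorphic_on S \<and> crit_den n holomorphic_on S"
  proof (induction n)
    case 0
    have "crit_num 0 = (\<lambda>_. -1)" "crit_den 0 = (\<lambda>_. 1)" by (auto simp: PQ_simps)
    then show ?case by simp
  next
    case (Suc n)
    have "crit_num (Suc n) = (\<lambda>T. (crit_num n T)\<^sup>2 + T * crit_num n T * crit_den n T + (crit_den n T)\<^sup>2)" "crit_den (Suc n) = (\<lambda>T. crit_num n T * crit_den n T)"
      by (auto simp: PQ_simps)
    then show ?case using Suc by (auto intro!: holomorphic_intros)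
  qed
  then show "crit_num n holomorphic_on S" "crit_den n holomorphic_on S" by auto
qed

lemma PQ_finite: "crit_den n T \<noteq> 0 \<Longrightarrow> (gmap 1 T ^^ n) (Fin (-1)) = Fin (crit_num n T / crit_den n T)"
  by (simp add: PQ_orbit ratio_def)

text \<open>\<open>critical_not_periodic\<close> asks for an orbit in the plane minus 0. A periodic
  orbit through -1 is of this kind, since from \<infinity> it could not return.\<close>

lemma PQ_not_periodic:
  assumes T: "T \<in> sector" and n: "n > 0"
  shows "crit_num n T + crit_den n T \<noteq> 0"
proof
  assume e: "crit_num n T + crit_den n T = 0"
  have one: "(1::complex) \<noteq> 0" by simp
  have "crit_den n T \<noteq> 0" using e PQ_nz[of n T] by auto
  moreover have "crit_num n T = - crit_den n T" using e by (simp add: add_eq_0_iff2)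
  ultimately have per: "(gmap 1 T ^^ n) (Fin (-1)) = Fin (-1)" using PQ_finite by simp
  have per': "(gmap 1 T ^^ (k * n)) (Fin (-1)) = Fin (-1)" for k
    by (induction k) (simp_all add: funpow_add per)
  have fin: "(gmap 1 T ^^ i) (Fin (-1)) \<noteq> Infty" for i
  proof
    assume h: "(gmap 1 T ^^ i) (Fin (-1)) = Infty"
    have "i * n = (i * n - i) + i" using n by (cases n) auto
    then have "(gmap 1 T ^^ (i * n)) (Fin (-1)) = (gmap 1 T ^^ (i * n - i)) ((gmap 1 T ^^ i) (Fin (-1)))"
      by (metis funpow_add comp_apply)
    then show False using h per'[of i] gmap_funpow_Infty[OF one] by simp
  qed
  have orb: "(gmap 1 T ^^ k) (Fin (-1)) = Fin ((gfun 1 T ^^ k) (-1))" "(gfun 1 T ^^ k) (-1) \<noteq> 0" for k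
    using gmap_orbit_finite[OF one, of T "-1" k] fin by blast+
  have "(gfun 1 T ^^ n) (-1) = -1" using orb(1)[of n] per by simp
  moreover have "(gfun 1 T ^^ n) (-1) \<noteq> -1"
    by (rule critical_not_periodic[OF _ n]) (use T orb(2) in \<open>auto simp: sector_def\<close>)
  ultimately show False by blast
qed

lemma PQ_avoids_preimage:
  assumes T: "T \<in> sector" and b: "b * b + (T + 1) * b + 1 = 0"
  shows "crit_num n T - b * crit_den n T \<noteq> 0"
proof
  assume e: "crit_num n T - b * crit_den n T = 0"
  then have p: "crit_num n T = b * crit_den n T" by simp
  have "crit_num (Suc n) T + crit_den (Suc n) T = crit_den n T * crit_den n T * (b * b + (T + 1) * b + 1)"
    unfolding PQ_simps p by (simp add: algebra_simps power2_eq_square)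
  then have "crit_num (Suc n) T + crit_den (Suc n) T = 0" using b by simp
  then show False using PQ_not_periodic[OF T, of "Suc n"] by simp
qed

text \<open>\<open>\<alpha> T\<close> and \<open>\<alpha>' T\<close> are the preimages of \<open>-1\<close> under \<open>gfun 1 T\<close>.\<close>
lemma preimages_of_critical:
  assumes T0: "T0 \<in> sector"
  obtains \<alpha> \<alpha>' where "\<alpha> holomorphic_on sector" "\<alpha>' holomorphic_on sector"
    "\<forall>T\<in>sector. \<alpha> T * \<alpha>' T = 1" "\<forall>T\<in>sector. \<alpha> T + \<alpha>' T = - (T + 1)"
    "cmod (\<alpha>' T0) < 1"
proof -
  have nz: "(T + 1)\<^sup>2 - 4 \<noteq> 0" if "T \<in> sector" for T
  proof
    assume "(T + 1)\<^sup>2 - 4 = 0"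
    then have "(T + 3) * (T - 1) = 0" by (simp add: algebra_simps power2_eq_square)
    then have "T = -3 \<or> T = 1" by (auto simp: add_eq_0_iff2)
    then show False using that by (auto simp: sector_def)
  qed
  have "(\<lambda>T. (T + 1)\<^sup>2 - 4) holomorphic_on sector" by (intro holomorphic_intros)
  moreover have "\<forall>T\<in>sector. (T + 1)\<^sup>2 - 4 \<noteq> 0" using nz by blast
  ultimately have "\<exists>g. g holomorphic_on sector \<and> (\<forall>T\<in>sector. (T + 1)\<^sup>2 - 4 = (g T)\<^sup>2)"
    using simply_connected_eq_holomorphic_sqrt[OF sector_open, THEN iffD1, OF convex_imp_simply_connected[OF sector_convex],
      THEN conjunct2, THEN spec, of "\<lambda>T. (T + 1)\<^sup>2 - 4"] by simp
  then obtain h where h: "h holomorphic_on sector" "\<forall>T\<in>sector. (T + 1)\<^sup>2 - 4 = (h T)\<^sup>2" by (elim exE conjE)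
  define a where "a s T = (- (T + 1) + s * h T) / 2" for s T
  have ah: "a s holomorphic_on sector" for s unfolding a_def[abs_def] by (intro holomorphic_intros h) simp
  have prod: "a 1 T * a (-1) T = 1" "a (-1) T * a 1 T = 1" if "T \<in> sector" for T
  proof -
    have "a 1 T * a (-1) T = ((T + 1)\<^sup>2 - (h T)\<^sup>2) / 4" by (simp add: a_def field_simps power2_eq_square)
    then show "a 1 T * a (-1) T = 1" "a (-1) T * a 1 T = 1"       using bspec[OF h(2) that, symmetric] by (simp_all add: mult.commute)
  qed
  have sum: "a 1 T + a (-1) T = - (T + 1)" "a (-1) T + a 1 T = - (T + 1)" for T by (simp_all add: a_def field_simps)
  \<comment> \<open>On the unit circle the two roots would be conjugate and their sum real, whereas
    Im (T0 + 1) > 0.\<close>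
  have ne: "cmod (a 1 T0) \<noteq> 1"
  proof
    assume n: "cmod (a 1 T0) = 1"
    have "a 1 T0 * cnj (a 1 T0) = 1" unfolding complex_norm_square[symmetric] n by simp
    then have "a 1 T0 * cnj (a 1 T0) = a 1 T0 * a (-1) T0" "a 1 T0 \<noteq> 0" using prod(1)[OF T0] by auto
    then have "a (-1) T0 = cnj (a 1 T0)" by simp
    then have "a 1 T0 + a (-1) T0 = of_real (2 * Re (a 1 T0))" by (simp only: complex_add_cnj)
    then have "- (T0 + 1) = of_real (2 * Re (a 1 T0))" unfolding sum(1) .
    then have "Im (- (T0 + 1)) = 0" by (simp only: Im_complex_of_real)
    then show False using T0 by (simp add: sector_def)
  qed
  have m: "cmod (a 1 T0) * cmod (a (-1) T0) = 1" using prod(1)[OF T0] by (metis norm_mult norm_one)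
  show ?thesis
  proof (cases "cmod (a 1 T0) < 1")
    case True
    show ?thesis by (rule that[of "a (-1)" "a 1"]) (use ah prod sum True in auto)
  next
    case False
    then have "cmod (a 1 T0) > 1" using ne by simp
    have "cmod (a (-1) T0) < 1"
    proof (rule ccontr)
      assume "\<not> cmod (a (-1) T0) < 1"
      then have "cmod (a 1 T0) * 1 \<le> cmod (a 1 T0) * cmod (a (-1) T0)" by (intro mult_left_mono) auto
      then show False using m \<open>cmod (a 1 T0) > 1\<close> by linarith
    qed
    show ?thesis by (rule that[of "a 1" "a (-1)"]) (use ah prod sum \<open>cmod (a (-1) T0) < 1\<close> in auto)
  qed
qed

lemma left_half_plane_orbit:
  assumes T: "Re T \<le> 0" and z: "Re z < 0"
  shows "Re ((gfun 1 T ^^ k) z) < 0" and "filterlim (\<lambda>k. (gfun 1 T ^^ k) z) at_infinity sequentially"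
proof -
  have r: "(gfun 1 (- cnj T) ^^ k) (- cnj z) = - cnj ((gfun 1 T ^^ k) z)" for k
    by (induction k) (simp_all add: G1_reflect)
  have "Re ((gfun 1 (- cnj T) ^^ k) (- cnj z)) > 0" by (rule half_plane_orbit(1)) (use T z in auto)
  then show "Re ((gfun 1 T ^^ k) z) < 0" unfolding r by simp
  have "filterlim (\<lambda>k. (gfun 1 (- cnj T) ^^ k) (- cnj z)) at_infinity sequentially"
    by (rule half_plane_orbit(2)) (use T z in auto)
  then show "filterlim (\<lambda>k. (gfun 1 T ^^ k) z) at_infinity sequentially"
    unfolding r filterlim_at_infinity_conv_norm_at_top by simp
qed

text \<open>By Schottky's theorem the cross-ratios of the critical orbit with \<open>-1\<close> and its preimages form a
  normal family; they converge over \<open>Re T < 0\<close>, hence everywhere.\<close>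
lemma critical_in_basin:
  assumes T1: "T1 \<in> sector"
  shows "-1 \<in> basin T1"
proof -
  \<comment> \<open>A base point in the half of the sector with Re T < 0, where convergence is
    known.\<close>
  define T0 where "T0 = Complex (-1) 2"
  have T0: "T0 \<in> sector" by (simp add: T0_def sector_def power2_eq_square)
  obtain \<alpha> \<alpha>' where hol: "\<alpha> holomorphic_on sector" "\<alpha>' holomorphic_on sector"
    and prod: "\<forall>T\<in>sector. \<alpha> T * \<alpha>' T = 1" and sum: "\<forall>T\<in>sector. \<alpha> T + \<alpha>' T = - (T + 1)"
    and lt: "cmod (\<alpha>' T0) < 1"
    by (rule preimages_of_critical[OF T0])
  have a0: "\<alpha>' T \<noteq> 0" if "T \<in> sector" for T using bspec[OF prod that] by auto
  have root: "\<alpha>' T * \<alpha>' T + (T + 1) * \<alpha>' T + 1 = 0" "\<alpha> T * \<alpha> T + (T + 1) * \<alpha> T + 1 = 0" if "T \<in> sector" for T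
  proof -
    have t: "T + 1 = - (\<alpha> T + \<alpha>' T)" unfolding bspec[OF sum that] by simp
    show "\<alpha>' T * \<alpha>' T + (T + 1) * \<alpha>' T + 1 = 0" "\<alpha> T * \<alpha> T + (T + 1) * \<alpha> T + 1 = 0"
      unfolding t using bspec[OF prod that] by (simp_all add: algebra_simps)
  qed
  have Im_sum: "Im (\<alpha> T + \<alpha>' T) \<noteq> 0" if "T \<in> sector" for T
    using bspec[OF sum that] that by (simp add: sector_def)
  have unit: "\<alpha> T \<noteq> \<alpha>' T" "\<alpha>' T \<noteq> 1" if "T \<in> sector" for T
  proof -
    show "\<alpha> T \<noteq> \<alpha>' T"
    proof
      assume e: "\<alpha> T = \<alpha>' T"
      then have "\<alpha> T * \<alpha> T = 1" using bspec[OF prod that] by simp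
      then have "\<alpha> T = 1 \<or> \<alpha> T = - 1" by (simp add: square_eq_1_iff)
      then show False using Im_sum[OF that] e by auto
    qed
    show "\<alpha>' T \<noteq> 1" using bspec[OF prod that] Im_sum[OF that] by auto
  qed
  have den: "crit_num n T - \<alpha>' T * crit_den n T \<noteq> 0" "crit_num n T - \<alpha> T * crit_den n T \<noteq> 0" if "T \<in> sector" for n T
    using PQ_avoids_preimage[OF that root(1)[OF that]] PQ_avoids_preimage[OF that root(2)[OF that]] by blast+
  \<comment> \<open>Moebius image of the orbit point: \<alpha> goes to 0, -1 to 1, \<alpha>' to
    \<infinity>, and \<infinity> to \<alpha>'. Avoiding -1 and its preimages becomes omitting 0, 1,
    \<infinity>, and escape becomes convergence to \<alpha>'. \<open>W\<close> is the difference
    from \<alpha>', which vanishes exactly when the orbit point is \<infinity>.\<close>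
  define Z where "Z n T = \<alpha>' T * (crit_num n T - \<alpha> T * crit_den n T) / (crit_num n T - \<alpha>' T * crit_den n T)" for n T
  define W where "W n T = \<alpha>' T * (\<alpha>' T - \<alpha> T) * crit_den n T / (crit_num n T - \<alpha>' T * crit_den n T)" for n T
  have ZW: "Z n T - \<alpha>' T = W n T" if "T \<in> sector" for n T
    using den(1)[OF that, of n] by (simp add: Z_def W_def field_simps)
  have Zhol: "Z n holomorphic_on sector" for n
    unfolding Z_def[abs_def] by (intro holomorphic_intros hol PQ_holomorphic den(1))
  have Whol: "W n holomorphic_on sector" for n
    unfolding W_def[abs_def] by (intro holomorphic_intros hol PQ_holomorphic den(1))
  have Z01: "Z n T \<noteq> 0 \<and> Z n T \<noteq> 1" if n: "n > 0" and T: "T \<in> sector" for n T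
  proof
    show "Z n T \<noteq> 0" using a0[OF T] den[OF T, of n] by (simp add: Z_def)
    show "Z n T \<noteq> 1"
    proof
      assume "Z n T = 1"
      then have e: "\<alpha>' T * (crit_num n T - \<alpha> T * crit_den n T) = crit_num n T - \<alpha>' T * crit_den n T"
        using den(1)[OF T, of n] by (simp add: Z_def)
      have "(\<alpha>' T - 1) * (crit_num n T + crit_den n T) = \<alpha>' T * crit_num n T - (\<alpha> T * \<alpha>' T) * crit_den n T - (crit_num n T - \<alpha>' T * crit_den n T)"
        unfolding bspec[OF prod T] by (simp add: algebra_simps)
      also have "\<dots> = \<alpha>' T * (crit_num n T - \<alpha> T * crit_den n T) - (crit_num n T - \<alpha>' T * crit_den n T)" by (simp add: algebra_simps)
      also have "\<dots> = 0" unfolding e by simp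
      finally show False using unit(2)[OF T] PQ_not_periodic[OF T n] by simp
    qed
  qed
  define L where "L = sector \<inter> {T. Re T < 0}"
  have L: "open L" "L \<subseteq> sector" "T0 \<in> L"
    unfolding L_def using T0 sector_open by (auto intro!: open_Int open_halfspace_Re_lt simp: T0_def)
  have left: "crit_den n T \<noteq> 0" "crit_num n T / crit_den n T = (gfun 1 T ^^ n) (-1)" if "T \<in> L" for n T
  proof -
    have one: "(1::complex) \<noteq> 0" by simp
    have nz: "(gfun 1 T ^^ i) (-1) \<noteq> 0" for i
      using left_half_plane_orbit(1)[of T "-1" i] that by (auto simp: L_def)
    have "ratio (crit_num n T) (crit_den n T) = Fin ((gfun 1 T ^^ n) (-1))"
      unfolding PQ_orbit[symmetric] using nz by (intro gmap_orbit[OF one])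
    then show "crit_den n T \<noteq> 0" "crit_num n T / crit_den n T = (gfun 1 T ^^ n) (-1)" by (auto simp: ratio_def split: if_splits)
  qed
  have Wfin: "W n T = \<alpha>' T * (\<alpha>' T - \<alpha> T) * inverse (crit_num n T / crit_den n T - \<alpha>' T)" if "T \<in> sector" "crit_den n T \<noteq> 0" for n T
    using den(1)[OF that(1), of n] that(2) by (simp add: W_def field_simps)
  have Zl: "(\<lambda>n. Z n T) \<longlonglongrightarrow> \<alpha>' T" if T: "T \<in> L" for T
  proof -
    have TS: "T \<in> sector" using T L(2) by blast
    have "filterlim (\<lambda>n. crit_num n T / crit_den n T) at_infinity sequentially"
      unfolding left(2)[OF T] by (rule left_half_plane_orbit(2)) (use T in \<open>auto simp: L_def\<close>)
    from tendsto_add_filterlim_at_infinity[OF tendsto_const this, of "- \<alpha>' T"]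
    have "filterlim (\<lambda>n. crit_num n T / crit_den n T - \<alpha>' T) at_infinity sequentially" by simp
    then have "(\<lambda>n. inverse (crit_num n T / crit_den n T - \<alpha>' T)) \<longlonglongrightarrow> 0" by (rule filterlim_compose[OF tendsto_inverse_0])
    from tendsto_mult[OF tendsto_const this, of "\<alpha>' T * (\<alpha>' T - \<alpha> T)"]
    have "(\<lambda>n. W n T) \<longlonglongrightarrow> 0" unfolding Wfin[OF TS left(1)[OF T]] by simp
    from tendsto_add[OF this tendsto_const, of "\<alpha>' T"] show ?thesis
      unfolding ZW[OF TS, symmetric] by simp
  qed
  have "eventually (\<lambda>n. cmod (Z n T0) < 1) sequentially"
    by (rule order_tendstoD(2)[OF tendsto_norm[OF Zl[OF L(3)]] lt])
  then obtain N where N: "\<And>n. n \<ge> N \<Longrightarrow> cmod (Z n T0) < 1" unfolding eventually_sequentially by blast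
  \<comment> \<open>The tail starts at \<open>Suc N\<close> because the orbit point at time 0 is -1
    itself, where Z takes the value 1.\<close>
  define Y where "Y = Z ` {Suc N..}"
  \<comment> \<open>A subsequence violating the claim would lie in a normal family; its limit agrees
    with \<alpha>' on \<open>L\<close>, hence on the whole sector.\<close>
  have U: "eventually (\<lambda>n. \<forall>T\<in>K. cmod (Z n T - \<alpha>' T) < e) sequentially"
    if K: "compact K" "K \<subseteq> sector" and e: "e > 0" for K e
  proof (rule ccontr)
    assume ng: "\<not> eventually (\<lambda>n. \<forall>T\<in>K. cmod (Z n T - \<alpha>' T) < e) sequentially"
    obtain s :: "nat \<Rightarrow> nat" where s: "strict_mono s" "\<And>n. \<not> (\<forall>T\<in>K. cmod (Z (s n) T - \<alpha>' T) < e)"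
      using not_eventually_sequentiallyD[OF ng] by blast
    define \<F> where "\<F> k = Z (s (k + Suc N))" for k
    have rng: "range \<F> \<subseteq> Y"
    proof
      fix h assume "h \<in> range \<F>"
      then obtain k where "h = Z (s (k + Suc N))" by (auto simp: \<F>_def)
      moreover have "s (k + Suc N) \<ge> Suc N" using seq_suble[OF s(1), of "k + Suc N"] by linarith
      ultimately show "h \<in> Y" unfolding Y_def by (intro image_eqI[of _ _ "s (k + Suc N)"]) auto
    qed
    have Yhol: "h holomorphic_on sector" if "h \<in> Y" for h using that Zhol by (auto simp: Y_def)
    have Y01: "h z \<noteq> 0 \<and> h z \<noteq> 1" if "h \<in> Y" "z \<in> sector" for h z using that Z01 by (auto simp: Y_def)
    have Y1: "norm (h T0) \<le> 1" if "h \<in> Y" for h using that N by (auto simp: Y_def intro!: less_imp_le)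
    have Ybd: "\<exists>B. \<forall>h\<in>Y. \<forall>z\<in>C. norm (h z) \<le> B" if C: "compact C" "C \<subseteq> sector" for C
    \<comment> \<open>The omitted values 0 and 1 and the bound at T0 control the family on compact
      sets. For this bound \<alpha>' was chosen as the root inside the unit disc at T0.\<close>
    proof (rule GPicard3[where S = sector and w = T0 and X = Y and Y = Y and K = C])
      show "open sector" "connected sector" "T0 \<in> sector" "Y \<subseteq> Y" "compact C" "C \<subseteq> sector"
        using sector_open convex_connected[OF sector_convex] T0 C by auto
      show "\<And>h. h \<in> Y \<Longrightarrow> h holomorphic_on sector" by (rule Yhol)
      show "\<And>h z. h \<in> Y \<Longrightarrow> z \<in> sector \<Longrightarrow> h z \<noteq> 0 \<and> h z \<noteq> 1" by (rule Y01)
      show "\<And>h. h \<in> Y \<Longrightarrow> norm (h T0) \<le> 1" by (rule Y1)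
      fix B assume "\<And>h z. h \<in> Y \<Longrightarrow> z \<in> C \<Longrightarrow> norm (h z) \<le> B"
      then have "\<forall>h\<in>Y. \<forall>z\<in>C. norm (h z) \<le> B" by blast
      then show ?thesis ..
    qed
    obtain g r where g: "g holomorphic_on sector" "strict_mono (r :: nat \<Rightarrow> nat)"
      "\<And>x. x \<in> sector \<Longrightarrow> (\<lambda>n. \<F> (r n) x) \<longlonglongrightarrow> g x"
      "\<And>K. \<lbrakk>compact K; K \<subseteq> sector\<rbrakk> \<Longrightarrow> uniform_limit K (\<F> \<circ> r) g sequentially"
    proof (rule Montel[where S = sector and \<H> = Y and \<F> = \<F>])
      show "open sector" "range \<F> \<subseteq> Y" by (rule sector_open rng)+
      show "\<And>h. h \<in> Y \<Longrightarrow> h holomorphic_on sector" by (rule Yhol)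
      show "\<And>K. compact K \<Longrightarrow> K \<subseteq> sector \<Longrightarrow> \<exists>B. \<forall>h\<in>Y. \<forall>z\<in>K. norm (h z) \<le> B" by (rule Ybd)
    qed (rule that)
    have sub: "strict_mono (\<lambda>n. s (r n + Suc N))"
      using s(1) g(2) by (simp add: strict_mono_def)
    have ga: "g T = \<alpha>' T" if "T \<in> sector" for T
    proof (rule analytic_continuation_open[OF L(1) sector_open _ convex_connected[OF sector_convex] L(2) g(1) hol(2) _ that])
      show "L \<noteq> {}" using L(3) by blast
      fix z assume z: "z \<in> L"
      have "(\<lambda>n. Z (s (r n + Suc N)) z) \<longlonglongrightarrow> \<alpha>' z"
        using LIMSEQ_subseq_LIMSEQ[OF Zl[OF z] sub] by (simp only: comp_def)
      moreover have "(\<lambda>n. Z (s (r n + Suc N)) z) \<longlonglongrightarrow> g z" using g(3)[of z] z L(2) unfolding \<F>_def by blast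
      ultimately show "g z = \<alpha>' z" using LIMSEQ_unique by blast
    qed
    from uniform_limitD[OF g(4)[OF K] e]
    obtain n where "\<forall>T\<in>K. dist ((\<F> \<circ> r) n T) (g T) < e" unfolding eventually_sequentially by blast
    moreover have "g T = \<alpha>' T" if "T \<in> K" for T using ga K(2) that by blast
    ultimately have "\<forall>T\<in>K. cmod (Z (s (r n + Suc N)) T - \<alpha>' T) < e"
      by (simp add: \<F>_def dist_norm)
    then show False using s(2) by blast
  qed
  show ?thesis
  proof (cases "\<exists>m. crit_den m T1 = 0")
    case False
    have one: "(1::complex) \<noteq> 0" by simp
    have fin: "(gmap 1 T1 ^^ i) (Fin (-1)) \<noteq> Infty" for i using PQ_finite[of i T1] False by auto
    have orb: "(gfun 1 T1 ^^ k) (-1) = crit_num k T1 / crit_den k T1" "(gfun 1 T1 ^^ k) (-1) \<noteq> 0" for k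
      using gmap_orbit_finite[OF one, of T1 "-1" k] fin PQ_finite[of k T1] False by auto
    have "(\<lambda>n. W n T1) \<longlonglongrightarrow> 0"
    proof (rule tendstoI)
      fix e :: real assume "e > 0"
      from U[of "{T1}", OF _ _ this] T1 have "eventually (\<lambda>n. cmod (Z n T1 - \<alpha>' T1) < e) sequentially" by simp
      then show "eventually (\<lambda>n. dist (W n T1) 0 < e) sequentially" by (simp add: ZW[OF T1])
    qed
    moreover have W0: "W n T1 \<noteq> 0" for n
      using False a0[OF T1] unit(1)[OF T1] den(1)[OF T1, of n] by (auto simp: W_def)
    ultimately have "filterlim (\<lambda>n. W n T1) (at 0) sequentially" by (simp add: filterlim_at)
    from filterlim_compose[OF filterlim_inverse_at_infinity this]
    have "filterlim (\<lambda>n. inverse (W n T1)) at_infinity sequentially" .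
    then have "filterlim (\<lambda>n. \<alpha>' T1 * (\<alpha>' T1 - \<alpha> T1) * inverse (W n T1)) at_infinity sequentially"
      by (rule tendsto_mult_filterlim_at_infinity[OF tendsto_const, rotated]) (use a0[OF T1] unit(1)[OF T1] in simp)
    from tendsto_add_filterlim_at_infinity[OF tendsto_const this, of "\<alpha>' T1"]
    have "filterlim (\<lambda>n. \<alpha>' T1 + \<alpha>' T1 * (\<alpha>' T1 - \<alpha> T1) * inverse (W n T1)) at_infinity sequentially" .
    moreover have "\<alpha>' T1 + \<alpha>' T1 * (\<alpha>' T1 - \<alpha> T1) * inverse (W n T1) = (gfun 1 T1 ^^ n) (-1)" for n
    proof -
      have q: "crit_den n T1 \<noteq> 0" using False by blast
      have "\<alpha>' T1 * (\<alpha>' T1 - \<alpha> T1) \<noteq> 0" using a0[OF T1] unit(1)[OF T1] by simp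
      moreover have "u + A * inverse (A * inverse (w - u)) = w" if "A \<noteq> 0" for A u w :: complex
        using that by (simp flip: mult.assoc)
      ultimately show ?thesis unfolding Wfin[OF T1 q] orb(1) by blast
    qed
    ultimately have "filterlim (\<lambda>n. (gfun 1 T1 ^^ n) (-1)) at_infinity sequentially" by simp
    then show ?thesis by (intro escaping_in_basin orb(2)) (use T1 in \<open>simp_all add: sector_def\<close>)
  next
    case True
    \<comment> \<open>The orbit reaches \<infinity> at time m and stays there. Near T1,
      \<open>W (m + k)\<close> is \<open>W m\<close> times \<open>E k\<close>. On a small circle
      \<open>W m\<close> is bounded below and \<open>W (m + k)\<close> tends to 0, so
      \<open>E k\<close> is small there, while it equals 1 at the centre.\<close>
    then obtain m where m: "crit_den m T1 = 0" by blast
    have Q0: "crit_den (m + i) T1 = 0" for i by (induction i) (simp_all add: m PQ_simps)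
    have Wm: "W m T1 = 0" "W m T0 \<noteq> 0"
      using m left(1)[OF L(3), of m] a0[OF T0] unit(1)[OF T0] den(1)[OF T0, of m] by (auto simp: W_def)
    \<comment> \<open>The factor from \<open>W j\<close> to \<open>W (Suc j)\<close>. Where the
      orbit is already at \<infinity> it is the multiplier of \<infinity>, which is 1.\<close>
    define f where "f j T = crit_num j T * (crit_num j T - \<alpha>' T * crit_den j T) / (crit_num (Suc j) T - \<alpha>' T * crit_den (Suc j) T)" for j T
    have fhol: "f j holomorphic_on sector" for j
      unfolding f_def[abs_def] by (intro holomorphic_intros hol PQ_holomorphic den(1))
    have fW: "W (Suc j) T = f j T * W j T" if "T \<in> sector" for j T
      using den(1)[OF that, of j] den(1)[OF that, of "Suc j"]
      unfolding W_def f_def PQ_simps(4)[of j T] by (simp add: divide_simps)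
    define E where "E k T = (\<Prod>i<k. f (m + i) T)" for k T
    have Ehol: "E k holomorphic_on sector" for k
      unfolding E_def[abs_def] by (intro holomorphic_intros fhol)
    have EW: "W (m + k) T = E k T * W m T" if "T \<in> sector" for k T
      by (induction k) (simp_all add: E_def fW[OF that] mult_ac)
    have E1: "E k T1 = 1" for k
    proof -
      have "f (m + i) T1 = 1" for i
      proof -
        have "crit_num (m + i) T1 \<noteq> 0" using PQ_nz[of "m + i" T1] Q0[of i] by auto
        moreover have "crit_den (Suc (m + i)) T1 = 0" using Q0[of "Suc i"] by simp
        ultimately show ?thesis using Q0[of i] by (simp add: f_def PQ_simps(3) power2_eq_square)
      qed
      then show ?thesis by (simp add: E_def)
    qed
    obtain r where r: "0 < r" "ball T1 r \<subseteq> sector" "\<And>z. z \<in> ball T1 r - {T1} \<Longrightarrow> W m z \<noteq> 0"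
      using isolated_zeros[OF Whol[of m] sector_open convex_connected[OF sector_convex] T1 Wm(1) T0 Wm(2)] by metis
    define K where "K = sphere T1 (r / 2)"
    have K: "compact K" "K \<subseteq> ball T1 r - {T1}" "K \<noteq> {}" using r(1) by (auto simp: K_def)
    have KS: "K \<subseteq> sector" using K(2) r(2) by blast
    have "continuous_on K (\<lambda>T. cmod (W m T))"
      using holomorphic_on_imp_continuous_on[OF Whol] KS by (intro continuous_on_norm) (rule continuous_on_subset)
    from continuous_attains_inf[OF K(1,3) this]
    obtain x where x: "x \<in> K" "\<forall>T\<in>K. cmod (W m x) \<le> cmod (W m T)" by blast
    define d where "d = cmod (W m x)"
    have "x \<in> ball T1 r - {T1}" using x(1) K(2) by blast
    then have d: "d > 0" using r(3) by (simp add: d_def)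
    have "eventually (\<lambda>n. n \<ge> m \<and> (\<forall>T\<in>K. cmod (Z n T - \<alpha>' T) < d / 2)) sequentially"
      using U[OF K(1) KS, of "d / 2"] d by (intro eventually_conj eventually_ge_at_top) auto
    then obtain n where n: "n \<ge> m" "\<forall>T\<in>K. cmod (Z n T - \<alpha>' T) < d / 2" unfolding eventually_sequentially by blast
    define k where "k = n - m"
    have nk: "n = m + k" using n(1) by (simp add: k_def)
    have small: "cmod (E k T) \<le> 1 / 2" if T: "T \<in> K" for T
    proof -
      have TS: "T \<in> sector" using T KS by blast
      have "cmod (E k T) * cmod (W m T) < d / 2"
        using bspec[OF n(2) T] unfolding ZW[OF TS] nk EW[OF TS] norm_mult .
      moreover have "d \<le> cmod (W m T)" using x(2) T by (simp add: d_def)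
      then have "cmod (E k T) * d \<le> cmod (E k T) * cmod (W m T)" by (intro mult_left_mono) auto
      ultimately have "cmod (E k T) * d < 1 / 2 * d" by simp
      then show ?thesis using d by (simp only: mult_less_cancel_right) linarith
    qed
    have cb: "cball T1 (r / 2) \<subseteq> sector" using r(1,2) by (intro order_trans[OF _ r(2)]) auto
    have "cmod (E k T1) \<le> 1 / 2"
    proof (rule maximum_modulus_frontier[of "E k" "cball T1 (r / 2)"])
      show "E k holomorphic_on interior (cball T1 (r / 2))"
        using Ehol cb interior_subset by (meson holomorphic_on_subset order_trans)
      show "continuous_on (closure (cball T1 (r / 2))) (E k)"
        using holomorphic_on_imp_continuous_on[OF holomorphic_on_subset[OF Ehol cb]] by simp
      show "bounded (cball T1 (r / 2))" by simp
      show "T1 \<in> cball T1 (r / 2)" using r(1) by simp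
      show "norm (E k z) \<le> 1 / 2" if "z \<in> frontier (cball T1 (r / 2))" for z
        using that small by (simp add: K_def frontier_cball)
    qed
    then show ?thesis unfolding E1 by simp
  qed
qed

section \<open>The boundary of the central component\<close>

text \<open>The half-plane argument covers the critical point on the side given by the sign of Re T;
  \<open>critical_in_basin\<close> covers the other one, after a reflection if Re T < 0.\<close>

lemma sector_Julia_disconnected:
  assumes T: "T \<in> sector"
  shows "\<not> connected (Julia_set (gmap 1 T))"
proof (cases "Re T \<ge> 0")
  case True
  then show ?thesis using Julia_disconnected_right[OF _ _ critical_in_basin[OF T]] T by (auto simp: sector_def)
next
  case False
  have "- cnj T \<in> sector" using T by (simp add: sector_def power2_eq_square)
  from basin_reflect[OF critical_in_basin[OF this]] have "1 \<in> basin T" by simp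
  then show ?thesis using Julia_disconnected_left[of T] T False by (auto simp: sector_def)
qed

lemma disc_classes_in_hyperbolic: "disc_classes \<subseteq> hyperbolic_classes"
proof
  fix C assume "C \<in> disc_classes"
  then obtain a b where ab: "C = conj_class (fam a b)" "cmod a < 1" "cmod b < 1" by (auto simp: disc_classes_def)
  have "hyperbolic (fam a b)" by (intro fixed_attracted_hyperbolic fam_fixed_attracted ab)
  moreover have "fam a b \<in> rational_maps 2" by (intro fam_rational norm_mult_lt_1 ab)
  ultimately show "C \<in> hyperbolic_classes" by (auto simp: hyperbolic_classes_def ab(1))
qed

lemma disc_classes_connectedin: "connectedin M2_topology disc_classes"
proof -
  have c: "continuous_map (top_of_set quad_coeff_set) M2_topology cls"
    unfolding continuous_map_def topspace_M2 by (auto simp: openin_M2_iff)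
  define D where "D = (\<lambda>(a, b). fam_coeffs a b) ` (ball 0 1 \<times> ball (0::complex) 1)"
  have "connected (ball (0::complex) 1 \<times> ball (0::complex) 1)"
    by (intro convex_connected convex_Times convex_ball)
  moreover have "continuous_on (ball 0 1 \<times> ball 0 1) (\<lambda>(a, b). fam_coeffs a b)"
    unfolding fam_coeffs_def case_prod_beta by (intro continuous_intros)
  ultimately have "connected D" unfolding D_def by (rule connected_continuous_image[rotated])
  moreover have "D \<subseteq> quad_coeff_set" using fam_mem norm_mult_lt_1 by (auto simp: D_def)
  ultimately have "connectedin (top_of_set quad_coeff_set) D"
    by (simp add: connectedin_subtopology)
  from connectedin_continuous_map_image[OF c this] have "connectedin M2_topology (cls ` D)" .
  moreover have "cls ` D = disc_classes"
    unfolding D_def disc_classes_def cls_def by (force simp: fam_qmap image_iff)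
  ultimately show ?thesis by simp
qed

lemma conj_class_hyperbolic:
  assumes "conj_class f \<in> hyperbolic_classes" "f \<in> rational_maps 2"
  shows "hyperbolic f"
proof -
  obtain g where g: "conj_class g = conj_class f" "g \<in> rational_maps 2" "hyperbolic g"
    using assms(1) by (auto simp: hyperbolic_classes_def)
  obtain \<phi> where "conjugates \<phi> g f" using conj_class_eqD[OF g(1,2)] .
  then show ?thesis using conjugates_hyperbolic g(2,3) by blast
qed

text \<open>Each class of the closure outside the bidisc has a multiplier of modulus 1 and falls
  under one of the two non-hyperbolicity lemmas. With openness this makes the bidisc classes clopen
  among the hyperbolic ones.\<close>

lemma closure_disc_classes_hyperbolic:
  assumes C: "C \<in> M2_topology closure_of disc_classes" and h: "C \<in> hyperbolic_classes"
  shows "C \<in> disc_classes"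
proof -
  have par: "C \<noteq> conj_class (gmap 1 T)" if "Re T \<ge> 0" for T
    using parabolic_not_hyperbolic[OF that] conj_class_hyperbolic[of "gmap 1 T"] gmap_rational[of 1 T] h by auto
  have ind: "C \<noteq> conj_class (fam a b)" if "cmod a \<le> 1" "cmod b = 1" "a * b \<noteq> 1" for a b
    using indifferent_not_hyperbolic[OF that] conj_class_hyperbolic[of "fam a b"] fam_rational[OF that(3)] h by auto
  from closure_disc_classes_cases[OF C] consider
      (disc) a b where "cmod a \<le> 1" "cmod b \<le> 1" "a * b \<noteq> 1" "C = conj_class (fam a b)"
    | (par) c where "Re c \<ge> 1" "c \<noteq> 1" "C = conj_class (fam 1 c)" | (zero) "C = conj_class (gmap 1 0)"
    unfolding closure_alternatives_def by blast
  then show ?thesis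
  proof cases
    case disc
    have ba: "b * a \<noteq> 1" using disc(3) by (simp add: mult.commute)
    have "cmod b \<noteq> 1" using ind[OF disc(1) _ disc(3)] disc(4) by blast
    moreover have "cmod a \<noteq> 1"
      using ind[OF disc(2) _ ba] disc(4) fam_swap_class[OF disc(3)] by auto
    ultimately show ?thesis
      unfolding disc_classes_def using disc by (intro CollectI exI[of _ a] exI[of _ b]) simp
  next
    case par': par
    \<comment> \<open>The principal root has Re T \<ge> 0, the hypothesis of
      \<open>parabolic_not_hyperbolic\<close>.\<close>
    define T where "T = csqrt (1 - c)"
    have T: "T \<noteq> 0" "c = 1 - T\<^sup>2" using par'(2) by (auto simp: T_def)
    have "Re T \<ge> 0" unfolding T_def using csqrt_principal[of "1 - c"] by auto
    from par[OF this] show ?thesis using gmap_class[OF T(1)] par'(3) T(2) by simp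
  next
    case zero
    then show ?thesis using par[of 0] by simp
  qed
qed

lemma central_component_eq: "central_component = disc_classes"
proof -
  define X where "X = subtopology M2_topology hyperbolic_classes"
  have sq: "square_map = fam 0 0" by (simp add: square_map_def fam_def one_pCons)
  have s: "conj_class square_map \<in> disc_classes" unfolding sq disc_classes_def by force
  have H: "disc_classes \<subseteq> topspace X"
    using openin_subset[OF disc_classes_open] disc_classes_in_hyperbolic by (auto simp: X_def)
  have "connectedin X disc_classes" unfolding X_def connectedin_subtopology
    using disc_classes_connectedin disc_classes_in_hyperbolic by blast
  then have 1: "disc_classes \<subseteq> connected_component_of_set X (conj_class square_map)"
    using s by (intro connected_component_of_maximal)
  have op: "openin X disc_classes" unfolding X_def openin_subtopology
    using disc_classes_open disc_classes_in_hyperbolic by (intro exI[of _ disc_classes]) auto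
  have cl: "closedin X disc_classes" unfolding X_def closedin_subtopology
  proof (intro exI conjI)
    show "closedin M2_topology (M2_topology closure_of disc_classes)" by simp
    show "disc_classes = M2_topology closure_of disc_classes \<inter> hyperbolic_classes"
      using closure_disc_classes_hyperbolic disc_classes_in_hyperbolic closure_of_subset[OF openin_subset[OF disc_classes_open]] by blast
  qed
  define K where "K = connected_component_of_set X (conj_class square_map)"
  have K: "connectedin X K" unfolding K_def by (rule connectedin_connected_component_of)
  have "openin (subtopology X K) (K \<inter> disc_classes)" "closedin (subtopology X K) (K \<inter> disc_classes)"
    using op cl by (auto simp: openin_subtopology_Int2 closedin_subtopology_Int_closed)
  with K have "K \<inter> disc_classes = {} \<or> K \<inter> disc_classes = topspace (subtopology X K)"
    unfolding connectedin_def connected_space_clopen_in by blast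
  moreover have "K \<inter> disc_classes \<noteq> {}" using 1 s by (auto simp: K_def)
  moreover have "topspace (subtopology X K) = K" using connectedin_subset_topspace[OF K] by auto
  ultimately have "K \<subseteq> disc_classes" by blast
  with 1 show ?thesis unfolding central_component_def K_def X_def by blast
qed

text \<open>Separates the bidisc from all classes with a multiplier on the unit circle; the second
  alternative accounts for the third fixed point.\<close>

lemma disc_classes_no_indifferent:
  assumes C: "conj_class f \<in> disc_classes" "f \<in> rational_maps 2" and m: "has_fixed_point_with_eigenvalue f m"
  shows "cmod m < 1 \<or> Re m > 1"
proof -
  obtain a b where ab: "conj_class f = conj_class (fam a b)" "cmod a < 1" "cmod b < 1"
    using C by (auto simp: disc_classes_def)
  have "m \<in> {a, b, (2 - a - b) / (1 - a * b)}"
    using class_eigenvalue[OF ab(1) C(2) m] fam_eigenvalue_iff[OF norm_mult_lt_1[OF ab(2,3)]] by blast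
  then show ?thesis using ab third_multiplier_re[OF ab(2,3)] by auto
qed

lemma fam_indifferent_not_disc_classes:
  assumes "a * b \<noteq> 1" "cmod b = 1"
  shows "conj_class (fam a b) \<notin> disc_classes"
proof
  assume "conj_class (fam a b) \<in> disc_classes"
  from disc_classes_no_indifferent[OF this fam_rational[OF assms(1)], of b]
  show False using assms(2) fam_eigenvalue_iff[OF assms(1)] complex_Re_le_cmod[of b] by simp
qed

lemma fam_one_not_disc_classes:
  assumes "b \<noteq> 1"
  shows "conj_class (fam 1 b) \<notin> disc_classes"
  using fam_indifferent_not_disc_classes[of b 1] fam_swap_class[of 1 b] assms by simp

lemma B2_subset_closure: "M2_topology closure_of B2 \<subseteq> M2_topology closure_of disc_classes"
  by (rule closure_of_minimal) (use parabolic_in_closure in \<open>auto simp: B2_def\<close>)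

lemma frontier_disc_classes: "M2_topology frontier_of disc_classes = B0 \<union> B1 \<union> M2_topology closure_of B2"
proof -
  have fr: "M2_topology frontier_of disc_classes = M2_topology closure_of disc_classes - disc_classes"
    using disc_classes_open by (simp add: frontier_of_def interior_of_openin)
  have B0I: "conj_class (fam a b) \<in> B0 \<union> B1" if ab: "cmod a \<le> 1" "cmod b = 1" "a * b \<noteq> 1" for a b
  proof -
    consider "a = 1" | "b = 1" | "a \<noteq> 1" "b \<noteq> 1" by blast
    then show ?thesis
    proof cases
      assume "a = 1"
      then show ?thesis using ab by (auto simp: B1_def intro!: exI[of _ b])
    next
      assume b: "b = 1"
      then have "conj_class (fam a b) = conj_class (fam 1 a)" using fam_swap_class[OF ab(3)] by simp
      then show ?thesis using ab b by (auto simp: B1_def)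
    next
      assume "a \<noteq> 1" "b \<noteq> 1"
      then have "conj_class (fam a b) \<in> B0"
        unfolding B0_def using ab by (intro CollectI exI[of _ a] exI[of _ b]) auto
      then show ?thesis by blast
    qed
  qed
  show ?thesis
  proof (intro equalityI subsetI)
    fix C assume "C \<in> M2_topology frontier_of disc_classes"
    then have C: "C \<in> M2_topology closure_of disc_classes" "C \<notin> disc_classes" by (auto simp: fr)
    from closure_disc_classes_cases[OF C(1)] consider
        (disc) a b where "cmod a \<le> 1" "cmod b \<le> 1" "a * b \<noteq> 1" "C = conj_class (fam a b)"
      | (par) c where "Re c \<ge> 1" "c \<noteq> 1" "C = conj_class (fam 1 c)" | (zero) "C = conj_class (gmap 1 0)"
      unfolding closure_alternatives_def by blast
    then show "C \<in> B0 \<union> B1 \<union> M2_topology closure_of B2"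
    proof cases
      case disc
      have ba: "b * a \<noteq> 1" using disc(3) by (simp add: mult.commute)
      have "\<not> (cmod a < 1 \<and> cmod b < 1)" using C(2) disc(4) by (auto simp: disc_classes_def)
      then consider "cmod b = 1" | "cmod a = 1" using disc(1,2) by linarith
      then show ?thesis
        using B0I[OF disc(1) _ disc(3)] B0I[OF disc(2) _ ba] fam_swap_class[OF disc(3)] disc(4) by cases auto
    qed (use B2_limit_1 B2_limit_2 in auto)
  next
    fix C assume "C \<in> B0 \<union> B1 \<union> M2_topology closure_of B2"
    then consider (B0) "C \<in> B0" | (B1) "C \<in> B1" | (B2) "C \<in> M2_topology closure_of B2" by blast
    then show "C \<in> M2_topology frontier_of disc_classes"
    proof cases
      case B0
      then obtain a b where "C = conj_class (fam a b)" "cmod a \<le> 1" "cmod b = 1" "a * b \<noteq> 1"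
        by (auto simp: B0_def)
      then show ?thesis using fam_approx_closure[of a b] fam_indifferent_not_disc_classes[of a b] by (simp add: fr)
    next
      case B1
      then obtain b where "C = conj_class (fam 1 b)" "cmod b \<le> 1" "b \<noteq> 1" by (auto simp: B1_def)
      then show ?thesis using fam_approx_closure[of 1 b] fam_one_not_disc_classes[of b] by (simp add: fr)
    next
      case B2
      have "disc_classes \<inter> B2 = {}"
      proof -
        have "conj_class (fam 1 b) \<notin> disc_classes" if "Re b > 1" for b
          using that by (intro fam_one_not_disc_classes) auto
        then show ?thesis by (auto simp: B2_def)
      qed
      then have "disc_classes \<inter> M2_topology closure_of B2 = {}"
        using openin_Int_closure_of_eq_empty[OF disc_classes_open] by blast
      then show ?thesis using B2 B2_subset_closure by (auto simp: fr)
    qed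
  qed
qed

section \<open>Disjointness from \<open>M1\<close> and a map outside the closure\<close>

lemma gmap_not_M1:
  assumes "\<not> connected (Julia_set (gmap 1 T))"
  shows "conj_class (gmap 1 T) \<notin> M1"
proof
  assume "conj_class (gmap 1 T) \<in> M1"
  then obtain f where f: "conj_class f = conj_class (gmap 1 T)" "f \<in> rational_maps 2" "connected (Julia_set f)"
    by (auto simp: M1_def)
  obtain \<phi> where "conjugates \<phi> f (gmap 1 T)" using conj_class_eqD[OF f(1,2)] .
  from conjugates_Julia_connected[OF this f(3)] assms show False by blast
qed

lemma B2_disjoint_M1: "B2 \<inter> M1 = {}"
proof -
  have "conj_class (fam 1 b) \<notin> M1" if b: "Re b > 1" for b
  proof -
    obtain S where S: "S\<^sup>2 = 1 - b" using power2_csqrt by blast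
    \<comment> \<open>The root in the upper half-plane; a real root is impossible because its square
      has negative real part.\<close>
    define T where "T = (if Im S > 0 then S else - S)"
    have T2: "T\<^sup>2 = 1 - b" by (simp add: T_def S)
    then have R: "Re (T\<^sup>2) < 0" using b by simp
    then have "Im T \<noteq> 0" "T \<noteq> 0" by (auto simp: power2_eq_square not_less)
    then have "Im T > 0" by (auto simp: T_def split: if_splits)
    with R have "T \<in> sector" by (simp add: sector_def)
    from gmap_not_M1[OF sector_Julia_disconnected[OF this]] show ?thesis
      unfolding gmap_class[OF \<open>T \<noteq> 0\<close>] T2 by simp
  qed
  then show ?thesis by (auto simp: B2_def)
qed

lemma disconnected_parabolic_outside_closure:
  obtains C where "C \<in> Per1 1" "C \<notin> M1" "C \<notin> M2_topology closure_of disc_classes"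
proof -
  \<comment> \<open>Re T > 2 sends -1 to T - 2 in the right half-plane, so both critical points are
    in the basin although T lies outside the sector. The multiplier c = -7 - 6i has modulus above 1
    but real part below 1, which fits no case of \<open>closure_alternatives\<close>.\<close>
  define T where "T = Complex 3 1"
  define c where "c = 1 - T\<^sup>2"
  define C where "C = conj_class (fam 1 c)"
  have c: "c = Complex (-7) (-6)" by (simp add: c_def T_def power2_eq_square complex_eq_iff)
  have T0: "T \<noteq> 0" by (auto simp: T_def complex_eq_iff)
  have c1: "1 * c \<noteq> 1" by (auto simp: c complex_eq_iff)
  have CT: "C = conj_class (gmap 1 T)" using gmap_class[OF T0] by (simp add: C_def c_def)
  have "gfun 1 T (-1) \<in> basin T"
    by (rule right_half_plane_basin) (simp_all add: T_def gfun_def)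
  then have "-1 \<in> basin T" by (rule basin_preimage[rotated]) simp
  then have "\<not> connected (Julia_set (gmap 1 T))"
    by (intro Julia_disconnected_right) (simp_all add: T_def)
  then have 1: "C \<notin> M1" unfolding CT by (rule gmap_not_M1)
  have ev: "has_fixed_point_with_eigenvalue (fam 1 c) m \<longleftrightarrow> m \<in> {1, c}" for m
    unfolding fam_eigenvalue_iff[OF c1] using c1 by auto
  have 2: "C \<in> Per1 1" unfolding Per1_def C_def
    using fam_rational[OF c1] ev by blast
  have eig: "m \<in> {1, c}" if "conj_class f = C" "f \<in> rational_maps 2" "has_fixed_point_with_eigenvalue f m" for f m
    using class_eigenvalue[OF that(1)[unfolded C_def] that(2,3)] ev by blast
  have "cmod c > 1" using abs_Re_le_cmod[of c] by (simp add: c)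
  have "\<not> closure_alternatives C"
  proof
    assume "closure_alternatives C"
    then consider
        (disc) a b where "cmod a \<le> 1" "cmod b \<le> 1" "a * b \<noteq> 1" "C = conj_class (fam a b)"
      | (par) d where "Re d \<ge> 1" "d \<noteq> 1" "C = conj_class (fam 1 d)" | (zero) "C = conj_class (gmap 1 0)"
      unfolding closure_alternatives_def by blast
    then show False
    proof cases
      case disc
      have "a \<in> {1, c}" "b \<in> {1, c}"
        using eig[OF disc(4)[symmetric] fam_rational[OF disc(3)]] fam_eigenvalue_iff[OF disc(3)] by blast+
      then show False using disc(1-3) \<open>cmod c > 1\<close> by auto
    next
      case par
      have "1 * d \<noteq> 1" using par(2) by simp
      then have "d \<in> {1, c}"
        using eig[OF par(3)[symmetric] fam_rational] fam_eigenvalue_iff by blast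
      then show False using par(1,2) by (auto simp: c)
    next
      case zero
      have "has_fixed_point_with_eigenvalue (fam 1 c) c" using ev by blast
      from class_eigenvalue[OF zero[unfolded C_def] fam_rational[OF c1] this]
      obtain p where p: "gmap 1 0 p = p" "local_deriv (gmap 1 0) p = c"
        by (auto simp: has_fixed_point_with_eigenvalue_def)
      have "p = Infty"
      proof (cases p)
        case (Fin z)
        then show ?thesis using p(1) by (cases "z = 0") (auto simp: gmap_simps gfun_def)
      qed
      then show False using p(2) c1 by (simp add: gmap_deriv)
    qed
  qed
  then have "C \<notin> M2_topology closure_of disc_classes" using closure_disc_classes_cases by blast
  with 1 2 show thesis by (intro that)
qed

theorem theorem1p1:
  shows "M2_topology frontier_of central_component =
           B0 \<union> B1 \<union> M2_topology closure_of B2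
       \<and> B2 \<inter> M1 = {}
       \<and> M2_topology frontier_of central_component \<inter> (Per1 1 - M1) \<noteq> Per1 1 - M1"
proof (intro conjI)
  obtain C where C: "C \<in> Per1 1" "C \<notin> M1" "C \<notin> M2_topology closure_of disc_classes"
    by (rule disconnected_parabolic_outside_closure)
  then have "C \<notin> M2_topology frontier_of disc_classes" by (simp add: frontier_of_def)
  with C show "M2_topology frontier_of central_component \<inter> (Per1 1 - M1) \<noteq> Per1 1 - M1"
    unfolding central_component_eq by blast
qed (simp_all only: central_component_eq frontier_disc_classes B2_disjoint_M1)

end
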